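(* Let $\mathcal{K}$ be a 2-category, let $(\mathbf{P},\mathbf{S},\upsilon)$ be a KZ context on $\mathcal{K}$, and let $(\mathbf{D},\delta)$ be a Gabriel–Ulmer envelope relative to it. Assume that for every $\upsilon$-accessible object $\mathbf{S}G$ (with $G$ a $\mathbf{P}$-petit object) there exist an $\mathbf{S}$-Cauchy complete and $\mathbf{P}$-petit object $\hat G$ and a 1-cell $i:G\to\hat G$ such that $\mathbf{S}_!i$ is an equivalence. Then there is a bi-adjunction $$\upsilon\text{-}\mathsf{Mod}:\ \upsilon\text{-}\mathsf{Rex}^{\mathrm{coop}}\ \rightleftarrows\ \upsilon\text{-}\mathsf{LP}\ :\upsilon\text{-}\mathsf{Th}$$ which is in fact a bi-equivalence of 2-categories.
   Context: Left extensions. In a 2-category $\mathcal{K}$, a left extension of $f:A\to C$ along $j:A\to B$ is a 1-cell $\mathrm{lan}_j f:B\to C$ with a 2-cell $\eta:f\Rightarrow(\mathrm{lan}_j f)\,j$ such that for every $g:B\to C$ pasting with $\eta$ is a bijection between 2-cells $\mathrm{lan}_jf\Rightarrow g$ and 2-cells $f\Rightarrow gj$. A 1-cell $k:C\to D$ preserves it if $k\eta$ exhibits $k\,\mathrm{lan}_jf$ as a left extension of $kf$ along $j$. KZ doctrines. A KZ doctrine (or doctrine) $(\mathbf{S},\sigma)$ on $\mathcal{K}$ consists of a function $A\mapsto\mathbf{S}A$ on objects, a 1-cell (unit) $\sigma_A:A\to\mathbf{S}A$ for each object $A$, and for each $f:A\to\mathbf{S}B$ a left extension $\bar f:\mathbf{S}A\to\mathbf{S}B$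 of $f$ along $\sigma_A$, exhibited by an invertible 2-cell $c_f:f\Rightarrow\bar f\sigma_A$, such that: the left extension of $\sigma_A$ along $\sigma_A$ is $\mathrm{id}_{\mathbf{S}A}$ with the identity 2-cell; and for every $g:B\to\mathbf{S}C$, the 1-cell $\bar g:\mathbf{S}B\to\mathbf{S}C$ preserves the left extension $\bar f$ of every $f:A\to\mathbf{S}B$. For $f:A\to B$ put $\mathbf{S}_!f:=\mathrm{lan}_{\sigma_A}(\sigma_Bf):\mathbf{S}A\to\mathbf{S}B$. Cocompleteness. An object $X$ is $\mathbf{S}$-cocomplete if every $g:B\to X$ has a left extension $\bar g:\mathbf{S}B\to X$ along $\sigma_B$ exhibited by an invertible 2-cell, and $\bar g$ preserves the left extension $\bar f:\mathbf{S}A\to\mathbf{S}B$ along $\sigma_A$ of every $f:A\to\mathbf{S}B$. A 1-cell $E:X\to Y$ between $\mathbf{S}$-cocomplete objects is $\mathbf{S}$-cocontinuous if it preserves all left extensions along $\sigma_B$ into $X$, for every object $B$. Fully faithful. A 1-cell $i:A\to B$ is (representably) fully faithful if $i\circ-:\mathcal{K}(X,A)\to\mathcal{K}(X,B)$ is fully faithful for every object $X$. Admissibility. A 1-cell $f:A\to B$ is $\mathbf{S}$-admissible if there is a left extension $N_f:B\to\mathbf{S}A$ of $\sigma_A$ along $f$, and this left extension is preserved by the extension $\bar h:\mathbf{S}A\to X$ along $\sigma_A$ of every $h:A\to X$ with $X$ $\mathbf{S}$-cocomplete. An object $A$ is $\mathbf{S}$-petit if every 1-cell with domain $A$ is $\mathbf{S}$-admissible.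 (These definitions apply to any doctrine, e.g. $\mathbf{P}$ or $\mathbf{D}$ in place of $\mathbf{S}$.) KZ contexts. A KZ context $(\mathbf{P},\mathbf{S},\upsilon)$ on $\mathcal{K}$ consists of two doctrines $(\mathbf{P},y)$ and $(\mathbf{S},\sigma)$ on $\mathcal{K}$ such that: all unit components $y_A:A\to\mathbf{P}A$ and $\sigma_A:A\to\mathbf{S}A$ are fully faithful; every $\mathbf{P}A$ is $\mathbf{S}$-cocomplete and, for every $f:A\to B$, the 1-cell $\mathbf{P}_!f=\mathrm{lan}_{y_A}(y_Bf)$ is $\mathbf{S}$-cocontinuous; and the 1-cell $\upsilon_A:=\mathrm{lan}_{\sigma_A}(y_A):\mathbf{S}A\to\mathbf{P}A$ is fully faithful for every $A$. Accessible and presentable objects. An object $A$ is $\upsilon$-accessible if there is a $\mathbf{P}$-petit object $G$ with $A\simeq\mathbf{S}G$. An object $A$ is $\upsilon$-presentable if it is $\upsilon$-accessible and there are a $\mathbf{P}$-petit object $G$ and an adjunction $L\dashv i$ with $L:\mathbf{P}G\to A$ and $i:A\to\mathbf{P}G$, where $i$ is fully faithful and $\mathbf{S}$-cocontinuous. Gabriel–Ulmer envelope. A Gabriel–Ulmer envelope relative to $(\mathbf{P},\mathbf{S},\upsilon)$ is a further doctrine $(\mathbf{D},\delta)$ on $\mathcal{K}$ with fully faithful units $\delta_A:A\to\mathbf{D}A$ such that: (i) $\mathbf{P}$ and $\mathbf{D}$ also form a KZ context (with $\mathbf{D}$ in the role of $\mathbf{S}$ and $\mathrm{lan}_{\delta_A}(y_A):\mathbf{D}A\to\mathbf{P}A$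 in the role of $\upsilon_A$); (ii) for every object $A$, $\mathbf{S}(\mathbf{D}A)$ is $\mathbf{P}$-cocomplete and the 1-cell $\iota_A:\mathbf{P}A\to\mathbf{S}(\mathbf{D}A)$, the left extension of $\sigma_{\mathbf{D}A}\circ\delta_A$ along $y_A$, is an equivalence. Cauchy completeness. An object $A$ is $\mathbf{S}$-Cauchy complete if for every object $B$ and every adjunction $q^*\dashv q_*$ with $q^*:\mathbf{S}B\to\mathbf{S}A$, $q_*:\mathbf{S}A\to\mathbf{S}B$ and $q_*$ $\mathbf{S}$-cocontinuous, there is a (necessarily $\mathbf{S}$-admissible) 1-cell $f:B\to A$ with $q^*\cong\mathbf{S}_!f$. The 2-categories. $\upsilon\text{-}\mathsf{Rex}$ has as objects the $\mathbf{P}$-petit, $\mathbf{S}$-Cauchy complete, $\mathbf{D}$-cocomplete objects of $\mathcal{K}$, as 1-cells the $\mathbf{D}$-cocontinuous 1-cells, and all 2-cells of $\mathcal{K}$ between them. $\upsilon\text{-}\mathsf{LP}$ has as objects the $\upsilon$-presentable objects of $\mathcal{K}$, as 1-cells the $\mathbf{S}$-cocontinuous 1-cells that are right adjoints (have a left adjoint in $\mathcal{K}$), and all 2-cells of $\mathcal{K}$ between them. The superscript $\mathrm{coop}$ denotes reversal of both 1-cells and 2-cells. The correspondences. $\upsilon\text{-}\mathsf{Mod}$ sends $G$ to $\mathbf{S}G$ and a 1-cell $f:G\to G'$ to the right adjoint $\mathbf{S}^*f:\mathbf{S}G'\to\mathbf{S}G$ of $\mathbf{S}_!f$, with the induced action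 on 2-cells. $\upsilon\text{-}\mathsf{Th}$ sends $A\simeq\mathbf{S}G$, with $G$ chosen $\mathbf{P}$-petit and $\mathbf{S}$-Cauchy complete, to $G$, and sends a 1-cell $f_*:\mathbf{S}G'\to\mathbf{S}G$ with left adjoint $f^*$ to the 1-cell $u:G\to G'$ with $\mathbf{S}_!u\cong f^*$ provided by $\mathbf{S}$-Cauchy completeness. *)

theory Defs
  imports Main
begin

section \<open>Strict 2-categories\<close>

record ('o, 'm, 'c) two_cat =
  obj  :: "'o set"
  arr  :: "'m set"
  src  :: "'m \<Rightarrow> 'o"
  trg  :: "'m \<Rightarrow> 'o"
  cel  :: "'c set"
  dom2 :: "'c \<Rightarrow> 'm"
  cod2 :: "'c \<Rightarrow> 'm"
  id1  :: "'o \<Rightarrow> 'm"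
  cmp  :: "'m \<Rightarrow> 'm \<Rightarrow> 'm"  (infixr "\<odot>\<index>" 75)
  id2  :: "'m \<Rightarrow> 'c"
  vcmp :: "'c \<Rightarrow> 'c \<Rightarrow> 'c"  (infixr "\<bullet>\<index>" 60)
  hcmp :: "'c \<Rightarrow> 'c \<Rightarrow> 'c"  (infixr "\<star>\<index>" 70)

text \<open>All compositions are written in applicative order: \<open>g \<odot> f\<close> is "first \<open>f\<close>, then \<open>g\<close>",
  likewise for vertical (\<open>\<bullet>\<close>) and horizontal (\<open>\<star>\<close>) composition of 2-cells.\<close>

context
  fixes K :: "('o, 'm, 'c) two_cat" (structure)
begin

definition hom :: "'o \<Rightarrow> 'o \<Rightarrow> 'm set" where
  "hom A B = {f \<in> arr K. src K f = A \<and> trg K f = B}"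

definition cells :: "'m \<Rightarrow> 'm \<Rightarrow> 'c set" where
  "cells f g = {\<alpha> \<in> cel K. dom2 K \<alpha> = f \<and> cod2 K \<alpha> = g}"

end

definition lw :: "('o, 'm, 'c) two_cat \<Rightarrow> 'm \<Rightarrow> 'c \<Rightarrow> 'c"  (infixr "\<rhd>\<index>" 72) where
  "lw K k \<alpha> = hcmp K (id2 K k) \<alpha>"

definition rw :: "('o, 'm, 'c) two_cat \<Rightarrow> 'c \<Rightarrow> 'm \<Rightarrow> 'c"  (infixl "\<lhd>\<index>" 73) where
  "rw K \<alpha> j = hcmp K \<alpha> (id2 K j)"

locale two_category =
  fixes K :: "('o, 'm, 'c) two_cat" (structure)
  assumes src_obj: "f \<in> arr K \<Longrightarrow> src K f \<in> obj K"
    and trg_obj: "f \<in> arr K \<Longrightarrow> trg K f \<in> obj K"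
    and dom2_arr: "\<alpha> \<in> cel K \<Longrightarrow> dom2 K \<alpha> \<in> arr K"
    and cod2_arr: "\<alpha> \<in> cel K \<Longrightarrow> cod2 K \<alpha> \<in> arr K"
    and src_parallel: "\<alpha> \<in> cel K \<Longrightarrow> src K (dom2 K \<alpha>) = src K (cod2 K \<alpha>)"
    and trg_parallel: "\<alpha> \<in> cel K \<Longrightarrow> trg K (dom2 K \<alpha>) = trg K (cod2 K \<alpha>)"
    and id1_hom: "A \<in> obj K \<Longrightarrow> id1 K A \<in> hom K A A"
    and cmp_hom: "\<lbrakk>f \<in> hom K A B; g \<in> hom K B C\<rbrakk> \<Longrightarrow> g \<odot> f \<in> hom K A C"
    and cmp_assoc: "\<lbrakk>f \<in> hom K A B; g \<in> hom K B C; h \<in> hom K C D\<rbrakk>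
          \<Longrightarrow> (h \<odot> g) \<odot> f = h \<odot> (g \<odot> f)"
    and id1_left: "f \<in> hom K A B \<Longrightarrow> id1 K B \<odot> f = f"
    and id1_right: "f \<in> hom K A B \<Longrightarrow> f \<odot> id1 K A = f"
    and id2_cells: "f \<in> arr K \<Longrightarrow> id2 K f \<in> cells K f f"
    and vcmp_cells: "\<lbrakk>\<alpha> \<in> cells K f g; \<beta> \<in> cells K g h\<rbrakk> \<Longrightarrow> \<beta> \<bullet> \<alpha> \<in> cells K f h"
    and vcmp_assoc: "\<lbrakk>\<alpha> \<in> cells K f g; \<beta> \<in> cells K g h; \<gamma> \<in> cells K h k\<rbrakk>
          \<Longrightarrow> (\<gamma> \<bullet> \<beta>) \<bullet> \<alpha> = \<gamma> \<bullet> (\<beta> \<bullet> \<alpha>)"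
    and id2_left: "\<alpha> \<in> cells K f g \<Longrightarrow> id2 K g \<bullet> \<alpha> = \<alpha>"
    and id2_right: "\<alpha> \<in> cells K f g \<Longrightarrow> \<alpha> \<bullet> id2 K f = \<alpha>"
    and hcmp_cells: "\<lbrakk>\<alpha> \<in> cells K f f'; \<beta> \<in> cells K g g'; trg K f = src K g\<rbrakk>
          \<Longrightarrow> \<beta> \<star> \<alpha> \<in> cells K (g \<odot> f) (g' \<odot> f')"
    and hcmp_assoc: "\<lbrakk>\<alpha> \<in> cells K f f'; \<beta> \<in> cells K g g'; \<gamma> \<in> cells K h h';
          trg K f = src K g; trg K g = src K h\<rbrakk>
          \<Longrightarrow> (\<gamma> \<star> \<beta>) \<star> \<alpha> = \<gamma> \<star> (\<beta> \<star> \<alpha>)"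
    and hcmp_left: "\<alpha> \<in> cells K f g \<Longrightarrow> id2 K (id1 K (trg K f)) \<star> \<alpha> = \<alpha>"
    and hcmp_right: "\<alpha> \<in> cells K f g \<Longrightarrow> \<alpha> \<star> id2 K (id1 K (src K f)) = \<alpha>"
    and hcmp_id2: "\<lbrakk>f \<in> hom K A B; g \<in> hom K B C\<rbrakk> \<Longrightarrow> id2 K g \<star> id2 K f = id2 K (g \<odot> f)"
    and interchange: "\<lbrakk>\<alpha> \<in> cells K f f'; \<alpha>' \<in> cells K f' f''; \<beta> \<in> cells K g g';
          \<beta>' \<in> cells K g' g''; trg K f = src K g\<rbrakk>
          \<Longrightarrow> (\<beta>' \<bullet> \<beta>) \<star> (\<alpha>' \<bullet> \<alpha>) = (\<beta>' \<star> \<alpha>') \<bullet> (\<beta> \<star> \<alpha>)"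

definition coop :: "('o, 'm, 'c) two_cat \<Rightarrow> ('o, 'm, 'c) two_cat" where
  "coop K = \<lparr> obj = obj K, arr = arr K, src = trg K, trg = src K,
     cel = cel K, dom2 = cod2 K, cod2 = dom2 K, id1 = id1 K, cmp = (\<lambda>g f. cmp K f g),
     id2 = id2 K, vcmp = (\<lambda>\<beta> \<alpha>. vcmp K \<alpha> \<beta>), hcmp = (\<lambda>\<beta> \<alpha>. hcmp K \<alpha> \<beta>) \<rparr>"

text \<open>The locally full sub-2-category on given objects and 1-cells.\<close>

definition sub2 :: "('o, 'm, 'c) two_cat \<Rightarrow> 'o set \<Rightarrow> 'm set \<Rightarrow> ('o, 'm, 'c) two_cat" where
  "sub2 K Ob Ar = K\<lparr> obj := Ob, arr := Ar,
     cel := {\<alpha> \<in> cel K. dom2 K \<alpha> \<in> Ar \<and> cod2 K \<alpha> \<in> Ar} \<rparr>"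

context
  fixes K :: "('o, 'm, 'c) two_cat" (structure)
begin

definition inverse2 :: "'c \<Rightarrow> 'c \<Rightarrow> bool" where
  "inverse2 \<alpha> \<beta> \<longleftrightarrow> \<alpha> \<in> cel K \<and> \<beta> \<in> cells K (cod2 K \<alpha>) (dom2 K \<alpha>) \<and>
     \<beta> \<bullet> \<alpha> = id2 K (dom2 K \<alpha>) \<and> \<alpha> \<bullet> \<beta> = id2 K (cod2 K \<alpha>)"

definition invertible2 :: "'c \<Rightarrow> bool" where
  "invertible2 \<alpha> \<longleftrightarrow> (\<exists>\<beta>. inverse2 \<alpha> \<beta>)"

definition inv2 :: "'c \<Rightarrow> 'c" where
  "inv2 \<alpha> = (THE \<beta>. inverse2 \<alpha> \<beta>)"

definition isomorphic1 :: "'m \<Rightarrow> 'm \<Rightarrow> bool" where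
  "isomorphic1 f g \<longleftrightarrow> (\<exists>\<alpha> \<in> cells K f g. invertible2 \<alpha>)"

definition equivalence1 :: "'m \<Rightarrow> bool" where
  "equivalence1 e \<longleftrightarrow> e \<in> arr K \<and>
     (\<exists>e' \<in> hom K (trg K e) (src K e).
        isomorphic1 (e' \<odot> e) (id1 K (src K e)) \<and> isomorphic1 (e \<odot> e') (id1 K (trg K e)))"

definition equivalent0 :: "'o \<Rightarrow> 'o \<Rightarrow> bool" where
  "equivalent0 A B \<longleftrightarrow> (\<exists>e \<in> hom K A B. equivalence1 e)"

definition adjunction :: "'m \<Rightarrow> 'm \<Rightarrow> 'c \<Rightarrow> 'c \<Rightarrow> bool" where
  "adjunction l r \<eta> \<epsilon> \<longleftrightarrow> l \<in> arr K \<and> r \<in> hom K (trg K l) (src K l) \<and>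
     \<eta> \<in> cells K (id1 K (src K l)) (r \<odot> l) \<and> \<epsilon> \<in> cells K (l \<odot> r) (id1 K (trg K l)) \<and>
     (\<epsilon> \<lhd> l) \<bullet> (l \<rhd> \<eta>) = id2 K l \<and> (r \<rhd> \<epsilon>) \<bullet> (\<eta> \<lhd> r) = id2 K r"

definition adjoint :: "'m \<Rightarrow> 'm \<Rightarrow> bool" where
  "adjoint l r \<longleftrightarrow> (\<exists>\<eta> \<epsilon>. adjunction l r \<eta> \<epsilon>)"

text \<open>For adjunctions \<open>l \<stileturn> r\<close> (unit \<open>\<eta>\<close>) and \<open>l' \<stileturn> r'\<close> (counit \<open>\<epsilon>'\<close>):
  the conjugate \<open>r' \<Rightarrow> r\<close> of \<open>\<alpha> : l \<Rightarrow> l'\<close>, and the conjugate \<open>l' \<Rightarrow> l\<close> of \<open>\<beta> : r \<Rightarrow> r'\<close>.\<close>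

definition conj_right :: "'c \<Rightarrow> 'c \<Rightarrow> 'm \<Rightarrow> 'm \<Rightarrow> 'c \<Rightarrow> 'c" where
  "conj_right \<eta> \<epsilon>' r r' \<alpha> = (r \<rhd> \<epsilon>') \<bullet> (r \<rhd> \<alpha> \<lhd> r') \<bullet> (\<eta> \<lhd> r')"

definition conj_left :: "'c \<Rightarrow> 'c \<Rightarrow> 'm \<Rightarrow> 'm \<Rightarrow> 'c \<Rightarrow> 'c" where
  "conj_left \<eta> \<epsilon>' l l' \<beta> = (\<epsilon>' \<lhd> l) \<bullet> (l' \<rhd> \<beta> \<lhd> l) \<bullet> (l' \<rhd> \<eta>)"

definition fully_faithful1 :: "'m \<Rightarrow> bool" where
  "fully_faithful1 i \<longleftrightarrow> i \<in> arr K \<and>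
     (\<forall>X \<in> obj K. \<forall>f \<in> hom K X (src K i). \<forall>g \<in> hom K X (src K i).
        bij_betw (\<lambda>\<alpha>. i \<rhd> \<alpha>) (cells K f g) (cells K (i \<odot> f) (i \<odot> g)))"

text \<open>\<open>is_lan j f l \<eta>\<close>: the 2-cell \<open>\<eta> : f \<Rightarrow> l \<odot> j\<close> exhibits \<open>l\<close> as a left extension of \<open>f\<close> along \<open>j\<close>.\<close>

definition is_lan :: "'m \<Rightarrow> 'm \<Rightarrow> 'm \<Rightarrow> 'c \<Rightarrow> bool" where
  "is_lan j f l \<eta> \<longleftrightarrow> j \<in> arr K \<and> f \<in> arr K \<and> src K f = src K j \<and>
     l \<in> hom K (trg K j) (trg K f) \<and> \<eta> \<in> cells K f (l \<odot> j) \<and>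
     (\<forall>g \<in> hom K (trg K j) (trg K f).
        bij_betw (\<lambda>\<theta>. (\<theta> \<lhd> j) \<bullet> \<eta>) (cells K l g) (cells K f (g \<odot> j)))"

definition preserves_lan :: "'m \<Rightarrow> 'm \<Rightarrow> 'm \<Rightarrow> 'm \<Rightarrow> 'c \<Rightarrow> bool" where
  "preserves_lan k j f l \<eta> \<longleftrightarrow> is_lan j (k \<odot> f) (k \<odot> l) (k \<rhd> \<eta>)"

end


section \<open>KZ doctrines\<close>

text \<open>The chosen extension of \<open>f : A \<rightarrow> SB\<close> is \<open>ext S B f\<close>, with 2-cell \<open>extc S B f\<close>.
  The object \<open>B\<close> is an explicit argument since it need not be determined by \<open>SB\<close>.\<close>

record ('o, 'm, 'c) doctrine =
  dob  :: "'o \<Rightarrow> 'o"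
  unt  :: "'o \<Rightarrow> 'm"
  ext  :: "'o \<Rightarrow> 'm \<Rightarrow> 'm"
  extc :: "'o \<Rightarrow> 'm \<Rightarrow> 'c"

context
  fixes K :: "('o, 'm, 'c) two_cat" (structure)
begin

definition kz_doctrine :: "('o, 'm, 'c) doctrine \<Rightarrow> bool" where
  "kz_doctrine S \<longleftrightarrow>
     (\<forall>A \<in> obj K. dob S A \<in> obj K \<and> unt S A \<in> hom K A (dob S A)) \<and>
     (\<forall>A \<in> obj K. \<forall>B \<in> obj K. \<forall>f \<in> hom K A (dob S B).
        is_lan K (unt S A) f (ext S B f) (extc S B f) \<and> invertible2 K (extc S B f)) \<and>
     (\<forall>A \<in> obj K. is_lan K (unt S A) (unt S A) (id1 K (dob S A)) (id2 K (unt S A))) \<and>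
     (\<forall>A \<in> obj K. \<forall>B \<in> obj K. \<forall>C \<in> obj K. \<forall>f \<in> hom K A (dob S B). \<forall>g \<in> hom K B (dob S C).
        preserves_lan K (ext S C g) (unt S A) f (ext S B f) (extc S B f))"

text \<open>\<open>push S f\<close> is \<open>S\<^sub>! f\<close>; the remaining four are the 2-cell exhibiting it as a left extension,
  the action of \<open>S\<^sub>!\<close> on 2-cells, and the canonical comparisons
  \<open>S\<^sub>!(gf) \<Rightarrow> S\<^sub>!g S\<^sub>!f\<close> and \<open>S\<^sub>!(id) \<Rightarrow> id\<close>.\<close>

definition push :: "('o, 'm, 'c) doctrine \<Rightarrow> 'm \<Rightarrow> 'm" where
  "push S f = ext S (trg K f) (unt S (trg K f) \<odot> f)"

definition pushc :: "('o, 'm, 'c) doctrine \<Rightarrow> 'm \<Rightarrow> 'c" where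
  "pushc S f = extc S (trg K f) (unt S (trg K f) \<odot> f)"

definition push2 :: "('o, 'm, 'c) doctrine \<Rightarrow> 'c \<Rightarrow> 'c" where
  "push2 S \<alpha> = (THE \<theta>. \<theta> \<in> cells K (push S (dom2 K \<alpha>)) (push S (cod2 K \<alpha>)) \<and>
     (\<theta> \<lhd> unt S (src K (dom2 K \<alpha>))) \<bullet> pushc S (dom2 K \<alpha>) =
       pushc S (cod2 K \<alpha>) \<bullet> (unt S (trg K (dom2 K \<alpha>)) \<rhd> \<alpha>))"

definition push_cmp :: "('o, 'm, 'c) doctrine \<Rightarrow> 'm \<Rightarrow> 'm \<Rightarrow> 'c" where
  "push_cmp S g f = (THE \<theta>. \<theta> \<in> cells K (push S (g \<odot> f)) (push S g \<odot> push S f) \<and>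
     (\<theta> \<lhd> unt S (src K f)) \<bullet> pushc S (g \<odot> f) = (push S g \<rhd> pushc S f) \<bullet> (pushc S g \<lhd> f))"

definition push_id :: "('o, 'm, 'c) doctrine \<Rightarrow> 'o \<Rightarrow> 'c" where
  "push_id S A = (THE \<theta>. \<theta> \<in> cells K (push S (id1 K A)) (id1 K (dob S A)) \<and>
     (\<theta> \<lhd> unt S A) \<bullet> pushc S (id1 K A) = id2 K (unt S A))"

definition cocomplete :: "('o, 'm, 'c) doctrine \<Rightarrow> 'o \<Rightarrow> bool" where
  "cocomplete S X \<longleftrightarrow> X \<in> obj K \<and>
     (\<forall>B \<in> obj K. \<forall>g \<in> hom K B X.
        \<exists>gbar c. is_lan K (unt S B) g gbar c \<and> invertible2 K c \<and>
          (\<forall>A \<in> obj K. \<forall>f \<in> hom K A (dob S B).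
             preserves_lan K gbar (unt S A) f (ext S B f) (extc S B f)))"

definition cocontinuous :: "('o, 'm, 'c) doctrine \<Rightarrow> 'm \<Rightarrow> bool" where
  "cocontinuous S E \<longleftrightarrow> E \<in> arr K \<and> cocomplete S (src K E) \<and> cocomplete S (trg K E) \<and>
     (\<forall>B \<in> obj K. \<forall>g \<in> hom K B (src K E). \<forall>l \<eta>. is_lan K (unt S B) g l \<eta>
        \<longrightarrow> preserves_lan K E (unt S B) g l \<eta>)"

definition admissible :: "('o, 'm, 'c) doctrine \<Rightarrow> 'm \<Rightarrow> bool" where
  "admissible S f \<longleftrightarrow> f \<in> arr K \<and>
     (\<exists>N \<phi>. is_lan K f (unt S (src K f)) N \<phi> \<and>
        (\<forall>X. cocomplete S X \<longrightarrow> (\<forall>h \<in> hom K (src K f) X. \<forall>hbar c.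
           is_lan K (unt S (src K f)) h hbar c
             \<longrightarrow> preserves_lan K hbar f (unt S (src K f)) N \<phi>)))"

definition petit :: "('o, 'm, 'c) doctrine \<Rightarrow> 'o \<Rightarrow> bool" where
  "petit S A \<longleftrightarrow> A \<in> obj K \<and> (\<forall>f \<in> arr K. src K f = A \<longrightarrow> admissible S f)"

definition cauchy_complete :: "('o, 'm, 'c) doctrine \<Rightarrow> 'o \<Rightarrow> bool" where
  "cauchy_complete S A \<longleftrightarrow> A \<in> obj K \<and>
     (\<forall>B \<in> obj K. \<forall>ql \<in> hom K (dob S B) (dob S A). \<forall>qr \<in> hom K (dob S A) (dob S B).
        adjoint K ql qr \<longrightarrow> cocontinuous S qr \<longrightarrow>
        (\<exists>f \<in> hom K B A. isomorphic1 K ql (push S f)))"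

definition kz_context ::
    "('o, 'm, 'c) doctrine \<Rightarrow> ('o, 'm, 'c) doctrine \<Rightarrow> ('o \<Rightarrow> 'm) \<Rightarrow> bool" where
  "kz_context P S \<upsilon> \<longleftrightarrow> kz_doctrine P \<and> kz_doctrine S \<and>
     (\<forall>A \<in> obj K. fully_faithful1 K (unt P A) \<and> fully_faithful1 K (unt S A)) \<and>
     (\<forall>A \<in> obj K. cocomplete S (dob P A)) \<and>
     (\<forall>f \<in> arr K. cocontinuous S (push P f)) \<and>
     (\<forall>A \<in> obj K. (\<exists>c. is_lan K (unt S A) (unt P A) (\<upsilon> A) c) \<and> fully_faithful1 K (\<upsilon> A))"

definition accessible :: "('o, 'm, 'c) doctrine \<Rightarrow> ('o, 'm, 'c) doctrine \<Rightarrow> 'o \<Rightarrow> bool" where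
  "accessible P S A \<longleftrightarrow> A \<in> obj K \<and> (\<exists>G. petit P G \<and> equivalent0 K A (dob S G))"

definition presentable :: "('o, 'm, 'c) doctrine \<Rightarrow> ('o, 'm, 'c) doctrine \<Rightarrow> 'o \<Rightarrow> bool" where
  "presentable P S A \<longleftrightarrow> accessible P S A \<and>
     (\<exists>G. petit P G \<and> (\<exists>L \<in> hom K (dob P G) A. \<exists>i \<in> hom K A (dob P G).
        adjoint K L i \<and> fully_faithful1 K i \<and> cocontinuous S i))"

definition gabriel_ulmer_envelope ::
    "('o, 'm, 'c) doctrine \<Rightarrow> ('o, 'm, 'c) doctrine \<Rightarrow> ('o, 'm, 'c) doctrine \<Rightarrow> bool" where
  "gabriel_ulmer_envelope P S D \<longleftrightarrow>
     kz_doctrine D \<and> (\<forall>A \<in> obj K. fully_faithful1 K (unt D A)) \<and>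
     (\<exists>w. kz_context P D w) \<and>
     (\<forall>A \<in> obj K. cocomplete P (dob S (dob D A)) \<and>
        (\<exists>\<iota> c. is_lan K (unt P A) (unt S (dob D A) \<odot> unt D A) \<iota> c \<and> equivalence1 K \<iota>))"

definition Rex :: "('o, 'm, 'c) doctrine \<Rightarrow> ('o, 'm, 'c) doctrine \<Rightarrow> ('o, 'm, 'c) doctrine
    \<Rightarrow> ('o, 'm, 'c) two_cat" where
  "Rex P S D = (let Ob = {A. petit P A \<and> cauchy_complete S A \<and> cocomplete D A}
     in sub2 K Ob {f \<in> arr K. src K f \<in> Ob \<and> trg K f \<in> Ob \<and> cocontinuous D f})"

definition LP :: "('o, 'm, 'c) doctrine \<Rightarrow> ('o, 'm, 'c) doctrine \<Rightarrow> ('o, 'm, 'c) two_cat" where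
  "LP P S = (let Ob = {A. presentable P S A}
     in sub2 K Ob {f \<in> arr K. src K f \<in> Ob \<and> trg K f \<in> Ob \<and> cocontinuous S f \<and>
          (\<exists>l. adjoint K l f)})"

end


section \<open>Pseudofunctors, biadjunctions and biequivalences\<close>

record ('o, 'm, 'c, 'p, 'n, 'd) psfun =
  on0 :: "'o \<Rightarrow> 'p"
  on1 :: "'m \<Rightarrow> 'n"
  on2 :: "'c \<Rightarrow> 'd"
  mu  :: "'m \<Rightarrow> 'm \<Rightarrow> 'd"  \<comment> \<open>\<open>mu F g f : F g \<odot> F f \<Rightarrow> F (g \<odot> f)\<close>\<close>
  nu  :: "'o \<Rightarrow> 'd"  \<comment> \<open>\<open>nu F A : id \<Rightarrow> F id\<close>\<close>

definition pseudofunctor :: "('o, 'm, 'c) two_cat \<Rightarrow> ('p, 'n, 'd) two_cat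
    \<Rightarrow> ('o, 'm, 'c, 'p, 'n, 'd) psfun \<Rightarrow> bool" where
  "pseudofunctor A B F \<longleftrightarrow> two_category A \<and> two_category B \<and>
     (\<forall>a \<in> obj A. on0 F a \<in> obj B) \<and>
     (\<forall>f \<in> arr A. on1 F f \<in> hom B (on0 F (src A f)) (on0 F (trg A f))) \<and>
     (\<forall>\<alpha> \<in> cel A. on2 F \<alpha> \<in> cells B (on1 F (dom2 A \<alpha>)) (on1 F (cod2 A \<alpha>))) \<and>
     (\<forall>f \<in> arr A. on2 F (id2 A f) = id2 B (on1 F f)) \<and>
     (\<forall>\<alpha> \<in> cel A. \<forall>\<beta> \<in> cel A. cod2 A \<alpha> = dom2 A \<beta>
        \<longrightarrow> on2 F (\<beta> \<bullet>\<^bsub>A\<^esub> \<alpha>) = on2 F \<beta> \<bullet>\<^bsub>B\<^esub> on2 F \<alpha>) \<and>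
     (\<forall>f \<in> arr A. \<forall>g \<in> arr A. trg A f = src A g
        \<longrightarrow> mu F g f \<in> cells B (on1 F g \<odot>\<^bsub>B\<^esub> on1 F f) (on1 F (g \<odot>\<^bsub>A\<^esub> f))
          \<and> invertible2 B (mu F g f)) \<and>
     (\<forall>a \<in> obj A. nu F a \<in> cells B (id1 B (on0 F a)) (on1 F (id1 A a)) \<and> invertible2 B (nu F a)) \<and>
     (\<forall>\<alpha> \<in> cel A. \<forall>\<beta> \<in> cel A. trg A (dom2 A \<alpha>) = src A (dom2 A \<beta>)
        \<longrightarrow> mu F (cod2 A \<beta>) (cod2 A \<alpha>) \<bullet>\<^bsub>B\<^esub> (on2 F \<beta> \<star>\<^bsub>B\<^esub> on2 F \<alpha>)
          = on2 F (\<beta> \<star>\<^bsub>A\<^esub> \<alpha>) \<bullet>\<^bsub>B\<^esub> mu F (dom2 A \<beta>) (dom2 A \<alpha>)) \<and>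
     (\<forall>f \<in> arr A. \<forall>g \<in> arr A. \<forall>h \<in> arr A. trg A f = src A g \<longrightarrow> trg A g = src A h
        \<longrightarrow> mu F h (g \<odot>\<^bsub>A\<^esub> f) \<bullet>\<^bsub>B\<^esub> (on1 F h \<rhd>\<^bsub>B\<^esub> mu F g f)
          = mu F (h \<odot>\<^bsub>A\<^esub> g) f \<bullet>\<^bsub>B\<^esub> (mu F h g \<lhd>\<^bsub>B\<^esub> on1 F f)) \<and>
     (\<forall>f \<in> arr A. mu F (id1 A (trg A f)) f \<bullet>\<^bsub>B\<^esub> (nu F (trg A f) \<lhd>\<^bsub>B\<^esub> on1 F f) = id2 B (on1 F f)) \<and>
     (\<forall>f \<in> arr A. mu F f (id1 A (src A f)) \<bullet>\<^bsub>B\<^esub> (on1 F f \<rhd>\<^bsub>B\<^esub> nu F (src A f)) = id2 B (on1 F f))"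

definition ps_id :: "('o, 'm, 'c) two_cat \<Rightarrow> ('o, 'm, 'c, 'o, 'm, 'c) psfun" where
  "ps_id A = \<lparr> on0 = (\<lambda>a. a), on1 = (\<lambda>f. f), on2 = (\<lambda>\<alpha>. \<alpha>),
     mu = (\<lambda>g f. id2 A (g \<odot>\<^bsub>A\<^esub> f)), nu = (\<lambda>a. id2 A (id1 A a)) \<rparr>"

text \<open>The composite "first \<open>F\<close>, then \<open>G\<close>"; \<open>C\<close> is the target 2-category of \<open>G\<close>.\<close>

definition ps_comp :: "('q, 'l, 'e) two_cat \<Rightarrow> ('p, 'n, 'd, 'q, 'l, 'e) psfun
    \<Rightarrow> ('o, 'm, 'c, 'p, 'n, 'd) psfun \<Rightarrow> ('o, 'm, 'c, 'q, 'l, 'e) psfun" where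
  "ps_comp C G F = \<lparr> on0 = (\<lambda>a. on0 G (on0 F a)), on1 = (\<lambda>f. on1 G (on1 F f)),
     on2 = (\<lambda>\<alpha>. on2 G (on2 F \<alpha>)),
     mu = (\<lambda>g f. on2 G (mu F g f) \<bullet>\<^bsub>C\<^esub> mu G (on1 F g) (on1 F f)),
     nu = (\<lambda>a. on2 G (nu F a) \<bullet>\<^bsub>C\<^esub> nu G (on0 F a)) \<rparr>"

record ('o, 'm, 'n, 'd) pstrans =
  tc :: "'o \<Rightarrow> 'n"
  tn :: "'m \<Rightarrow> 'd"  \<comment> \<open>\<open>tn \<tau> f : G f \<odot> \<tau>\<^sub>a \<Rightarrow> \<tau>\<^sub>b \<odot> F f\<close> for \<open>f : a \<rightarrow> b\<close>\<close>

definition pseudonatural :: "('o, 'm, 'c) two_cat \<Rightarrow> ('p, 'n, 'd) two_cat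
    \<Rightarrow> ('o, 'm, 'c, 'p, 'n, 'd) psfun \<Rightarrow> ('o, 'm, 'c, 'p, 'n, 'd) psfun
    \<Rightarrow> ('o, 'm, 'n, 'd) pstrans \<Rightarrow> bool" where
  "pseudonatural A B F G \<tau> \<longleftrightarrow>
     pseudofunctor A B F \<and> pseudofunctor A B G \<and>
     (\<forall>a \<in> obj A. tc \<tau> a \<in> hom B (on0 F a) (on0 G a)) \<and>
     (\<forall>f \<in> arr A. tn \<tau> f \<in> cells B (on1 G f \<odot>\<^bsub>B\<^esub> tc \<tau> (src A f)) (tc \<tau> (trg A f) \<odot>\<^bsub>B\<^esub> on1 F f) \<and>
        invertible2 B (tn \<tau> f)) \<and>
     (\<forall>\<alpha> \<in> cel A. tn \<tau> (cod2 A \<alpha>) \<bullet>\<^bsub>B\<^esub> (on2 G \<alpha> \<lhd>\<^bsub>B\<^esub> tc \<tau> (src A (dom2 A \<alpha>)))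
        = (tc \<tau> (trg A (dom2 A \<alpha>)) \<rhd>\<^bsub>B\<^esub> on2 F \<alpha>) \<bullet>\<^bsub>B\<^esub> tn \<tau> (dom2 A \<alpha>)) \<and>
     (\<forall>f \<in> arr A. \<forall>g \<in> arr A. trg A f = src A g
        \<longrightarrow> tn \<tau> (g \<odot>\<^bsub>A\<^esub> f) \<bullet>\<^bsub>B\<^esub> (mu G g f \<lhd>\<^bsub>B\<^esub> tc \<tau> (src A f))
          = (tc \<tau> (trg A g) \<rhd>\<^bsub>B\<^esub> mu F g f) \<bullet>\<^bsub>B\<^esub> (tn \<tau> g \<lhd>\<^bsub>B\<^esub> on1 F f) \<bullet>\<^bsub>B\<^esub> (on1 G g \<rhd>\<^bsub>B\<^esub> tn \<tau> f)) \<and>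
     (\<forall>a \<in> obj A. tn \<tau> (id1 A a) \<bullet>\<^bsub>B\<^esub> (nu G a \<lhd>\<^bsub>B\<^esub> tc \<tau> a) = tc \<tau> a \<rhd>\<^bsub>B\<^esub> nu F a)"

definition tr_id :: "('p, 'n, 'd) two_cat \<Rightarrow> ('o, 'm, 'c, 'p, 'n, 'd) psfun
    \<Rightarrow> ('o, 'm, 'n, 'd) pstrans" where
  "tr_id B F = \<lparr> tc = (\<lambda>a. id1 B (on0 F a)), tn = (\<lambda>f. id2 B (on1 F f)) \<rparr>"

text \<open>\<open>tr_comp A B \<sigma> \<tau>\<close> is "first \<open>\<tau>\<close>, then \<open>\<sigma>\<close>".\<close>

definition tr_comp :: "('o, 'm, 'c) two_cat \<Rightarrow> ('p, 'n, 'd) two_cat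
    \<Rightarrow> ('o, 'm, 'n, 'd) pstrans \<Rightarrow> ('o, 'm, 'n, 'd) pstrans \<Rightarrow> ('o, 'm, 'n, 'd) pstrans" where
  "tr_comp A B \<sigma> \<tau> = \<lparr> tc = (\<lambda>a. tc \<sigma> a \<odot>\<^bsub>B\<^esub> tc \<tau> a),
     tn = (\<lambda>f. (tc \<sigma> (trg A f) \<rhd>\<^bsub>B\<^esub> tn \<tau> f) \<bullet>\<^bsub>B\<^esub> (tn \<sigma> f \<lhd>\<^bsub>B\<^esub> tc \<tau> (src A f))) \<rparr>"

text \<open>\<open>tr_post A C H F G \<tau>\<close> is the whiskering \<open>H\<tau> : HF \<Rightarrow> HG\<close> of \<open>\<tau> : F \<Rightarrow> G\<close> with
  \<open>H\<close>, where \<open>A\<close> is the source of \<open>F, G\<close> and \<open>C\<close> the target of \<open>H\<close>;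
  \<open>tr_pre \<tau> H\<close> is the whiskering \<open>\<tau>H\<close>.\<close>

definition tr_post :: "('o, 'm, 'c) two_cat \<Rightarrow> ('q, 'l, 'e) two_cat
    \<Rightarrow> ('p, 'n, 'd, 'q, 'l, 'e) psfun
    \<Rightarrow> ('o, 'm, 'c, 'p, 'n, 'd) psfun \<Rightarrow> ('o, 'm, 'c, 'p, 'n, 'd) psfun
    \<Rightarrow> ('o, 'm, 'n, 'd) pstrans \<Rightarrow> ('o, 'm, 'l, 'e) pstrans" where
  "tr_post A C H F G \<tau> = \<lparr> tc = (\<lambda>a. on1 H (tc \<tau> a)),
     tn = (\<lambda>f. inv2 C (mu H (tc \<tau> (trg A f)) (on1 F f)) \<bullet>\<^bsub>C\<^esub> on2 H (tn \<tau> f)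
       \<bullet>\<^bsub>C\<^esub> mu H (on1 G f) (tc \<tau> (src A f))) \<rparr>"

definition tr_pre :: "('p, 'n, 'l, 'e) pstrans \<Rightarrow> ('o, 'm, 'c, 'p, 'n, 'd) psfun
    \<Rightarrow> ('o, 'm, 'l, 'e) pstrans" where
  "tr_pre \<tau> H = \<lparr> tc = (\<lambda>a. tc \<tau> (on0 H a)), tn = (\<lambda>f. tn \<tau> (on1 H f)) \<rparr>"

text \<open>Invertible modifications \<open>\<tau> \<Rrightarrow> \<tau>'\<close> between pseudonatural transformations \<open>F \<Rightarrow> G\<close>.\<close>

definition invertible_modification :: "('o, 'm, 'c) two_cat \<Rightarrow> ('p, 'n, 'd) two_cat
    \<Rightarrow> ('o, 'm, 'c, 'p, 'n, 'd) psfun \<Rightarrow> ('o, 'm, 'c, 'p, 'n, 'd) psfun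
    \<Rightarrow> ('o, 'm, 'n, 'd) pstrans \<Rightarrow> ('o, 'm, 'n, 'd) pstrans \<Rightarrow> ('o \<Rightarrow> 'd) \<Rightarrow> bool" where
  "invertible_modification A B F G \<tau> \<tau>' m \<longleftrightarrow>
     (\<forall>a \<in> obj A. m a \<in> cells B (tc \<tau> a) (tc \<tau>' a) \<and> invertible2 B (m a)) \<and>
     (\<forall>f \<in> arr A. tn \<tau>' f \<bullet>\<^bsub>B\<^esub> (on1 G f \<rhd>\<^bsub>B\<^esub> m (src A f)) = (m (trg A f) \<lhd>\<^bsub>B\<^esub> on1 F f) \<bullet>\<^bsub>B\<^esub> tn \<tau> f)"

text \<open>\<open>F\<close> is left biadjoint to \<open>G\<close>: pseudonatural unit and counit, and triangle identities up to
  invertible modifications. No further coherence is imposed on the triangulators, so the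
  existence of such data amounts to a pseudonatural equivalence \<open>B(Fa, b) \<simeq> A(a, Gb)\<close>.\<close>

definition biadjunction :: "('o, 'm, 'c) two_cat \<Rightarrow> ('p, 'n, 'd) two_cat
    \<Rightarrow> ('o, 'm, 'c, 'p, 'n, 'd) psfun \<Rightarrow> ('p, 'n, 'd, 'o, 'm, 'c) psfun
    \<Rightarrow> ('o, 'm, 'm, 'c) pstrans \<Rightarrow> ('p, 'n, 'n, 'd) pstrans \<Rightarrow> bool" where
  "biadjunction A B F G \<eta> \<epsilon> \<longleftrightarrow>
     pseudofunctor A B F \<and> pseudofunctor B A G \<and>
     pseudonatural A A (ps_id A) (ps_comp A G F) \<eta> \<and>
     pseudonatural B B (ps_comp B F G) (ps_id B) \<epsilon> \<and>
     (\<exists>s. invertible_modification A B F F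
        (tr_comp A B (tr_pre \<epsilon> F) (tr_post A B F (ps_id A) (ps_comp A G F) \<eta>)) (tr_id B F) s) \<and>
     (\<exists>t. invertible_modification B A G G
        (tr_comp B A (tr_post B A G (ps_comp B F G) (ps_id B) \<epsilon>) (tr_pre \<eta> G)) (tr_id A G) t)"

definition biequivalence :: "('o, 'm, 'c) two_cat \<Rightarrow> ('p, 'n, 'd) two_cat
    \<Rightarrow> ('o, 'm, 'c, 'p, 'n, 'd) psfun \<Rightarrow> ('p, 'n, 'd, 'o, 'm, 'c) psfun
    \<Rightarrow> ('o, 'm, 'm, 'c) pstrans \<Rightarrow> ('p, 'n, 'n, 'd) pstrans \<Rightarrow> bool" where
  "biequivalence A B F G \<eta> \<epsilon> \<longleftrightarrow>
     pseudofunctor A B F \<and> pseudofunctor B A G \<and>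
     pseudonatural A A (ps_id A) (ps_comp A G F) \<eta> \<and> (\<forall>a \<in> obj A. equivalence1 A (tc \<eta> a)) \<and>
     pseudonatural B B (ps_comp B F G) (ps_id B) \<epsilon> \<and> (\<forall>b \<in> obj B. equivalence1 B (tc \<epsilon> b))"


section \<open>The correspondences\<close>

context
  fixes K :: "('o, 'm, 'c) two_cat" (structure)
begin

text \<open>\<open>Mod\<close> and \<open>Th\<close> are determined up to choices of adjoints (and, for \<open>Th\<close>, of objects \<open>G\<close> and
  1-cells \<open>u\<close>). The predicates below say that a pseudofunctor arises from such choices, with action
  on 2-cells and coherence 2-cells induced by those of \<open>S\<^sub>!\<close> through conjugation.

  In \<open>is_Mod\<close>, \<open>\<eta> f\<close> and \<open>\<epsilon> f\<close> are the unit and counit of \<open>S\<^sub>! f \<stileturn> S\<^sup>* f\<close>.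
  The composite of \<open>f : G \<rightarrow> G'\<close> and \<open>g : G' \<rightarrow> G''\<close> in \<open>K\<close> is, in the coop, the composite of
  \<open>g\<close> followed by \<open>f\<close>; so \<open>mu M f g\<close> is a 2-cell \<open>S\<^sup>* f \<odot> S\<^sup>* g \<Rightarrow> S\<^sup>* (g \<odot> f)\<close>.\<close>

definition is_Mod :: "('o, 'm, 'c) doctrine \<Rightarrow> ('o, 'm, 'c) doctrine \<Rightarrow> ('o, 'm, 'c) doctrine
    \<Rightarrow> ('o, 'm, 'c, 'o, 'm, 'c) psfun \<Rightarrow> bool" where
  "is_Mod P S D M \<longleftrightarrow> pseudofunctor (coop (Rex K P S D)) (LP K P S) M \<and>
     (\<forall>G \<in> obj (Rex K P S D). on0 M G = dob S G) \<and>
     (\<exists>\<eta> \<epsilon>.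
        (\<forall>f \<in> arr (Rex K P S D). adjunction K (push K S f) (on1 M f) (\<eta> f) (\<epsilon> f)) \<and>
        (\<forall>\<alpha> \<in> cel (Rex K P S D). on2 M \<alpha> =
           conj_right K (\<eta> (dom2 K \<alpha>)) (\<epsilon> (cod2 K \<alpha>)) (on1 M (dom2 K \<alpha>)) (on1 M (cod2 K \<alpha>))
             (push2 K S \<alpha>)) \<and>
        (\<forall>f \<in> arr (Rex K P S D). \<forall>g \<in> arr (Rex K P S D). trg K f = src K g
           \<longrightarrow> mu M f g =
             conj_right K (\<eta> (g \<odot> f)) (\<epsilon> g \<bullet> (push K S g \<rhd> \<epsilon> f \<lhd> on1 M g))
               (on1 M (g \<odot> f)) (on1 M f \<odot> on1 M g) (push_cmp K S g f)) \<and>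
        (\<forall>G \<in> obj (Rex K P S D). nu M G =
           conj_right K (\<eta> (id1 K G)) (id2 K (id1 K (dob S G)))
             (on1 M (id1 K G)) (id1 K (dob S G)) (push_id K S G)))"

text \<open>In \<open>is_Th\<close>, \<open>E A : A \<rightarrow> S(T A)\<close> is the chosen equivalence, \<open>la p\<close> is the left adjoint of
  \<open>p : A \<rightarrow> B\<close> with unit \<open>\<eta> p\<close> and counit \<open>\<epsilon> p\<close>, and \<open>\<theta> p : S\<^sub>! (T p) \<odot> E B \<cong> E A \<odot> la p\<close>
  says that \<open>S\<^sub>! (T p)\<close> is the left adjoint of \<open>p\<close> transported along the chosen equivalences.
  The last three clauses determine \<open>on2 T\<close>, \<open>mu T\<close> and \<open>nu T\<close> by compatibility with \<open>\<theta>\<close>. Being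
  2-cells of the coop, these have underlying 2-cells \<open>T p' \<Rightarrow> T p\<close> (for \<open>p \<Rightarrow> p'\<close>),
  \<open>T (q \<odot> p) \<Rightarrow> T p \<odot> T q\<close> and \<open>T id \<Rightarrow> id\<close> in \<open>K\<close>. The \<open>conj_left\<close> in the clause for \<open>mu T\<close> is the
  canonical comparison \<open>la (q \<odot> p) \<Rightarrow> la p \<odot> la q\<close>; for identities this comparison
  \<open>la id \<Rightarrow> id\<close> is the counit.\<close>

definition is_Th :: "('o, 'm, 'c) doctrine \<Rightarrow> ('o, 'm, 'c) doctrine \<Rightarrow> ('o, 'm, 'c) doctrine
    \<Rightarrow> ('o, 'm, 'c, 'o, 'm, 'c) psfun \<Rightarrow> bool" where
  "is_Th P S D T \<longleftrightarrow> pseudofunctor (LP K P S) (coop (Rex K P S D)) T \<and>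
     (\<exists>E la \<eta> \<epsilon> \<theta>.
        (\<forall>A \<in> obj (LP K P S). E A \<in> hom K A (dob S (on0 T A)) \<and> equivalence1 K (E A)) \<and>
        (\<forall>p \<in> arr (LP K P S). adjunction K (la p) p (\<eta> p) (\<epsilon> p) \<and>
           \<theta> p \<in> cells K (push K S (on1 T p) \<odot> E (trg K p)) (E (src K p) \<odot> la p) \<and>
           invertible2 K (\<theta> p)) \<and>
        (\<forall>\<beta> \<in> cel (LP K P S).
           \<theta> (dom2 K \<beta>) \<bullet> (push2 K S (on2 T \<beta>) \<lhd> E (trg K (dom2 K \<beta>))) =
           (E (src K (dom2 K \<beta>)) \<rhd>
              conj_left K (\<eta> (dom2 K \<beta>)) (\<epsilon> (cod2 K \<beta>)) (la (dom2 K \<beta>)) (la (cod2 K \<beta>)) \<beta>)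
             \<bullet> \<theta> (cod2 K \<beta>)) \<and>
        (\<forall>p \<in> arr (LP K P S). \<forall>q \<in> arr (LP K P S). trg K p = src K q \<longrightarrow>
           (\<theta> p \<lhd> la q) \<bullet> (push K S (on1 T p) \<rhd> \<theta> q) \<bullet>
             ((push_cmp K S (on1 T p) (on1 T q) \<bullet> push2 K S (mu T q p)) \<lhd> E (trg K q)) =
           (E (src K p) \<rhd>
              conj_left K ((q \<rhd> \<eta> p \<lhd> la q) \<bullet> \<eta> q) (\<epsilon> (q \<odot> p)) (la p \<odot> la q) (la (q \<odot> p))
                (id2 K (q \<odot> p)))
             \<bullet> \<theta> (q \<odot> p)) \<and>
        (\<forall>A \<in> obj (LP K P S).
           (push_id K S (on0 T A) \<bullet> push2 K S (nu T A)) \<lhd> E A =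
           (E A \<rhd> \<epsilon> (id1 K A)) \<bullet> \<theta> (id1 K A)))"

end

end

theory Submission
  imports Defs
begin

text \<open>
  Write \<open>y\<close>, \<open>\<sigma>\<close>, \<open>\<delta>\<close> for the units of \<open>P\<close>, \<open>S\<close>, \<open>D\<close>. Locally, the duality is a computation with
  left extensions: 2-cells \<open>S\<^sub>!f \<Rightarrow> S\<^sub>!g\<close> correspond to 2-cells \<open>\<sigma> f \<Rightarrow> \<sigma> g\<close> because \<open>S\<^sub>!f\<close> is a left
  extension along \<open>\<sigma>\<close>, and these to 2-cells \<open>f \<Rightarrow> g\<close> because \<open>\<sigma>\<close> is fully faithful; passing to right
  adjoints then reverses 1-cells and 2-cells. What remains is to match objects and 1-cells.

  On objects, a \<open>P\<close>-petit and \<open>S\<close>-Cauchy complete \<open>G\<close> is \<open>D\<close>-cocomplete exactly when \<open>SG\<close> is presentable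
  (\<open>presentable_S_free\<close>, \<open>D_cocomplete_if_presentable\<close>), and by the hypothesis on Cauchy completions every
  presentable object is equivalent to such an \<open>SG\<close> (\<open>LPO_equivalent_free\<close>). On 1-cells, \<open>f\<close> is
  \<open>D\<close>-cocontinuous exactly when \<open>S\<^sub>!f\<close> has an \<open>S\<close>-cocontinuous right adjoint (\<open>push_S_right_adjoint\<close>,
  \<open>pres_if_push_left_adjoint\<close>), and Cauchy completeness says that all left adjoints with such a right
  adjoint arise in this way. Everything here depends on \<open>\<sigma> : G \<rightarrow> SG\<close> preserving extensions along
  \<open>\<delta>\<close> (\<open>unt_S_pres\<close>). The reason is the equivalence \<open>PG \<simeq> S(DG)\<close>: carried back along it, the unit
  \<open>DG \<rightarrow> S(DG)\<close> becomes a 1-cell \<open>DG \<rightarrow> PG\<close>, which turns out to be the left extension of \<open>y\<close> along \<open>\<delta>\<close>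
  (\<open>unt_S_D_dense\<close>).

  The pseudofunctors, their pseudonatural unit and counit and the triangle modifications come from a span.
  Its apex is the 2-category of framings: an object is a 1-cell \<open>s : G \<rightarrow> X\<close> isomorphic to
  \<open>\<sigma> : G \<rightarrow> SG\<close> followed by an equivalence, a 1-cell consists of \<open>f : G \<rightarrow> G'\<close>, an adjunction
  \<open>l \<stileturn> r\<close> with \<open>l : X \<rightarrow> X'\<close>, and an isomorphism \<open>s' f \<cong> l s\<close>. Both ways of forgetting, to \<open>f\<close> and to \<open>r\<close>,
  are strict 2-functors that are surjective on objects, full on 1-cells between given framings, and
  bijective on 2-cells (\<open>projection_G\<close>, \<open>projection_X\<close>). For any such span one chooses sections on
  objects and 1-cells; the 2-cells required by the definitions are unique lifts, and every coherence law
  holds because it holds after projection (\<open>span_biequivalence\<close>, \<open>span_biadjunction\<close>). The pseudofunctor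
  \<open>Mod\<close> is the section \<open>G \<mapsto> (\<sigma> : G \<rightarrow> SG)\<close> followed by the other projection, and \<open>Th\<close> arises likewise from
  a section in the opposite direction. Identifying the 2-cells of these two pseudofunctors with those
  given by \<open>S\<^sub>!\<close> and conjugation (\<open>is_Mod_M\<close>, \<open>is_Th_T\<close>) is again the uniqueness property of left extensions.
\<close>

section \<open>Calculus of whiskering\<close>

lemma in_hom [simp]: "f \<in> hom K A B \<longleftrightarrow> f \<in> arr K \<and> src K f = A \<and> trg K f = B"
  by (simp add: hom_def)

lemma in_cells [simp]: "\<alpha> \<in> cells K f g \<longleftrightarrow> \<alpha> \<in> cel K \<and> dom2 K \<alpha> = f \<and> cod2 K \<alpha> = g"
  by (simp add: cells_def)

lemma bij_betw_iff_ex1: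
  assumes "\<And>x. x \<in> A \<Longrightarrow> F x \<in> B"
  shows "bij_betw F A B \<longleftrightarrow> (\<forall>y. y \<in> B \<longrightarrow> (\<exists>!x. x \<in> A \<and> F x = y))"
proof
  assume "bij_betw F A B"
  then have "inj_on F A" "B = F ` A" by (auto simp: bij_betw_def)
  then show "\<forall>y. y \<in> B \<longrightarrow> (\<exists>!x. x \<in> A \<and> F x = y)" by (blast dest: inj_onD)
next
  assume *: "\<forall>y. y \<in> B \<longrightarrow> (\<exists>!x. x \<in> A \<and> F x = y)"
  have "inj_on F A" using * assms by (intro inj_onI) metis
  moreover have "F ` A = B" using * assms by blast
  ultimately show "bij_betw F A B" by (simp add: bij_betw_def)
qed

lemma ex1_eq: "\<exists>!x. Q x \<Longrightarrow> Q a \<Longrightarrow> Q b \<Longrightarrow> a = b"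
  by blast

context two_category
begin

declare src_obj [simp] trg_obj [simp] dom2_arr [simp] cod2_arr [simp]

lemma src_cod2 [simp]: "\<alpha> \<in> cel K \<Longrightarrow> src K (cod2 K \<alpha>) = src K (dom2 K \<alpha>)"
  by (simp add: src_parallel)

lemma trg_cod2 [simp]: "\<alpha> \<in> cel K \<Longrightarrow> trg K (cod2 K \<alpha>) = trg K (dom2 K \<alpha>)"
  by (simp add: trg_parallel)

lemma id1_type [simp]:
  assumes "A \<in> obj K"
  shows "id1 K A \<in> arr K" "src K (id1 K A) = A" "trg K (id1 K A) = A"
  using id1_hom[OF assms] by simp_all

lemma cmp_type [simp]:
  assumes "f \<in> arr K" "g \<in> arr K" "trg K f = src K g"
  shows "g \<odot> f \<in> arr K" "src K (g \<odot> f) = src K f" "trg K (g \<odot> f) = trg K g"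
  using cmp_hom[of f "src K f" "src K g" g "trg K g"] assms by simp_all

lemma cmp_assoc' [simp]:
  "\<lbrakk>f \<in> arr K; g \<in> arr K; h \<in> arr K; trg K f = src K g; trg K g = src K h\<rbrakk>
     \<Longrightarrow> (h \<odot> g) \<odot> f = h \<odot> (g \<odot> f)"
  using cmp_assoc[of f "src K f" "trg K f" g "trg K g" h "trg K h"] by simp

lemma id1_cmp [simp]:
  "\<lbrakk>f \<in> arr K; A = trg K f\<rbrakk> \<Longrightarrow> id1 K A \<odot> f = f"
  "\<lbrakk>f \<in> arr K; A = src K f\<rbrakk> \<Longrightarrow> f \<odot> id1 K A = f"
  using id1_left[of f "src K f" "trg K f"] id1_right[of f "src K f" "trg K f"] by simp_all

lemma id2_type [simp]:
  assumes "f \<in> arr K"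
  shows "id2 K f \<in> cel K" "dom2 K (id2 K f) = f" "cod2 K (id2 K f) = f"
  using id2_cells[OF assms] by simp_all

lemma vcmp_type [simp]:
  assumes "\<alpha> \<in> cel K" "\<beta> \<in> cel K" "cod2 K \<alpha> = dom2 K \<beta>"
  shows "\<beta> \<bullet> \<alpha> \<in> cel K" "dom2 K (\<beta> \<bullet> \<alpha>) = dom2 K \<alpha>" "cod2 K (\<beta> \<bullet> \<alpha>) = cod2 K \<beta>"
  using vcmp_cells[of \<alpha> "dom2 K \<alpha>" "cod2 K \<alpha>" \<beta> "cod2 K \<beta>"] assms by simp_all

lemma vcmp_assoc' [simp]:
  "\<lbrakk>\<alpha> \<in> cel K; \<beta> \<in> cel K; \<gamma> \<in> cel K; cod2 K \<alpha> = dom2 K \<beta>; cod2 K \<beta> = dom2 K \<gamma>\<rbrakk>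
     \<Longrightarrow> (\<gamma> \<bullet> \<beta>) \<bullet> \<alpha> = \<gamma> \<bullet> (\<beta> \<bullet> \<alpha>)"
  using vcmp_assoc[of \<alpha> "dom2 K \<alpha>" "cod2 K \<alpha>" \<beta> "cod2 K \<beta>" \<gamma> "cod2 K \<gamma>"] by simp

lemma id2_vcmp [simp]:
  "\<lbrakk>\<alpha> \<in> cel K; f = cod2 K \<alpha>\<rbrakk> \<Longrightarrow> id2 K f \<bullet> \<alpha> = \<alpha>"
  "\<lbrakk>\<alpha> \<in> cel K; f = dom2 K \<alpha>\<rbrakk> \<Longrightarrow> \<alpha> \<bullet> id2 K f = \<alpha>"
  using id2_left[of \<alpha> "dom2 K \<alpha>" "cod2 K \<alpha>"] id2_right[of \<alpha> "dom2 K \<alpha>" "cod2 K \<alpha>"] by simp_all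

lemma hcmp_type [simp]:
  assumes "\<alpha> \<in> cel K" "\<beta> \<in> cel K" "trg K (dom2 K \<alpha>) = src K (dom2 K \<beta>)"
  shows "\<beta> \<star> \<alpha> \<in> cel K" "dom2 K (\<beta> \<star> \<alpha>) = dom2 K \<beta> \<odot> dom2 K \<alpha>"
    "cod2 K (\<beta> \<star> \<alpha>) = cod2 K \<beta> \<odot> cod2 K \<alpha>"
  using hcmp_cells[of \<alpha> "dom2 K \<alpha>" "cod2 K \<alpha>" \<beta> "dom2 K \<beta>" "cod2 K \<beta>"] assms by simp_all

lemma lw_type [simp]:
  assumes "\<alpha> \<in> cel K" "k \<in> arr K" "trg K (dom2 K \<alpha>) = src K k"
  shows "k \<rhd> \<alpha> \<in> cel K" "dom2 K (k \<rhd> \<alpha>) = k \<odot> dom2 K \<alpha>" "cod2 K (k \<rhd> \<alpha>) = k \<odot> cod2 K \<alpha>"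
  using assms by (simp_all add: lw_def)

lemma rw_type [simp]:
  assumes "\<alpha> \<in> cel K" "j \<in> arr K" "src K (dom2 K \<alpha>) = trg K j"
  shows "\<alpha> \<lhd> j \<in> cel K" "dom2 K (\<alpha> \<lhd> j) = dom2 K \<alpha> \<odot> j" "cod2 K (\<alpha> \<lhd> j) = cod2 K \<alpha> \<odot> j"
  using assms by (simp_all add: rw_def)

lemma hcmp_assoc':
  "\<lbrakk>\<alpha> \<in> cel K; \<beta> \<in> cel K; \<gamma> \<in> cel K;
    trg K (dom2 K \<alpha>) = src K (dom2 K \<beta>); trg K (dom2 K \<beta>) = src K (dom2 K \<gamma>)\<rbrakk>
     \<Longrightarrow> (\<gamma> \<star> \<beta>) \<star> \<alpha> = \<gamma> \<star> (\<beta> \<star> \<alpha>)"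
  using hcmp_assoc[of \<alpha> "dom2 K \<alpha>" "cod2 K \<alpha>" \<beta> "dom2 K \<beta>" "cod2 K \<beta>" \<gamma> "dom2 K \<gamma>" "cod2 K \<gamma>"]
  by simp

lemma interchange':
  "\<lbrakk>\<alpha> \<in> cel K; \<alpha>' \<in> cel K; \<beta> \<in> cel K; \<beta>' \<in> cel K; cod2 K \<alpha> = dom2 K \<alpha>'; cod2 K \<beta> = dom2 K \<beta>';
    trg K (dom2 K \<alpha>) = src K (dom2 K \<beta>)\<rbrakk>
     \<Longrightarrow> (\<beta>' \<bullet> \<beta>) \<star> (\<alpha>' \<bullet> \<alpha>) = (\<beta>' \<star> \<alpha>') \<bullet> (\<beta> \<star> \<alpha>)"
  using interchange[of \<alpha> "dom2 K \<alpha>" "dom2 K \<alpha>'" \<alpha>' "cod2 K \<alpha>'"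
      \<beta> "dom2 K \<beta>" "dom2 K \<beta>'" \<beta>' "cod2 K \<beta>'"] by simp

lemma hcmp_id2' [simp]:
  "\<lbrakk>f \<in> arr K; g \<in> arr K; trg K f = src K g\<rbrakk> \<Longrightarrow> id2 K g \<star> id2 K f = id2 K (g \<odot> f)"
  using hcmp_id2[of f "src K f" "trg K f" g "trg K g"] by simp

lemma lw_id2 [simp]:
  "\<lbrakk>f \<in> arr K; g \<in> arr K; trg K f = src K g\<rbrakk> \<Longrightarrow> g \<rhd> id2 K f = id2 K (g \<odot> f)"
  by (simp add: lw_def)

lemma rw_id2 [simp]:
  "\<lbrakk>f \<in> arr K; g \<in> arr K; trg K f = src K g\<rbrakk> \<Longrightarrow> id2 K g \<lhd> f = id2 K (g \<odot> f)"
  by (simp add: rw_def)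

lemma lw_id1 [simp]: "\<lbrakk>\<alpha> \<in> cel K; A = trg K (dom2 K \<alpha>)\<rbrakk> \<Longrightarrow> id1 K A \<rhd> \<alpha> = \<alpha>"
  using hcmp_left[of \<alpha> "dom2 K \<alpha>" "cod2 K \<alpha>"] by (simp add: lw_def)

lemma rw_id1 [simp]: "\<lbrakk>\<alpha> \<in> cel K; A = src K (dom2 K \<alpha>)\<rbrakk> \<Longrightarrow> \<alpha> \<lhd> id1 K A = \<alpha>"
  using hcmp_right[of \<alpha> "dom2 K \<alpha>" "cod2 K \<alpha>"] by (simp add: rw_def)

lemma lw_vcmp [simp]:
  assumes "\<alpha> \<in> cel K" "\<beta> \<in> cel K" "cod2 K \<alpha> = dom2 K \<beta>" "k \<in> arr K" "trg K (dom2 K \<alpha>) = src K k"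
  shows "k \<rhd> (\<beta> \<bullet> \<alpha>) = (k \<rhd> \<beta>) \<bullet> (k \<rhd> \<alpha>)"
  using interchange'[of \<alpha> \<beta> "id2 K k" "id2 K k"] assms by (simp add: lw_def)

lemma rw_vcmp [simp]:
  assumes "\<alpha> \<in> cel K" "\<beta> \<in> cel K" "cod2 K \<alpha> = dom2 K \<beta>" "j \<in> arr K" "src K (dom2 K \<alpha>) = trg K j"
  shows "(\<beta> \<bullet> \<alpha>) \<lhd> j = (\<beta> \<lhd> j) \<bullet> (\<alpha> \<lhd> j)"
  using interchange'[of "id2 K j" "id2 K j" \<alpha> \<beta>] assms by (simp add: rw_def)

lemma lw_lw [simp]:
  assumes "\<alpha> \<in> cel K" "k \<in> arr K" "h \<in> arr K" "trg K (dom2 K \<alpha>) = src K h" "trg K h = src K k"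
  shows "(k \<odot> h) \<rhd> \<alpha> = k \<rhd> (h \<rhd> \<alpha>)"
  using hcmp_assoc'[of \<alpha> "id2 K h" "id2 K k"] assms by (simp add: lw_def)

lemma rw_rw [simp]:
  assumes "\<alpha> \<in> cel K" "j \<in> arr K" "h \<in> arr K" "src K (dom2 K \<alpha>) = trg K j" "trg K h = src K j"
  shows "\<alpha> \<lhd> (j \<odot> h) = \<alpha> \<lhd> j \<lhd> h"
  using hcmp_assoc'[of "id2 K h" "id2 K j" \<alpha>] assms by (simp add: rw_def)

lemma lw_rw [simp]:
  assumes "\<alpha> \<in> cel K" "k \<in> arr K" "j \<in> arr K" "trg K (dom2 K \<alpha>) = src K k" "src K (dom2 K \<alpha>) = trg K j"
  shows "(k \<rhd> \<alpha>) \<lhd> j = k \<rhd> (\<alpha> \<lhd> j)"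
  using hcmp_assoc'[of "id2 K j" \<alpha> "id2 K k"] assms by (simp add: lw_def rw_def)

lemma hcmp_eq1:
  assumes "\<alpha> \<in> cel K" "\<beta> \<in> cel K" "trg K (dom2 K \<alpha>) = src K (dom2 K \<beta>)"
  shows "\<beta> \<star> \<alpha> = (\<beta> \<lhd> cod2 K \<alpha>) \<bullet> (dom2 K \<beta> \<rhd> \<alpha>)"
  using interchange'[of \<alpha> "id2 K (cod2 K \<alpha>)" "id2 K (dom2 K \<beta>)" \<beta>] assms
  by (simp add: lw_def rw_def)

lemma hcmp_eq2:
  assumes "\<alpha> \<in> cel K" "\<beta> \<in> cel K" "trg K (dom2 K \<alpha>) = src K (dom2 K \<beta>)"
  shows "\<beta> \<star> \<alpha> = (cod2 K \<beta> \<rhd> \<alpha>) \<bullet> (\<beta> \<lhd> dom2 K \<alpha>)"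
  using interchange'[of "id2 K (dom2 K \<alpha>)" \<alpha> \<beta> "id2 K (cod2 K \<beta>)"] assms
  by (simp add: lw_def rw_def)

text \<open>As a bare equation between objects, this condition would act as a rewrite rule whenever an instance
  of \<open>slide\<close> below is handed to the simplifier, and could make it loop.\<close>

definition composable :: "'m \<Rightarrow> 'm \<Rightarrow> bool" where
  "composable g f \<longleftrightarrow> trg K f = src K g"

text \<open>Interchange, in the form in which it is used: 2-cells on adjacent strands move past each other.\<close>

lemma slide:
  assumes "\<alpha> \<in> cells K f f'" "\<beta> \<in> cells K g g'" "composable g f"
  shows "(\<beta> \<lhd> f') \<bullet> (g \<rhd> \<alpha>) = (g' \<rhd> \<alpha>) \<bullet> (\<beta> \<lhd> f)"
  using hcmp_eq1[of \<alpha> \<beta>] hcmp_eq2[of \<alpha> \<beta>] assms by (auto simp: composable_def)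

declare composable_def [simp]

lemma rw_split:
  assumes "\<delta> \<in> cel K" "\<gamma> \<in> cel K" "cod2 K \<delta> = dom2 K \<gamma>" "E \<in> arr K" "trg K E = src K (dom2 K \<delta>)"
    "\<beta> \<in> cel K" "\<alpha> \<in> cel K" "cod2 K \<gamma> \<odot> E = dom2 K \<beta>" "cod2 K \<beta> = dom2 K \<alpha>"
  shows "\<alpha> \<bullet> \<beta> \<bullet> ((\<gamma> \<bullet> \<delta>) \<lhd> E) = (\<alpha> \<bullet> \<beta> \<bullet> (\<gamma> \<lhd> E)) \<bullet> (\<delta> \<lhd> E)"
  using assms src_parallel[of \<delta>] by simp

text \<open>Vertical composites are kept nested to the right. These two lemmas make an equation about a
  composite of two 2-cells applicable in the middle of a longer chain.\<close>

lemma extend_eq: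
  assumes "a \<bullet> b = c \<bullet> d" "a \<in> cel K" "b \<in> cel K" "c \<in> cel K" "d \<in> cel K" "x \<in> cel K"
    "dom2 K a = cod2 K b" "dom2 K c = cod2 K d" "cod2 K x = dom2 K b" "dom2 K b = dom2 K d"
  shows "a \<bullet> (b \<bullet> x) = c \<bullet> (d \<bullet> x)"
  using assms by (metis vcmp_assoc')

lemma extend_eq1:
  assumes "a \<bullet> b = c" "a \<in> cel K" "b \<in> cel K" "x \<in> cel K"
    "dom2 K a = cod2 K b" "cod2 K x = dom2 K b"
  shows "a \<bullet> (b \<bullet> x) = c \<bullet> x"
  using assms by (metis vcmp_assoc')

subsection \<open>Invertible 2-cells\<close>

lemma inverse2_iff: "inverse2 K \<alpha> \<beta> \<longleftrightarrow> \<alpha> \<in> cel K \<and> \<beta> \<in> cel K \<and> dom2 K \<beta> = cod2 K \<alpha> \<and>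
   cod2 K \<beta> = dom2 K \<alpha> \<and> \<beta> \<bullet> \<alpha> = id2 K (dom2 K \<alpha>) \<and> \<alpha> \<bullet> \<beta> = id2 K (cod2 K \<alpha>)"
  by (auto simp: inverse2_def)

lemma inverse2_unique: "inverse2 K \<alpha> \<beta> \<Longrightarrow> inverse2 K \<alpha> \<gamma> \<Longrightarrow> \<beta> = \<gamma>"
  unfolding inverse2_iff by (metis id2_vcmp vcmp_assoc')

lemma inv2_eq: "inverse2 K \<alpha> \<beta> \<Longrightarrow> inv2 K \<alpha> = \<beta>"
  unfolding inv2_def using inverse2_unique by blast

lemma inv2_inverse: "invertible2 K \<alpha> \<Longrightarrow> inverse2 K \<alpha> (inv2 K \<alpha>)"
  using inv2_eq unfolding invertible2_def by auto

lemma invertible_cel: "invertible2 K \<alpha> \<Longrightarrow> \<alpha> \<in> cel K"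
  by (auto simp: invertible2_def inverse2_iff)

lemma inv2_type [simp]:
  assumes "invertible2 K \<alpha>"
  shows "inv2 K \<alpha> \<in> cel K" "dom2 K (inv2 K \<alpha>) = cod2 K \<alpha>" "cod2 K (inv2 K \<alpha>) = dom2 K \<alpha>"
    "inv2 K \<alpha> \<bullet> \<alpha> = id2 K (dom2 K \<alpha>)" "\<alpha> \<bullet> inv2 K \<alpha> = id2 K (cod2 K \<alpha>)"
  using inv2_inverse[OF assms] by (simp_all add: inverse2_iff)

lemma inv2_cancel [simp]:
  assumes "invertible2 K \<alpha>" "x \<in> cel K"
  shows "cod2 K x = dom2 K \<alpha> \<Longrightarrow> inv2 K \<alpha> \<bullet> (\<alpha> \<bullet> x) = x"
    "cod2 K x = cod2 K \<alpha> \<Longrightarrow> \<alpha> \<bullet> (inv2 K \<alpha> \<bullet> x) = x"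
  using extend_eq1[of "inv2 K \<alpha>" \<alpha> _ x] extend_eq1[of \<alpha> "inv2 K \<alpha>" _ x] invertible_cel[OF assms(1)]
    assms by simp_all

lemma invertible_inv2: "invertible2 K \<alpha> \<Longrightarrow> invertible2 K (inv2 K \<alpha>)"
  using inv2_inverse[of \<alpha>] unfolding invertible2_def inverse2_iff by metis

lemma invertible_id2: "f \<in> arr K \<Longrightarrow> invertible2 K (id2 K f)"
  unfolding invertible2_def inverse2_iff by (rule exI[of _ "id2 K f"]) simp

lemma invertible_vcmp:
  assumes "invertible2 K \<alpha>" "invertible2 K \<beta>" "cod2 K \<alpha> = dom2 K \<beta>"
  shows "invertible2 K (\<beta> \<bullet> \<alpha>)"
  using assms invertible_cel[OF assms(1)] invertible_cel[OF assms(2)]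
  unfolding invertible2_def[of _ "\<beta> \<bullet> \<alpha>"] inverse2_iff
  by (intro exI[of _ "inv2 K \<alpha> \<bullet> inv2 K \<beta>"]) simp

lemma invertible_lw:
  assumes "invertible2 K \<alpha>" "k \<in> arr K" "trg K (dom2 K \<alpha>) = src K k"
  shows "invertible2 K (k \<rhd> \<alpha>)"
  using assms invertible_cel[OF assms(1)]
  unfolding invertible2_def[of _ "k \<rhd> \<alpha>"] inverse2_iff
  by (intro exI[of _ "k \<rhd> inv2 K \<alpha>"]) (simp flip: lw_vcmp)

lemma invertible_rw:
  assumes "invertible2 K \<alpha>" "j \<in> arr K" "src K (dom2 K \<alpha>) = trg K j"
  shows "invertible2 K (\<alpha> \<lhd> j)"
  using assms invertible_cel[OF assms(1)]
  unfolding invertible2_def[of _ "\<alpha> \<lhd> j"] inverse2_iff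
  by (intro exI[of _ "inv2 K \<alpha> \<lhd> j"]) (simp flip: rw_vcmp)

section \<open>Isomorphic 1-cells\<close>

abbreviation iso1 (infix "\<simeq>" 50) where "f \<simeq> g \<equiv> isomorphic1 K f g"

lemma iso1_def: "f \<simeq> g \<longleftrightarrow> (\<exists>\<alpha>. invertible2 K \<alpha> \<and> dom2 K \<alpha> = f \<and> cod2 K \<alpha> = g)"
  unfolding isomorphic1_def using invertible_cel by auto

lemma iso1_type:
  assumes "f \<simeq> g"
  shows "f \<in> arr K" "g \<in> arr K" "src K g = src K f" "trg K g = trg K f"
  using assms unfolding iso1_def by (auto dest!: invertible_cel)

lemma iso1_refl: "f \<in> arr K \<Longrightarrow> f \<simeq> f"
  unfolding iso1_def using invertible_id2 by fastforce

lemma iso1_sym: "f \<simeq> g \<Longrightarrow> g \<simeq> f"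
  unfolding iso1_def using invertible_inv2 by fastforce

lemma iso1I: "invertible2 K \<alpha> \<Longrightarrow> dom2 K \<alpha> = f \<Longrightarrow> cod2 K \<alpha> = g \<Longrightarrow> f \<simeq> g"
  by (auto simp: iso1_def)

lemma iso1E:
  assumes "f \<simeq> g"
  obtains \<alpha> where "invertible2 K \<alpha>" "\<alpha> \<in> cel K" "dom2 K \<alpha> = f" "cod2 K \<alpha> = g"
  using assms invertible_cel unfolding iso1_def by blast

lemma iso1_trans [trans]:
  assumes "f \<simeq> g" "g \<simeq> h"
  shows "f \<simeq> h"
proof -
  obtain \<alpha> where "invertible2 K \<alpha>" "\<alpha> \<in> cel K" "dom2 K \<alpha> = f" "cod2 K \<alpha> = g" using assms(1) by (rule iso1E)
  moreover obtain \<beta> where "invertible2 K \<beta>" "\<beta> \<in> cel K" "dom2 K \<beta> = g" "cod2 K \<beta> = h" using assms(2) by (rule iso1E)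
  ultimately show ?thesis by (intro iso1I[of "\<beta> \<bullet> \<alpha>"] invertible_vcmp) simp_all
qed

lemma iso1_lw:
  assumes "f \<simeq> g" "k \<in> arr K" "trg K f = src K k"
  shows "k \<odot> f \<simeq> k \<odot> g"
proof -
  obtain \<alpha> where "invertible2 K \<alpha>" "\<alpha> \<in> cel K" "dom2 K \<alpha> = f" "cod2 K \<alpha> = g" using assms(1) by (rule iso1E)
  then show ?thesis using assms(2,3) by (intro iso1I[of "k \<rhd> \<alpha>"] invertible_lw) simp_all
qed

lemma iso1_rw:
  assumes "f \<simeq> g" "j \<in> arr K" "src K f = trg K j"
  shows "f \<odot> j \<simeq> g \<odot> j"
proof -
  obtain \<alpha> where "invertible2 K \<alpha>" "\<alpha> \<in> cel K" "dom2 K \<alpha> = f" "cod2 K \<alpha> = g" using assms(1) by (rule iso1E)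
  then show ?thesis using assms(2,3) by (intro iso1I[of "\<alpha> \<lhd> j"] invertible_rw) simp_all
qed

section \<open>Adjunctions and mates\<close>

lemma adjunctionD:
  assumes "adjunction K l r \<eta> \<epsilon>"
  shows "l \<in> arr K" "r \<in> arr K" "src K r = trg K l" "trg K r = src K l"
    "\<eta> \<in> cel K" "dom2 K \<eta> = id1 K (src K l)" "cod2 K \<eta> = r \<odot> l"
    "\<epsilon> \<in> cel K" "dom2 K \<epsilon> = l \<odot> r" "cod2 K \<epsilon> = id1 K (trg K l)"
    "(\<epsilon> \<lhd> l) \<bullet> (l \<rhd> \<eta>) = id2 K l" "(r \<rhd> \<epsilon>) \<bullet> (\<eta> \<lhd> r) = id2 K r"
  using assms unfolding adjunction_def by auto

lemma adjunctionI:
  assumes "l \<in> arr K" "r \<in> arr K" "src K r = trg K l" "trg K r = src K l"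
    "\<eta> \<in> cel K" "dom2 K \<eta> = id1 K (src K l)" "cod2 K \<eta> = r \<odot> l"
    "\<epsilon> \<in> cel K" "dom2 K \<epsilon> = l \<odot> r" "cod2 K \<epsilon> = id1 K (trg K l)"
    "(\<epsilon> \<lhd> l) \<bullet> (l \<rhd> \<eta>) = id2 K l" "(r \<rhd> \<epsilon>) \<bullet> (\<eta> \<lhd> r) = id2 K r"
  shows "adjunction K l r \<eta> \<epsilon>"
  using assms unfolding adjunction_def by auto

text \<open>Mates \<open>\<mu> : l \<Rightarrow> l'\<close> and \<open>\<rho> : r' \<Rightarrow> r\<close>, expressed by the counits alone. In this form the
  relation is stable under vertical and horizontal composition without any triangle identity.\<close>

definition mate :: "'c \<Rightarrow> 'c \<Rightarrow> 'c \<Rightarrow> 'c \<Rightarrow> bool" where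
  "mate \<epsilon> \<epsilon>' \<mu> \<rho> \<longleftrightarrow> \<epsilon>' \<bullet> (\<mu> \<lhd> dom2 K \<rho>) = \<epsilon> \<bullet> (dom2 K \<mu> \<rhd> \<rho>)"

text \<open>Each side of a pair of mates determines the other: conjugation produces a mate by one triangle
  identity, and the other triangle identity makes it unique.\<close>

lemma mate_conj_right:
  assumes a: "adjunction K l r \<eta> \<epsilon>" and b: "adjunction K l' r' \<eta>' \<epsilon>'"
    and "\<mu> \<in> cells K l l'" and "src K l' = src K l" "trg K l' = trg K l"
  shows "conj_right K \<eta> \<epsilon>' r r' \<mu> \<in> cells K r' r"
    and "mate \<epsilon> \<epsilon>' \<mu> (conj_right K \<eta> \<epsilon>' r r' \<mu>)"
proof -
  note [simp] = adjunctionD(1-10)[OF a] adjunctionD(1-10)[OF b] assms(4,5)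
  have l [simp]: "\<mu> \<in> cel K" "dom2 K \<mu> = l" "cod2 K \<mu> = l'" using assms(3) by auto
  show 1: "conj_right K \<eta> \<epsilon>' r r' \<mu> \<in> cells K r' r"
    by (simp add: conj_right_def)
  have s1: "\<epsilon> \<bullet> (l \<rhd> r \<rhd> \<epsilon>') = \<epsilon>' \<bullet> (\<epsilon> \<lhd> l' \<lhd> r')"
    using slide[of \<epsilon>' "l' \<odot> r'" "id1 K (trg K l)" \<epsilon> "l \<odot> r" "id1 K (trg K l)"] by simp
  have s2: "(\<epsilon> \<lhd> l' \<lhd> r') \<bullet> (l \<rhd> r \<rhd> (\<mu> \<lhd> r')) = (\<mu> \<lhd> r') \<bullet> (\<epsilon> \<lhd> l \<lhd> r')"
    using slide[of "\<mu> \<lhd> r'" "l \<odot> r'" "l' \<odot> r'" \<epsilon> "l \<odot> r" "id1 K (trg K l)"] by simp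
  have s3: "(\<epsilon> \<lhd> l \<lhd> r') \<bullet> (l \<rhd> \<eta> \<lhd> r') = id2 K (l \<odot> r')"
    using arg_cong[OF adjunctionD(11)[OF a], of "\<lambda>x. x \<lhd> r'"] by simp
  have "\<epsilon> \<bullet> (l \<rhd> conj_right K \<eta> \<epsilon>' r r' \<mu>) = \<epsilon>' \<bullet> (\<mu> \<lhd> r')"
    by (simp add: conj_right_def extend_eq[OF s1] extend_eq[OF s2] s3)
  then show "mate \<epsilon> \<epsilon>' \<mu> (conj_right K \<eta> \<epsilon>' r r' \<mu>)"
    using 1 by (simp add: mate_def)
qed

lemma mate_unique_right:
  assumes a: "adjunction K l r \<eta> \<epsilon>" and b: "adjunction K l' r' \<eta>' \<epsilon>'"
    and "\<mu> \<in> cells K l l'" and "src K l' = src K l" "trg K l' = trg K l"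
    and "\<rho> \<in> cells K r' r" "mate \<epsilon> \<epsilon>' \<mu> \<rho>"
  shows "\<rho> = conj_right K \<eta> \<epsilon>' r r' \<mu>"
proof -
  note [simp] = adjunctionD(1-10)[OF a] adjunctionD(1-10)[OF b] assms(4,5)
  have l [simp]: "\<mu> \<in> cel K" "dom2 K \<mu> = l" "cod2 K \<mu> = l'"
     "\<rho> \<in> cel K" "dom2 K \<rho> = r'" "cod2 K \<rho> = r" using assms(3,6) by auto
  have m: "\<epsilon>' \<bullet> (\<mu> \<lhd> r') = \<epsilon> \<bullet> (l \<rhd> \<rho>)" using assms(7) by (simp add: mate_def)
  have m': "(r \<rhd> \<epsilon>') \<bullet> (r \<rhd> (\<mu> \<lhd> r')) = (r \<rhd> \<epsilon>) \<bullet> (r \<rhd> l \<rhd> \<rho>)"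
    using arg_cong[OF m, of "\<lambda>x. r \<rhd> x"] by simp
  have s: "(r \<rhd> l \<rhd> \<rho>) \<bullet> (\<eta> \<lhd> r') = (\<eta> \<lhd> r) \<bullet> \<rho>"
    using slide[of \<rho> r' r \<eta> "id1 K (src K l)" "r \<odot> l"] by simp
  show ?thesis
    using extend_eq1[OF adjunctionD(12)[OF a], of \<rho>]
    by (simp add: conj_right_def extend_eq[OF m'] s)
qed

lemma mate_conj_left:
  assumes a: "adjunction K l r \<eta> \<epsilon>" and b: "adjunction K l' r' \<eta>' \<epsilon>'"
    and "\<rho> \<in> cells K r' r" and "src K l' = src K l" "trg K l' = trg K l"
  shows "conj_left K \<eta>' \<epsilon> l' l \<rho> \<in> cells K l l'"
    and "mate \<epsilon> \<epsilon>' (conj_left K \<eta>' \<epsilon> l' l \<rho>) \<rho>"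
proof -
  note [simp] = adjunctionD(1-10)[OF a] adjunctionD(1-10)[OF b] assms(4,5)
  have l [simp]: "\<rho> \<in> cel K" "dom2 K \<rho> = r'" "cod2 K \<rho> = r" using assms(3) by auto
  show 1: "conj_left K \<eta>' \<epsilon> l' l \<rho> \<in> cells K l l'"
    by (simp add: conj_left_def)
  have s1: "\<epsilon>' \<bullet> (\<epsilon> \<lhd> l' \<lhd> r') = \<epsilon> \<bullet> (l \<rhd> r \<rhd> \<epsilon>')"
    using slide[of \<epsilon>' "l' \<odot> r'" "id1 K (trg K l)" \<epsilon> "l \<odot> r" "id1 K (trg K l)"] by simp
  have s2: "(l \<rhd> r \<rhd> \<epsilon>') \<bullet> (l \<rhd> (\<rho> \<lhd> l' \<lhd> r')) = (l \<rhd> \<rho>) \<bullet> (l \<rhd> r' \<rhd> \<epsilon>')"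
    using arg_cong[OF slide[of \<epsilon>' "l' \<odot> r'" "id1 K (trg K l)" \<rho> "r'" "r"], of "\<lambda>x. l \<rhd> x"] by simp
  have s3: "(l \<rhd> r' \<rhd> \<epsilon>') \<bullet> (l \<rhd> (\<eta>' \<lhd> r')) = id2 K (l \<odot> r')"
    using arg_cong[OF adjunctionD(12)[OF b], of "\<lambda>x. l \<rhd> x"] by simp
  have "\<epsilon>' \<bullet> (conj_left K \<eta>' \<epsilon> l' l \<rho> \<lhd> r') = \<epsilon> \<bullet> (l \<rhd> \<rho>)"
    by (simp add: conj_left_def extend_eq[OF s1] extend_eq[OF s2] s3)
  then show "mate \<epsilon> \<epsilon>' (conj_left K \<eta>' \<epsilon> l' l \<rho>) \<rho>"
    using 1 by (simp add: mate_def)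
qed

lemma mate_unique_left:
  assumes a: "adjunction K l r \<eta> \<epsilon>" and b: "adjunction K l' r' \<eta>' \<epsilon>'"
    and "\<rho> \<in> cells K r' r" and "src K l' = src K l" "trg K l' = trg K l"
    and "\<mu> \<in> cells K l l'" "mate \<epsilon> \<epsilon>' \<mu> \<rho>"
  shows "\<mu> = conj_left K \<eta>' \<epsilon> l' l \<rho>"
proof -
  note [simp] = adjunctionD(1-10)[OF a] adjunctionD(1-10)[OF b] assms(4,5)
  have l [simp]: "\<mu> \<in> cel K" "dom2 K \<mu> = l" "cod2 K \<mu> = l'"
     "\<rho> \<in> cel K" "dom2 K \<rho> = r'" "cod2 K \<rho> = r" using assms(3,6) by auto
  have m: "\<epsilon> \<bullet> (l \<rhd> \<rho>) = \<epsilon>' \<bullet> (\<mu> \<lhd> r')" using assms(7) by (simp add: mate_def)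
  have m': "(\<epsilon> \<lhd> l') \<bullet> (l \<rhd> (\<rho> \<lhd> l')) = (\<epsilon>' \<lhd> l') \<bullet> (\<mu> \<lhd> r' \<lhd> l')"
    using arg_cong[OF m, of "\<lambda>x. x \<lhd> l'"] by simp
  have s: "(\<mu> \<lhd> r' \<lhd> l') \<bullet> (l \<rhd> \<eta>') = (l' \<rhd> \<eta>') \<bullet> \<mu>"
    using slide[of \<eta>' "id1 K (src K l)" "r' \<odot> l'" \<mu> l l'] by simp
  show ?thesis
    using extend_eq1[OF adjunctionD(11)[OF b], of \<mu>]
    by (simp add: conj_left_def extend_eq[OF m'] s)
qed

lemma adjunction_id: "A \<in> obj K \<Longrightarrow> adjunction K (id1 K A) (id1 K A) (id2 K (id1 K A)) (id2 K (id1 K A))"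
  by (rule adjunctionI) simp_all

lemma adjunction_cmp:
  assumes a: "adjunction K l r \<eta> \<epsilon>" and b: "adjunction K l2 r2 \<eta>2 \<epsilon>2" and c: "trg K l = src K l2"
  shows "adjunction K (l2 \<odot> l) (r \<odot> r2) ((r \<rhd> \<eta>2 \<lhd> l) \<bullet> \<eta>) (\<epsilon>2 \<bullet> (l2 \<rhd> \<epsilon> \<lhd> r2))"
proof -
  note [simp] = adjunctionD(1-10)[OF a] adjunctionD(1-10)[OF b] c
  have s1: "(\<epsilon> \<lhd> r2 \<lhd> l2 \<lhd> l) \<bullet> (l \<rhd> r \<rhd> (\<eta>2 \<lhd> l)) = (\<eta>2 \<lhd> l) \<bullet> (\<epsilon> \<lhd> l)"
    using slide[of "\<eta>2 \<lhd> l" "l" "r2 \<odot> l2 \<odot> l" \<epsilon> "l \<odot> r" "id1 K (trg K l)"] by simp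
  have s1': "(l2 \<rhd> (\<epsilon> \<lhd> r2 \<lhd> l2 \<lhd> l)) \<bullet> (l2 \<rhd> l \<rhd> r \<rhd> (\<eta>2 \<lhd> l)) = (l2 \<rhd> \<eta>2 \<lhd> l) \<bullet> (l2 \<rhd> \<epsilon> \<lhd> l)"
    using arg_cong[OF s1, of "\<lambda>x. l2 \<rhd> x"] by simp
  have s2: "(l2 \<rhd> \<epsilon> \<lhd> l) \<bullet> (l2 \<rhd> l \<rhd> \<eta>) = id2 K (l2 \<odot> l)"
    using arg_cong[OF adjunctionD(11)[OF a], of "\<lambda>x. l2 \<rhd> x"] by simp
  have s3: "(\<epsilon>2 \<lhd> l2 \<lhd> l) \<bullet> (l2 \<rhd> \<eta>2 \<lhd> l) = id2 K (l2 \<odot> l)"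
    using arg_cong[OF adjunctionD(11)[OF b], of "\<lambda>x. x \<lhd> l"] by simp
  have v1: "(r2 \<rhd> l2 \<rhd> (\<epsilon> \<lhd> r2)) \<bullet> (\<eta>2 \<lhd> l \<lhd> r \<lhd> r2) = (\<eta>2 \<lhd> r2) \<bullet> (\<epsilon> \<lhd> r2)"
    using slide[of "\<epsilon> \<lhd> r2" "l \<odot> r \<odot> r2" r2 \<eta>2 "id1 K (trg K l)" "r2 \<odot> l2"] by simp
  have v1': "(r \<rhd> r2 \<rhd> l2 \<rhd> (\<epsilon> \<lhd> r2)) \<bullet> (r \<rhd> (\<eta>2 \<lhd> l \<lhd> r \<lhd> r2)) = (r \<rhd> (\<eta>2 \<lhd> r2)) \<bullet> (r \<rhd> (\<epsilon> \<lhd> r2))"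
    using arg_cong[OF v1, of "\<lambda>x. r \<rhd> x"] by simp
  have v2: "(r \<rhd> r2 \<rhd> \<epsilon>2) \<bullet> (r \<rhd> (\<eta>2 \<lhd> r2)) = id2 K (r \<odot> r2)"
    using arg_cong[OF adjunctionD(12)[OF b], of "\<lambda>x. r \<rhd> x"] by simp
  have v3: "(r \<rhd> (\<epsilon> \<lhd> r2)) \<bullet> (\<eta> \<lhd> r \<lhd> r2) = id2 K (r \<odot> r2)"
    using arg_cong[OF adjunctionD(12)[OF a], of "\<lambda>x. x \<lhd> r2"] by simp
  show ?thesis
    by (rule adjunctionI)
      (simp_all add: extend_eq[OF s1'] s2 s3 extend_eq[OF v1'] v2 v3)
qed

lemma adjointI: "adjunction K l r \<eta> \<epsilon> \<Longrightarrow> adjoint K l r"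
  by (auto simp: adjoint_def)

lemma adjoint_type:
  assumes "adjoint K l r"
  shows "l \<in> arr K" "r \<in> arr K" "src K r = trg K l" "trg K r = src K l"
  using assms adjunctionD(1-4) by (auto simp: adjoint_def)

lemma adjoint_cmp:
  "\<lbrakk>adjoint K l r; adjoint K l2 r2; trg K l = src K l2\<rbrakk> \<Longrightarrow> adjoint K (l2 \<odot> l) (r \<odot> r2)"
  unfolding adjoint_def using adjunction_cmp by metis

lemma adjoint_id: "A \<in> obj K \<Longrightarrow> adjoint K (id1 K A) (id1 K A)"
  using adjunction_id adjointI by blast

lemma adjoint_iso_right:
  assumes "adjoint K l r" "r \<simeq> r'"
  shows "adjoint K l r'"
proof -
  obtain \<eta> \<epsilon> where a: "adjunction K l r \<eta> \<epsilon>" using assms(1) by (auto simp: adjoint_def)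
  obtain \<theta> where t [simp]: "invertible2 K \<theta>" "dom2 K \<theta> = r" "cod2 K \<theta> = r'"
    using assms(2) by (auto simp: iso1_def)
  note [simp] = adjunctionD(1-10)[OF a] iso1_type[OF assms(2)] invertible_cel[OF t(1)]
  have c: "(l \<rhd> (inv2 K \<theta> \<lhd> l)) \<bullet> (l \<rhd> (\<theta> \<lhd> l)) = id2 K (l \<odot> r \<odot> l)"
    by (simp flip: lw_vcmp rw_vcmp)
  have s3: "(r' \<rhd> l \<rhd> inv2 K \<theta>) \<bullet> (\<theta> \<lhd> l \<lhd> r') = (\<theta> \<lhd> l \<lhd> r) \<bullet> (r \<rhd> l \<rhd> inv2 K \<theta>)"
    using slide[of "l \<rhd> inv2 K \<theta>" "l \<odot> r'" "l \<odot> r" \<theta> r r'] by simp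
  have s4: "(r' \<rhd> \<epsilon>) \<bullet> (\<theta> \<lhd> l \<lhd> r) = \<theta> \<bullet> (r \<rhd> \<epsilon>)"
    using slide[of \<epsilon> "l \<odot> r" "id1 K (trg K l)" \<theta> r r'] by simp
  have s5: "(r \<rhd> l \<rhd> inv2 K \<theta>) \<bullet> (\<eta> \<lhd> r') = (\<eta> \<lhd> r) \<bullet> inv2 K \<theta>"
    using slide[of "inv2 K \<theta>" r' r \<eta> "id1 K (src K l)" "r \<odot> l"] by simp
  have "adjunction K l r' ((\<theta> \<lhd> l) \<bullet> \<eta>) (\<epsilon> \<bullet> (l \<rhd> inv2 K \<theta>))"
    by (rule adjunctionI)
      (simp_all add: extend_eq1[OF c] extend_eq[OF s3] extend_eq[OF s4] s5
        extend_eq1[OF adjunctionD(12)[OF a]] adjunctionD(11)[OF a])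
  then show ?thesis by (rule adjointI)
qed

lemma adjoint_iso_left:
  assumes "adjoint K l r" "l \<simeq> l'"
  shows "adjoint K l' r"
proof -
  obtain \<eta> \<epsilon> where a: "adjunction K l r \<eta> \<epsilon>" using assms(1) by (auto simp: adjoint_def)
  obtain \<theta> where t [simp]: "invertible2 K \<theta>" "dom2 K \<theta> = l" "cod2 K \<theta> = l'"
    using assms(2) by (auto simp: iso1_def)
  note [simp] = adjunctionD(1-10)[OF a] iso1_type[OF assms(2)] invertible_cel[OF t(1)]
  have c: "(r \<rhd> (inv2 K \<theta> \<lhd> r)) \<bullet> (r \<rhd> (\<theta> \<lhd> r)) = id2 K (r \<odot> l \<odot> r)"
    by (simp flip: lw_vcmp rw_vcmp)
  have s3: "(inv2 K \<theta> \<lhd> r \<lhd> l') \<bullet> (l' \<rhd> r \<rhd> \<theta>) = (l \<rhd> r \<rhd> \<theta>) \<bullet> (inv2 K \<theta> \<lhd> r \<lhd> l)"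
    using slide[of "r \<rhd> \<theta>" "r \<odot> l" "r \<odot> l'" "inv2 K \<theta>" l' l] by simp
  have s4: "(\<epsilon> \<lhd> l') \<bullet> (l \<rhd> r \<rhd> \<theta>) = \<theta> \<bullet> (\<epsilon> \<lhd> l)"
    using slide[of \<theta> l l' \<epsilon> "l \<odot> r" "id1 K (trg K l)"] by simp
  have s5: "(inv2 K \<theta> \<lhd> r \<lhd> l) \<bullet> (l' \<rhd> \<eta>) = (l \<rhd> \<eta>) \<bullet> inv2 K \<theta>"
    using slide[of \<eta> "id1 K (src K l)" "r \<odot> l" "inv2 K \<theta>" l' l] by simp
  have "adjunction K l' r ((r \<rhd> \<theta>) \<bullet> \<eta>) (\<epsilon> \<bullet> (inv2 K \<theta> \<lhd> r))"
    by (rule adjunctionI)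
      (simp_all add: extend_eq1[OF c] extend_eq[OF s3] extend_eq[OF s4] s5
        extend_eq1[OF adjunctionD(11)[OF a]] adjunctionD(12)[OF a])
  then show ?thesis by (rule adjointI)
qed

subsection \<open>Fully faithful 1-cells and reflections\<close>

lemma fully_faithful_iff:
  "fully_faithful1 K i \<longleftrightarrow> i \<in> arr K \<and>
     (\<forall>f g \<gamma>. f \<in> arr K \<longrightarrow> g \<in> arr K \<longrightarrow> src K g = src K f \<longrightarrow> trg K f = src K i \<longrightarrow> trg K g = src K i
        \<longrightarrow> \<gamma> \<in> cells K (i \<odot> f) (i \<odot> g) \<longrightarrow> (\<exists>!\<alpha>. \<alpha> \<in> cells K f g \<and> i \<rhd> \<alpha> = \<gamma>))"
proof -
  have "bij_betw (\<lambda>\<alpha>. i \<rhd> \<alpha>) (cells K f g) (cells K (i \<odot> f) (i \<odot> g)) \<longleftrightarrow>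
     (\<forall>\<gamma>. \<gamma> \<in> cells K (i \<odot> f) (i \<odot> g) \<longrightarrow> (\<exists>!\<alpha>. \<alpha> \<in> cells K f g \<and> i \<rhd> \<alpha> = \<gamma>))"
    if "i \<in> arr K" "f \<in> arr K" "g \<in> arr K" "trg K f = src K i" for f g
    using that by (intro bij_betw_iff_ex1) auto
  note * = this
  show ?thesis (is "_ \<longleftrightarrow> ?R")
  proof
    assume f: "fully_faithful1 K i"
    have i: "i \<in> arr K" using f by (simp add: fully_faithful1_def)
    show ?R
    proof (intro conjI i allI impI)
      fix f g \<gamma>
      assume t: "f \<in> arr K" "g \<in> arr K" "src K g = src K f" "trg K f = src K i" "trg K g = src K i"
        and c: "\<gamma> \<in> cells K (i \<odot> f) (i \<odot> g)"
      have "bij_betw (\<lambda>\<alpha>. i \<rhd> \<alpha>) (cells K f g) (cells K (i \<odot> f) (i \<odot> g))"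
      proof -
        have "f \<in> hom K (src K f) (src K i)" "g \<in> hom K (src K f) (src K i)" using t by simp_all
        then show ?thesis using f src_obj[OF t(1)] unfolding fully_faithful1_def by blast
      qed
      then show "\<exists>!\<alpha>. \<alpha> \<in> cells K f g \<and> i \<rhd> \<alpha> = \<gamma>" using *[OF i t(1,2,4)] c by blast
    qed
  next
    assume r: ?R
    show "fully_faithful1 K i"
      unfolding fully_faithful1_def in_hom
    proof (intro conjI ballI)
      show i: "i \<in> arr K" using r by blast
      fix X f g assume "X \<in> obj K" and f: "f \<in> hom K X (src K i)" and g: "g \<in> hom K X (src K i)"
      then show "bij_betw (\<lambda>\<alpha>. i \<rhd> \<alpha>) (cells K f g) (cells K (i \<odot> f) (i \<odot> g))"
        using r by (subst *) (auto simp del: in_cells)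
    qed
  qed
qed

lemma ff_arr: "fully_faithful1 K i \<Longrightarrow> i \<in> arr K"
  by (simp add: fully_faithful1_def)

lemma ff_full:
  assumes "fully_faithful1 K i" "f \<in> arr K" "g \<in> arr K" "src K g = src K f"
    "trg K f = src K i" "trg K g = src K i" "\<gamma> \<in> cells K (i \<odot> f) (i \<odot> g)"
  obtains \<alpha> where "\<alpha> \<in> cel K" "dom2 K \<alpha> = f" "cod2 K \<alpha> = g" "i \<rhd> \<alpha> = \<gamma>"
proof -
  have "\<exists>!\<alpha>. \<alpha> \<in> cells K f g \<and> i \<rhd> \<alpha> = \<gamma>"
    using assms unfolding fully_faithful_iff by blast
  then show ?thesis using that by auto
qed

lemma ff_faithful:
  assumes "fully_faithful1 K i" "\<alpha> \<in> cel K" "\<beta> \<in> cel K" "dom2 K \<beta> = dom2 K \<alpha>" "cod2 K \<beta> = cod2 K \<alpha>"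
    "trg K (dom2 K \<alpha>) = src K i" "i \<rhd> \<alpha> = i \<rhd> \<beta>"
  shows "\<alpha> = \<beta>"
proof -
  have "i \<rhd> \<alpha> \<in> cells K (i \<odot> dom2 K \<alpha>) (i \<odot> cod2 K \<alpha>)"
    using assms ff_arr by simp
  then have "\<exists>!x. x \<in> cells K (dom2 K \<alpha>) (cod2 K \<alpha>) \<and> i \<rhd> x = i \<rhd> \<alpha>"
    using assms dom2_arr[of \<alpha>] cod2_arr[of \<alpha>] src_cod2[of \<alpha>] trg_cod2[of \<alpha>]
    unfolding fully_faithful_iff by (auto simp del: in_cells)
  then show ?thesis using assms by auto
qed

text \<open>A 2-cell \<open>r f \<Rightarrow> r g\<close> comes from \<open>f \<cong> l r f \<Rightarrow> l r g \<cong> g\<close>.\<close>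

lemma ff_right_adjoint:
  assumes a: "adjunction K l r \<eta> \<epsilon>" and e: "invertible2 K \<epsilon>"
  shows "fully_faithful1 K r"
  unfolding fully_faithful_iff
proof (intro conjI allI impI)
  note [simp] = adjunctionD(1-10)[OF a] e
  show "r \<in> arr K" by simp
  fix f g \<gamma>
  assume t [simp]: "f \<in> arr K" "g \<in> arr K" "src K g = src K f" "trg K f = src K r" "trg K g = src K r"
    and "\<gamma> \<in> cells K (r \<odot> f) (r \<odot> g)"
  then have [simp]: "\<gamma> \<in> cel K" "dom2 K \<gamma> = r \<odot> f" "cod2 K \<gamma> = r \<odot> g" by auto
  define \<beta> where "\<beta> = (\<epsilon> \<lhd> g) \<bullet> (l \<rhd> \<gamma>) \<bullet> (inv2 K \<epsilon> \<lhd> f)"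
  have re: "r \<rhd> inv2 K \<epsilon> = \<eta> \<lhd> r"
  proof -
    have c: "(r \<rhd> inv2 K \<epsilon>) \<bullet> (r \<rhd> \<epsilon>) = id2 K (r \<odot> l \<odot> r)"
      by (simp flip: lw_vcmp)
    have "r \<rhd> inv2 K \<epsilon> = (r \<rhd> inv2 K \<epsilon>) \<bullet> ((r \<rhd> \<epsilon>) \<bullet> (\<eta> \<lhd> r))"
      by (simp add: adjunctionD(12)[OF a])
    also have "\<dots> = \<eta> \<lhd> r" by (simp add: extend_eq1[OF c])
    finally show ?thesis .
  qed
  have ref: "r \<rhd> (inv2 K \<epsilon> \<lhd> f) = \<eta> \<lhd> r \<lhd> f"
    using arg_cong[OF re, of "\<lambda>x. x \<lhd> f"] by simp
  have s: "(r \<rhd> l \<rhd> \<gamma>) \<bullet> (\<eta> \<lhd> r \<lhd> f) = (\<eta> \<lhd> r \<lhd> g) \<bullet> \<gamma>"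
    using slide[of \<gamma> "r \<odot> f" "r \<odot> g" \<eta> "id1 K (src K l)" "r \<odot> l"] by simp
  have d: "(r \<rhd> (\<epsilon> \<lhd> g)) \<bullet> (\<eta> \<lhd> r \<lhd> g) = id2 K (r \<odot> g)"
    using arg_cong[OF adjunctionD(12)[OF a], of "\<lambda>x. x \<lhd> g"] by simp
  have ex: "r \<rhd> \<beta> = \<gamma>" by (simp add: \<beta>_def ref s extend_eq1[OF d])
  have un: "\<alpha> = \<beta>" if [simp]: "\<alpha> \<in> cel K" "dom2 K \<alpha> = f" "cod2 K \<alpha> = g" "r \<rhd> \<alpha> = \<gamma>" for \<alpha>
  proof -
    have s: "(\<epsilon> \<lhd> g) \<bullet> (l \<rhd> \<gamma>) = \<alpha> \<bullet> (\<epsilon> \<lhd> f)"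
      using slide[of \<alpha> f g \<epsilon> "l \<odot> r" "id1 K (trg K l)"] by simp
    have c: "(\<epsilon> \<lhd> f) \<bullet> (inv2 K \<epsilon> \<lhd> f) = id2 K f" by (simp flip: rw_vcmp)
    show ?thesis by (simp add: \<beta>_def extend_eq[OF s] c)
  qed
  have "\<beta> \<in> cells K f g" by (simp add: \<beta>_def)
  then show "\<exists>!\<alpha>. \<alpha> \<in> cells K f g \<and> r \<rhd> \<alpha> = \<gamma>" using ex un by auto
qed

text \<open>The inverse of the counit is the 2-cell that \<open>r\<close> sends to the unit at \<open>r\<close>.\<close>

lemma counit_iso_if_ff:
  assumes a: "adjunction K l r \<eta> \<epsilon>" and r: "fully_faithful1 K r"
  shows "invertible2 K \<epsilon>"
proof -
  note [simp] = adjunctionD(1-10)[OF a]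
  obtain \<xi> where x [simp]: "\<xi> \<in> cel K" "dom2 K \<xi> = id1 K (trg K l)" "cod2 K \<xi> = l \<odot> r" "r \<rhd> \<xi> = \<eta> \<lhd> r"
    using ff_full[OF r, of "id1 K (trg K l)" "l \<odot> r" "\<eta> \<lhd> r"] by auto
  have 1: "\<epsilon> \<bullet> \<xi> = id2 K (id1 K (trg K l))"
    by (rule ff_faithful[OF r]) (simp_all add: adjunctionD(12)[OF a])
  have "r \<rhd> (\<xi> \<bullet> \<epsilon>) = r \<rhd> id2 K (l \<odot> r)"
  proof -
    have t: "(\<epsilon> \<lhd> l \<lhd> r) \<bullet> (l \<rhd> \<eta> \<lhd> r) = id2 K (l \<odot> r)"
      using arg_cong[OF adjunctionD(11)[OF a], of "\<lambda>x. x \<lhd> r"] by simp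
    have s4: "(\<epsilon> \<lhd> l \<lhd> r) \<bullet> (l \<rhd> \<eta> \<lhd> r) = \<xi> \<bullet> \<epsilon>"
      using slide[of \<xi> "id1 K (trg K l)" "l \<odot> r" \<epsilon> "l \<odot> r" "id1 K (trg K l)"] by simp
    have "\<xi> \<bullet> \<epsilon> = id2 K (l \<odot> r)" using s4 t by simp
    then show ?thesis by simp
  qed
  then have 2: "\<xi> \<bullet> \<epsilon> = id2 K (l \<odot> r)"
    by (rule ff_faithful[OF r, rotated -1]) simp_all
  show ?thesis unfolding invertible2_def inverse2_iff
    using 1 2 by (intro exI[of _ \<xi>]) simp
qed

subsection \<open>Equivalences\<close>

text \<open>One of the two given isomorphisms becomes the unit; the other is corrected so that the
  triangle identities hold.\<close>

lemma equivalence_adjunction: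
  assumes "equivalence1 K e"
  obtains e' \<eta> \<epsilon> where "adjunction K e e' \<eta> \<epsilon>" "invertible2 K \<eta>" "invertible2 K \<epsilon>"
proof -
  obtain e' where e [simp]: "e \<in> arr K" "e' \<in> arr K" "src K e' = trg K e" "trg K e' = src K e"
    and ae: "e' \<odot> e \<simeq> id1 K (src K e)" and be: "e \<odot> e' \<simeq> id1 K (trg K e)"
    using assms unfolding equivalence1_def by auto
  obtain \<alpha> where A: "invertible2 K \<alpha>" "\<alpha> \<in> cel K" "dom2 K \<alpha> = e' \<odot> e" "cod2 K \<alpha> = id1 K (src K e)"
    using ae by (rule iso1E)
  obtain \<beta> where B: "invertible2 K \<beta>" "\<beta> \<in> cel K" "dom2 K \<beta> = e \<odot> e'" "cod2 K \<beta> = id1 K (trg K e)"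
    using be by (rule iso1E)
  note [simp] = A B
  define \<epsilon> where "\<epsilon> = \<beta> \<bullet> (e \<rhd> \<alpha> \<lhd> e') \<bullet> (inv2 K \<beta> \<lhd> e \<lhd> e')"
  have ai: "inv2 K \<alpha> \<lhd> e' \<lhd> e = e' \<rhd> e \<rhd> inv2 K \<alpha>"
  proof -
    have "(inv2 K \<alpha> \<lhd> e' \<lhd> e) \<bullet> inv2 K \<alpha> = (e' \<rhd> e \<rhd> inv2 K \<alpha>) \<bullet> inv2 K \<alpha>"
      using slide[of "inv2 K \<alpha>" "id1 K (src K e)" "e' \<odot> e" "inv2 K \<alpha>" "id1 K (src K e)" "e' \<odot> e"] by simp
    from arg_cong[OF this, of "\<lambda>x. x \<bullet> \<alpha>"] show ?thesis by simp
  qed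
  have aa: "\<alpha> \<lhd> e' \<lhd> e = e' \<rhd> e \<rhd> \<alpha>"
  proof -
    have "\<alpha> \<bullet> (\<alpha> \<lhd> e' \<lhd> e) = \<alpha> \<bullet> (e' \<rhd> e \<rhd> \<alpha>)"
      using slide[of \<alpha> "e' \<odot> e" "id1 K (src K e)" \<alpha> "e' \<odot> e" "id1 K (src K e)"] by simp
    from arg_cong[OF this, of "\<lambda>x. inv2 K \<alpha> \<bullet> x"] show ?thesis by simp
  qed
  have bi: "inv2 K \<beta> \<lhd> e \<lhd> e' = e \<rhd> e' \<rhd> inv2 K \<beta>"
  proof -
    have "(inv2 K \<beta> \<lhd> e \<lhd> e') \<bullet> inv2 K \<beta> = (e \<rhd> e' \<rhd> inv2 K \<beta>) \<bullet> inv2 K \<beta>"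
      using slide[of "inv2 K \<beta>" "id1 K (trg K e)" "e \<odot> e'" "inv2 K \<beta>" "id1 K (trg K e)" "e \<odot> e'"] by simp
    from arg_cong[OF this, of "\<lambda>x. x \<bullet> \<beta>"] show ?thesis by simp
  qed
  have s1: "(inv2 K \<beta> \<lhd> e \<lhd> e' \<lhd> e) \<bullet> (e \<rhd> inv2 K \<alpha>) = (e \<rhd> e' \<rhd> e \<rhd> inv2 K \<alpha>) \<bullet> (inv2 K \<beta> \<lhd> e)"
    using slide[of "e \<rhd> inv2 K \<alpha>" "e" "e \<odot> e' \<odot> e" "inv2 K \<beta>" "id1 K (trg K e)" "e \<odot> e'"] by simp
  have s2: "(e \<rhd> (\<alpha> \<lhd> e' \<lhd> e)) \<bullet> (e \<rhd> e' \<rhd> e \<rhd> inv2 K \<alpha>) = id2 K (e \<odot> e' \<odot> e)"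
  proof -
    have "(\<alpha> \<lhd> e' \<lhd> e) \<bullet> (e' \<rhd> e \<rhd> inv2 K \<alpha>) = id2 K (e' \<odot> e)"
      unfolding ai[symmetric] by (simp flip: rw_vcmp)
    from arg_cong[OF this, of "\<lambda>x. e \<rhd> x"] show ?thesis by simp
  qed
  have s3: "(\<beta> \<lhd> e) \<bullet> (inv2 K \<beta> \<lhd> e) = id2 K e" by (simp flip: rw_vcmp)
  have aa': "e' \<rhd> e \<rhd> (\<alpha> \<lhd> e') = \<alpha> \<lhd> e' \<lhd> e \<lhd> e'"
    using arg_cong[OF aa, of "\<lambda>x. x \<lhd> e'"] by simp
  have bi': "e' \<rhd> (inv2 K \<beta> \<lhd> e \<lhd> e') = e' \<rhd> e \<rhd> e' \<rhd> inv2 K \<beta>"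
    using arg_cong[OF bi, of "\<lambda>x. e' \<rhd> x"] by simp
  have s4: "(e' \<rhd> e \<rhd> e' \<rhd> inv2 K \<beta>) \<bullet> (inv2 K \<alpha> \<lhd> e') = (inv2 K \<alpha> \<lhd> e' \<lhd> e \<lhd> e') \<bullet> (e' \<rhd> inv2 K \<beta>)"
    using slide[of "e' \<rhd> inv2 K \<beta>" "e'" "e' \<odot> e \<odot> e'" "inv2 K \<alpha>" "id1 K (src K e)" "e' \<odot> e"] by simp
  have s5: "(\<alpha> \<lhd> e' \<lhd> e \<lhd> e') \<bullet> (inv2 K \<alpha> \<lhd> e' \<lhd> e \<lhd> e') = id2 K (e' \<odot> e \<odot> e')"
    by (simp flip: rw_vcmp)
  have s6: "(e' \<rhd> \<beta>) \<bullet> (e' \<rhd> inv2 K \<beta>) = id2 K e'" by (simp flip: lw_vcmp)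
  have "adjunction K e e' (inv2 K \<alpha>) \<epsilon>"
    by (rule adjunctionI)
      (simp_all add: \<epsilon>_def s1 extend_eq1[OF s2] s3 aa' bi' s4 extend_eq1[OF s5] s6)
  moreover have "invertible2 K \<epsilon>" unfolding \<epsilon>_def
    by (intro invertible_vcmp invertible_lw invertible_rw invertible_inv2) simp_all
  ultimately show ?thesis using that invertible_inv2[OF A(1)] by blast
qed

lemma adjunction_reverse:
  assumes a: "adjunction K l r \<eta> \<epsilon>" and i: "invertible2 K \<eta>" "invertible2 K \<epsilon>"
  shows "adjunction K r l (inv2 K \<epsilon>) (inv2 K \<eta>)"
proof -
  note [simp] = adjunctionD(1-10)[OF a] i
  have 1: "(inv2 K \<eta> \<lhd> r) \<bullet> (r \<rhd> inv2 K \<epsilon>) = id2 K r"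
  proof -
    have c: "(r \<rhd> inv2 K \<epsilon>) \<bullet> (r \<rhd> \<epsilon>) = id2 K (r \<odot> l \<odot> r)" by (simp flip: lw_vcmp)
    have d: "(inv2 K \<eta> \<lhd> r) \<bullet> (\<eta> \<lhd> r) = id2 K r" by (simp flip: rw_vcmp)
    have "(inv2 K \<eta> \<lhd> r) \<bullet> (r \<rhd> inv2 K \<epsilon>) =
        (inv2 K \<eta> \<lhd> r) \<bullet> (r \<rhd> inv2 K \<epsilon>) \<bullet> ((r \<rhd> \<epsilon>) \<bullet> (\<eta> \<lhd> r))"
      by (simp add: adjunctionD(12)[OF a])
    also have "\<dots> = id2 K r" by (simp add: extend_eq1[OF c] d)
    finally show ?thesis .
  qed
  have 2: "(l \<rhd> inv2 K \<eta>) \<bullet> (inv2 K \<epsilon> \<lhd> l) = id2 K l"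
  proof -
    have c: "(inv2 K \<epsilon> \<lhd> l) \<bullet> (\<epsilon> \<lhd> l) = id2 K (l \<odot> r \<odot> l)" by (simp flip: rw_vcmp)
    have d: "(l \<rhd> inv2 K \<eta>) \<bullet> (l \<rhd> \<eta>) = id2 K l" by (simp flip: lw_vcmp)
    have "(l \<rhd> inv2 K \<eta>) \<bullet> (inv2 K \<epsilon> \<lhd> l) =
        (l \<rhd> inv2 K \<eta>) \<bullet> (inv2 K \<epsilon> \<lhd> l) \<bullet> ((\<epsilon> \<lhd> l) \<bullet> (l \<rhd> \<eta>))"
      by (simp add: adjunctionD(11)[OF a])
    also have "\<dots> = id2 K l" by (simp add: extend_eq1[OF c] d)
    finally show ?thesis .
  qed
  show ?thesis by (rule adjunctionI) (simp_all add: 1 2)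
qed

lemma equivalence_inverse:
  assumes "equivalence1 K e"
  obtains e' where "adjoint K e e'" "adjoint K e' e" "equivalence1 K e'"
    "e' \<odot> e \<simeq> id1 K (src K e)" "e \<odot> e' \<simeq> id1 K (trg K e)" "fully_faithful1 K e" "fully_faithful1 K e'"
proof -
  obtain e' \<eta> \<epsilon> where a: "adjunction K e e' \<eta> \<epsilon>" and i: "invertible2 K \<eta>" "invertible2 K \<epsilon>"
    using equivalence_adjunction[OF assms] .
  note b = adjunction_reverse[OF a i]
  note [simp] = adjunctionD(1-10)[OF a] i
  have c: "e' \<odot> e \<simeq> id1 K (src K e)" "e \<odot> e' \<simeq> id1 K (trg K e)"
    by (rule iso1I[of "inv2 K \<eta>"] iso1I[of "\<epsilon>"]; simp add: invertible_inv2)+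
  have "equivalence1 K e'" unfolding equivalence1_def
    using c by (auto intro!: bexI[of _ e])
  then show ?thesis
    using that adjointI[OF a] adjointI[OF b] c ff_right_adjoint[OF a i(2)]
      ff_right_adjoint[OF b invertible_inv2[OF i(1)]] by blast
qed

lemma equivalence_arr: "equivalence1 K e \<Longrightarrow> e \<in> arr K"
  by (simp add: equivalence1_def)

lemma equivalence_cmp:
  assumes e: "equivalence1 K e" and f: "equivalence1 K f" and t: "trg K e = src K f"
  shows "equivalence1 K (f \<odot> e)"
proof -
  obtain e' where [simp]: "e \<in> arr K" "e' \<in> arr K" "src K e' = trg K e" "trg K e' = src K e"
    and ee: "e' \<odot> e \<simeq> id1 K (src K e)" "e \<odot> e' \<simeq> id1 K (trg K e)"
    using e unfolding equivalence1_def by auto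
  obtain f' where [simp]: "f \<in> arr K" "f' \<in> arr K" "src K f' = trg K f" "trg K f' = src K f"
    and ff: "f' \<odot> f \<simeq> id1 K (src K f)" "f \<odot> f' \<simeq> id1 K (trg K f)"
    using f unfolding equivalence1_def by auto
  note [simp] = t
  have "e' \<odot> f' \<odot> f \<odot> e \<simeq> e' \<odot> e" using iso1_lw[OF iso1_rw[OF ff(1), of e], of e'] by simp
  also note ee(1)
  finally have 1: "e' \<odot> f' \<odot> f \<odot> e \<simeq> id1 K (src K e)" .
  have "f \<odot> e \<odot> e' \<odot> f' \<simeq> f \<odot> f'" using iso1_lw[OF iso1_rw[OF ee(2), of f'], of f] by simp
  also note ff(2)
  finally have 2: "f \<odot> e \<odot> e' \<odot> f' \<simeq> id1 K (trg K f)" .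
  show ?thesis
    unfolding equivalence1_def using 1 2 by (intro conjI bexI[of _ "e' \<odot> f'"]) simp_all
qed

lemma ff_cmp:
  assumes "fully_faithful1 K i" "fully_faithful1 K k" "trg K i = src K k"
  shows "fully_faithful1 K (k \<odot> i)"
  unfolding fully_faithful_iff
proof (intro conjI allI impI)
  note [simp] = ff_arr[OF assms(1)] ff_arr[OF assms(2)] assms(3)
  show "k \<odot> i \<in> arr K" by simp
  fix f g \<gamma>
  assume t [simp]: "f \<in> arr K" "g \<in> arr K" "src K g = src K f" and "trg K f = src K (k \<odot> i)" "trg K g = src K (k \<odot> i)"
    and "\<gamma> \<in> cells K ((k \<odot> i) \<odot> f) ((k \<odot> i) \<odot> g)"
  then have [simp]: "trg K f = src K i" "trg K g = src K i"
     "\<gamma> \<in> cel K" "dom2 K \<gamma> = k \<odot> i \<odot> f" "cod2 K \<gamma> = k \<odot> i \<odot> g" by auto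
  obtain \<beta> where [simp]: "\<beta> \<in> cel K" "dom2 K \<beta> = i \<odot> f" "cod2 K \<beta> = i \<odot> g" "k \<rhd> \<beta> = \<gamma>"
    using ff_full[OF assms(2), of "i \<odot> f" "i \<odot> g" \<gamma>] by auto
  obtain \<alpha> where a [simp]: "\<alpha> \<in> cel K" "dom2 K \<alpha> = f" "cod2 K \<alpha> = g" "i \<rhd> \<alpha> = \<beta>"
    using ff_full[OF assms(1), of "f" "g" \<beta>] by auto
  have "\<alpha>' = \<alpha>" if [simp]: "\<alpha>' \<in> cel K" "dom2 K \<alpha>' = f" "cod2 K \<alpha>' = g" and e: "k \<rhd> i \<rhd> \<alpha>' = \<gamma>" for \<alpha>'
  proof -
    have "i \<rhd> \<alpha>' = i \<rhd> \<alpha>" by (rule ff_faithful[OF assms(2)]) (simp_all add: e)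
    then show ?thesis by (intro ff_faithful[OF assms(1), of \<alpha>' \<alpha>]) simp_all
  qed
  note un = this
  show "\<exists>!\<alpha>. \<alpha> \<in> cells K f g \<and> (k \<odot> i) \<rhd> \<alpha> = \<gamma>"
  proof (rule ex1I[of _ \<alpha>])
    fix \<alpha>' assume "\<alpha>' \<in> cells K f g \<and> (k \<odot> i) \<rhd> \<alpha>' = \<gamma>"
    then have "\<alpha>' \<in> cel K" "dom2 K \<alpha>' = f" "cod2 K \<alpha>' = g" "(k \<odot> i) \<rhd> \<alpha>' = \<gamma>"
      by (simp_all del: lw_lw)
    then show "\<alpha>' = \<alpha>" by (intro un) simp_all
  qed simp
qed

lemma ff_iso:
  assumes "fully_faithful1 K i" "i \<simeq> k"
  shows "fully_faithful1 K k"
  unfolding fully_faithful_iff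
proof (intro conjI allI impI)
  note [simp] = ff_arr[OF assms(1)] iso1_type[OF assms(2)]
  show "k \<in> arr K" by simp
  obtain \<phi> where p: "invertible2 K \<phi>" "\<phi> \<in> cel K" "dom2 K \<phi> = i" "cod2 K \<phi> = k"
    using assms(2) by (rule iso1E)
  note [simp] = p
  fix f g \<gamma>
  assume t [simp]: "f \<in> arr K" "g \<in> arr K" "src K g = src K f" and "trg K f = src K k" "trg K g = src K k"
    and "\<gamma> \<in> cells K (k \<odot> f) (k \<odot> g)"
  then have [simp]: "trg K f = src K i" "trg K g = src K i"
     "\<gamma> \<in> cel K" "dom2 K \<gamma> = k \<odot> f" "cod2 K \<gamma> = k \<odot> g" by auto
  have nat: "(\<phi> \<lhd> g) \<bullet> (i \<rhd> \<alpha>) = (k \<rhd> \<alpha>) \<bullet> (\<phi> \<lhd> f)" if "\<alpha> \<in> cells K f g" for \<alpha>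
    using that slide[of \<alpha> f g \<phi> i k] by simp
  have c1: "(\<phi> \<lhd> f) \<bullet> (inv2 K \<phi> \<lhd> f) = id2 K (k \<odot> f)" by (simp flip: rw_vcmp)
  have c2: "(inv2 K \<phi> \<lhd> g) \<bullet> (\<phi> \<lhd> g) = id2 K (i \<odot> g)" by (simp flip: rw_vcmp)
  have c3: "(\<phi> \<lhd> g) \<bullet> (inv2 K \<phi> \<lhd> g) = id2 K (k \<odot> g)" by (simp flip: rw_vcmp)
  obtain \<alpha> where a [simp]: "\<alpha> \<in> cel K" "dom2 K \<alpha> = f" "cod2 K \<alpha> = g"
      "i \<rhd> \<alpha> = (inv2 K \<phi> \<lhd> g) \<bullet> \<gamma> \<bullet> (\<phi> \<lhd> f)"
    using ff_full[OF assms(1), of f g "(inv2 K \<phi> \<lhd> g) \<bullet> \<gamma> \<bullet> (\<phi> \<lhd> f)"] by auto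
  have n: "(k \<rhd> \<alpha>) \<bullet> (\<phi> \<lhd> f) = \<gamma> \<bullet> (\<phi> \<lhd> f)"
    using nat[of \<alpha>] by (simp add: extend_eq1[OF c3])
  have e: "k \<rhd> \<alpha> = \<gamma>"
    using arg_cong[OF n, of "\<lambda>x. x \<bullet> (inv2 K \<phi> \<lhd> f)"] by (simp add: c1)
  have "\<alpha>' = \<alpha>" if [simp]: "\<alpha>' \<in> cel K" "dom2 K \<alpha>' = f" "cod2 K \<alpha>' = g" "k \<rhd> \<alpha>' = \<gamma>" for \<alpha>'
  proof -
    have "i \<rhd> \<alpha>' = i \<rhd> \<alpha>"
      using arg_cong[OF nat[of \<alpha>'], of "\<lambda>x. (inv2 K \<phi> \<lhd> g) \<bullet> x"] by (simp add: extend_eq1[OF c2])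
    then show ?thesis by (intro ff_faithful[OF assms(1), of \<alpha>' \<alpha>]) simp_all
  qed
  then show "\<exists>!\<alpha>. \<alpha> \<in> cells K f g \<and> k \<rhd> \<alpha> = \<gamma>" using e by (intro ex1I[of _ \<alpha>]) auto
qed

subsection \<open>Adjunctions from reflective and fully faithful 1-cells\<close>

text \<open>The counit of \<open>F d \<stileturn> W\<close> also serves \<open>F \<stileturn> d W\<close>. The unit is
  \<open>id \<cong> d i \<Rightarrow> d W F d i \<cong> d W F\<close>, whose isomorphisms come from the invertible counit of \<open>d \<stileturn> i\<close>.\<close>

lemma adjoint_along_reflection:
  assumes a: "adjunction K d i \<eta>\<^sub>1 \<epsilon>\<^sub>1" and e: "invertible2 K \<epsilon>\<^sub>1"
    and b: "adjoint K (F \<odot> d) W" and F: "F \<in> arr K" "src K F = trg K d"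
  shows "adjoint K F (d \<odot> W)"
proof -
  obtain \<eta> \<epsilon> where b': "adjunction K (F \<odot> d) W \<eta> \<epsilon>" using b by (auto simp: adjoint_def)
  note [simp] = adjunctionD(1-10)[OF a] e F
  note B = adjunctionD[OF b']
  have [simp]: "W \<in> arr K" "src K W = trg K F" "trg K W = src K d"
    "\<eta> \<in> cel K" "dom2 K \<eta> = id1 K (src K d)" "cod2 K \<eta> = W \<odot> F \<odot> d"
    "\<epsilon> \<in> cel K" "dom2 K \<epsilon> = F \<odot> d \<odot> W" "cod2 K \<epsilon> = id1 K (trg K F)"
    using B by simp_all
  have t1: "(\<epsilon> \<lhd> F \<lhd> d) \<bullet> (F \<rhd> d \<rhd> \<eta>) = id2 K (F \<odot> d)" using B(11) by simp
  have t2: "(W \<rhd> \<epsilon>) \<bullet> (\<eta> \<lhd> W) = id2 K W" using B(12) by simp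
  define u where "u = (d \<rhd> W \<rhd> F \<rhd> \<epsilon>\<^sub>1) \<bullet> (d \<rhd> \<eta> \<lhd> i) \<bullet> inv2 K \<epsilon>\<^sub>1"
  have s1: "(\<epsilon> \<lhd> F) \<bullet> (F \<rhd> d \<rhd> W \<rhd> F \<rhd> \<epsilon>\<^sub>1) = (F \<rhd> \<epsilon>\<^sub>1) \<bullet> (\<epsilon> \<lhd> F \<lhd> d \<lhd> i)"
    using slide[of "F \<rhd> \<epsilon>\<^sub>1" "F \<odot> d \<odot> i" F \<epsilon> "F \<odot> d \<odot> W" "id1 K (trg K F)"] by simp
  have t1': "(\<epsilon> \<lhd> F \<lhd> d \<lhd> i) \<bullet> (F \<rhd> d \<rhd> (\<eta> \<lhd> i)) = id2 K (F \<odot> d \<odot> i)"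
    using arg_cong[OF t1, of "\<lambda>x. x \<lhd> i"] by simp
  have c1: "(F \<rhd> \<epsilon>\<^sub>1) \<bullet> (F \<rhd> inv2 K \<epsilon>\<^sub>1) = id2 K F" by (simp flip: lw_vcmp)
  have de: "inv2 K \<epsilon>\<^sub>1 \<lhd> d = d \<rhd> \<eta>\<^sub>1"
  proof -
    have c: "(inv2 K \<epsilon>\<^sub>1 \<lhd> d) \<bullet> (\<epsilon>\<^sub>1 \<lhd> d) = id2 K (d \<odot> i \<odot> d)" by (simp flip: rw_vcmp)
    have "inv2 K \<epsilon>\<^sub>1 \<lhd> d = (inv2 K \<epsilon>\<^sub>1 \<lhd> d) \<bullet> ((\<epsilon>\<^sub>1 \<lhd> d) \<bullet> (d \<rhd> \<eta>\<^sub>1))"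
      by (simp add: adjunctionD(11)[OF a])
    also have "\<dots> = d \<rhd> \<eta>\<^sub>1" by (simp add: extend_eq1[OF c])
    finally show ?thesis .
  qed
  have de': "inv2 K \<epsilon>\<^sub>1 \<lhd> d \<lhd> W = d \<rhd> (\<eta>\<^sub>1 \<lhd> W)"
    using arg_cong[OF de, of "\<lambda>x. x \<lhd> W"] by simp
  have s2: "(d \<rhd> (\<eta> \<lhd> i \<lhd> d \<lhd> W)) \<bullet> (d \<rhd> (\<eta>\<^sub>1 \<lhd> W)) =
      (d \<rhd> W \<rhd> F \<rhd> d \<rhd> (\<eta>\<^sub>1 \<lhd> W)) \<bullet> (d \<rhd> (\<eta> \<lhd> W))"
    using arg_cong[OF slide[of "\<eta>\<^sub>1 \<lhd> W" W "i \<odot> d \<odot> W" \<eta> "id1 K (src K d)" "W \<odot> F \<odot> d"], of "\<lambda>x. d \<rhd> x"]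
    by simp
  have s3: "(d \<rhd> W \<rhd> F \<rhd> (\<epsilon>\<^sub>1 \<lhd> d \<lhd> W)) \<bullet> (d \<rhd> W \<rhd> F \<rhd> d \<rhd> (\<eta>\<^sub>1 \<lhd> W)) = id2 K (d \<odot> W \<odot> F \<odot> d \<odot> W)"
    using arg_cong[OF adjunctionD(11)[OF a], of "\<lambda>x. d \<rhd> W \<rhd> F \<rhd> (x \<lhd> W)"] by simp
  have t2': "(d \<rhd> W \<rhd> \<epsilon>) \<bullet> (d \<rhd> (\<eta> \<lhd> W)) = id2 K (d \<odot> W)"
    using arg_cong[OF t2, of "\<lambda>x. d \<rhd> x"] by simp
  have "adjunction K F (d \<odot> W) u \<epsilon>"
    by (rule adjunctionI)
      (simp_all add: u_def extend_eq[OF s1] extend_eq1[OF t1'] c1 de' s2 extend_eq1[OF s3] t2')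
  then show ?thesis by (rule adjointI)
qed

text \<open>Unit and counit of \<open>L \<stileturn> R\<close>, restricted along \<open>s\<close> and \<open>t\<close>, come from 2-cells \<open>id \<Rightarrow> r d\<close> and
  \<open>d r \<Rightarrow> id\<close> by full faithfulness, and the triangle identities may be checked after composing with \<open>t\<close> and \<open>s\<close>.\<close>

lemma adjoint_restrict:
  assumes LR: "adjoint K L R" and s: "fully_faithful1 K s" and t: "fully_faithful1 K t"
    and d: "d \<in> arr K" "src K d = src K s" "trg K d = src K t"
    and r: "r \<in> arr K" "src K r = src K t" "trg K r = src K s"
    and td: "t \<odot> d \<simeq> L \<odot> s" and sr: "s \<odot> r \<simeq> R \<odot> t"
    and st: "trg K s = src K L" "trg K t = trg K L"
  shows "adjoint K d r"
proof -
  obtain \<eta> \<epsilon> where lr: "adjunction K L R \<eta> \<epsilon>" using LR by (auto simp: adjoint_def)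
  obtain a where a: "invertible2 K a" "a \<in> cel K" "dom2 K a = t \<odot> d" "cod2 K a = L \<odot> s"
    using td by (rule iso1E)
  obtain b where b: "invertible2 K b" "b \<in> cel K" "dom2 K b = s \<odot> r" "cod2 K b = R \<odot> t"
    using sr by (rule iso1E)
  note [simp] = adjunctionD(1-10)[OF lr] ff_arr[OF s] ff_arr[OF t] d r st a b
  obtain u where u: "u \<in> cel K" "dom2 K u = id1 K (src K s)" "cod2 K u = r \<odot> d"
    "s \<rhd> u = (inv2 K b \<lhd> d) \<bullet> (R \<rhd> inv2 K a) \<bullet> (\<eta> \<lhd> s)"
    using ff_full[OF s, of "id1 K (src K s)" "r \<odot> d" "(inv2 K b \<lhd> d) \<bullet> (R \<rhd> inv2 K a) \<bullet> (\<eta> \<lhd> s)"] by auto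
  obtain v where v: "v \<in> cel K" "dom2 K v = d \<odot> r" "cod2 K v = id1 K (src K t)"
    "t \<rhd> v = (\<epsilon> \<lhd> t) \<bullet> (L \<rhd> b) \<bullet> (a \<lhd> r)"
    using ff_full[OF t, of "d \<odot> r" "id1 K (src K t)" "(\<epsilon> \<lhd> t) \<bullet> (L \<rhd> b) \<bullet> (a \<lhd> r)"] by auto
  note [simp] = u v
  have vd: "t \<rhd> (v \<lhd> d) = (\<epsilon> \<lhd> t \<lhd> d) \<bullet> (L \<rhd> (b \<lhd> d)) \<bullet> (a \<lhd> r \<lhd> d)"
    using arg_cong[OF v(4), of "\<lambda>x. x \<lhd> d"] by (simp del: v(4))
  have ur: "s \<rhd> (u \<lhd> r) = (inv2 K b \<lhd> d \<lhd> r) \<bullet> (R \<rhd> (inv2 K a \<lhd> r)) \<bullet> (\<eta> \<lhd> s \<lhd> r)"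
    using arg_cong[OF u(4), of "\<lambda>x. x \<lhd> r"] by (simp del: u(4))
  have 1: "(v \<lhd> d) \<bullet> (d \<rhd> u) = id2 K d"
  proof (rule ff_faithful[OF t])
    have s1: "(a \<lhd> r \<lhd> d) \<bullet> (t \<rhd> d \<rhd> u) = (L \<rhd> s \<rhd> u) \<bullet> a"
      using slide[of u "id1 K (src K s)" "r \<odot> d" a "t \<odot> d" "L \<odot> s"] by (simp del: u(4))
    have c: "(L \<rhd> (b \<lhd> d)) \<bullet> (L \<rhd> (inv2 K b \<lhd> d)) = id2 K (L \<odot> R \<odot> t \<odot> d)"
      by (simp flip: lw_vcmp rw_vcmp)
    have s2: "(\<epsilon> \<lhd> t \<lhd> d) \<bullet> (L \<rhd> R \<rhd> inv2 K a) = inv2 K a \<bullet> (\<epsilon> \<lhd> L \<lhd> s)"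
      using slide[of "inv2 K a" "L \<odot> s" "t \<odot> d" \<epsilon> "L \<odot> R" "id1 K (trg K L)"] by simp
    have t': "(\<epsilon> \<lhd> L \<lhd> s) \<bullet> (L \<rhd> \<eta> \<lhd> s) = id2 K (L \<odot> s)"
      using arg_cong[OF adjunctionD(11)[OF lr], of "\<lambda>x. x \<lhd> s"] by simp
    show "t \<rhd> ((v \<lhd> d) \<bullet> (d \<rhd> u)) = t \<rhd> id2 K d"
      by (simp add: vd s1 extend_eq1[OF c] extend_eq[OF s2] extend_eq1[OF t'])
  qed simp_all
  have 2: "(r \<rhd> v) \<bullet> (u \<lhd> r) = id2 K r"
  proof (rule ff_faithful[OF s])
    have s1: "(s \<rhd> r \<rhd> v) \<bullet> (inv2 K b \<lhd> d \<lhd> r) = inv2 K b \<bullet> (R \<rhd> t \<rhd> v)"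
      using slide[of v "d \<odot> r" "id1 K (src K t)" "inv2 K b" "R \<odot> t" "s \<odot> r"] by (simp del: v(4))
    have c: "(R \<rhd> (a \<lhd> r)) \<bullet> (R \<rhd> (inv2 K a \<lhd> r)) = id2 K (R \<odot> L \<odot> s \<odot> r)"
      by (simp flip: lw_vcmp rw_vcmp)
    have s2: "(R \<rhd> L \<rhd> b) \<bullet> (\<eta> \<lhd> s \<lhd> r) = (\<eta> \<lhd> R \<lhd> t) \<bullet> b"
      using slide[of b "s \<odot> r" "R \<odot> t" \<eta> "id1 K (src K L)" "R \<odot> L"] by simp
    have t': "(R \<rhd> (\<epsilon> \<lhd> t)) \<bullet> (\<eta> \<lhd> R \<lhd> t) = id2 K (R \<odot> t)"
      using arg_cong[OF adjunctionD(12)[OF lr], of "\<lambda>x. x \<lhd> t"] by simp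
    show "s \<rhd> ((r \<rhd> v) \<bullet> (u \<lhd> r)) = s \<rhd> id2 K r"
      by (simp add: ur extend_eq[OF s1] extend_eq1[OF c] s2 extend_eq1[OF t'])
  qed simp_all
  have "adjunction K d r u v"
    by (rule adjunctionI) (simp_all add: 1 2)
  then show ?thesis by (rule adjointI)
qed

section \<open>Left extensions\<close>

lemma ball_hom:
  "(\<forall>g \<in> hom K A B. Q g) \<longleftrightarrow> (\<forall>g. g \<in> arr K \<longrightarrow> src K g = A \<longrightarrow> trg K g = B \<longrightarrow> Q g)"
  by auto

lemma is_lan_iff:
  "is_lan K j f l \<eta> \<longleftrightarrow> j \<in> arr K \<and> f \<in> arr K \<and> l \<in> arr K \<and> src K f = src K j \<and>
     src K l = trg K j \<and> trg K l = trg K f \<and> \<eta> \<in> cells K f (l \<odot> j) \<and>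
     (\<forall>g \<gamma>. g \<in> arr K \<longrightarrow> src K g = trg K j \<longrightarrow> trg K g = trg K f \<longrightarrow> \<gamma> \<in> cells K f (g \<odot> j)
        \<longrightarrow> (\<exists>!\<theta>. \<theta> \<in> cells K l g \<and> (\<theta> \<lhd> j) \<bullet> \<eta> = \<gamma>))"
proof -
  have "bij_betw (\<lambda>\<theta>. (\<theta> \<lhd> j) \<bullet> \<eta>) (cells K l g) (cells K f (g \<odot> j)) \<longleftrightarrow>
     (\<forall>\<gamma>. \<gamma> \<in> cells K f (g \<odot> j) \<longrightarrow> (\<exists>!\<theta>. \<theta> \<in> cells K l g \<and> (\<theta> \<lhd> j) \<bullet> \<eta> = \<gamma>))"
    if "j \<in> arr K" "l \<in> arr K" "src K l = trg K j" "\<eta> \<in> cells K f (l \<odot> j)" for g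
    using that by (intro bij_betw_iff_ex1) auto
  note * = this
  show ?thesis (is "?L \<longleftrightarrow> ?R")
  proof
    assume l: ?L
    then have "\<forall>g. g \<in> arr K \<longrightarrow> src K g = trg K j \<longrightarrow> trg K g = trg K f \<longrightarrow>
      bij_betw (\<lambda>\<theta>. (\<theta> \<lhd> j) \<bullet> \<eta>) (cells K l g) (cells K f (g \<odot> j))"
      unfolding is_lan_def ball_hom by blast
    moreover have t: "j \<in> arr K" "f \<in> arr K" "l \<in> arr K" "src K f = src K j" "src K l = trg K j"
      "trg K l = trg K f" "\<eta> \<in> cells K f (l \<odot> j)" using l by (auto simp: is_lan_def)
    ultimately show ?R unfolding *[OF t(1,3,5,7)] by blast
  next
    assume r: ?R
    then have t: "j \<in> arr K" "f \<in> arr K" "l \<in> arr K" "src K f = src K j" "src K l = trg K j"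
      "trg K l = trg K f" "\<eta> \<in> cells K f (l \<odot> j)" by blast+
    then show ?L using r unfolding is_lan_def ball_hom *[OF t(1,3,5,7)] in_hom by blast
  qed
qed

lemma is_lan_type:
  assumes "is_lan K j f l \<eta>"
  shows "j \<in> arr K" "f \<in> arr K" "l \<in> arr K" "src K f = src K j" "src K l = trg K j" "trg K l = trg K f"
    "\<eta> \<in> cel K" "dom2 K \<eta> = f" "cod2 K \<eta> = l \<odot> j"
  using assms by (simp_all add: is_lan_def)

lemma is_lan_ex:
  assumes "is_lan K j f l \<eta>" "g \<in> arr K" "src K g = trg K j" "trg K g = trg K f" "\<gamma> \<in> cells K f (g \<odot> j)"
  obtains \<theta> where "\<theta> \<in> cel K" "dom2 K \<theta> = l" "cod2 K \<theta> = g" "(\<theta> \<lhd> j) \<bullet> \<eta> = \<gamma>"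
proof -
  have "\<exists>!\<theta>. \<theta> \<in> cells K l g \<and> (\<theta> \<lhd> j) \<bullet> \<eta> = \<gamma>"
    using assms unfolding is_lan_iff by blast
  then show ?thesis using that by auto
qed

lemma is_lan_unique:
  assumes l: "is_lan K j f l \<eta>" and a: "\<alpha> \<in> cel K" "\<beta> \<in> cel K" "dom2 K \<alpha> = l" "dom2 K \<beta> = l"
    "cod2 K \<beta> = cod2 K \<alpha>" "(\<alpha> \<lhd> j) \<bullet> \<eta> = (\<beta> \<lhd> j) \<bullet> \<eta>"
  shows "\<alpha> = \<beta>"
proof -
  note [simp] = is_lan_type[OF l] a(1-5)
  have t: "src K (cod2 K \<alpha>) = trg K j" "trg K (cod2 K \<alpha>) = trg K f" "cod2 K \<alpha> \<in> arr K"
    by simp_all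
  have "(\<alpha> \<lhd> j) \<bullet> \<eta> \<in> cells K f (cod2 K \<alpha> \<odot> j)" by simp
  then have "\<exists>!\<theta>. \<theta> \<in> cells K l (cod2 K \<alpha>) \<and> (\<theta> \<lhd> j) \<bullet> \<eta> = (\<alpha> \<lhd> j) \<bullet> \<eta>"
    using l t unfolding is_lan_iff by blast
  then show ?thesis by (rule ex1_eq) (use a in simp_all)
qed

lemma is_lanI:
  assumes "j \<in> arr K" "f \<in> arr K" "l \<in> arr K" "src K f = src K j" "src K l = trg K j" "trg K l = trg K f"
    "\<eta> \<in> cel K" "dom2 K \<eta> = f" "cod2 K \<eta> = l \<odot> j"
    and "\<And>g \<gamma>. \<lbrakk>g \<in> arr K; src K g = trg K j; trg K g = trg K f; \<gamma> \<in> cel K; dom2 K \<gamma> = f; cod2 K \<gamma> = g \<odot> j\<rbrakk>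
        \<Longrightarrow> \<exists>\<theta>. \<theta> \<in> cells K l g \<and> (\<theta> \<lhd> j) \<bullet> \<eta> = \<gamma>"
    and "\<And>g \<alpha> \<beta>. \<lbrakk>g \<in> arr K; src K g = trg K j; trg K g = trg K f; \<alpha> \<in> cel K; dom2 K \<alpha> = l; cod2 K \<alpha> = g;
        \<beta> \<in> cel K; dom2 K \<beta> = l; cod2 K \<beta> = g; (\<alpha> \<lhd> j) \<bullet> \<eta> = (\<beta> \<lhd> j) \<bullet> \<eta>\<rbrakk> \<Longrightarrow> \<alpha> = \<beta>"
  shows "is_lan K j f l \<eta>"
proof -
  have "\<exists>!\<theta>. \<theta> \<in> cells K l g \<and> (\<theta> \<lhd> j) \<bullet> \<eta> = \<gamma>"
    if g: "g \<in> arr K" "src K g = trg K j" "trg K g = trg K f" "\<gamma> \<in> cells K f (g \<odot> j)" for g \<gamma>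
  proof -
    obtain \<theta> where t: "\<theta> \<in> cells K l g" "(\<theta> \<lhd> j) \<bullet> \<eta> = \<gamma>" using assms(10)[of g \<gamma>] g by auto
    show ?thesis
    proof (rule ex1I[of _ \<theta>])
      show "\<theta> \<in> cells K l g \<and> (\<theta> \<lhd> j) \<bullet> \<eta> = \<gamma>" using t by blast
      fix \<theta>' assume "\<theta>' \<in> cells K l g \<and> (\<theta>' \<lhd> j) \<bullet> \<eta> = \<gamma>"
      then show "\<theta>' = \<theta>" using t assms(11)[OF g(1-3), of \<theta>' \<theta>] by simp
    qed
  qed
  then show ?thesis unfolding is_lan_iff using assms(1-9) by simp
qed

lemma is_lan_iso_unique:
  assumes l: "is_lan K j f l \<eta>" and l': "is_lan K j f l' \<eta>'"
  obtains \<theta> where "invertible2 K \<theta>" "\<theta> \<in> cel K" "dom2 K \<theta> = l" "cod2 K \<theta> = l'" "(\<theta> \<lhd> j) \<bullet> \<eta> = \<eta>'"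
proof -
  note [simp] = is_lan_type[OF l] is_lan_type(3,5-)[OF l']
  obtain \<theta> where t [simp]: "\<theta> \<in> cel K" "dom2 K \<theta> = l" "cod2 K \<theta> = l'" and te: "(\<theta> \<lhd> j) \<bullet> \<eta> = \<eta>'"
    using is_lan_ex[OF l, of l' \<eta>'] by auto
  obtain \<theta>' where t' [simp]: "\<theta>' \<in> cel K" "dom2 K \<theta>' = l'" "cod2 K \<theta>' = l" and te': "(\<theta>' \<lhd> j) \<bullet> \<eta>' = \<eta>"
    using is_lan_ex[OF l', of l \<eta>] by auto
  have "\<theta>' \<bullet> \<theta> = id2 K l" by (rule is_lan_unique[OF l]) (simp_all add: te te')
  moreover have "\<theta> \<bullet> \<theta>' = id2 K l'" by (rule is_lan_unique[OF l']) (simp_all add: te te')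
  ultimately have "invertible2 K \<theta>"
    unfolding invertible2_def inverse2_iff by (intro exI[of _ \<theta>']) simp
  then show ?thesis using that t te by blast
qed

lemma is_lan_transport:
  assumes l: "is_lan K j f l \<eta>" and t: "invertible2 K \<theta>" "dom2 K \<theta> = l"
  shows "is_lan K j f (cod2 K \<theta>) ((\<theta> \<lhd> j) \<bullet> \<eta>)"
proof -
  note [simp] = is_lan_type[OF l] t invertible_cel[OF t(1)]
  have [simp]: "src K (cod2 K \<theta>) = trg K j" "trg K (cod2 K \<theta>) = trg K f" by simp_all
  have c: "(inv2 K \<theta> \<lhd> j) \<bullet> (\<theta> \<lhd> j) = id2 K (l \<odot> j)" by (simp flip: rw_vcmp)
  show ?thesis
  proof (rule is_lanI)
    fix g \<gamma>
    assume [simp]: "g \<in> arr K" "src K g = trg K j" "trg K g = trg K f" "\<gamma> \<in> cel K" "dom2 K \<gamma> = f" "cod2 K \<gamma> = g \<odot> j"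
    obtain \<chi> where [simp]: "\<chi> \<in> cel K" "dom2 K \<chi> = l" "cod2 K \<chi> = g" "(\<chi> \<lhd> j) \<bullet> \<eta> = \<gamma>"
      using is_lan_ex[OF l, of g \<gamma>] by auto
    show "\<exists>\<theta>'. \<theta>' \<in> cells K (cod2 K \<theta>) g \<and> (\<theta>' \<lhd> j) \<bullet> (\<theta> \<lhd> j) \<bullet> \<eta> = \<gamma>"
      by (rule exI[of _ "\<chi> \<bullet> inv2 K \<theta>"]) (simp add: extend_eq1[OF c])
  next
    fix g \<alpha> \<beta>
    assume t: "\<alpha> \<in> cel K" "dom2 K \<alpha> = cod2 K \<theta>" "cod2 K \<alpha> = g" "\<beta> \<in> cel K" "dom2 K \<beta> = cod2 K \<theta>" "cod2 K \<beta> = g"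
      and e: "(\<alpha> \<lhd> j) \<bullet> (\<theta> \<lhd> j) \<bullet> \<eta> = (\<beta> \<lhd> j) \<bullet> (\<theta> \<lhd> j) \<bullet> \<eta>"
    note [simp] = t
    have "\<alpha> \<bullet> \<theta> = \<beta> \<bullet> \<theta>" by (rule is_lan_unique[OF l]) (simp_all add: e)
    from arg_cong[OF this, of "\<lambda>x. x \<bullet> inv2 K \<theta>"] show "\<alpha> = \<beta>" by simp
  qed simp_all
qed

lemma is_lan_precompose:
  assumes l: "is_lan K j f l \<eta>" and t: "invertible2 K \<phi>" "cod2 K \<phi> = f"
  shows "is_lan K j (dom2 K \<phi>) l (\<eta> \<bullet> \<phi>)"
proof -
  note [simp] = is_lan_type[OF l] t invertible_cel[OF t(1)]
  have [simp]: "src K (dom2 K \<phi>) = src K j" "trg K (dom2 K \<phi>) = trg K f"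
    using src_cod2[of \<phi>] trg_cod2[of \<phi>] by (simp_all del: src_cod2 trg_cod2)
  show ?thesis
  proof (rule is_lanI)
    fix g \<gamma>
    assume [simp]: "g \<in> arr K" "src K g = trg K j" "trg K g = trg K (dom2 K \<phi>)"
      "\<gamma> \<in> cel K" "dom2 K \<gamma> = dom2 K \<phi>" "cod2 K \<gamma> = g \<odot> j"
    obtain \<chi> where x [simp]: "\<chi> \<in> cel K" "dom2 K \<chi> = l" "cod2 K \<chi> = g" "(\<chi> \<lhd> j) \<bullet> \<eta> = \<gamma> \<bullet> inv2 K \<phi>"
      using is_lan_ex[OF l, of g "\<gamma> \<bullet> inv2 K \<phi>"] by auto
    show "\<exists>\<theta>'. \<theta>' \<in> cells K l g \<and> (\<theta>' \<lhd> j) \<bullet> \<eta> \<bullet> \<phi> = \<gamma>"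
      by (rule exI[of _ "\<chi>"]) (simp add: extend_eq1[OF x(4)])
  next
    fix g \<alpha> \<beta>
    assume t: "\<alpha> \<in> cel K" "dom2 K \<alpha> = l" "cod2 K \<alpha> = g" "\<beta> \<in> cel K" "dom2 K \<beta> = l" "cod2 K \<beta> = g"
      and e: "(\<alpha> \<lhd> j) \<bullet> \<eta> \<bullet> \<phi> = (\<beta> \<lhd> j) \<bullet> \<eta> \<bullet> \<phi>"
    note [simp] = t
    have "((\<alpha> \<lhd> j) \<bullet> \<eta>) = ((\<beta> \<lhd> j) \<bullet> \<eta>)"
      using arg_cong[OF e, of "\<lambda>x. x \<bullet> inv2 K \<phi>"] by simp
    then show "\<alpha> = \<beta>" by - (rule is_lan_unique[OF l]; simp)
  qed simp_all
qed

lemma is_lan_along_iso: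
  assumes l: "is_lan K j f l \<eta>" and t: "invertible2 K \<psi>" "dom2 K \<psi> = j"
  shows "is_lan K (cod2 K \<psi>) f l ((l \<rhd> \<psi>) \<bullet> \<eta>)"
proof -
  note [simp] = is_lan_type[OF l] t invertible_cel[OF t(1)]
  have [simp]: "src K (cod2 K \<psi>) = src K j" "trg K (cod2 K \<psi>) = trg K j" by simp_all
  have c: "(g \<rhd> inv2 K \<psi>) \<bullet> (g \<rhd> \<psi>) = id2 K (g \<odot> j)" "(g \<rhd> \<psi>) \<bullet> (g \<rhd> inv2 K \<psi>) = id2 K (g \<odot> cod2 K \<psi>)"
    if "g \<in> arr K" "src K g = trg K j" for g using that by (simp_all flip: lw_vcmp)
  have s: "(\<alpha> \<lhd> cod2 K \<psi>) \<bullet> (l \<rhd> \<psi>) = (cod2 K \<alpha> \<rhd> \<psi>) \<bullet> (\<alpha> \<lhd> j)" if "\<alpha> \<in> cel K" "dom2 K \<alpha> = l" for \<alpha>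
    using that slide[of \<psi> j "cod2 K \<psi>" \<alpha> l "cod2 K \<alpha>"] by simp
  show ?thesis
  proof (rule is_lanI)
    fix g \<gamma>
    assume [simp]: "g \<in> arr K" "src K g = trg K (cod2 K \<psi>)" "trg K g = trg K f"
      "\<gamma> \<in> cel K" "dom2 K \<gamma> = f" "cod2 K \<gamma> = g \<odot> cod2 K \<psi>"
    obtain \<chi> where x [simp]: "\<chi> \<in> cel K" "dom2 K \<chi> = l" "cod2 K \<chi> = g" "(\<chi> \<lhd> j) \<bullet> \<eta> = (g \<rhd> inv2 K \<psi>) \<bullet> \<gamma>"
      using is_lan_ex[OF l, of g "(g \<rhd> inv2 K \<psi>) \<bullet> \<gamma>"] by auto
    show "\<exists>\<theta>'. \<theta>' \<in> cells K l g \<and> (\<theta>' \<lhd> cod2 K \<psi>) \<bullet> (l \<rhd> \<psi>) \<bullet> \<eta> = \<gamma>"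
      by (rule exI[of _ "\<chi>"]) (simp add: extend_eq[OF s] extend_eq1[OF c(2)])
  next
    fix g \<alpha> \<beta>
    assume t: "\<alpha> \<in> cel K" "dom2 K \<alpha> = l" "cod2 K \<alpha> = g" "\<beta> \<in> cel K" "dom2 K \<beta> = l" "cod2 K \<beta> = g"
      and g: "g \<in> arr K" "src K g = trg K (cod2 K \<psi>)"
      and e: "(\<alpha> \<lhd> cod2 K \<psi>) \<bullet> (l \<rhd> \<psi>) \<bullet> \<eta> = (\<beta> \<lhd> cod2 K \<psi>) \<bullet> (l \<rhd> \<psi>) \<bullet> \<eta>"
    note [simp] = t g
    have "(g \<rhd> \<psi>) \<bullet> ((\<alpha> \<lhd> j) \<bullet> \<eta>) = (g \<rhd> \<psi>) \<bullet> ((\<beta> \<lhd> j) \<bullet> \<eta>)"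
      using e by (simp add: extend_eq[OF s])
    from arg_cong[OF this, of "\<lambda>x. (g \<rhd> inv2 K \<psi>) \<bullet> x"]
    have "((\<alpha> \<lhd> j) \<bullet> \<eta>) = ((\<beta> \<lhd> j) \<bullet> \<eta>)"
      by (simp add: extend_eq1[OF c(1)])
    then show "\<alpha> = \<beta>" by - (rule is_lan_unique[OF l]; simp)
  qed simp_all
qed

lemma is_lan_paste:
  assumes 1: "is_lan K j\<^sub>1 f l\<^sub>1 \<eta>\<^sub>1" and 2: "is_lan K j\<^sub>2 l\<^sub>1 l\<^sub>2 \<eta>\<^sub>2"
  shows "is_lan K (j\<^sub>2 \<odot> j\<^sub>1) f l\<^sub>2 ((\<eta>\<^sub>2 \<lhd> j\<^sub>1) \<bullet> \<eta>\<^sub>1)"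
proof -
  note [simp] = is_lan_type[OF 1] is_lan_type[OF 2]
  have [simp]: "src K j\<^sub>2 = trg K j\<^sub>1" using is_lan_type[OF 1] is_lan_type[OF 2] by simp
  show ?thesis
  proof (rule is_lanI)
    fix g \<gamma>
    assume g: "g \<in> arr K" "src K g = trg K (j\<^sub>2 \<odot> j\<^sub>1)" "trg K g = trg K f"
      and [simp]: "\<gamma> \<in> cel K" "dom2 K \<gamma> = f" "cod2 K \<gamma> = g \<odot> j\<^sub>2 \<odot> j\<^sub>1"
    then have [simp]: "g \<in> arr K" "src K g = trg K j\<^sub>2" "trg K g = trg K f" by simp_all
    obtain \<chi> where x [simp]: "\<chi> \<in> cel K" "dom2 K \<chi> = l\<^sub>1" "cod2 K \<chi> = g \<odot> j\<^sub>2" "(\<chi> \<lhd> j\<^sub>1) \<bullet> \<eta>\<^sub>1 = \<gamma>"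
      using is_lan_ex[OF 1, of "g \<odot> j\<^sub>2" "\<gamma>"] by auto
    obtain \<xi> where y [simp]: "\<xi> \<in> cel K" "dom2 K \<xi> = l\<^sub>2" "cod2 K \<xi> = g" and ye: "(\<xi> \<lhd> j\<^sub>2) \<bullet> \<eta>\<^sub>2 = \<chi>"
      using is_lan_ex[OF 2, of "g" "\<chi>"] by auto
    have "(\<xi> \<lhd> j\<^sub>2 \<lhd> j\<^sub>1) \<bullet> (\<eta>\<^sub>2 \<lhd> j\<^sub>1) = \<chi> \<lhd> j\<^sub>1"
      using arg_cong[OF ye, of "\<lambda>x. x \<lhd> j\<^sub>1"] by simp
    from extend_eq1[OF this, of \<eta>\<^sub>1]
    show "\<exists>\<theta>'. \<theta>' \<in> cells K l\<^sub>2 g \<and> (\<theta>' \<lhd> (j\<^sub>2 \<odot> j\<^sub>1)) \<bullet> (\<eta>\<^sub>2 \<lhd> j\<^sub>1) \<bullet> \<eta>\<^sub>1 = \<gamma>"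
      by (intro exI[of _ "\<xi>"]) simp
  next
    fix g \<alpha> \<beta>
    assume t: "\<alpha> \<in> cel K" "dom2 K \<alpha> = l\<^sub>2" "cod2 K \<alpha> = g" "\<beta> \<in> cel K" "dom2 K \<beta> = l\<^sub>2" "cod2 K \<beta> = g"
      and e: "(\<alpha> \<lhd> (j\<^sub>2 \<odot> j\<^sub>1)) \<bullet> (\<eta>\<^sub>2 \<lhd> j\<^sub>1) \<bullet> \<eta>\<^sub>1 = (\<beta> \<lhd> (j\<^sub>2 \<odot> j\<^sub>1)) \<bullet> (\<eta>\<^sub>2 \<lhd> j\<^sub>1) \<bullet> \<eta>\<^sub>1"
    note [simp] = t
    have "(\<alpha> \<lhd> j\<^sub>2) \<bullet> \<eta>\<^sub>2 = (\<beta> \<lhd> j\<^sub>2) \<bullet> \<eta>\<^sub>2"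
      by (rule is_lan_unique[OF 1]) (use e in simp_all)
    then show "\<alpha> = \<beta>" by - (rule is_lan_unique[OF 2]; simp)
  qed simp_all
qed

lemma is_lan_paste_cancel:
  assumes 1: "is_lan K j\<^sub>1 f l\<^sub>1 \<eta>\<^sub>1" and 2: "is_lan K (j\<^sub>2 \<odot> j\<^sub>1) f l\<^sub>2 ((\<eta>\<^sub>2 \<lhd> j\<^sub>1) \<bullet> \<eta>\<^sub>1)"
    and j: "j\<^sub>2 \<in> arr K" "src K j\<^sub>2 = trg K j\<^sub>1" and e: "\<eta>\<^sub>2 \<in> cells K l\<^sub>1 (l\<^sub>2 \<odot> j\<^sub>2)"
  shows "is_lan K j\<^sub>2 l\<^sub>1 l\<^sub>2 \<eta>\<^sub>2"
proof -
  note [simp] = is_lan_type[OF 1] j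
  have [simp]: "l\<^sub>2 \<in> arr K" "src K l\<^sub>2 = trg K j\<^sub>2" "trg K l\<^sub>2 = trg K f"
    "\<eta>\<^sub>2 \<in> cel K" "dom2 K \<eta>\<^sub>2 = l\<^sub>1" "cod2 K \<eta>\<^sub>2 = l\<^sub>2 \<odot> j\<^sub>2" using is_lan_type[OF 2] e by simp_all
  show ?thesis
  proof (rule is_lanI)
    fix g \<gamma>
    assume g: "g \<in> arr K" "src K g = trg K j\<^sub>2" "trg K g = trg K l\<^sub>1"
      and [simp]: "\<gamma> \<in> cel K" "dom2 K \<gamma> = l\<^sub>1" "cod2 K \<gamma> = g \<odot> j\<^sub>2"
    then have [simp]: "g \<in> arr K" "src K g = trg K j\<^sub>2" "trg K g = trg K f" by simp_all
    obtain \<xi> where y [simp]: "\<xi> \<in> cel K" "dom2 K \<xi> = l\<^sub>2" "cod2 K \<xi> = g"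
      and ye: "(\<xi> \<lhd> (j\<^sub>2 \<odot> j\<^sub>1)) \<bullet> ((\<eta>\<^sub>2 \<lhd> j\<^sub>1) \<bullet> \<eta>\<^sub>1) = (\<gamma> \<lhd> j\<^sub>1) \<bullet> \<eta>\<^sub>1"
      using is_lan_ex[OF 2, of "g" "(\<gamma> \<lhd> j\<^sub>1) \<bullet> \<eta>\<^sub>1"] by auto
    have "(\<xi> \<lhd> j\<^sub>2) \<bullet> \<eta>\<^sub>2 = \<gamma>"
      by (rule is_lan_unique[OF 1]) (use ye in simp_all)
    then show "\<exists>\<theta>'. \<theta>' \<in> cells K l\<^sub>2 g \<and> (\<theta>' \<lhd> j\<^sub>2) \<bullet> \<eta>\<^sub>2 = \<gamma>"
      by (intro exI[of _ "\<xi>"]) simp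
  next
    fix g \<alpha> \<beta>
    assume t: "\<alpha> \<in> cel K" "dom2 K \<alpha> = l\<^sub>2" "cod2 K \<alpha> = g" "\<beta> \<in> cel K" "dom2 K \<beta> = l\<^sub>2" "cod2 K \<beta> = g"
      and e: "(\<alpha> \<lhd> j\<^sub>2) \<bullet> \<eta>\<^sub>2 = (\<beta> \<lhd> j\<^sub>2) \<bullet> \<eta>\<^sub>2"
    note [simp] = t
    have "(\<alpha> \<lhd> j\<^sub>2 \<lhd> j\<^sub>1) \<bullet> (\<eta>\<^sub>2 \<lhd> j\<^sub>1) = (\<beta> \<lhd> j\<^sub>2 \<lhd> j\<^sub>1) \<bullet> (\<eta>\<^sub>2 \<lhd> j\<^sub>1)"
      using arg_cong[OF e, of "\<lambda>x. x \<lhd> j\<^sub>1"] by simp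
    from extend_eq[OF this, of \<eta>\<^sub>1]
    show "\<alpha> = \<beta>" by - (rule is_lan_unique[OF 2]; simp)
  qed simp_all
qed

text \<open>Across \<open>L \<stileturn> R\<close>, 2-cells \<open>L l \<Rightarrow> g\<close> and \<open>L f \<Rightarrow> g j\<close> transpose to 2-cells
  \<open>l \<Rightarrow> R g\<close> and \<open>f \<Rightarrow> R g j\<close>.\<close>

lemma left_adjoint_preserves_lan:
  assumes L: "adjoint K L R" and l: "is_lan K j f l \<eta>" and t: "trg K f = src K L"
  shows "is_lan K j (L \<odot> f) (L \<odot> l) (L \<rhd> \<eta>)"
proof -
  obtain u c where a: "adjunction K L R u c" using L by (auto simp: adjoint_def)
  note [simp] = adjunctionD(1-10)[OF a] is_lan_type[OF l] t
  have t1: "(c \<lhd> L \<lhd> f) \<bullet> (L \<rhd> u \<lhd> f) = id2 K (L \<odot> f)"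
    using arg_cong[OF adjunctionD(11)[OF a], of "\<lambda>x. x \<lhd> f"] by simp
  show ?thesis
  proof (rule is_lanI)
    fix g \<gamma>
    assume [simp]: "g \<in> arr K" "src K g = trg K j" "trg K g = trg K (L \<odot> f)"
      and [simp]: "\<gamma> \<in> cel K" "dom2 K \<gamma> = L \<odot> f" "cod2 K \<gamma> = g \<odot> j"
    obtain \<chi> where x [simp]: "\<chi> \<in> cel K" "dom2 K \<chi> = l" "cod2 K \<chi> = R \<odot> g"
      and xe: "(\<chi> \<lhd> j) \<bullet> \<eta> = (R \<rhd> \<gamma>) \<bullet> (u \<lhd> f)"
      using is_lan_ex[OF l, of "R \<odot> g" "(R \<rhd> \<gamma>) \<bullet> (u \<lhd> f)"] by auto
    have xe': "(L \<rhd> (\<chi> \<lhd> j)) \<bullet> (L \<rhd> \<eta>) = (L \<rhd> R \<rhd> \<gamma>) \<bullet> (L \<rhd> u \<lhd> f)"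
      using arg_cong[OF xe, of "\<lambda>x. L \<rhd> x"] by simp
    have s: "(c \<lhd> g \<lhd> j) \<bullet> (L \<rhd> R \<rhd> \<gamma>) = \<gamma> \<bullet> (c \<lhd> L \<lhd> f)"
      using slide[of \<gamma> "L \<odot> f" "g \<odot> j" c "L \<odot> R" "id1 K (trg K L)"] by simp
    show "\<exists>\<theta>'. \<theta>' \<in> cells K (L \<odot> l) g \<and> (\<theta>' \<lhd> j) \<bullet> (L \<rhd> \<eta>) = \<gamma>"
      by (intro exI[of _ "(c \<lhd> g) \<bullet> (L \<rhd> \<chi>)"]) (simp add: xe' extend_eq[OF s] t1)
  next
    fix g \<alpha> \<beta>
    assume t: "\<alpha> \<in> cel K" "dom2 K \<alpha> = L \<odot> l" "cod2 K \<alpha> = g" "\<beta> \<in> cel K" "dom2 K \<beta> = L \<odot> l" "cod2 K \<beta> = g"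
      and g: "g \<in> arr K" "src K g = trg K j" "trg K g = trg K (L \<odot> f)"
      and e: "(\<alpha> \<lhd> j) \<bullet> (L \<rhd> \<eta>) = (\<beta> \<lhd> j) \<bullet> (L \<rhd> \<eta>)"
    note [simp] = t g
    have s: "(R \<rhd> L \<rhd> \<eta>) \<bullet> (u \<lhd> f) = (u \<lhd> l \<lhd> j) \<bullet> \<eta>"
      using slide[of \<eta> f "l \<odot> j" u "id1 K (src K L)" "R \<odot> L"] by simp
    have e': "(R \<rhd> (\<alpha> \<lhd> j)) \<bullet> (R \<rhd> L \<rhd> \<eta>) = (R \<rhd> (\<beta> \<lhd> j)) \<bullet> (R \<rhd> L \<rhd> \<eta>)"
      using arg_cong[OF e, of "\<lambda>x. R \<rhd> x"] by simp
    have "(R \<rhd> \<alpha>) \<bullet> (u \<lhd> l) = (R \<rhd> \<beta>) \<bullet> (u \<lhd> l)"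
      by (rule is_lan_unique[OF l]) (use extend_eq[OF e', of "u \<lhd> f"] s in simp_all)
    from arg_cong[OF this, of "\<lambda>x. (c \<lhd> g) \<bullet> (L \<rhd> x)"]
    have q: "(c \<lhd> g) \<bullet> (L \<rhd> R \<rhd> \<alpha>) \<bullet> (L \<rhd> u \<lhd> l) = (c \<lhd> g) \<bullet> (L \<rhd> R \<rhd> \<beta>) \<bullet> (L \<rhd> u \<lhd> l)" by simp
    have sa: "(c \<lhd> g) \<bullet> (L \<rhd> R \<rhd> x) = x \<bullet> (c \<lhd> L \<lhd> l)" if "x \<in> cel K" "dom2 K x = L \<odot> l" "cod2 K x = g" for x
      using that slide[of x "L \<odot> l" g c "L \<odot> R" "id1 K (trg K L)"] by simp
    have t1: "(c \<lhd> L \<lhd> l) \<bullet> (L \<rhd> u \<lhd> l) = id2 K (L \<odot> l)"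
      using arg_cong[OF adjunctionD(11)[OF a], of "\<lambda>x. x \<lhd> l"] by simp
    show "\<alpha> = \<beta>" using q by (simp add: extend_eq[OF sa] t1)
  qed simp_all
qed

lemma ff_reflects_lan:
  assumes i: "fully_faithful1 K i" and l: "is_lan K j (i \<odot> f) (i \<odot> l) (i \<rhd> \<eta>)"
    and f: "f \<in> arr K" "trg K f = src K i" "l \<in> arr K" "trg K l = src K i"
    and e: "\<eta> \<in> cells K f (l \<odot> j)"
  shows "is_lan K j f l \<eta>"
proof -
  note [simp] = ff_arr[OF i] f
  have [simp]: "j \<in> arr K" "src K f = src K j" "src K l = trg K j" "\<eta> \<in> cel K" "dom2 K \<eta> = f" "cod2 K \<eta> = l \<odot> j"
    using is_lan_type[OF l] e by simp_all
  show ?thesis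
  proof (rule is_lanI)
    fix g \<gamma>
    assume "g \<in> arr K" "src K g = trg K j" "trg K g = trg K f"
      and "\<gamma> \<in> cel K" "dom2 K \<gamma> = f" "cod2 K \<gamma> = g \<odot> j"
    note [simp] = this
    obtain \<chi> where x [simp]: "\<chi> \<in> cel K" "dom2 K \<chi> = i \<odot> l" "cod2 K \<chi> = i \<odot> g"
      and xe: "(\<chi> \<lhd> j) \<bullet> (i \<rhd> \<eta>) = i \<rhd> \<gamma>"
      using is_lan_ex[OF l, of "i \<odot> g" "i \<rhd> \<gamma>"] by auto
    obtain \<xi> where y [simp]: "\<xi> \<in> cel K" "dom2 K \<xi> = l" "cod2 K \<xi> = g" and ye: "i \<rhd> \<xi> = \<chi>"
      using ff_full[OF i, of l g \<chi>] by auto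
    have "i \<rhd> (\<xi> \<lhd> j) = \<chi> \<lhd> j" using arg_cong[OF ye, of "\<lambda>x. x \<lhd> j"] by simp
    then have "(\<xi> \<lhd> j) \<bullet> \<eta> = \<gamma>" by - (rule ff_faithful[OF i]; simp add: xe)
    then show "\<exists>\<theta>'. \<theta>' \<in> cells K l g \<and> (\<theta>' \<lhd> j) \<bullet> \<eta> = \<gamma>" by (intro exI[of _ \<xi>]) simp
  next
    fix g \<alpha> \<beta>
    assume t: "\<alpha> \<in> cel K" "dom2 K \<alpha> = l" "cod2 K \<alpha> = g" "\<beta> \<in> cel K" "dom2 K \<beta> = l" "cod2 K \<beta> = g"
      and e: "(\<alpha> \<lhd> j) \<bullet> \<eta> = (\<beta> \<lhd> j) \<bullet> \<eta>"
    note [simp] = t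
    have "i \<rhd> \<alpha> = i \<rhd> \<beta>"
      by (rule is_lan_unique[OF l]) (use arg_cong[OF e, of "\<lambda>x. i \<rhd> x"] in simp_all)
    then show "\<alpha> = \<beta>" by - (rule ff_faithful[OF i]; simp)
  qed simp_all
qed

text \<open>Pasting with the counit inverts pasting with the unit. As \<open>k\<close> is arbitrary, these extensions are
  absolute.\<close>

lemma adjunction_is_lan:
  assumes e: "adjunction K d r \<eta> \<epsilon>" and k: "k \<in> arr K" "src K k = src K d"
  shows "is_lan K d k (k \<odot> r) (k \<rhd> \<eta>)"
proof (rule is_lanI)
  note [simp] = adjunctionD(1-10)[OF e] k
  fix g \<gamma> assume [simp]: "g \<in> arr K" "src K g = trg K d" "trg K g = trg K k"
    "\<gamma> \<in> cel K" "dom2 K \<gamma> = k" "cod2 K \<gamma> = g \<odot> d"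
  have s: "(\<gamma> \<lhd> r \<lhd> d) \<bullet> (k \<rhd> \<eta>) = (g \<rhd> d \<rhd> \<eta>) \<bullet> \<gamma>"
    using slide[of \<eta> "id1 K (src K d)" "r \<odot> d" \<gamma> k "g \<odot> d"] by simp
  have t: "(g \<rhd> (\<epsilon> \<lhd> d)) \<bullet> (g \<rhd> d \<rhd> \<eta>) = id2 K (g \<odot> d)"
    using arg_cong[OF adjunctionD(11)[OF e], of "\<lambda>x. g \<rhd> x"] by simp
  show "\<exists>\<theta>. \<theta> \<in> cells K (k \<odot> r) g \<and> (\<theta> \<lhd> d) \<bullet> (k \<rhd> \<eta>) = \<gamma>"
    by (intro exI[of _ "(g \<rhd> \<epsilon>) \<bullet> (\<gamma> \<lhd> r)"]) (simp add: s extend_eq1[OF t])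
next
  note [simp] = adjunctionD(1-10)[OF e] k
  fix g \<alpha> \<beta> assume t: "\<alpha> \<in> cel K" "dom2 K \<alpha> = k \<odot> r" "cod2 K \<alpha> = g" "\<beta> \<in> cel K" "dom2 K \<beta> = k \<odot> r" "cod2 K \<beta> = g"
    and eq: "(\<alpha> \<lhd> d) \<bullet> (k \<rhd> \<eta>) = (\<beta> \<lhd> d) \<bullet> (k \<rhd> \<eta>)"
    and g: "g \<in> arr K" "src K g = trg K d" "trg K g = trg K k"
  note [simp] = t g
  have r: "x = (g \<rhd> \<epsilon>) \<bullet> (((x \<lhd> d) \<bullet> (k \<rhd> \<eta>)) \<lhd> r)" if [simp]: "x \<in> cel K" "dom2 K x = k \<odot> r" "cod2 K x = g" for x
  proof -
    have s: "(g \<rhd> \<epsilon>) \<bullet> (x \<lhd> d \<lhd> r) = x \<bullet> (k \<rhd> r \<rhd> \<epsilon>)"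
      using slide[of \<epsilon> "d \<odot> r" "id1 K (trg K d)" x "k \<odot> r" g] by simp
    have "(k \<rhd> r \<rhd> \<epsilon>) \<bullet> (k \<rhd> (\<eta> \<lhd> r)) = id2 K (k \<odot> r)"
      using arg_cong[OF adjunctionD(12)[OF e], of "\<lambda>x. k \<rhd> x"] by simp
    then show ?thesis by (simp add: extend_eq[OF s])
  qed
  show "\<alpha> = \<beta>" using r[of \<alpha>] r[of \<beta>] eq t by metis
qed (use adjunctionD(1-10)[OF e] k in simp_all)

text \<open>Conversely, that \<open>l\<close> preserves the extension of the identity along \<open>l\<close> yields the counit, defined by
  one triangle identity; the other one holds by the uniqueness property of that extension.\<close>

lemma adjoint_from_lan:
  assumes 1: "is_lan K l (id1 K (src K l)) r \<eta>" and 2: "is_lan K l l (l \<odot> r) (l \<rhd> \<eta>)"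
  shows "adjoint K l r"
proof -
  note [simp] = is_lan_type(1-3,5-)[OF 1]
  have [simp]: "trg K r = src K l" using is_lan_type[OF 1] by simp
  obtain \<epsilon> where [simp]: "\<epsilon> \<in> cel K" "dom2 K \<epsilon> = l \<odot> r" "cod2 K \<epsilon> = id1 K (trg K l)"
     and e: "(\<epsilon> \<lhd> l) \<bullet> (l \<rhd> \<eta>) = id2 K l"
    using is_lan_ex[OF 2, of "id1 K (trg K l)" "id2 K l"] by auto
  have s: "(\<eta> \<lhd> r \<lhd> l) \<bullet> \<eta> = (r \<rhd> l \<rhd> \<eta>) \<bullet> \<eta>"
    using slide[of \<eta> "id1 K (src K l)" "r \<odot> l" \<eta> "id1 K (src K l)" "r \<odot> l"] by simp
  have e': "(r \<rhd> (\<epsilon> \<lhd> l)) \<bullet> (r \<rhd> l \<rhd> \<eta>) = id2 K (r \<odot> l)"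
    using arg_cong[OF e, of "\<lambda>x. r \<rhd> x"] by simp
  have "(r \<rhd> \<epsilon>) \<bullet> (\<eta> \<lhd> r) = id2 K r"
    by (rule is_lan_unique[OF 1]) (simp_all add: s extend_eq1[OF e'])
  then have "adjunction K l r \<eta> \<epsilon>"
    using e by (intro adjunctionI) simp_all
  then show ?thesis by (rule adjointI)
qed

subsection \<open>1-cells that are left extensions of their own restriction\<close>

text \<open>When the unit of a left extension \<open>l\<close> along \<open>j\<close> is invertible, the unit may be taken to be an
  identity; being such an extension is then a property of \<open>l\<close> alone, stable under isomorphism.\<close>

abbreviation lext :: "'m \<Rightarrow> 'm \<Rightarrow> bool" where
  "lext j l \<equiv> is_lan K j (l \<odot> j) l (id2 K (l \<odot> j))"

lemma lextI:
  assumes l: "is_lan K j f l \<eta>" and i: "invertible2 K \<eta>"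
  shows "lext j l"
proof -
  note [simp] = is_lan_type[OF l] i
  show ?thesis using is_lan_precompose[OF l invertible_inv2[OF i]] by simp
qed

lemma lext_is_lan:
  assumes l: "lext j l" and i: "invertible2 K \<eta>" "cod2 K \<eta> = l \<odot> j"
  shows "is_lan K j (dom2 K \<eta>) l \<eta>"
  using is_lan_precompose[OF l i] i invertible_cel[OF i(1)] by simp

lemma lext_type:
  assumes "lext j l"
  shows "j \<in> arr K" "l \<in> arr K" "src K l = trg K j"
  using is_lan_type[OF assms] by auto

lemma lext_iso:
  assumes l: "lext j l" and i: "l \<simeq> l'"
  shows "lext j l'"
proof -
  obtain \<theta> where t: "invertible2 K \<theta>" "\<theta> \<in> cel K" "dom2 K \<theta> = l" "cod2 K \<theta> = l'"
    using i by (rule iso1E)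
  note [simp] = t lext_type[OF l]
  have "is_lan K j (l \<odot> j) l' (\<theta> \<lhd> j)"
    using is_lan_transport[OF l, of \<theta>] by simp
  then show ?thesis by (rule lextI) (simp add: invertible_rw)
qed

lemma lext_unique:
  assumes l: "lext j l" and l': "lext j l'" and i: "l \<odot> j \<simeq> l' \<odot> j"
  shows "l \<simeq> l'"
proof -
  obtain \<theta> where t: "invertible2 K \<theta>" "\<theta> \<in> cel K" "dom2 K \<theta> = l \<odot> j" "cod2 K \<theta> = l' \<odot> j"
    using i by (rule iso1E)
  have "is_lan K j (l \<odot> j) l' \<theta>" using lext_is_lan[OF l' t(1,4)] t by simp
  then show ?thesis by (rule is_lan_iso_unique[OF l]) (rule iso1I)
qed

lemma lext_left_adjoint:
  assumes L: "adjoint K L R" and l: "lext j l" and "trg K l = src K L"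
  shows "lext j (L \<odot> l)"
  using left_adjoint_preserves_lan[OF L l] lext_type[OF l] adjoint_type[OF L] assms(3) by simp

lemma ff_reflects_lext:
  assumes i: "fully_faithful1 K i" and l: "lext j (i \<odot> l)" and t: "l \<in> arr K" "trg K l = src K i"
  shows "lext j l"
proof -
  have [simp]: "j \<in> arr K" "src K l = trg K j" using lext_type[OF l] t ff_arr[OF i] by simp_all
  show ?thesis using l t ff_arr[OF i] by - (rule ff_reflects_lan[OF i]; simp)
qed

lemma preserves_iff_lext:
  assumes l: "is_lan K j f l \<eta>" and i: "invertible2 K \<eta>" and k: "k \<in> arr K" "src K k = trg K f"
  shows "preserves_lan K k j f l \<eta> \<longleftrightarrow> lext j (k \<odot> l)"
proof -
  note [simp] = is_lan_type[OF l] k i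
  have "is_lan K j (k \<odot> f) (k \<odot> l) (k \<rhd> \<eta>) \<longleftrightarrow> lext j (k \<odot> l)"
    using lextI[of j "k \<odot> f" "k \<odot> l" "k \<rhd> \<eta>"] lext_is_lan[of j "k \<odot> l" "k \<rhd> \<eta>"]
    by (auto simp: invertible_lw)
  then show ?thesis by (simp add: preserves_lan_def)
qed

lemma preserves_lan_unique:
  assumes l: "is_lan K j f l \<eta>" and l': "is_lan K j f l' \<eta>'" and p: "preserves_lan K k j f l \<eta>"
    and k: "k \<in> arr K" "src K k = trg K f"
  shows "preserves_lan K k j f l' \<eta>'"
proof -
  note [simp] = is_lan_type[OF l] is_lan_type(3,5-)[OF l'] k
  obtain \<theta> where t: "invertible2 K \<theta>" "\<theta> \<in> cel K" "dom2 K \<theta> = l" "cod2 K \<theta> = l'" "(\<theta> \<lhd> j) \<bullet> \<eta> = \<eta>'"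
    using is_lan_iso_unique[OF l l'] .
  note [simp] = t(1-4)
  have "(k \<rhd> (\<theta> \<lhd> j)) \<bullet> (k \<rhd> \<eta>) = k \<rhd> \<eta>'" using arg_cong[OF t(5), of "\<lambda>x. k \<rhd> x"] by simp
  then show ?thesis
    using is_lan_transport[of j "k \<odot> f" "k \<odot> l" "k \<rhd> \<eta>" "k \<rhd> \<theta>"] p
    by (simp add: preserves_lan_def invertible_lw)
qed

text \<open>This is how admissibility produces adjunctions. Both the identity and \<open>l\<close> are extensions along the
  dense 1-cell \<open>s\<close>. Cancelling these from the extensions of \<open>s\<close> and of \<open>l s\<close> along \<open>f \<cong> l s\<close> shows that \<open>N\<close>
  is the extension of the identity along \<open>l\<close> and that \<open>l\<close> preserves it.\<close>

lemma adjoint_from_dense: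
  assumes s: "lext s (id1 K (trg K s))" and l: "lext s l"
    and f: "f \<simeq> l \<odot> s" and N: "is_lan K f s N \<phi>" and p: "preserves_lan K l f s N \<phi>"
  shows "adjoint K l N"
proof -
  note [simp] = lext_type[OF l] is_lan_type(1,3,5-)[OF N]
  have [simp]: "src K f = src K s" using is_lan_type(4)[OF N] by simp
  have [simp]: "trg K f = trg K l" using iso1_type(4)[OF f] by simp
  obtain \<psi> where psi: "invertible2 K \<psi>" "\<psi> \<in> cel K" "dom2 K \<psi> = f" "cod2 K \<psi> = l \<odot> s"
    using f by (rule iso1E)
  note [simp] = psi
  define \<phi>' where "\<phi>' = (N \<rhd> \<psi>) \<bullet> \<phi>"
  have [simp]: "\<phi>' \<in> cel K" "dom2 K \<phi>' = s" "cod2 K \<phi>' = N \<odot> l \<odot> s" by (simp_all add: \<phi>'_def)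
  have 1: "is_lan K (l \<odot> s) s N \<phi>'"
    using is_lan_along_iso[OF N, of \<psi>] by (simp add: \<phi>'_def)
  have 2: "is_lan K (l \<odot> s) (l \<odot> s) (l \<odot> N) (l \<rhd> \<phi>')"
    using is_lan_along_iso[of f "l \<odot> s" "l \<odot> N" "l \<rhd> \<phi>" \<psi>] p by (simp add: \<phi>'_def preserves_lan_def)
  have s': "is_lan K s s (id1 K (trg K s)) (id2 K s)" using s by simp
  obtain \<eta> where [simp]: "\<eta> \<in> cel K" "dom2 K \<eta> = id1 K (trg K s)" "cod2 K \<eta> = N \<odot> l"
    and e: "(\<eta> \<lhd> s) \<bullet> id2 K s = \<phi>'"
    using is_lan_ex[OF s', of "N \<odot> l" \<phi>'] by auto
  have e': "\<eta> \<lhd> s = \<phi>'" using e by simp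
  have "l \<rhd> (\<eta> \<lhd> s) = l \<rhd> \<phi>'" using e' by simp
  then have "(l \<rhd> \<eta>) \<lhd> s = l \<rhd> \<phi>'" by simp
  then have "is_lan K l l (l \<odot> N) (l \<rhd> \<eta>)"
    using 2 by (intro is_lan_paste_cancel[OF l]) simp_all
  moreover have "is_lan K l (id1 K (trg K s)) N \<eta>"
    using 1 e by (intro is_lan_paste_cancel[OF s']) simp_all
  ultimately show ?thesis by (intro adjoint_from_lan[of _ _ \<eta>]) simp_all
qed

end

section \<open>KZ doctrines\<close>

locale kz = two_category K for K :: "('o, 'm, 'c) two_cat" (structure) +
  fixes S :: "('o, 'm, 'c) doctrine"
  assumes kz: "kz_doctrine K S"
begin

lemma dob_obj [simp]: "A \<in> obj K \<Longrightarrow> dob S A \<in> obj K"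
  using kz by (simp add: kz_doctrine_def)

lemma unt_type [simp]:
  assumes "A \<in> obj K"
  shows "unt S A \<in> arr K" "src K (unt S A) = A" "trg K (unt S A) = dob S A"
  using kz assms by (simp_all add: kz_doctrine_def)

lemma ext_lan:
  assumes "f \<in> arr K" "B \<in> obj K" "trg K f = dob S B"
  shows "is_lan K (unt S (src K f)) f (ext S B f) (extc S B f)" "invertible2 K (extc S B f)"
proof -
  have "f \<in> hom K (src K f) (dob S B)" "src K f \<in> obj K" using assms by simp_all
  then show "is_lan K (unt S (src K f)) f (ext S B f) (extc S B f)" "invertible2 K (extc S B f)"
    using kz assms(2) unfolding kz_doctrine_def by blast+
qed

lemma ext_type [simp]:
  assumes "f \<in> arr K" "B \<in> obj K" "trg K f = dob S B"
  shows "ext S B f \<in> arr K" "src K (ext S B f) = dob S (src K f)" "trg K (ext S B f) = dob S B"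
  using is_lan_type[OF ext_lan(1)[OF assms]] assms by simp_all

lemma ext_lext:
  assumes "f \<in> arr K" "B \<in> obj K" "trg K f = dob S B"
  shows "lext (unt S (src K f)) (ext S B f)"
  using lextI ext_lan[OF assms] by blast

lemma ext_unt:
  assumes "f \<in> arr K" "B \<in> obj K" "trg K f = dob S B"
  shows "ext S B f \<odot> unt S (src K f) \<simeq> f"
  by (rule iso1_sym, rule iso1I[OF ext_lan(2)[OF assms]])
    (use is_lan_type[OF ext_lan(1)[OF assms]] in simp_all)

lemma dense:
  assumes "A \<in> obj K"
  shows "lext (unt S A) (id1 K (dob S A))"
proof -
  have "is_lan K (unt S A) (unt S A) (id1 K (dob S A)) (id2 K (unt S A))"
    using kz assms unfolding kz_doctrine_def by blast
  then show ?thesis using assms by simp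
qed

lemma ext_ext:
  assumes "f \<in> arr K" "B \<in> obj K" "trg K f = dob S B" "g \<in> arr K" "src K g = B" "C \<in> obj K" "trg K g = dob S C"
  shows "lext (unt S (src K f)) (ext S C g \<odot> ext S B f)"
proof -
  have "f \<in> hom K (src K f) (dob S B)" "src K f \<in> obj K" "g \<in> hom K B (dob S C)" using assms by simp_all
  then have "preserves_lan K (ext S C g) (unt S (src K f)) f (ext S B f) (extc S B f)"
    using kz assms(2,6) unfolding kz_doctrine_def by blast
  then show ?thesis using preserves_iff_lext[OF ext_lan[OF assms(1-3)], of "ext S C g"] assms by simp
qed

subsection \<open>Preservation of extensions along units\<close>

text \<open>The part of cocontinuity that concerns the 1-cell alone. It makes sense, and composes, without
  cocompleteness of the objects involved.\<close>

definition pres :: "'m \<Rightarrow> bool" where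
  "pres k \<longleftrightarrow> k \<in> arr K \<and> (\<forall>A l. A \<in> obj K \<longrightarrow> lext (unt S A) l \<longrightarrow> trg K l = src K k \<longrightarrow> lext (unt S A) (k \<odot> l))"

lemma pres_arr: "pres k \<Longrightarrow> k \<in> arr K"
  by (simp add: pres_def)

lemma presD: "pres k \<Longrightarrow> A \<in> obj K \<Longrightarrow> lext (unt S A) l \<Longrightarrow> trg K l = src K k \<Longrightarrow> lext (unt S A) (k \<odot> l)"
  unfolding pres_def by blast

lemma presI:
  assumes "k \<in> arr K" "\<And>A l. A \<in> obj K \<Longrightarrow> lext (unt S A) l \<Longrightarrow> trg K l = src K k \<Longrightarrow> lext (unt S A) (k \<odot> l)"
  shows "pres k"
  using assms unfolding pres_def by blast

lemma pres_cmp: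
  assumes "pres k" "pres h" "src K h = trg K k"
  shows "pres (h \<odot> k)"
proof (rule presI)
  note [simp] = pres_arr[OF assms(1)] pres_arr[OF assms(2)] assms(3)
  show "h \<odot> k \<in> arr K" by simp
  fix A l assume A: "A \<in> obj K" and l: "lext (unt S A) l" "trg K l = src K (h \<odot> k)"
  note [simp] = lext_type[OF l(1)]
  have "lext (unt S A) (k \<odot> l)" using presD[OF assms(1) A l(1)] l(2) by simp
  from presD[OF assms(2) A this] l(2) A show "lext (unt S A) ((h \<odot> k) \<odot> l)" by simp
qed

lemma pres_iso:
  assumes "pres k" "k \<simeq> h"
  shows "pres h"
proof (rule presI)
  note [simp] = iso1_type[OF assms(2)]
  show "h \<in> arr K" by simp
  fix A l assume A: "A \<in> obj K" and l: "lext (unt S A) l" "trg K l = src K h"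
  have "lext (unt S A) (k \<odot> l)" using presD[OF assms(1) A l(1)] l(2) by simp
  then show "lext (unt S A) (h \<odot> l)"
    by (rule lext_iso) (use l lext_type[OF l(1)] iso1_rw[OF assms(2)] in simp)
qed

lemma pres_left_adjoint:
  assumes "adjoint K L R"
  shows "pres L"
  by (rule presI[OF adjoint_type(1)[OF assms]]) (rule lext_left_adjoint[OF assms])

lemma ff_reflects_pres:
  assumes i: "fully_faithful1 K i" and p: "pres (i \<odot> k)" and k: "k \<in> arr K" "trg K k = src K i"
  shows "pres k"
proof (rule presI)
  note [simp] = ff_arr[OF i] k
  fix A l assume A: "A \<in> obj K" and l: "lext (unt S A) l" "trg K l = src K k"
  note [simp] = lext_type[OF l(1)] l(2)
  have "lext (unt S A) (i \<odot> k \<odot> l)" using presD[OF p A l(1)] l(2) by simp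
  then show "lext (unt S A) (k \<odot> l)" by (rule ff_reflects_lext[OF i]) simp_all
qed fact

lemma lext_ext_iso:
  assumes l: "lext (unt S A) l" and A: "A \<in> obj K" and B: "B \<in> obj K" "trg K l = dob S B"
  shows "l \<simeq> ext S B (l \<odot> unt S A)"
proof (rule lext_unique[OF l])
  note [simp] = lext_type[OF l] A B
  show "lext (unt S A) (ext S B (l \<odot> unt S A))" using ext_lext[of "l \<odot> unt S A" B] by simp
  show "l \<odot> unt S A \<simeq> ext S B (l \<odot> unt S A) \<odot> unt S A"
    using iso1_sym[OF ext_unt[of "l \<odot> unt S A" B]] by simp
qed

text \<open>Every extension along a unit into a free object is isomorphic to a chosen one.\<close>

lemma pres_from_free:
  assumes k: "k \<in> arr K" "src K k = dob S B" and B: "B \<in> obj K"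
  shows "pres k \<longleftrightarrow> (\<forall>A \<in> obj K. \<forall>f \<in> hom K A (dob S B). lext (unt S A) (k \<odot> ext S B f))"
proof
  assume p: "pres k"
  show "\<forall>A \<in> obj K. \<forall>f \<in> hom K A (dob S B). lext (unt S A) (k \<odot> ext S B f)"
  proof (intro ballI)
    fix A f assume "A \<in> obj K" "f \<in> hom K A (dob S B)"
    then show "lext (unt S A) (k \<odot> ext S B f)" using ext_lext[of f B] B k by (intro presD[OF p]) simp_all
  qed
next
  assume *: "\<forall>A \<in> obj K. \<forall>f \<in> hom K A (dob S B). lext (unt S A) (k \<odot> ext S B f)"
  show "pres k"
  proof (rule presI[OF k(1)])
    fix A l assume A: "A \<in> obj K" and l: "lext (unt S A) l" "trg K l = src K k"
    note [simp] = lext_type[OF l(1)] l(2) A B k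
    have "lext (unt S A) (k \<odot> ext S B (l \<odot> unt S A))" using * by simp
    moreover have "k \<odot> ext S B (l \<odot> unt S A) \<simeq> k \<odot> l"
      using iso1_lw[OF iso1_sym[OF lext_ext_iso[OF l(1) A B]], of k] by simp
    ultimately show "lext (unt S A) (k \<odot> l)" by (rule lext_iso)
  qed
qed

lemma ball_obj_hom:
  "(\<forall>B \<in> obj K. \<forall>g \<in> hom K B X. Q B g) \<longleftrightarrow> (\<forall>g. g \<in> arr K \<longrightarrow> trg K g = X \<longrightarrow> Q (src K g) g)"
  by auto

text \<open>Cocompleteness without reference to the chosen extensions and their 2-cells.\<close>

lemma cocomplete_iff:
  "cocomplete K S X \<longleftrightarrow> X \<in> obj K \<and>
     (\<forall>g. g \<in> arr K \<longrightarrow> trg K g = X \<longrightarrow> (\<exists>h. lext (unt S (src K g)) h \<and> h \<odot> unt S (src K g) \<simeq> g \<and> pres h))"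
  (is "_ \<longleftrightarrow> _ \<and> ?R")
proof -
  have "(\<exists>gbar c. is_lan K (unt S B) g gbar c \<and> invertible2 K c \<and>
          (\<forall>A \<in> obj K. \<forall>f \<in> hom K A (dob S B). preserves_lan K gbar (unt S A) f (ext S B f) (extc S B f)))
     \<longleftrightarrow> (\<exists>h. lext (unt S B) h \<and> h \<odot> unt S B \<simeq> g \<and> pres h)"
    if B: "B \<in> obj K" and g: "g \<in> arr K" "src K g = B" for B g
  proof -
    have p: "(\<forall>A \<in> obj K. \<forall>f \<in> hom K A (dob S B). preserves_lan K h (unt S A) f (ext S B f) (extc S B f)) \<longleftrightarrow> pres h"
      if h: "h \<in> arr K" "src K h = dob S B" for h
    proof -
      have "preserves_lan K h (unt S A) f (ext S B f) (extc S B f) \<longleftrightarrow> lext (unt S A) (h \<odot> ext S B f)"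
        if "f \<in> hom K A (dob S B)" for A f
      proof -
        have [simp]: "f \<in> arr K" "trg K f = dob S B" and A: "A = src K f" using that by simp_all
        show ?thesis unfolding A using preserves_iff_lext[OF ext_lan[of f B], of h] B h by simp
      qed
      then show ?thesis unfolding pres_from_free[OF h B] by blast
    qed
    show ?thesis
    proof
      assume "\<exists>gbar c. is_lan K (unt S B) g gbar c \<and> invertible2 K c \<and>
          (\<forall>A \<in> obj K. \<forall>f \<in> hom K A (dob S B). preserves_lan K gbar (unt S A) f (ext S B f) (extc S B f))"
      then obtain h c where h: "is_lan K (unt S B) g h c" "invertible2 K c" and
        q: "\<forall>A \<in> obj K. \<forall>f \<in> hom K A (dob S B). preserves_lan K h (unt S A) f (ext S B f) (extc S B f)" by blast
      have "h \<in> arr K" "src K h = dob S B" using is_lan_type[OF h(1)] B by simp_all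
      then have "pres h" using p q by blast
      moreover have "h \<odot> unt S B \<simeq> g"
        by (rule iso1_sym, rule iso1I[OF h(2)]) (use is_lan_type[OF h(1)] in simp_all)
      ultimately show "\<exists>h. lext (unt S B) h \<and> h \<odot> unt S B \<simeq> g \<and> pres h" using lextI[OF h] by blast
    next
      assume "\<exists>h. lext (unt S B) h \<and> h \<odot> unt S B \<simeq> g \<and> pres h"
      then obtain h where h: "lext (unt S B) h" "h \<odot> unt S B \<simeq> g" "pres h" by blast
      obtain c where c: "invertible2 K c" "c \<in> cel K" "dom2 K c = g" "cod2 K c = h \<odot> unt S B"
        using iso1_sym[OF h(2)] by (rule iso1E)
      have "is_lan K (unt S B) g h c" using lext_is_lan[OF h(1) c(1,4)] c(3) by simp
      moreover have "\<forall>A \<in> obj K. \<forall>f \<in> hom K A (dob S B). preserves_lan K h (unt S A) f (ext S B f) (extc S B f)"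
        using p[of h] h(3) lext_type[OF h(1)] B by simp
      ultimately show "\<exists>gbar c. is_lan K (unt S B) g gbar c \<and> invertible2 K c \<and>
          (\<forall>A \<in> obj K. \<forall>f \<in> hom K A (dob S B). preserves_lan K gbar (unt S A) f (ext S B f) (extc S B f))"
        using c(1) by blast
    qed
  qed
  then have "(\<forall>B \<in> obj K. \<forall>g \<in> hom K B X. \<exists>gbar c. is_lan K (unt S B) g gbar c \<and> invertible2 K c \<and>
          (\<forall>A \<in> obj K. \<forall>f \<in> hom K A (dob S B). preserves_lan K gbar (unt S A) f (ext S B f) (extc S B f)))
      \<longleftrightarrow> (\<forall>B \<in> obj K. \<forall>g \<in> hom K B X. \<exists>h. lext (unt S B) h \<and> h \<odot> unt S B \<simeq> g \<and> pres h)"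
    by (intro ball_cong refl) (simp only: in_hom)
  also have "\<dots> \<longleftrightarrow> ?R" by (rule ball_obj_hom)
  finally show ?thesis unfolding cocomplete_def by blast
qed

lemma cocomplete_obj: "cocomplete K S X \<Longrightarrow> X \<in> obj K"
  by (simp add: cocomplete_def)

lemma cocompleteE:
  assumes "cocomplete K S X" "g \<in> arr K" "trg K g = X"
  obtains h where "lext (unt S (src K g)) h" "h \<odot> unt S (src K g) \<simeq> g" "pres h"
    "h \<in> arr K" "src K h = dob S (src K g)" "trg K h = X"
proof -
  obtain h where h: "lext (unt S (src K g)) h" "h \<odot> unt S (src K g) \<simeq> g" "pres h"
    using assms unfolding cocomplete_iff by blast
  have t: "h \<in> arr K" "src K h = dob S (src K g)" using lext_type[OF h(1)] assms by simp_all
  moreover have "trg K h = X" using iso1_type(4)[OF h(2)] t assms by simp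
  ultimately show ?thesis using that h by blast
qed

lemma pres_extension:
  assumes X: "cocomplete K S X" and h: "lext (unt S B) h" "trg K h = X" and B: "B \<in> obj K"
  shows "pres h"
proof -
  note [simp] = lext_type[OF h(1)] h(2) B
  obtain h' where h': "lext (unt S B) h'" "h' \<odot> unt S B \<simeq> h \<odot> unt S B" "pres h'"
    using cocompleteE[OF X, of "h \<odot> unt S B"] by auto
  show ?thesis using pres_iso[OF h'(3) lext_unique[OF h'(1) h(1) h'(2)]] .
qed

text \<open>Extensions are unique up to isomorphism, and cocompleteness supplies one with an invertible 2-cell.\<close>

lemma lan_invertible:
  assumes X: "cocomplete K S X" and l: "is_lan K (unt S B) g l \<eta>" and B: "B \<in> obj K" and g: "trg K g = X"
  shows "invertible2 K \<eta>"
proof -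
  note [simp] = is_lan_type[OF l] B g
  obtain h where h: "lext (unt S B) h" "h \<odot> unt S B \<simeq> g" "pres h" "src K h = dob S B" "trg K h = X"
    using cocompleteE[OF X, of g] is_lan_type(4)[OF l] by auto
  obtain a where a: "invertible2 K a" "a \<in> cel K" "dom2 K a = g" "cod2 K a = h \<odot> unt S B"
    using iso1_sym[OF h(2)] by (rule iso1E)
  have "is_lan K (unt S B) g h a" using lext_is_lan[OF h(1) a(1,4)] a(3) by simp
  then obtain \<theta> where t: "invertible2 K \<theta>" "\<theta> \<in> cel K" "dom2 K \<theta> = h" "(\<theta> \<lhd> unt S B) \<bullet> a = \<eta>"
    using is_lan_iso_unique[of "unt S B" g h a l \<eta>] l by metis
  show ?thesis unfolding t(4)[symmetric]
    using a t h lext_type[OF h(1)] by (intro invertible_vcmp invertible_rw) simp_all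
qed

lemma cocontinuous_iff:
  "cocontinuous K S E \<longleftrightarrow> cocomplete K S (src K E) \<and> cocomplete K S (trg K E) \<and> pres E"
proof
  assume c: "cocontinuous K S E"
  then have E: "E \<in> arr K" by (simp add: cocontinuous_def)
  have "pres E"
  proof (rule presI[OF E])
    fix A l assume A: "A \<in> obj K" and l: "lext (unt S A) l" "trg K l = src K E"
    note [simp] = lext_type[OF l(1)] l(2) A E
    have "l \<odot> unt S A \<in> hom K A (src K E)" by simp
    then have "preserves_lan K E (unt S A) (l \<odot> unt S A) l (id2 K (l \<odot> unt S A))"
      using c l(1) A unfolding cocontinuous_def by blast
    then show "lext (unt S A) (E \<odot> l)"
      by (subst (asm) preserves_iff_lext[OF l(1)]) (simp_all add: invertible_id2)
  qed
  then show "cocomplete K S (src K E) \<and> cocomplete K S (trg K E) \<and> pres E"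
    using c by (simp add: cocontinuous_def)
next
  assume c: "cocomplete K S (src K E) \<and> cocomplete K S (trg K E) \<and> pres E"
  have "preserves_lan K E (unt S B) g l \<eta>"
    if B: "B \<in> obj K" and g: "g \<in> hom K B (src K E)" and l: "is_lan K (unt S B) g l \<eta>" for B g l \<eta>
  proof -
    have "E \<in> arr K" using c pres_arr by blast
    note [simp] = is_lan_type[OF l] B this
    have "invertible2 K \<eta>" using c g by (intro lan_invertible[OF _ l]) simp_all
    then show ?thesis
      using presD[of E B l] c lextI[OF l] preserves_iff_lext[OF l, of E] g by simp
  qed
  then show "cocontinuous K S E" using c pres_arr unfolding cocontinuous_def by blast
qed

lemma cocontinuous_pres: "cocontinuous K S E \<Longrightarrow> pres E"
  by (simp add: cocontinuous_iff)

lemma free_cocomplete: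
  assumes "B \<in> obj K"
  shows "cocomplete K S (dob S B)"
  unfolding cocomplete_iff
proof (intro conjI allI impI)
  show "dob S B \<in> obj K" using assms by simp
  fix g assume g: "g \<in> arr K" "trg K g = dob S B"
  have "pres (ext S B g)"
    using g assms ext_ext[of _ "src K g" g B] by (subst pres_from_free[of _ "src K g"]) auto
  then show "\<exists>h. lext (unt S (src K g)) h \<and> h \<odot> unt S (src K g) \<simeq> g \<and> pres h"
    using ext_lext[OF g(1) assms g(2)] ext_unt[OF g(1) assms g(2)] by blast
qed

text \<open>Extensions into \<open>trg L\<close> are computed in \<open>X\<close> and sent back by \<open>L\<close>, which preserves them as a left
  adjoint.\<close>

lemma cocomplete_reflective:
  assumes X: "cocomplete K S X" and L: "adjoint K L R" "src K L = X"
    and i: "i \<in> arr K" "src K i = trg K L" "trg K i = X" and Li: "L \<odot> i \<simeq> id1 K (trg K L)"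
  shows "cocomplete K S (trg K L)"
  unfolding cocomplete_iff
proof (intro conjI allI impI)
  note [simp] = adjoint_type[OF L(1)] L(2) i
  show "trg K L \<in> obj K" by simp
  fix g assume g [simp]: "g \<in> arr K" "trg K g = trg K L"
  obtain h where h: "lext (unt S (src K g)) h" "h \<odot> unt S (src K g) \<simeq> i \<odot> g" "pres h"
     and [simp]: "h \<in> arr K" "src K h = dob S (src K g)" "trg K h = X"
    using cocompleteE[OF X, of "i \<odot> g"] by auto
  have "lext (unt S (src K g)) (L \<odot> h)" using lext_left_adjoint[OF L(1) h(1)] by simp
  moreover have "(L \<odot> h) \<odot> unt S (src K g) \<simeq> g"
  proof -
    have "L \<odot> h \<odot> unt S (src K g) \<simeq> L \<odot> i \<odot> g" using h(2) by (intro iso1_lw) simp_all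
    also have "L \<odot> i \<odot> g \<simeq> id1 K (trg K L) \<odot> g" using iso1_rw[OF Li, of g] by simp
    finally show ?thesis by simp
  qed
  moreover have "pres (L \<odot> h)" using pres_cmp[OF h(3) pres_left_adjoint[OF L(1)]] by simp
  ultimately show "\<exists>h. lext (unt S (src K g)) h \<and> h \<odot> unt S (src K g) \<simeq> g \<and> pres h" by blast
qed

lemma cocomplete_equivalence:
  assumes X: "cocomplete K S (src K e)" and e: "equivalence1 K e"
  shows "cocomplete K S (trg K e)"
proof -
  obtain e' where e': "adjoint K e e'" "e \<odot> e' \<simeq> id1 K (trg K e)"
    using equivalence_inverse[OF e] by metis
  show ?thesis using cocomplete_reflective[OF X e'(1) refl _ _ _ e'(2)] adjoint_type[OF e'(1)] by simp
qed

text \<open>The left adjoint is the extension of the identity. Density of the unit induces \<open>id \<Rightarrow> \<sigma> d\<close>, and the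
  counit is the inverse of the 2-cell of the extension.\<close>

lemma unit_left_adjoint:
  assumes X: "cocomplete K S X"
  obtains d where "adjoint K d (unt S X)" "d \<odot> unt S X \<simeq> id1 K X" "lext (unt S X) d"
    "d \<in> arr K" "src K d = dob S X" "trg K d = X"
proof -
  have X0 [simp]: "X \<in> obj K" using cocomplete_obj[OF X] .
  obtain d where d: "lext (unt S X) d" "d \<odot> unt S X \<simeq> id1 K X"
     and [simp]: "d \<in> arr K" "src K d = dob S X" "trg K d = X"
    using cocompleteE[OF X, of "id1 K X"] by auto
  obtain c where c: "invertible2 K c" "c \<in> cel K" "dom2 K c = id1 K X" "cod2 K c = d \<odot> unt S X"
    using iso1_sym[OF d(2)] by (rule iso1E)
  note [simp] = c
  obtain \<theta> where t: "\<theta> \<in> cel K" "dom2 K \<theta> = id1 K (dob S X)" "cod2 K \<theta> = unt S X \<odot> d"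
    and te: "(\<theta> \<lhd> unt S X) \<bullet> id2 K (id1 K (dob S X) \<odot> unt S X) = unt S X \<rhd> c"
    using is_lan_ex[OF dense[OF X0], of "unt S X \<odot> d" "unt S X \<rhd> c"] by auto
  note [simp] = t
  have te': "\<theta> \<lhd> unt S X = unt S X \<rhd> c" using te by simp
  have te2: "(\<theta> \<lhd> unt S X) \<lhd> x = unt S X \<rhd> (c \<lhd> x)" if "x \<in> arr K" "trg K x = X" for x
    using that by (simp add: te')
  have tri2: "(unt S X \<rhd> inv2 K c) \<bullet> (\<theta> \<lhd> unt S X) = id2 K (unt S X)"
    by (simp add: te' flip: lw_vcmp)
  have s: "(c \<lhd> d \<lhd> unt S X) \<bullet> c = (d \<rhd> unt S X \<rhd> c) \<bullet> c"
    using slide[of c "id1 K X" "d \<odot> unt S X" c "id1 K X" "d \<odot> unt S X"] by simp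
  have dt: "d \<rhd> (\<theta> \<lhd> unt S X) = d \<rhd> unt S X \<rhd> c" using arg_cong[OF te', of "\<lambda>x. d \<rhd> x"] by simp
  have ci: "(inv2 K c \<lhd> d \<lhd> unt S X) \<bullet> (c \<lhd> d \<lhd> unt S X) = id2 K (d \<odot> unt S X)"
    by (simp flip: rw_vcmp)
  have l: "is_lan K (unt S X) (id1 K X) d c" using lext_is_lan[OF d(1), of c] by simp
  have tri1: "(inv2 K c \<lhd> d) \<bullet> (d \<rhd> \<theta>) = id2 K d"
    by (rule is_lan_unique[OF l]) (simp_all add: dt s[symmetric] extend_eq1[OF ci])
  have "adjunction K d (unt S X) \<theta> (inv2 K c)"
    by (rule adjunctionI) (simp_all add: tri1 tri2)
  from adjointI[OF this] show ?thesis using that[of d] d by simp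
qed

subsection \<open>The action on 1-cells\<close>

lemma push_type [simp]:
  assumes "f \<in> arr K"
  shows "push K S f \<in> arr K" "src K (push K S f) = dob S (src K f)" "trg K (push K S f) = dob S (trg K f)"
  using assms by (simp_all add: push_def)

lemma pushc_type [simp]:
  assumes "f \<in> arr K"
  shows "pushc K S f \<in> cel K" "dom2 K (pushc K S f) = unt S (trg K f) \<odot> f"
    "cod2 K (pushc K S f) = push K S f \<odot> unt S (src K f)" "invertible2 K (pushc K S f)"
  using assms is_lan_type[OF ext_lan(1)[of "unt S (trg K f) \<odot> f" "trg K f"]]
    ext_lan(2)[of "unt S (trg K f) \<odot> f" "trg K f"] by (simp_all add: push_def pushc_def)

lemma push_lan:
  assumes "f \<in> arr K"
  shows "is_lan K (unt S (src K f)) (unt S (trg K f) \<odot> f) (push K S f) (pushc K S f)"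
  using assms ext_lan(1)[of "unt S (trg K f) \<odot> f" "trg K f"] by (simp add: push_def pushc_def)

lemma push_lext: "f \<in> arr K \<Longrightarrow> lext (unt S (src K f)) (push K S f)"
  using lextI[OF push_lan] by simp

lemma push_unt: "f \<in> arr K \<Longrightarrow> push K S f \<odot> unt S (src K f) \<simeq> unt S (trg K f) \<odot> f"
  by (rule iso1_sym, rule iso1I[of "pushc K S f"]) simp_all

lemma pres_push: "f \<in> arr K \<Longrightarrow> pres (push K S f)"
  using pres_extension[OF free_cocomplete[OF trg_obj] push_lext, of f f] by simp

lemma push_unique:
  assumes l: "lext (unt S A) l" and A: "A \<in> obj K" and f: "f \<in> arr K" "src K f = A"
    and i: "l \<odot> unt S A \<simeq> unt S (trg K f) \<odot> f"
  shows "l \<simeq> push K S f"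
  using push_lext[OF f(1)] f(2) iso1_trans[OF i iso1_sym[OF push_unt[OF f(1)]]]
  by (intro lext_unique[OF l]) simp_all

lemma push_iso:
  assumes "f \<simeq> g"
  shows "push K S f \<simeq> push K S g"
proof -
  note [simp] = iso1_type[OF assms]
  have "push K S f \<odot> unt S (src K f) \<simeq> unt S (trg K f) \<odot> f" using push_unt by simp
  also have "\<dots> \<simeq> unt S (trg K f) \<odot> g" by (rule iso1_lw[OF assms]) simp_all
  finally show ?thesis by (intro push_unique[OF push_lext]) simp_all
qed

lemma push_cmp_iso:
  assumes [simp]: "f \<in> arr K" "g \<in> arr K" "trg K f = src K g"
  shows "push K S g \<odot> push K S f \<simeq> push K S (g \<odot> f)"
proof (rule push_unique)
  show "lext (unt S (src K f)) (push K S g \<odot> push K S f)"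
    by (rule presD[OF pres_push _ push_lext]) simp_all
  have "push K S g \<odot> push K S f \<odot> unt S (src K f) \<simeq> push K S g \<odot> unt S (trg K f) \<odot> f"
    by (rule iso1_lw[OF push_unt]) simp_all
  also have "push K S g \<odot> unt S (trg K f) \<odot> f \<simeq> unt S (trg K g) \<odot> g \<odot> f"
    using iso1_rw[OF push_unt[of g], of f] by simp
  finally show "(push K S g \<odot> push K S f) \<odot> unt S (src K f) \<simeq> unt S (trg K (g \<odot> f)) \<odot> g \<odot> f"
    by simp
qed simp_all

lemma push_id_iso:
  assumes [simp]: "A \<in> obj K"
  shows "push K S (id1 K A) \<simeq> id1 K (dob S A)"
  by (rule iso1_sym, rule push_unique[OF dense]) (simp_all add: iso1_refl)

text \<open>Extending along \<open>\<sigma> d\<close> means composing with \<open>r\<close> and then extending along \<open>\<sigma>\<close>, so that \<open>S\<^sub>!r\<close> is the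
  extension of \<open>\<sigma>\<close> along \<open>\<sigma> d \<cong> S\<^sub>!d \<sigma>\<close>. It is preserved by \<open>S\<^sub>!d\<close>: the first step is absolute, and the
  second is preserved by cocontinuity. Density of \<open>\<sigma>\<close> concludes.\<close>

lemma push_adjoint:
  assumes a: "adjoint K d r"
  shows "adjoint K (push K S d) (push K S r)"
proof -
  note [simp] = adjoint_type[OF a]
  obtain \<eta> \<epsilon> where e: "adjunction K d r \<eta> \<epsilon>" using a by (auto simp: adjoint_def)
  note [simp] = adjunctionD(1-10)[OF e]
  note abs = adjunction_is_lan[OF e]
  let ?X = "src K d" let ?Y = "trg K d"
  let ?l = "push K S d"
  define \<phi> where "\<phi> = (pushc K S r \<lhd> d) \<bullet> (unt S ?X \<rhd> \<eta>)"
  have N: "is_lan K (unt S ?Y \<odot> d) (unt S ?X) (push K S r) \<phi>"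
    unfolding \<phi>_def by (rule is_lan_paste[OF abs]) (use push_lan[of r] in simp_all)
  have p: "is_lan K (unt S ?Y) (?l \<odot> unt S ?X \<odot> r) (?l \<odot> push K S r) (?l \<rhd> pushc K S r)"
  proof -
    have "lext (unt S ?Y) (?l \<odot> push K S r)"
      using presD[OF pres_push, of d ?Y "push K S r"] push_lext[of r] by simp
    from lext_is_lan[OF this, of "?l \<rhd> pushc K S r"] show ?thesis by (simp add: invertible_lw)
  qed
  have "is_lan K (unt S ?Y \<odot> d) (?l \<odot> unt S ?X) (?l \<odot> push K S r) (((?l \<rhd> pushc K S r) \<lhd> d) \<bullet> ((?l \<odot> unt S ?X) \<rhd> \<eta>))"
    by (rule is_lan_paste[OF abs]) (use p in simp_all)
  then have P: "preserves_lan K ?l (unt S ?Y \<odot> d) (unt S ?X) (push K S r) \<phi>"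
    by (simp add: preserves_lan_def \<phi>_def)
  show ?thesis
    by (rule adjoint_from_dense[OF _ push_lext _ N P])
      (use dense[of ?X] iso1_sym[OF push_unt[of d]] in simp_all)
qed

text \<open>Admissibility is exactly the preservation needed to conclude from density of the unit, for one
  extension of the unit along \<open>f\<close> and therefore for all.\<close>

lemma admissible_adjoint:
  assumes f: "admissible K S f" and X: "cocomplete K S (trg K f)"
    and l: "lext (unt S (src K f)) l" "l \<odot> unt S (src K f) \<simeq> f"
    and N: "is_lan K f (unt S (src K f)) N \<phi>"
  shows "adjoint K l N"
proof -
  note [simp] = is_lan_type[OF N] lext_type[OF l(1)]
  have [simp]: "trg K l = trg K f" using iso1_type(4)[OF l(2)] by simp
  obtain N' \<phi>' where N': "is_lan K f (unt S (src K f)) N' \<phi>'"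
    and p: "\<And>X h hbar c. cocomplete K S X \<Longrightarrow> h \<in> hom K (src K f) X \<Longrightarrow> is_lan K (unt S (src K f)) h hbar c
        \<Longrightarrow> preserves_lan K hbar f (unt S (src K f)) N' \<phi>'"
    using f unfolding admissible_def by blast
  have "preserves_lan K l f (unt S (src K f)) N' \<phi>'"
    using p[OF X _ l(1)] by simp
  then have P: "preserves_lan K l f (unt S (src K f)) N \<phi>"
    by (rule preserves_lan_unique[OF N' N]) simp_all
  show ?thesis
    by (rule adjoint_from_dense[OF _ l(1) _ N P]) (use dense iso1_sym[OF l(2)] in simp_all)
qed

lemma admissible_lan:
  assumes "admissible K S f"
  obtains N \<phi> where "is_lan K f (unt S (src K f)) N \<phi>"
  using assms unfolding admissible_def by blast

end

section \<open>Gabriel--Ulmer duality on objects and 1-cells\<close>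

locale gu_context = two_category K for K :: "('o, 'm, 'c) two_cat" (structure) +
  fixes P S D :: "('o, 'm, 'c) doctrine" and \<upsilon> :: "'o \<Rightarrow> 'm"
  assumes PS: "kz_context K P S \<upsilon>" and gu: "gabriel_ulmer_envelope K P S D"
begin

sublocale P: kz K P using PS by unfold_locales (simp add: kz_context_def)
sublocale S: kz K S using PS by unfold_locales (simp add: kz_context_def)
sublocale D: kz K D using gu by unfold_locales (simp add: gabriel_ulmer_envelope_def)

lemma ff_unt:
  assumes "A \<in> obj K"
  shows "fully_faithful1 K (unt P A)" "fully_faithful1 K (unt S A)" "fully_faithful1 K (unt D A)"
  using PS gu assms by (auto simp: kz_context_def gabriel_ulmer_envelope_def)

lemma P_free_cocomplete:
  assumes "A \<in> obj K"
  shows "cocomplete K S (dob P A)" "cocomplete K D (dob P A)"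
  using PS gu assms by (auto simp: kz_context_def gabriel_ulmer_envelope_def)

lemma pres_push_P: "f \<in> arr K \<Longrightarrow> S.pres (push K P f)"
  using PS S.cocontinuous_pres by (simp add: kz_context_def)

text \<open>As \<open>PA\<close> is \<open>S\<close>-cocomplete, the 2-cell defining \<open>\<upsilon>\<close> is invertible and \<open>\<upsilon>\<close> is \<open>S\<close>-cocontinuous.\<close>

lemma ups:
  assumes A: "A \<in> obj K"
  shows "fully_faithful1 K (\<upsilon> A)" "\<exists>c. is_lan K (unt S A) (unt P A) (\<upsilon> A) c" "lext (unt S A) (\<upsilon> A)"
    "\<upsilon> A \<in> arr K" "src K (\<upsilon> A) = dob S A" "trg K (\<upsilon> A) = dob P A"
    "\<upsilon> A \<odot> unt S A \<simeq> unt P A" "S.pres (\<upsilon> A)"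
proof -
  show ff: "fully_faithful1 K (\<upsilon> A)" "\<exists>c. is_lan K (unt S A) (unt P A) (\<upsilon> A) c"
    using PS A by (simp_all add: kz_context_def)
  then obtain c where c: "is_lan K (unt S A) (unt P A) (\<upsilon> A) c" by blast
  have i: "invertible2 K c"
    by (rule S.lan_invertible[OF P_free_cocomplete(1)[OF A] c A]) (use A in simp)
  show l: "lext (unt S A) (\<upsilon> A)" by (rule lextI[OF c i])
  show "\<upsilon> A \<in> arr K" "src K (\<upsilon> A) = dob S A" "trg K (\<upsilon> A) = dob P A"
    using is_lan_type[OF c] A by simp_all
  then show "S.pres (\<upsilon> A)" using S.pres_extension[OF P_free_cocomplete(1)[OF A] l] A by simp
  show "\<upsilon> A \<odot> unt S A \<simeq> unt P A"
    by (rule iso1_sym, rule iso1I[OF i]) (use is_lan_type[OF c] in simp_all)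
qed

lemma ups_cocontinuous: "A \<in> obj K \<Longrightarrow> cocontinuous K S (\<upsilon> A)"
  using ups[of A] by (simp add: S.cocontinuous_iff S.free_cocomplete P_free_cocomplete)

lemma iota:
  assumes A: "A \<in> obj K"
  obtains \<iota> \<iota>' where "lext (unt P A) \<iota>" "\<iota> \<odot> unt P A \<simeq> unt S (dob D A) \<odot> unt D A"
    "\<iota> \<in> arr K" "src K \<iota> = dob P A" "trg K \<iota> = dob S (dob D A)"
    "\<iota>' \<in> arr K" "src K \<iota>' = dob S (dob D A)" "trg K \<iota>' = dob P A"
    "adjoint K \<iota> \<iota>'" "adjoint K \<iota>' \<iota>" "\<iota>' \<odot> \<iota> \<simeq> id1 K (dob P A)" "\<iota> \<odot> \<iota>' \<simeq> id1 K (dob S (dob D A))"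
    "fully_faithful1 K \<iota>'"
proof -
  have "\<exists>\<iota> c. is_lan K (unt P A) (unt S (dob D A) \<odot> unt D A) \<iota> c \<and> equivalence1 K \<iota>"
    and X: "cocomplete K P (dob S (dob D A))"
    using gu A unfolding gabriel_ulmer_envelope_def by blast+
  then obtain \<iota> c where c: "is_lan K (unt P A) (unt S (dob D A) \<odot> unt D A) \<iota> c" and e: "equivalence1 K \<iota>"
    by blast
  have i: "invertible2 K c"
    by (rule P.lan_invertible[OF X c A]) (use A in simp)
  have t: "\<iota> \<in> arr K" "src K \<iota> = dob P A" "trg K \<iota> = dob S (dob D A)"
    using is_lan_type[OF c] A by simp_all
  have r: "\<iota> \<odot> unt P A \<simeq> unt S (dob D A) \<odot> unt D A"
    by (rule iso1_sym, rule iso1I[OF i]) (use is_lan_type[OF c] in simp_all)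
  obtain \<iota>' where i': "adjoint K \<iota> \<iota>'" "adjoint K \<iota>' \<iota>" "\<iota>' \<odot> \<iota> \<simeq> id1 K (src K \<iota>)"
     "\<iota> \<odot> \<iota>' \<simeq> id1 K (trg K \<iota>)" "fully_faithful1 K \<iota>'"
    using equivalence_inverse[OF e] by metis
  show ?thesis using that[OF lextI[OF c i] r t, of \<iota>'] adjoint_type[OF i'(1)] i' t by simp
qed

lemma SD_P_cocomplete: "A \<in> obj K \<Longrightarrow> cocomplete K P (dob S (dob D A))"
  using gu by (simp add: gabriel_ulmer_envelope_def)

text \<open>The extension of \<open>h\<close> is \<open>P\<^sub>!h\<close> followed by the left adjoint of the unit at \<open>PC\<close>. The first factor is
  \<open>S\<close>-cocontinuous in a KZ context.\<close>

lemma pres_ext_P: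
  assumes h: "h \<in> arr K" "trg K h = dob P C" and C: "C \<in> obj K"
  shows "S.pres (ext P C h)"
proof -
  note [simp] = h C
  obtain m where m: "adjoint K m (unt P (dob P C))" "m \<odot> unt P (dob P C) \<simeq> id1 K (dob P C)"
    and [simp]: "m \<in> arr K" "src K m = dob P (dob P C)" "trg K m = dob P C"
    using P.unit_left_adjoint[OF P.free_cocomplete[OF C]] by metis
  have "m \<odot> push K P h \<simeq> ext P C h"
  proof (rule lext_unique)
    show "lext (unt P (src K h)) (m \<odot> push K P h)"
      by (rule lext_left_adjoint[OF m(1) P.push_lext]) simp_all
    show "lext (unt P (src K h)) (ext P C h)" by (rule P.ext_lext) simp_all
    have "m \<odot> push K P h \<odot> unt P (src K h) \<simeq> m \<odot> unt P (dob P C) \<odot> h"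
      using P.push_unt[of h] by (intro iso1_lw) simp_all
    also have "m \<odot> unt P (dob P C) \<odot> h \<simeq> h" using iso1_rw[OF m(2), of h] by simp
    also have "h \<simeq> ext P C h \<odot> unt P (src K h)" by (rule iso1_sym, rule P.ext_unt) simp_all
    finally show "(m \<odot> push K P h) \<odot> unt P (src K h) \<simeq> ext P C h \<odot> unt P (src K h)" by simp
  qed
  moreover have "S.pres (m \<odot> push K P h)"
    using S.pres_cmp[OF pres_push_P S.pres_left_adjoint[OF m(1)]] by simp
  ultimately show ?thesis using S.pres_iso by blast
qed

lemma petitD:
  assumes "petit K P G"
  shows "G \<in> obj K" "\<And>f. f \<in> arr K \<Longrightarrow> src K f = G \<Longrightarrow> admissible K P f"
  using assms unfolding petit_def by blast+

text \<open>Since \<open>G\<close> is petit, \<open>y f\<close> is admissible and the extension of \<open>y\<close> along it is right adjoint to \<open>P\<^sub>!f\<close>.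
  Computing that extension in two steps, first along \<open>f\<close> and then along \<open>y\<close>, exhibits it as an extension
  along the unit of \<open>P\<close> of a 1-cell into \<open>PG\<close>, whence it is \<open>S\<close>-cocontinuous.\<close>

lemma push_P_right_adjoint:
  assumes G: "petit K P G" and f: "f \<in> arr K" "src K f = G" and N: "is_lan K f (unt P G) N \<phi>"
  shows "adjoint K (push K P f) (ext P G N)" "S.pres (ext P G N)"
    "is_lan K (unt P (trg K f) \<odot> f) (unt P G) (ext P G N) ((extc P G N \<lhd> f) \<bullet> \<phi>)"
proof -
  note [simp] = petitD(1)[OF G] f
  have n [simp]: "N \<in> arr K" "src K N = trg K f" "trg K N = dob P G" using is_lan_type[OF N] by simp_all
  show l: "is_lan K (unt P (trg K f) \<odot> f) (unt P G) (ext P G N) ((extc P G N \<lhd> f) \<bullet> \<phi>)"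
    by (rule is_lan_paste[OF N]) (use P.ext_lan[of N G] in simp)
  show "S.pres (ext P G N)" by (rule pres_ext_P) simp_all
  show "adjoint K (push K P f) (ext P G N)"
    by (rule P.admissible_adjoint[of "unt P (trg K f) \<odot> f"])
      (use l petitD(2)[OF G] P.push_lext[of f] P.push_unt[of f] in \<open>simp_all add: P.free_cocomplete\<close>)
qed

text \<open>Admissibility of \<open>\<sigma>\<close> applies here, because \<open>\<upsilon>\<close> is the extension of \<open>y\<close> along \<open>\<sigma>\<close>.\<close>

lemma ups_left_adjoint:
  assumes G: "petit K P G" and X: "cocomplete K P (dob S G)"
  obtains L where "adjoint K L (\<upsilon> G)" "L \<odot> unt P G \<simeq> unt S G"
    "L \<in> arr K" "src K L = dob P G" "trg K L = dob S G"
proof -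
  note [simp] = petitD(1)[OF G]
  obtain L where L: "lext (unt P G) L" "L \<odot> unt P G \<simeq> unt S G"
    "L \<in> arr K" "src K L = dob P G" "trg K L = dob S G"
    using P.cocompleteE[OF X, of "unt S G"] by auto
  obtain c where "is_lan K (unt S G) (unt P G) (\<upsilon> G) c" using ups(2)[of G] by auto
  then have "adjoint K L (\<upsilon> G)"
    using P.admissible_adjoint[of "unt S G" L] petitD(2)[OF G, of "unt S G"] X L by simp
  then show ?thesis using that L by blast
qed

subsection \<open>The unit of \<open>S\<close> at a free \<open>D\<close>-cocomplete object preserves \<open>D\<close>-extensions\<close>

text \<open>Here \<open>e\<close> is the unit of \<open>S\<close> at \<open>DG\<close>, carried to \<open>PG\<close> along the equivalence \<open>\<iota> : PG \<rightarrow> S(DG)\<close>, and the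
  claim is that it is the left extension of \<open>y\<close> along \<open>\<delta>\<close>. Let \<open>L = P\<^sub>!\<delta>\<close> with right adjoint \<open>R\<close>, let \<open>y'\<close>
  be the unit of \<open>P\<close> at \<open>DG\<close> and \<open>w = R y'\<close>. As \<open>G\<close> is petit, \<open>w\<close> is an extension of \<open>y\<close> along \<open>\<delta>\<close>, and it
  suffices to compare \<open>e\<close> with \<open>w\<close>.

  Both \<open>L\<close> and \<open>v = \<upsilon> \<iota>\<close> restrict along \<open>y\<close> to \<open>y' \<delta>\<close>, which induces \<open>\<nu> : L \<Rightarrow> v\<close>. Since \<open>v e \<cong> y'\<close>, it gives a
  2-cell \<open>L e \<Rightarrow> y'\<close> and hence, by transposition, \<open>\<lambda> : e \<Rightarrow> w\<close>. Restricted along \<open>\<delta>\<close>, \<open>\<lambda>\<close> becomes the 2-cell that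
  exhibits \<open>w\<close> as an extension. So there is \<open>\<kappa> : w \<Rightarrow> e\<close> over the identity of \<open>y\<close>, and \<open>\<lambda> \<kappa> = id\<close> by the uniqueness
  property of \<open>w\<close>. For \<open>\<kappa> \<lambda> = id\<close>, which is a statement about 2-cells out of \<open>e\<close>, one uses that \<open>e\<close> is fully
  faithful: \<open>\<kappa> \<lambda>\<close> comes from an endomorphism of the identity on \<open>DG\<close>, which is trivial because its restriction
  along the dense \<open>\<delta>\<close> is.\<close>

lemma unt_S_D_dense:
  assumes G: "petit K P G"
  obtains \<iota> \<iota>' e where "e \<in> arr K" "src K e = dob D G" "trg K e = dob P G" "lext (unt D G) e"
    "adjoint K \<iota> \<iota>'" "src K \<iota> = dob P G" "\<iota> \<odot> e \<simeq> unt S (dob D G)"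
proof -
  let ?y = "unt P G" let ?\<delta> = "unt D G" let ?\<sigma> = "unt S (dob D G)" let ?y' = "unt P (dob D G)"
  note G0 [simp] = petitD(1)[OF G]
  obtain \<iota> \<iota>' where io: "\<iota> \<odot> ?y \<simeq> ?\<sigma> \<odot> ?\<delta>" and it [simp]: "\<iota> \<in> arr K" "src K \<iota> = dob P G" "trg K \<iota> = dob S (dob D G)"
    "\<iota>' \<in> arr K" "src K \<iota>' = dob S (dob D G)" "trg K \<iota>' = dob P G"
    and ii: "adjoint K \<iota> \<iota>'" "\<iota>' \<odot> \<iota> \<simeq> id1 K (dob P G)" "\<iota> \<odot> \<iota>' \<simeq> id1 K (dob S (dob D G))"
    "fully_faithful1 K \<iota>'"
    using iota[OF G0] by metis
  define e where "e = \<iota>' \<odot> ?\<sigma>"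
  have e [simp]: "e \<in> arr K" "src K e = dob D G" "trg K e = dob P G" by (simp_all add: e_def)
  have ffe: "fully_faithful1 K e" unfolding e_def by (rule ff_cmp) (simp_all add: ff_unt ii)
  have ie: "\<iota> \<odot> e \<simeq> ?\<sigma>" using iso1_rw[OF ii(3), of ?\<sigma>] by (simp add: e_def)
  have "?y \<simeq> \<iota>' \<odot> \<iota> \<odot> ?y" using iso1_sym[OF iso1_rw[OF ii(2), of ?y]] by simp
  also have "\<iota>' \<odot> \<iota> \<odot> ?y \<simeq> e \<odot> ?\<delta>" using iso1_lw[OF io, of \<iota>'] by (simp add: e_def)
  finally obtain \<alpha> where a: "invertible2 K \<alpha>" "\<alpha> \<in> cel K" "dom2 K \<alpha> = ?y" "cod2 K \<alpha> = e \<odot> ?\<delta>"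
    by (rule iso1E)
  note [simp] = a
  obtain N \<phi>\<^sub>1 where N: "is_lan K ?\<delta> ?y N \<phi>\<^sub>1"
    using P.admissible_lan[OF petitD(2)[OF G, of ?\<delta>]] by auto
  have n [simp]: "N \<in> arr K" "src K N = dob D G" "trg K N = dob P G"
    "\<phi>\<^sub>1 \<in> cel K" "dom2 K \<phi>\<^sub>1 = ?y" "cod2 K \<phi>\<^sub>1 = N \<odot> ?\<delta>" using is_lan_type[OF N] by simp_all
  define R where "R = ext P G N"
  define L where "L = push K P ?\<delta>"
  have L [simp]: "L \<in> arr K" "src K L = dob P G" "trg K L = dob P (dob D G)" by (simp_all add: L_def)
  have R [simp]: "R \<in> arr K" "src K R = dob P (dob D G)" "trg K R = dob P G" by (simp_all add: R_def)
  define q where "q = extc P G N"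
  have q [simp]: "q \<in> cel K" "dom2 K q = N" "cod2 K q = R \<odot> ?y'" "invertible2 K q"
    using is_lan_type[OF P.ext_lan(1)[of N G]] P.ext_lan(2)[of N G] by (simp_all add: q_def R_def)
  have "adjoint K L R" and lR: "is_lan K (?y' \<odot> ?\<delta>) ?y R ((q \<lhd> ?\<delta>) \<bullet> \<phi>\<^sub>1)"
    using push_P_right_adjoint[OF G _ _ N] by (simp_all add: R_def L_def q_def)
  then obtain u c where uc: "adjunction K L R u c" by (auto simp: adjoint_def)
  note [simp] = adjunctionD(5-10)[OF uc]
  obtain \<tau> where t: "invertible2 K \<tau>" "\<tau> \<in> cel K" "dom2 K \<tau> = \<upsilon> (dob D G) \<odot> \<iota> \<odot> e" "cod2 K \<tau> = ?y'"
  proof -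
    note [simp] = ups(4-6)[of "dob D G"]
    have "\<upsilon> (dob D G) \<odot> \<iota> \<odot> e \<simeq> \<upsilon> (dob D G) \<odot> ?\<sigma>" by (rule iso1_lw[OF ie]) simp_all
    also have "\<dots> \<simeq> ?y'" by (rule ups(7)) simp
    finally show ?thesis using that by (rule iso1E)
  qed
  define v where "v = \<upsilon> (dob D G) \<odot> \<iota>"
  have v [simp]: "v \<in> arr K" "src K v = dob P G" "trg K v = dob P (dob D G)"
    using ups(4-6)[of "dob D G"] by (simp_all add: v_def)
  have t' [simp]: "invertible2 K \<tau>" "\<tau> \<in> cel K" "dom2 K \<tau> = v \<odot> e" "cod2 K \<tau> = ?y'"
    using t ups(4-6)[of "dob D G"] by (simp_all add: v_def)
  \<comment> \<open>\<open>\<nu>\<close> is known to be invertible only after restriction along \<open>y\<close>, which is enough below.\<close>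
  obtain \<nu> where nu [simp]: "\<nu> \<in> cel K" "dom2 K \<nu> = L" "cod2 K \<nu> = v" and ni: "invertible2 K (\<nu> \<lhd> ?y)"
  proof -
    obtain \<gamma> where g [simp]: "invertible2 K \<gamma>" "\<gamma> \<in> cel K" "dom2 K \<gamma> = ?y' \<odot> ?\<delta>" "cod2 K \<gamma> = v \<odot> ?y"
    proof -
      have "?y' \<odot> ?\<delta> \<simeq> v \<odot> e \<odot> ?\<delta>" using iso1_rw[OF iso1_sym[OF iso1I[OF t'(1,3,4)]], of ?\<delta>] by simp
      also have "v \<odot> e \<odot> ?\<delta> \<simeq> v \<odot> ?y" using iso1_lw[OF iso1_sym[OF iso1I[OF a(1,3,4)]], of v] by simp
      finally show ?thesis using that by (rule iso1E)
    qed
    have pl: "is_lan K ?y (?y' \<odot> ?\<delta>) L (pushc K P ?\<delta>)" using P.push_lan[of ?\<delta>] by (simp add: L_def)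
    obtain \<nu> where nu: "\<nu> \<in> cel K" "dom2 K \<nu> = L" "cod2 K \<nu> = v" "(\<nu> \<lhd> ?y) \<bullet> pushc K P ?\<delta> = \<gamma>"
      using is_lan_ex[OF pl, of v \<gamma>] by auto
    have [simp]: "cod2 K (pushc K P ?\<delta>) = L \<odot> ?y" by (simp add: L_def)
    have "\<nu> \<lhd> ?y = \<gamma> \<bullet> inv2 K (pushc K P ?\<delta>)"
      using nu by (simp flip: nu(4))
    then have "invertible2 K (\<nu> \<lhd> ?y)" by (simp add: invertible_vcmp invertible_inv2)
    then show ?thesis using that nu by blast
  qed
  define \<mu> where "\<mu> = \<tau> \<bullet> (\<nu> \<lhd> e)"
  have mu [simp]: "\<mu> \<in> cel K" "dom2 K \<mu> = L \<odot> e" "cod2 K \<mu> = ?y'" by (simp_all add: \<mu>_def)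
  define \<psi> where "\<psi> = (\<mu> \<lhd> ?\<delta>) \<bullet> (L \<rhd> \<alpha>)"
  have psi [simp]: "\<psi> \<in> cel K" "dom2 K \<psi> = L \<odot> ?y" "cod2 K \<psi> = ?y' \<odot> ?\<delta>" by (simp_all add: \<psi>_def)
  have "\<psi> = (\<tau> \<lhd> ?\<delta>) \<bullet> (v \<rhd> \<alpha>) \<bullet> (\<nu> \<lhd> ?y)"
    using slide[of \<alpha> ?y "e \<odot> ?\<delta>" \<nu> L v] by (simp add: \<psi>_def \<mu>_def)
  then have psi_i [simp]: "invertible2 K \<psi>"
    by (auto intro!: invertible_vcmp invertible_lw invertible_rw ni)
  define w where "w = R \<odot> ?y'"
  have w [simp]: "w \<in> arr K" "src K w = dob D G" "trg K w = dob P G" by (simp_all add: w_def)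
  define la where "la = (R \<rhd> \<mu>) \<bullet> (u \<lhd> e)"
  have la [simp]: "la \<in> cel K" "dom2 K la = e" "cod2 K la = w" by (simp_all add: la_def w_def)
  define \<phi> where "\<phi> = (la \<lhd> ?\<delta>) \<bullet> \<alpha>"
  have phi [simp]: "\<phi> \<in> cel K" "dom2 K \<phi> = ?y" "cod2 K \<phi> = w \<odot> ?\<delta>" by (simp_all add: \<phi>_def)
  have phi_eq: "\<phi> = (R \<rhd> \<psi>) \<bullet> (u \<lhd> ?y)"
    using slide[of \<alpha> ?y "e \<odot> ?\<delta>" u "id1 K (dob P G)" "R \<odot> L"] by (simp add: \<phi>_def la_def \<psi>_def)
  \<comment> \<open>\<open>R\<close> is the extension of \<open>y\<close> along \<open>L y\<close>, hence along \<open>y' \<delta>\<close>, with \<open>\<phi>\<close> as its 2-cell.\<close>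
  have "is_lan K L (id1 K (dob P G)) R u" using adjunction_is_lan[OF uc, of "id1 K (dob P G)"] by simp
  from is_lan_paste[of ?y "?y" "id1 K (dob P G)" "id2 K ?y", OF _ this] P.dense[of G]
  have "is_lan K (L \<odot> ?y) ?y R (u \<lhd> ?y)" by simp
  from is_lan_along_iso[OF this, of \<psi>] have lw: "is_lan K (?y' \<odot> ?\<delta>) ?y R \<phi>" by (simp add: phi_eq)
  obtain \<theta> where th [simp]: "invertible2 K \<theta>" "\<theta> \<in> cel K" "dom2 K \<theta> = R" "cod2 K \<theta> = R"
    and the: "(\<theta> \<lhd> (?y' \<odot> ?\<delta>)) \<bullet> \<phi> = (q \<lhd> ?\<delta>) \<bullet> \<phi>\<^sub>1"
    using is_lan_iso_unique[OF lw lR] .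
  \<comment> \<open>The extension \<open>N\<close> of \<open>y\<close> along \<open>\<delta>\<close>, given by admissibility, satisfies \<open>N \<cong> R y'\<close>; the
    isomorphism is adjusted by \<open>\<theta>\<close> so that it carries one universal 2-cell to the other.\<close>
  have "is_lan K ?\<delta> ?y w \<phi>"
  proof -
    define \<Theta> where "\<Theta> = (inv2 K \<theta> \<lhd> ?y') \<bullet> q"
    have i: "invertible2 K \<Theta>" unfolding \<Theta>_def
      by (intro invertible_vcmp invertible_rw invertible_inv2) simp_all
    have c: "(inv2 K \<theta> \<lhd> ?y' \<lhd> ?\<delta>) \<bullet> (\<theta> \<lhd> ?y' \<lhd> ?\<delta>) = id2 K (R \<odot> ?y' \<odot> ?\<delta>)" by (simp flip: rw_vcmp)
    have "(\<Theta> \<lhd> ?\<delta>) \<bullet> \<phi>\<^sub>1 = (inv2 K \<theta> \<lhd> ?y' \<lhd> ?\<delta>) \<bullet> ((\<theta> \<lhd> (?y' \<odot> ?\<delta>)) \<bullet> \<phi>)"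
      unfolding the by (simp add: \<Theta>_def)
    also have "\<dots> = \<phi>" by (simp add: extend_eq1[OF c] w_def)
    finally show ?thesis using is_lan_transport[OF N i] by (simp add: \<Theta>_def w_def)
  qed
  note lw = this
  obtain ka where ka [simp]: "ka \<in> cel K" "dom2 K ka = w" "cod2 K ka = e" and kae: "(ka \<lhd> ?\<delta>) \<bullet> \<phi> = \<alpha>"
    using is_lan_ex[OF lw, of e \<alpha>] by auto
  have 1: "la \<bullet> ka = id2 K w"
    by (rule is_lan_unique[OF lw]) (simp_all add: kae, simp add: \<phi>_def)
  have 2: "ka \<bullet> la = id2 K e"
  proof -
    have kl: "(ka \<lhd> ?\<delta>) \<bullet> (la \<lhd> ?\<delta>) = id2 K (e \<odot> ?\<delta>)"
      using arg_cong[OF kae, of "\<lambda>x. x \<bullet> inv2 K \<alpha>"] by (simp add: \<phi>_def)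
    obtain \<chi> where x [simp]: "\<chi> \<in> cel K" "dom2 K \<chi> = id1 K (dob D G)" "cod2 K \<chi> = id1 K (dob D G)"
      and xe: "e \<rhd> \<chi> = ka \<bullet> la"
      using ff_full[OF ffe, of "id1 K (dob D G)" "id1 K (dob D G)" "ka \<bullet> la"] by auto
    have "e \<rhd> (\<chi> \<lhd> ?\<delta>) = e \<rhd> id2 K ?\<delta>"
      using arg_cong[OF xe, of "\<lambda>x. x \<lhd> ?\<delta>"] kl by simp
    then have "\<chi> \<lhd> ?\<delta> = id2 K ?\<delta>" by - (rule ff_faithful[OF ffe]; simp)
    then have "\<chi> = id2 K (id1 K (dob D G))"
      by - (rule is_lan_unique[OF D.dense[OF G0]]; simp)
    then show ?thesis using xe by simp
  qed
  have "invertible2 K ka" unfolding invertible2_def inverse2_iff using 1 2 by (intro exI[of _ la]) simp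
  then have "is_lan K ?\<delta> ?y e \<alpha>" using is_lan_transport[OF lw, of ka] kae by simp
  then have "lext ?\<delta> e" using lextI by simp
  then show ?thesis using that[OF e _ ii(1) it(2) ie] by simp
qed

text \<open>The extension \<open>e\<close> along \<open>\<delta>\<close> takes values in the \<open>D\<close>-cocomplete object \<open>PG\<close>, so it preserves extensions.\<close>

lemma unt_S_D_pres:
  assumes G: "petit K P G"
  shows "D.pres (unt S (dob D G))"
proof -
  note [simp] = petitD(1)[OF G]
  obtain \<iota> \<iota>' e where e: "e \<in> arr K" "src K e = dob D G" "trg K e = dob P G" "lext (unt D G) e"
    "adjoint K \<iota> \<iota>'" "src K \<iota> = dob P G" "\<iota> \<odot> e \<simeq> unt S (dob D G)"
    using unt_S_D_dense[OF G] .
  have "D.pres e" by (rule D.pres_extension[OF P_free_cocomplete(2)[of G] e(4)]) (simp_all add: e)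
  then have "D.pres (\<iota> \<odot> e)" using D.pres_cmp[OF _ D.pres_left_adjoint[OF e(5)], of e] e by simp
  then show ?thesis by (rule D.pres_iso) (rule e(7))
qed

lemma unt_S_D_lext:
  assumes G: "petit K P G"
  shows "lext (unt D G) (unt S (dob D G))"
  using D.presD[OF unt_S_D_pres[OF G] _ D.dense[of G]] petitD(1)[OF G] by simp

text \<open>The action of \<open>S\<close> turns the reflection of \<open>DG\<close> onto \<open>G\<close> into a reflection of \<open>S(DG)\<close> onto \<open>SG\<close>.\<close>

lemma D_reflector:
  assumes G: "petit K P G" and X: "cocomplete K D G"
  obtains d where "adjoint K d (unt D G)" "d \<odot> unt D G \<simeq> id1 K G" "lext (unt D G) d"
    "d \<in> arr K" "src K d = dob D G" "trg K d = G"
    "adjoint K (push K S d) (push K S (unt D G))"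
    "push K S d \<odot> push K S (unt D G) \<simeq> id1 K (dob S G)"
proof -
  note [simp] = petitD(1)[OF G]
  obtain d where d: "adjoint K d (unt D G)" "d \<odot> unt D G \<simeq> id1 K G" "lext (unt D G) d"
    "d \<in> arr K" "src K d = dob D G" "trg K d = G"
    using D.unit_left_adjoint[OF X] .
  have "push K S d \<odot> push K S (unt D G) \<simeq> push K S (d \<odot> unt D G)"
    using d by (intro S.push_cmp_iso) simp_all
  also have "\<dots> \<simeq> push K S (id1 K G)" by (rule S.push_iso[OF d(2)])
  also have "\<dots> \<simeq> id1 K (dob S G)" by (rule S.push_id_iso) simp
  finally show ?thesis using that[OF d S.push_adjoint[OF d(1)]] by blast
qed

text \<open>An extension along \<open>\<delta>\<close> into \<open>G\<close> is \<open>D\<^sub>!g\<close> followed by the reflector \<open>d : DG \<rightarrow> G\<close>, and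
  \<open>\<sigma> d \<cong> S\<^sub>!d \<sigma>\<close> preserves such extensions: the unit at \<open>DG\<close> does, and \<open>S\<^sub>!d\<close> is a left adjoint.\<close>

lemma unt_S_pres:
  assumes G: "petit K P G" and X: "cocomplete K D G"
  shows "D.pres (unt S G)"
proof (rule D.presI)
  note [simp] = petitD(1)[OF G]
  show "unt S G \<in> arr K" by simp
  fix B l assume B: "B \<in> obj K" and l: "lext (unt D B) l" and t: "trg K l = src K (unt S G)"
  obtain d where d: "adjoint K d (unt D G)" "d \<odot> unt D G \<simeq> id1 K G" "lext (unt D G) d"
    "d \<in> arr K" "src K d = dob D G" "trg K d = G"
    "adjoint K (push K S d) (push K S (unt D G))"
    using D_reflector[OF G X] .
  note [simp] = d(4-6) B lext_type[OF l] t
  let ?g = "l \<odot> unt D B"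
  have "push K S d \<odot> unt S (dob D G) \<simeq> unt S G \<odot> d" using S.push_unt[of d] by simp
  moreover have "D.pres (push K S d \<odot> unt S (dob D G))"
    by (rule D.pres_cmp[OF unt_S_D_pres[OF G] D.pres_left_adjoint[OF d(7)]]) simp
  ultimately have "D.pres (unt S G \<odot> d)" using D.pres_iso by blast
  then have 1: "lext (unt D B) ((unt S G \<odot> d) \<odot> push K D ?g)"
    using D.push_lext[of ?g] by (intro D.presD) simp_all
  have "d \<odot> push K D ?g \<simeq> l"
  proof (rule lext_unique[OF _ l])
    show "lext (unt D B) (d \<odot> push K D ?g)"
      using D.push_lext[of ?g] by (intro lext_left_adjoint[OF d(1)]) simp_all
    have "d \<odot> push K D ?g \<odot> unt D B \<simeq> d \<odot> unt D G \<odot> ?g"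
      using D.push_unt[of ?g] by (intro iso1_lw) simp_all
    also have "d \<odot> unt D G \<odot> ?g \<simeq> ?g" using iso1_rw[OF d(2), of ?g] by simp
    finally show "(d \<odot> push K D ?g) \<odot> unt D B \<simeq> ?g" by simp
  qed
  then have 2: "unt S G \<odot> d \<odot> push K D ?g \<simeq> unt S G \<odot> l" by (intro iso1_lw) simp_all
  show "lext (unt D B) (unt S G \<odot> l)"
    by (rule lext_iso[OF _ 2]) (use 1 in simp)
qed

subsection \<open>Objects\<close>

lemma S_free_P_cocomplete:
  assumes G: "petit K P G" and X: "cocomplete K D G"
  shows "cocomplete K P (dob S G)"
proof -
  note [simp] = petitD(1)[OF G]
  obtain d where [simp]: "d \<in> arr K" "src K d = dob D G" "trg K d = G" and
    d: "adjoint K (push K S d) (push K S (unt D G))"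
    "push K S d \<odot> push K S (unt D G) \<simeq> id1 K (dob S G)"
    using D_reflector[OF G X] .
  show ?thesis
    using P.cocomplete_reflective[OF SD_P_cocomplete[of G] d(1) _ _ _ _ _, of "push K S (unt D G)"] d(2) by simp
qed

lemma equivalent0_refl: "A \<in> obj K \<Longrightarrow> equivalent0 K A A"
  unfolding equivalent0_def equivalence1_def
  by (rule bexI[of _ "id1 K A"]) (auto intro!: bexI[of _ "id1 K A"] iso1_refl)

lemma presentable_S_free:
  assumes G: "petit K P G" and X: "cocomplete K D G"
  shows "presentable K P S (dob S G)"
proof -
  note [simp] = petitD(1)[OF G]
  obtain L where L: "adjoint K L (\<upsilon> G)" "L \<in> arr K" "src K L = dob P G" "trg K L = dob S G"
    using ups_left_adjoint[OF G S_free_P_cocomplete[OF G X]] .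
  have "accessible K P S (dob S G)"
    unfolding accessible_def using G equivalent0_refl by auto
  moreover have "L \<in> hom K (dob P G) (dob S G)" "\<upsilon> G \<in> hom K (dob S G) (dob P G)"
    using L ups[of G] by simp_all
  ultimately show ?thesis
    unfolding presentable_def using G L(1) ups(1)[OF petitD(1)[OF G]] ups_cocontinuous[OF petitD(1)[OF G]] by blast
qed

text \<open>As a reflection of a free object, \<open>SG\<close> is \<open>P\<close>-cocomplete, so \<open>\<upsilon>\<close> has a left adjoint. Along
  \<open>PG \<simeq> S(DG)\<close> this becomes a left adjoint \<open>S(DG) \<rightarrow> SG\<close> of \<open>S\<^sub>!\<delta>\<close>, which is \<open>S\<^sub>!d\<close> for some \<open>d\<close> by Cauchy
  completeness. Restricting the adjunction along the units of \<open>S\<close> gives \<open>d \<stileturn> \<delta>\<close>, and \<open>G\<close> is a reflection of \<open>DG\<close>.\<close>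

lemma D_cocomplete_if_presentable:
  assumes G: "petit K P G" and C: "cauchy_complete K S G" and X: "presentable K P S (dob S G)"
  shows "cocomplete K D G"
proof -
  note [simp] = petitD(1)[OF G]
  obtain H L i where H: "petit K P H" "adjoint K L i" "fully_faithful1 K i"
    and t [simp]: "L \<in> arr K" "src K L = dob P H" "trg K L = dob S G" "i \<in> arr K" "src K i = dob S G" "trg K i = dob P H"
    using X unfolding presentable_def by auto
  obtain \<eta> \<epsilon> where a: "adjunction K L i \<eta> \<epsilon>" using H(2) by (auto simp: adjoint_def)
  have "L \<odot> i \<simeq> id1 K (dob S G)"
    using iso1I[OF counit_iso_if_ff[OF a H(3)]] adjunctionD[OF a] by simp
  then have PC: "cocomplete K P (dob S G)"
    using P.cocomplete_reflective[OF P.free_cocomplete[OF petitD(1)[OF H(1)]] H(2), of i] by simp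
  obtain LG where LG: "adjoint K LG (\<upsilon> G)" and [simp]: "LG \<in> arr K" "src K LG = dob P G" "trg K LG = dob S G"
    using ups_left_adjoint[OF G PC] by metis
  obtain \<iota> \<iota>' where io: "\<iota> \<odot> unt P G \<simeq> unt S (dob D G) \<odot> unt D G"
    and it [simp]: "\<iota> \<in> arr K" "src K \<iota> = dob P G" "trg K \<iota> = dob S (dob D G)"
    "\<iota>' \<in> arr K" "src K \<iota>' = dob S (dob D G)" "trg K \<iota>' = dob P G"
    and ii: "adjoint K \<iota> \<iota>'" "adjoint K \<iota>' \<iota>"
    using iota[OF petitD(1)[OF G]] by metis
  note U [simp] = ups(4-6)[of G, simplified]
  have adj: "adjoint K (LG \<odot> \<iota>') (\<iota> \<odot> \<upsilon> G)" by (rule adjoint_cmp[OF ii(2) LG]) simp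
  have pu: "S.pres (\<iota> \<odot> \<upsilon> G)" by (rule S.pres_cmp[OF ups(8) S.pres_left_adjoint[OF ii(1)]]) simp_all
  then have "cocontinuous K S (\<iota> \<odot> \<upsilon> G)" by (simp add: S.cocontinuous_iff S.free_cocomplete)
  moreover have "LG \<odot> \<iota>' \<in> hom K (dob S (dob D G)) (dob S G)" "\<iota> \<odot> \<upsilon> G \<in> hom K (dob S G) (dob S (dob D G))"
    by simp_all
  ultimately obtain d where dh: "d \<in> hom K (dob D G) G" and di: "LG \<odot> \<iota>' \<simeq> push K S d"
    using C adj D.dob_obj[of G] unfolding cauchy_complete_def by (metis (no_types) \<open>G \<in> obj K\<close>)
  then have d [simp]: "d \<in> arr K" "src K d = dob D G" "trg K d = G" by simp_all
  have "\<iota> \<odot> \<upsilon> G \<simeq> push K S (unt D G)"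
  proof (rule S.push_unique)
    show "lext (unt S G) (\<iota> \<odot> \<upsilon> G)" using lext_left_adjoint[OF ii(1) ups(3)[OF petitD(1)[OF G]]] by simp
    have "\<iota> \<odot> \<upsilon> G \<odot> unt S G \<simeq> \<iota> \<odot> unt P G" by (rule iso1_lw[OF ups(7)]) simp_all
    also note io
    finally show "(\<iota> \<odot> \<upsilon> G) \<odot> unt S G \<simeq> unt S (trg K (unt D G)) \<odot> unt D G" by simp
  qed simp_all
  then have ad: "adjoint K (push K S d) (push K S (unt D G))"
    using adjoint_iso_left[OF adjoint_iso_right[OF adj] di] by blast
  have dd: "adjoint K d (unt D G)"
    by (rule adjoint_restrict[OF ad ff_unt(2)[of "dob D G"] ff_unt(2)[of G]])
      (use iso1_sym[OF S.push_unt[of d]] iso1_sym[OF S.push_unt[of "unt D G"]] in simp_all)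
  then obtain \<eta>' \<epsilon>' where a': "adjunction K d (unt D G) \<eta>' \<epsilon>'" by (auto simp: adjoint_def)
  have "d \<odot> unt D G \<simeq> id1 K G"
    using iso1I[OF counit_iso_if_ff[OF a' ff_unt(3)]] adjunctionD[OF a'] by simp
  then show ?thesis
    using D.cocomplete_reflective[OF D.free_cocomplete dd, of G "unt D G"] by simp
qed

subsection \<open>1-cells\<close>

text \<open>Let \<open>L\<close>, \<open>L'\<close> be the left adjoints of \<open>\<upsilon>\<close> at \<open>G\<close>, \<open>G'\<close> and \<open>R\<close> the \<open>S\<close>-cocontinuous right adjoint of \<open>P\<^sub>!f\<close>.
  Once \<open>S\<^sub>!f L \<cong> L' P\<^sub>!f\<close> is known, \<open>S\<^sub>!f L\<close> is left adjoint to \<open>R \<upsilon>\<close>, and \<open>S\<^sub>!f\<close> itself to \<open>L R \<upsilon>\<close> because \<open>L\<close>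
  is a reflector. The isomorphism is tested in stages: transported to \<open>S(DG) \<simeq> PG\<close>, both sides are extensions
  along \<open>\<sigma>\<close>; restricted to \<open>DG\<close> they are extensions along \<open>\<delta>\<close>, where \<open>D\<close>-cocontinuity of \<open>f\<close> enters; and on \<open>G\<close>
  both are \<open>\<sigma> f\<close>.\<close>

lemma push_S_right_adjoint:
  assumes G: "petit K P G" "cocomplete K D G" and G': "petit K P G'" "cocomplete K D G'"
    and f: "f \<in> arr K" "src K f = G" "trg K f = G'" and p: "D.pres f"
  obtains R where "adjoint K (push K S f) R" "S.pres R"
proof -
  note [simp] = petitD(1)[OF G(1)] petitD(1)[OF G'(1)] f
  obtain d where d: "adjoint K d (unt D G)" "d \<odot> unt D G \<simeq> id1 K G" "lext (unt D G) d"
    and dt [simp]: "d \<in> arr K" "src K d = dob D G" "trg K d = G"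
    using D_reflector[OF G] by metis
  obtain L where L: "adjoint K L (\<upsilon> G)" "L \<odot> unt P G \<simeq> unt S G"
    and Lt [simp]: "L \<in> arr K" "src K L = dob P G" "trg K L = dob S G"
    using ups_left_adjoint[OF G(1) S_free_P_cocomplete[OF G]] .
  obtain L' where L': "adjoint K L' (\<upsilon> G')" "L' \<odot> unt P G' \<simeq> unt S G'"
    and Lt' [simp]: "L' \<in> arr K" "src K L' = dob P G'" "trg K L' = dob S G'"
    using ups_left_adjoint[OF G'(1) S_free_P_cocomplete[OF G']] .
  obtain N \<phi> where N: "is_lan K f (unt P G) N \<phi>"
    using P.admissible_lan[OF petitD(2)[OF G(1) f(1,2)]] f(2) by metis
  define R where "R = ext P G N"
  have R: "adjoint K (push K P f) R" "S.pres R"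
    using push_P_right_adjoint[OF G(1) f(1,2) N] by (simp_all add: R_def)
  have [simp]: "R \<in> arr K" "src K R = dob P G'" "trg K R = dob P G" using adjoint_type[OF R(1)] by simp_all
  obtain \<iota> \<iota>' where io: "\<iota> \<odot> unt P G \<simeq> unt S (dob D G) \<odot> unt D G"
    and it [simp]: "\<iota> \<in> arr K" "src K \<iota> = dob P G" "trg K \<iota> = dob S (dob D G)"
    "\<iota>' \<in> arr K" "src K \<iota>' = dob S (dob D G)" "trg K \<iota>' = dob P G"
    and ii: "adjoint K \<iota> \<iota>'" "adjoint K \<iota>' \<iota>" "\<iota>' \<odot> \<iota> \<simeq> id1 K (dob P G)"
    using iota[OF petitD(1)[OF G(1)]] by metis
  let ?\<sigma> = "unt S (dob D G)" let ?\<delta> = "unt D G"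
  define e where "e = \<iota>' \<odot> ?\<sigma>"
  have e [simp]: "e \<in> arr K" "src K e = dob D G" "trg K e = dob P G" by (simp_all add: e_def)
  have le: "lext ?\<delta> e" unfolding e_def by (rule lext_left_adjoint[OF ii(2) unt_S_D_lext[OF G(1)]]) simp
  have "e \<odot> ?\<delta> \<simeq> \<iota>' \<odot> \<iota> \<odot> unt P G" using iso1_lw[OF iso1_sym[OF io], of \<iota>'] by (simp add: e_def)
  also have "\<iota>' \<odot> \<iota> \<odot> unt P G \<simeq> unt P G" using iso1_rw[OF ii(3), of "unt P G"] by simp
  finally have ed: "e \<odot> ?\<delta> \<simeq> unt P G" .
  have Le: "L \<odot> e \<simeq> unt S G \<odot> d"
  proof (rule lext_unique)
    show "lext ?\<delta> (L \<odot> e)" by (rule lext_left_adjoint[OF L(1) le]) simp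
    show "lext ?\<delta> (unt S G \<odot> d)" by (rule D.presD[OF unt_S_pres[OF G] _ d(3)]) simp_all
    have "L \<odot> e \<odot> ?\<delta> \<simeq> L \<odot> unt P G" by (rule iso1_lw[OF ed]) simp_all
    also have "\<dots> \<simeq> unt S G" by (rule L(2))
    also have "unt S G \<simeq> unt S G \<odot> d \<odot> ?\<delta>" using iso1_lw[OF iso1_sym[OF d(2)], of "unt S G"] by simp
    finally show "(L \<odot> e) \<odot> ?\<delta> \<simeq> (unt S G \<odot> d) \<odot> ?\<delta>" by simp
  qed
  let ?T1 = "push K S f \<odot> L" let ?T2 = "L' \<odot> push K P f"
  have aT2: "adjoint K ?T2 (R \<odot> \<upsilon> G')" by (rule adjoint_cmp[OF R(1) L'(1)]) simp
  have Te: "?T1 \<odot> e \<simeq> ?T2 \<odot> e"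
  proof -
    have "push K S f \<odot> L \<odot> e \<simeq> push K S f \<odot> unt S G \<odot> d" by (rule iso1_lw[OF Le]) simp_all
    also have "push K S f \<odot> unt S G \<odot> d \<simeq> unt S G' \<odot> f \<odot> d" using iso1_rw[OF S.push_unt[of f], of d] by simp
    also have "unt S G' \<odot> f \<odot> d \<simeq> ?T2 \<odot> e"
    proof (rule lext_unique)
      have "lext ?\<delta> (f \<odot> d)" by (rule D.presD[OF p _ d(3)]) simp_all
      then show "lext ?\<delta> (unt S G' \<odot> f \<odot> d)" by (intro D.presD[OF unt_S_pres[OF G']]) simp_all
      show "lext ?\<delta> (?T2 \<odot> e)" by (rule lext_left_adjoint[OF aT2 le]) simp
      have "unt S G' \<odot> f \<odot> d \<odot> ?\<delta> \<simeq> unt S G' \<odot> f" using iso1_lw[OF d(2), of "unt S G' \<odot> f"] by simp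
      also have "unt S G' \<odot> f \<simeq> L' \<odot> unt P G' \<odot> f" using iso1_rw[OF iso1_sym[OF L'(2)], of f] by simp
      also have "L' \<odot> unt P G' \<odot> f \<simeq> L' \<odot> push K P f \<odot> unt P G"
        using iso1_lw[OF iso1_sym[OF P.push_unt[of f]], of L'] by simp
      also have "L' \<odot> push K P f \<odot> unt P G \<simeq> L' \<odot> push K P f \<odot> e \<odot> ?\<delta>"
        using iso1_lw[OF iso1_sym[OF ed], of "L' \<odot> push K P f"] by simp
      finally show "(unt S G' \<odot> f \<odot> d) \<odot> ?\<delta> \<simeq> (?T2 \<odot> e) \<odot> ?\<delta>" by simp
    qed
    finally show ?thesis by simp
  qed
  have "?T1 \<odot> \<iota>' \<simeq> ?T2 \<odot> \<iota>'"
  proof (rule lext_unique)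
    have l: "lext ?\<sigma> \<iota>'" using lext_left_adjoint[OF ii(2) S.dense[of "dob D G"]] by simp
    have "lext ?\<sigma> (L \<odot> \<iota>')" by (rule lext_left_adjoint[OF L(1) l]) simp
    then have "lext ?\<sigma> (push K S f \<odot> L \<odot> \<iota>')" by (intro S.presD[OF S.pres_push]) simp_all
    then show "lext ?\<sigma> (?T1 \<odot> \<iota>')" by simp
    show "lext ?\<sigma> (?T2 \<odot> \<iota>')" by (rule lext_left_adjoint[OF aT2 l]) simp
    show "(?T1 \<odot> \<iota>') \<odot> ?\<sigma> \<simeq> (?T2 \<odot> \<iota>') \<odot> ?\<sigma>" using Te by (simp add: e_def)
  qed
  from iso1_rw[OF this, of \<iota>] have "?T1 \<odot> \<iota>' \<odot> \<iota> \<simeq> ?T2 \<odot> \<iota>' \<odot> \<iota>" by simp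
  moreover have "?T1 \<odot> \<iota>' \<odot> \<iota> \<simeq> ?T1" using iso1_lw[OF ii(3), of ?T1] by simp
  moreover have "?T2 \<odot> \<iota>' \<odot> \<iota> \<simeq> ?T2" using iso1_lw[OF ii(3), of ?T2] by simp
  ultimately have "?T2 \<simeq> ?T1" using iso1_sym iso1_trans by metis
  then have aT1: "adjoint K ?T1 (R \<odot> \<upsilon> G')" by (rule adjoint_iso_left[OF aT2])
  obtain \<eta> \<epsilon> where a: "adjunction K L (\<upsilon> G) \<eta> \<epsilon>" using L(1) by (auto simp: adjoint_def)
  have "adjoint K (push K S f) (L \<odot> R \<odot> \<upsilon> G')"
    by (rule adjoint_along_reflection[OF a counit_iso_if_ff[OF a] aT1]) (simp_all add: ups)
  moreover have "S.pres (L \<odot> R \<odot> \<upsilon> G')"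
    using S.pres_cmp[OF S.pres_cmp[OF ups(8) R(2)] S.pres_left_adjoint[OF L(1)]] ups(4-6)[of G'] by simp
  ultimately show ?thesis using that by blast
qed

text \<open>The fully faithful \<open>\<sigma> : G' \<rightarrow> SG'\<close> reflects extensions, and \<open>\<sigma> u \<cong> S\<^sub>!u \<sigma>\<close> preserves them because \<open>S\<^sub>!u\<close> is
  a left adjoint.\<close>

lemma pres_if_push_left_adjoint:
  assumes G: "petit K P G" "cocomplete K D G" and G': "G' \<in> obj K"
    and u: "u \<in> arr K" "src K u = G" "trg K u = G'" and a: "adjoint K (push K S u) R"
  shows "D.pres u"
proof (rule D.ff_reflects_pres[OF ff_unt(2)[OF G']])
  note [simp] = petitD(1)[OF G(1)] u G'
  have "D.pres (push K S u \<odot> unt S G)"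
    by (rule D.pres_cmp[OF unt_S_pres[OF G] D.pres_left_adjoint[OF a]]) simp
  then show "D.pres (unt S G' \<odot> u)" by (rule D.pres_iso) (use S.push_unt[of u] in simp)
qed (use u G' in simp_all)

end

section \<open>Biequivalences from spans of surjective strict biequivalences\<close>

subsection \<open>Composition of pseudofunctors\<close>

context
  fixes A :: "('o, 'm, 'c) two_cat" and B :: "('p, 'n, 'd) two_cat" and F :: "('o, 'm, 'c, 'p, 'n, 'd) psfun"
  assumes F: "pseudofunctor A B F"
begin

lemma psf_cats: "two_category A" "two_category B"
  using F unfolding pseudofunctor_def by blast+

lemma psf_on:
  "a \<in> obj A \<Longrightarrow> on0 F a \<in> obj B"
  "f \<in> arr A \<Longrightarrow> on1 F f \<in> arr B"
  "f \<in> arr A \<Longrightarrow> src B (on1 F f) = on0 F (src A f)"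
  "f \<in> arr A \<Longrightarrow> trg B (on1 F f) = on0 F (trg A f)"
  "\<alpha> \<in> cel A \<Longrightarrow> on2 F \<alpha> \<in> cel B"
  "\<alpha> \<in> cel A \<Longrightarrow> dom2 B (on2 F \<alpha>) = on1 F (dom2 A \<alpha>)"
  "\<alpha> \<in> cel A \<Longrightarrow> cod2 B (on2 F \<alpha>) = on1 F (cod2 A \<alpha>)"
  using F unfolding pseudofunctor_def in_hom in_cells by blast+

lemma psf_functor:
  "f \<in> arr A \<Longrightarrow> on2 F (id2 A f) = id2 B (on1 F f)"
  "\<alpha> \<in> cel A \<Longrightarrow> \<beta> \<in> cel A \<Longrightarrow> cod2 A \<alpha> = dom2 A \<beta> \<Longrightarrow> on2 F (\<beta> \<bullet>\<^bsub>A\<^esub> \<alpha>) = on2 F \<beta> \<bullet>\<^bsub>B\<^esub> on2 F \<alpha>"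
  using F unfolding pseudofunctor_def by blast+

lemma psf_mu:
  assumes "f \<in> arr A" "g \<in> arr A" "trg A f = src A g"
  shows "mu F g f \<in> cel B" "dom2 B (mu F g f) = on1 F g \<odot>\<^bsub>B\<^esub> on1 F f"
    "cod2 B (mu F g f) = on1 F (g \<odot>\<^bsub>A\<^esub> f)" "invertible2 B (mu F g f)"
  using F assms unfolding pseudofunctor_def in_cells by blast+

lemma psf_nu:
  assumes "a \<in> obj A"
  shows "nu F a \<in> cel B" "dom2 B (nu F a) = id1 B (on0 F a)"
    "cod2 B (nu F a) = on1 F (id1 A a)" "invertible2 B (nu F a)"
  using F assms unfolding pseudofunctor_def in_cells by blast+

lemma psf_mu_natural:
  "\<alpha> \<in> cel A \<Longrightarrow> \<beta> \<in> cel A \<Longrightarrow> trg A (dom2 A \<alpha>) = src A (dom2 A \<beta>)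
    \<Longrightarrow> mu F (cod2 A \<beta>) (cod2 A \<alpha>) \<bullet>\<^bsub>B\<^esub> (on2 F \<beta> \<star>\<^bsub>B\<^esub> on2 F \<alpha>)
          = on2 F (\<beta> \<star>\<^bsub>A\<^esub> \<alpha>) \<bullet>\<^bsub>B\<^esub> mu F (dom2 A \<beta>) (dom2 A \<alpha>)"
  using F unfolding pseudofunctor_def by blast

lemma psf_mu_assoc:
  "f \<in> arr A \<Longrightarrow> g \<in> arr A \<Longrightarrow> h \<in> arr A \<Longrightarrow> trg A f = src A g \<Longrightarrow> trg A g = src A h
    \<Longrightarrow> mu F h (g \<odot>\<^bsub>A\<^esub> f) \<bullet>\<^bsub>B\<^esub> (on1 F h \<rhd>\<^bsub>B\<^esub> mu F g f)
          = mu F (h \<odot>\<^bsub>A\<^esub> g) f \<bullet>\<^bsub>B\<^esub> (mu F h g \<lhd>\<^bsub>B\<^esub> on1 F f)"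
  using F unfolding pseudofunctor_def by blast

lemma psf_unit:
  "f \<in> arr A \<Longrightarrow> mu F (id1 A (trg A f)) f \<bullet>\<^bsub>B\<^esub> (nu F (trg A f) \<lhd>\<^bsub>B\<^esub> on1 F f) = id2 B (on1 F f)"
  "f \<in> arr A \<Longrightarrow> mu F f (id1 A (src A f)) \<bullet>\<^bsub>B\<^esub> (on1 F f \<rhd>\<^bsub>B\<^esub> nu F (src A f)) = id2 B (on1 F f)"
  using F unfolding pseudofunctor_def by blast+

lemma psf_mu_lw:
  assumes "\<alpha> \<in> cel A" "h \<in> arr A" "trg A (dom2 A \<alpha>) = src A h"
  shows "mu F h (cod2 A \<alpha>) \<bullet>\<^bsub>B\<^esub> (on1 F h \<rhd>\<^bsub>B\<^esub> on2 F \<alpha>) = on2 F (h \<rhd>\<^bsub>A\<^esub> \<alpha>) \<bullet>\<^bsub>B\<^esub> mu F h (dom2 A \<alpha>)"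
proof -
  interpret A: two_category A by (rule psf_cats)
  show ?thesis using psf_mu_natural[of \<alpha> "id2 A h"] assms by (simp add: lw_def psf_functor)
qed

lemma psf_mu_rw:
  assumes "\<alpha> \<in> cel A" "h \<in> arr A" "trg A h = src A (dom2 A \<alpha>)"
  shows "mu F (cod2 A \<alpha>) h \<bullet>\<^bsub>B\<^esub> (on2 F \<alpha> \<lhd>\<^bsub>B\<^esub> on1 F h) = on2 F (\<alpha> \<lhd>\<^bsub>A\<^esub> h) \<bullet>\<^bsub>B\<^esub> mu F (dom2 A \<alpha>) h"
proof -
  interpret A: two_category A by (rule psf_cats)
  show ?thesis using psf_mu_natural[of "id2 A h" \<alpha>] assms by (simp add: rw_def psf_functor)
qed

lemma psf_invertible:
  assumes "invertible2 A \<alpha>"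
  shows "invertible2 B (on2 F \<alpha>)"
proof -
  interpret A: two_category A by (rule psf_cats)
  interpret B: two_category B by (rule psf_cats)
  note [simp] = psf_on psf_functor(1) A.invertible_cel[OF assms] assms
  show ?thesis
    unfolding invertible2_def[of B] B.inverse2_iff
    by (intro exI[of _ "on2 F (inv2 A \<alpha>)"]) (simp flip: psf_functor(2))
qed

end

lemma pseudofunctor_id:
  assumes "two_category A"
  shows "pseudofunctor A A (ps_id A)"
proof -
  interpret A: two_category A by fact
  show ?thesis unfolding pseudofunctor_def
    by (intro conjI ballI impI) (simp_all add: ps_id_def A.invertible_id2 assms)
qed

lemma pseudofunctor_comp:
  assumes F: "pseudofunctor A B F" and G: "pseudofunctor B C G"
  shows "pseudofunctor A C (ps_comp C G F)"
proof -
  interpret A: two_category A by (rule psf_cats[OF F])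
  interpret B: two_category B by (rule psf_cats[OF F])
  interpret C: two_category C by (rule psf_cats[OF G])
  note [simp] = psf_on[OF F] psf_on[OF G] psf_functor[OF F] psf_functor[OF G] psf_mu[OF F] psf_mu[OF G]
    psf_nu[OF F] psf_nu[OF G]
  show ?thesis unfolding pseudofunctor_def
  proof (intro conjI ballI impI)
    show "two_category A" "two_category C" using F G psf_cats by blast+
    fix \<alpha> \<beta> assume [simp]: "\<alpha> \<in> cel A" "\<beta> \<in> cel A" "trg A (dom2 A \<alpha>) = src A (dom2 A \<beta>)"
    have 1: "mu G (on1 F (cod2 A \<beta>)) (on1 F (cod2 A \<alpha>)) \<bullet>\<^bsub>C\<^esub> (on2 G (on2 F \<beta>) \<star>\<^bsub>C\<^esub> on2 G (on2 F \<alpha>)) =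
       on2 G (on2 F \<beta> \<star>\<^bsub>B\<^esub> on2 F \<alpha>) \<bullet>\<^bsub>C\<^esub> mu G (on1 F (dom2 A \<beta>)) (on1 F (dom2 A \<alpha>))"
      using psf_mu_natural[OF G, of "on2 F \<alpha>" "on2 F \<beta>"] by simp
    have 2: "on2 G (mu F (cod2 A \<beta>) (cod2 A \<alpha>)) \<bullet>\<^bsub>C\<^esub> on2 G (on2 F \<beta> \<star>\<^bsub>B\<^esub> on2 F \<alpha>) =
       on2 G (on2 F (\<beta> \<star>\<^bsub>A\<^esub> \<alpha>)) \<bullet>\<^bsub>C\<^esub> on2 G (mu F (dom2 A \<beta>) (dom2 A \<alpha>))"
      using arg_cong[OF psf_mu_natural[OF F, of \<alpha> \<beta>], of "on2 G"] by simp
    show "mu (ps_comp C G F) (cod2 A \<beta>) (cod2 A \<alpha>) \<bullet>\<^bsub>C\<^esub> (on2 (ps_comp C G F) \<beta> \<star>\<^bsub>C\<^esub> on2 (ps_comp C G F) \<alpha>)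
      = on2 (ps_comp C G F) (\<beta> \<star>\<^bsub>A\<^esub> \<alpha>) \<bullet>\<^bsub>C\<^esub> mu (ps_comp C G F) (dom2 A \<beta>) (dom2 A \<alpha>)"
      by (simp add: ps_comp_def 1 C.extend_eq[OF 2])
  next
    fix f g h assume [simp]: "f \<in> arr A" "g \<in> arr A" "h \<in> arr A" "trg A f = src A g" "trg A g = src A h"
    have 1: "mu G (on1 F h) (on1 F (g \<odot>\<^bsub>A\<^esub> f)) \<bullet>\<^bsub>C\<^esub> (on1 G (on1 F h) \<rhd>\<^bsub>C\<^esub> on2 G (mu F g f)) =
       on2 G (on1 F h \<rhd>\<^bsub>B\<^esub> mu F g f) \<bullet>\<^bsub>C\<^esub> mu G (on1 F h) (on1 F g \<odot>\<^bsub>B\<^esub> on1 F f)"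
      using psf_mu_lw[OF G, of "mu F g f" "on1 F h"] by simp
    have 2: "mu G (on1 F (h \<odot>\<^bsub>A\<^esub> g)) (on1 F f) \<bullet>\<^bsub>C\<^esub> (on2 G (mu F h g) \<lhd>\<^bsub>C\<^esub> on1 G (on1 F f)) =
       on2 G (mu F h g \<lhd>\<^bsub>B\<^esub> on1 F f) \<bullet>\<^bsub>C\<^esub> mu G (on1 F h \<odot>\<^bsub>B\<^esub> on1 F g) (on1 F f)"
      using psf_mu_rw[OF G, of "mu F h g" "on1 F f"] by simp
    have 3: "on2 G (mu F h (g \<odot>\<^bsub>A\<^esub> f)) \<bullet>\<^bsub>C\<^esub> on2 G (on1 F h \<rhd>\<^bsub>B\<^esub> mu F g f) =
       on2 G (mu F (h \<odot>\<^bsub>A\<^esub> g) f) \<bullet>\<^bsub>C\<^esub> on2 G (mu F h g \<lhd>\<^bsub>B\<^esub> on1 F f)"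
      using arg_cong[OF psf_mu_assoc[OF F, of f g h], of "on2 G"] by simp
    have 4: "mu G (on1 F h) (on1 F g \<odot>\<^bsub>B\<^esub> on1 F f) \<bullet>\<^bsub>C\<^esub> (on1 G (on1 F h) \<rhd>\<^bsub>C\<^esub> mu G (on1 F g) (on1 F f)) =
       mu G (on1 F h \<odot>\<^bsub>B\<^esub> on1 F g) (on1 F f) \<bullet>\<^bsub>C\<^esub> (mu G (on1 F h) (on1 F g) \<lhd>\<^bsub>C\<^esub> on1 G (on1 F f))"
      using psf_mu_assoc[OF G, of "on1 F f" "on1 F g" "on1 F h"] by simp
    show "mu (ps_comp C G F) h (g \<odot>\<^bsub>A\<^esub> f) \<bullet>\<^bsub>C\<^esub> (on1 (ps_comp C G F) h \<rhd>\<^bsub>C\<^esub> mu (ps_comp C G F) g f)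
       = mu (ps_comp C G F) (h \<odot>\<^bsub>A\<^esub> g) f \<bullet>\<^bsub>C\<^esub> (mu (ps_comp C G F) h g \<lhd>\<^bsub>C\<^esub> on1 (ps_comp C G F) f)"
      by (simp add: ps_comp_def C.extend_eq[OF 1] C.extend_eq[OF 2] C.extend_eq[OF 3] 4)
  next
    fix f assume [simp]: "f \<in> arr A"
    have 1: "mu G (on1 F (id1 A (trg A f))) (on1 F f) \<bullet>\<^bsub>C\<^esub> (on2 G (nu F (trg A f)) \<lhd>\<^bsub>C\<^esub> on1 G (on1 F f)) =
       on2 G (nu F (trg A f) \<lhd>\<^bsub>B\<^esub> on1 F f) \<bullet>\<^bsub>C\<^esub> mu G (id1 B (on0 F (trg A f))) (on1 F f)"
      using psf_mu_rw[OF G, of "nu F (trg A f)" "on1 F f"] by simp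
    have 2: "on2 G (mu F (id1 A (trg A f)) f) \<bullet>\<^bsub>C\<^esub> on2 G (nu F (trg A f) \<lhd>\<^bsub>B\<^esub> on1 F f) = id2 C (on1 G (on1 F f))"
      using arg_cong[OF psf_unit(1)[OF F, of f], of "on2 G"] by simp
    show "mu (ps_comp C G F) (id1 A (trg A f)) f \<bullet>\<^bsub>C\<^esub> (nu (ps_comp C G F) (trg A f) \<lhd>\<^bsub>C\<^esub> on1 (ps_comp C G F) f)
       = id2 C (on1 (ps_comp C G F) f)"
      using psf_unit(1)[OF G, of "on1 F f"] by (simp add: ps_comp_def C.extend_eq[OF 1] C.extend_eq1[OF 2] 2)
    have 1: "mu G (on1 F f) (on1 F (id1 A (src A f))) \<bullet>\<^bsub>C\<^esub> (on1 G (on1 F f) \<rhd>\<^bsub>C\<^esub> on2 G (nu F (src A f))) =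
       on2 G (on1 F f \<rhd>\<^bsub>B\<^esub> nu F (src A f)) \<bullet>\<^bsub>C\<^esub> mu G (on1 F f) (id1 B (on0 F (src A f)))"
      using psf_mu_lw[OF G, of "nu F (src A f)" "on1 F f"] by simp
    have 2: "on2 G (mu F f (id1 A (src A f))) \<bullet>\<^bsub>C\<^esub> on2 G (on1 F f \<rhd>\<^bsub>B\<^esub> nu F (src A f)) = id2 C (on1 G (on1 F f))"
      using arg_cong[OF psf_unit(2)[OF F, of f], of "on2 G"] by simp
    show "mu (ps_comp C G F) f (id1 A (src A f)) \<bullet>\<^bsub>C\<^esub> (on1 (ps_comp C G F) f \<rhd>\<^bsub>C\<^esub> nu (ps_comp C G F) (src A f))
       = id2 C (on1 (ps_comp C G F) f)"
      using psf_unit(2)[OF G, of "on1 F f"] by (simp add: ps_comp_def C.extend_eq[OF 1] C.extend_eq1[OF 2] 2)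
  qed (simp_all add: ps_comp_def C.invertible_vcmp psf_invertible[OF G])
qed

subsection \<open>Strict 2-functors and their sections\<close>

locale strict_functor = W: two_category W + A: two_category A
  for W :: "('o, 'm, 'c) two_cat" and A :: "('p, 'n, 'd) two_cat" +
  fixes F0 :: "'o \<Rightarrow> 'p" and F1 :: "'m \<Rightarrow> 'n" and F2 :: "'c \<Rightarrow> 'd"
  assumes F0_obj [simp]: "w \<in> obj W \<Longrightarrow> F0 w \<in> obj A"
    and F1_type [simp]: "p \<in> arr W \<Longrightarrow> F1 p \<in> arr A" "p \<in> arr W \<Longrightarrow> src A (F1 p) = F0 (src W p)"
      "p \<in> arr W \<Longrightarrow> trg A (F1 p) = F0 (trg W p)"
    and F2_type [simp]: "\<chi> \<in> cel W \<Longrightarrow> F2 \<chi> \<in> cel A" "\<chi> \<in> cel W \<Longrightarrow> dom2 A (F2 \<chi>) = F1 (dom2 W \<chi>)"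
      "\<chi> \<in> cel W \<Longrightarrow> cod2 A (F2 \<chi>) = F1 (cod2 W \<chi>)"
    and F1_id [simp]: "w \<in> obj W \<Longrightarrow> F1 (id1 W w) = id1 A (F0 w)"
    and F1_cmp [simp]: "\<lbrakk>p \<in> arr W; q \<in> arr W; trg W p = src W q\<rbrakk> \<Longrightarrow> F1 (q \<odot>\<^bsub>W\<^esub> p) = F1 q \<odot>\<^bsub>A\<^esub> F1 p"
    and F2_id [simp]: "p \<in> arr W \<Longrightarrow> F2 (id2 W p) = id2 A (F1 p)"
    and F2_vcmp [simp]: "\<lbrakk>\<chi> \<in> cel W; \<xi> \<in> cel W; cod2 W \<chi> = dom2 W \<xi>\<rbrakk> \<Longrightarrow> F2 (\<xi> \<bullet>\<^bsub>W\<^esub> \<chi>) = F2 \<xi> \<bullet>\<^bsub>A\<^esub> F2 \<chi>"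
    and F2_hcmp [simp]: "\<lbrakk>\<chi> \<in> cel W; \<xi> \<in> cel W; trg W (dom2 W \<chi>) = src W (dom2 W \<xi>)\<rbrakk>
      \<Longrightarrow> F2 (\<xi> \<star>\<^bsub>W\<^esub> \<chi>) = F2 \<xi> \<star>\<^bsub>A\<^esub> F2 \<chi>"
begin

lemma F2_lw [simp]: "\<lbrakk>\<chi> \<in> cel W; k \<in> arr W; trg W (dom2 W \<chi>) = src W k\<rbrakk> \<Longrightarrow> F2 (k \<rhd>\<^bsub>W\<^esub> \<chi>) = F1 k \<rhd>\<^bsub>A\<^esub> F2 \<chi>"
  by (simp add: lw_def)

lemma F2_rw [simp]: "\<lbrakk>\<chi> \<in> cel W; k \<in> arr W; src W (dom2 W \<chi>) = trg W k\<rbrakk> \<Longrightarrow> F2 (\<chi> \<lhd>\<^bsub>W\<^esub> k) = F2 \<chi> \<lhd>\<^bsub>A\<^esub> F1 k"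
  by (simp add: rw_def)

lemma F2_inverse:
  assumes "invertible2 W \<chi>"
  shows "inverse2 A (F2 \<chi>) (F2 (inv2 W \<chi>))"
  using assms W.invertible_cel[OF assms] unfolding A.inverse2_iff by (simp flip: F2_vcmp)

lemma F2_invertible: "invertible2 W \<chi> \<Longrightarrow> invertible2 A (F2 \<chi>)"
  using F2_inverse unfolding invertible2_def by blast

lemma F2_inv2: "invertible2 W \<chi> \<Longrightarrow> F2 (inv2 W \<chi>) = inv2 A (F2 \<chi>)"
  using A.inv2_eq[OF F2_inverse] by simp

lemma F1_isomorphic: "isomorphic1 W p q \<Longrightarrow> isomorphic1 A (F1 p) (F1 q)"
  using F2_invertible W.invertible_cel unfolding isomorphic1_def by fastforce

lemma F1_equivalence:
  assumes "equivalence1 W p"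
  shows "equivalence1 A (F1 p)"
proof -
  obtain q where [simp]: "p \<in> arr W" "q \<in> arr W" "src W q = trg W p" "trg W q = src W p" and
    i: "isomorphic1 W (q \<odot>\<^bsub>W\<^esub> p) (id1 W (src W p))" "isomorphic1 W (p \<odot>\<^bsub>W\<^esub> q) (id1 W (trg W p))"
    using assms unfolding equivalence1_def by auto
  show ?thesis unfolding equivalence1_def
    using F1_isomorphic[OF i(1)] F1_isomorphic[OF i(2)] by (auto intro!: bexI[of _ "F1 q"])
qed

end

text \<open>Surjectivity on objects is not included: it enters through the sections below.\<close>

locale projection = strict_functor W A F0 F1 F2
  for W :: "('o, 'm, 'c) two_cat" and A :: "('p, 'n, 'd) two_cat" and F0 F1 F2 +
  assumes full1: "\<lbrakk>w \<in> obj W; w' \<in> obj W; f \<in> hom A (F0 w) (F0 w')\<rbrakk> \<Longrightarrow> \<exists>p \<in> hom W w w'. F1 p = f"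
    and lift_ex1: "\<lbrakk>p \<in> arr W; q \<in> arr W; src W q = src W p; trg W q = trg W p; \<alpha> \<in> cells A (F1 p) (F1 q)\<rbrakk>
      \<Longrightarrow> \<exists>!\<chi>. \<chi> \<in> cells W p q \<and> F2 \<chi> = \<alpha>"
begin

definition lift :: "'m \<Rightarrow> 'm \<Rightarrow> 'd \<Rightarrow> 'c" where
  "lift p q \<alpha> = (THE \<chi>. \<chi> \<in> cells W p q \<and> F2 \<chi> = \<alpha>)"

lemma lift [simp]:
  assumes "p \<in> arr W" "q \<in> arr W" "src W q = src W p" "trg W q = trg W p"
    "\<alpha> \<in> cel A" "dom2 A \<alpha> = F1 p" "cod2 A \<alpha> = F1 q"
  shows "lift p q \<alpha> \<in> cel W" "dom2 W (lift p q \<alpha>) = p" "cod2 W (lift p q \<alpha>) = q" "F2 (lift p q \<alpha>) = \<alpha>"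
  using theI'[OF lift_ex1[of p q \<alpha>]] assms unfolding lift_def[symmetric] by simp_all

text \<open>Coherence laws are proved by this lemma: the two sides are parallel 2-cells of \<open>W\<close> over the same 2-cell.\<close>

lemma faithful:
  assumes "\<chi> \<in> cel W" "\<xi> \<in> cel W" "dom2 W \<xi> = dom2 W \<chi>" "cod2 W \<xi> = cod2 W \<chi>" "F2 \<chi> = F2 \<xi>"
  shows "\<chi> = \<xi>"
proof -
  have "\<exists>!x. x \<in> cells W (dom2 W \<chi>) (cod2 W \<chi>) \<and> F2 x = F2 \<chi>"
    using assms(1) by (intro lift_ex1) simp_all
  then show ?thesis by (rule ex1_eq) (use assms in simp_all)
qed

lemma lift_invertible:
  assumes "p \<in> arr W" "q \<in> arr W" "src W q = src W p" "trg W q = trg W p"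
    "invertible2 A \<alpha>" "dom2 A \<alpha> = F1 p" "cod2 A \<alpha> = F1 q"
  shows "invertible2 W (lift p q \<alpha>)"
proof -
  note [simp] = assms A.invertible_cel[OF assms(5)]
  have "lift q p (inv2 A \<alpha>) \<bullet>\<^bsub>W\<^esub> lift p q \<alpha> = id2 W p" "lift p q \<alpha> \<bullet>\<^bsub>W\<^esub> lift q p (inv2 A \<alpha>) = id2 W q"
    by (rule faithful; simp)+
  then show ?thesis unfolding invertible2_def W.inverse2_iff
    by (intro exI[of _ "lift q p (inv2 A \<alpha>)"]) simp
qed

lemma equivalence_over_identity:
  assumes "p \<in> arr W" "q \<in> arr W" "src W q = trg W p" "trg W q = src W p"
    and "F1 p = id1 A (F0 (src W p))" "F1 q = id1 A (F0 (src W p))" "F0 (trg W p) = F0 (src W p)"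
  shows "equivalence1 W p"
proof -
  note [simp] = assms
  have "isomorphic1 W (q \<odot>\<^bsub>W\<^esub> p) (id1 W (src W p))"
    unfolding W.iso1_def using lift_invertible[of "q \<odot>\<^bsub>W\<^esub> p" "id1 W (src W p)" "id2 A (id1 A (F0 (src W p)))"]
    by (intro exI[of _ "lift (q \<odot>\<^bsub>W\<^esub> p) (id1 W (src W p)) (id2 A (id1 A (F0 (src W p))))"])
      (simp add: A.invertible_id2)
  moreover have "isomorphic1 W (p \<odot>\<^bsub>W\<^esub> q) (id1 W (trg W p))"
    unfolding W.iso1_def using lift_invertible[of "p \<odot>\<^bsub>W\<^esub> q" "id1 W (trg W p)" "id2 A (id1 A (F0 (src W p)))"]
    by (intro exI[of _ "lift (p \<odot>\<^bsub>W\<^esub> q) (id1 W (trg W p)) (id2 A (id1 A (F0 (src W p))))"])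
      (simp add: A.invertible_id2)
  ultimately show ?thesis unfolding equivalence1_def by (auto intro!: bexI[of _ q])
qed

end

text \<open>A choice of lifts of objects and 1-cells along a projection \<open>W \<rightarrow> A\<close> is a pseudofunctor \<open>A \<rightarrow> W\<close> in a unique
  way: its values on 2-cells and its coherence 2-cells are the lifts of the given 2-cells and of identities. It is
  composed at once with a strict 2-functor \<open>W \<rightarrow> B\<close>.\<close>

locale section_image = proj: projection W A U0 U1 U2 + img: strict_functor W B V0 V1 V2
  for W :: "('o, 'm, 'c) two_cat" and A :: "('p, 'n, 'd) two_cat" and U0 U1 U2
    and B :: "('q, 'l, 'e) two_cat" and V0 V1 V2 +
  fixes s0 :: "'p \<Rightarrow> 'o" and s1 :: "'n \<Rightarrow> 'm"
  assumes s0 [simp]: "a \<in> obj A \<Longrightarrow> s0 a \<in> obj W" "a \<in> obj A \<Longrightarrow> U0 (s0 a) = a"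
    and s1 [simp]: "f \<in> arr A \<Longrightarrow> s1 f \<in> arr W" "f \<in> arr A \<Longrightarrow> src W (s1 f) = s0 (src A f)"
      "f \<in> arr A \<Longrightarrow> trg W (s1 f) = s0 (trg A f)" "f \<in> arr A \<Longrightarrow> U1 (s1 f) = f"
begin

definition s2 :: "'d \<Rightarrow> 'c" where
  "s2 \<alpha> = proj.lift (s1 (dom2 A \<alpha>)) (s1 (cod2 A \<alpha>)) \<alpha>"

definition smu :: "'n \<Rightarrow> 'n \<Rightarrow> 'c" where
  "smu g f = proj.lift (s1 g \<odot>\<^bsub>W\<^esub> s1 f) (s1 (g \<odot>\<^bsub>A\<^esub> f)) (id2 A (g \<odot>\<^bsub>A\<^esub> f))"

definition snu :: "'p \<Rightarrow> 'c" where
  "snu a = proj.lift (id1 W (s0 a)) (s1 (id1 A a)) (id2 A (id1 A a))"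

definition psf :: "('p, 'n, 'd, 'q, 'l, 'e) psfun" where
  "psf = \<lparr> on0 = (\<lambda>a. V0 (s0 a)), on1 = (\<lambda>f. V1 (s1 f)), on2 = (\<lambda>\<alpha>. V2 (s2 \<alpha>)),
     mu = (\<lambda>g f. V2 (smu g f)), nu = (\<lambda>a. V2 (snu a)) \<rparr>"

lemma psf_sel [simp]:
  "on0 psf a = V0 (s0 a)" "on1 psf f = V1 (s1 f)" "on2 psf \<alpha> = V2 (s2 \<alpha>)"
  "mu psf g f = V2 (smu g f)" "nu psf a = V2 (snu a)"
  by (simp_all add: psf_def)

lemma s2 [simp]:
  assumes "\<alpha> \<in> cel A"
  shows "s2 \<alpha> \<in> cel W" "dom2 W (s2 \<alpha>) = s1 (dom2 A \<alpha>)" "cod2 W (s2 \<alpha>) = s1 (cod2 A \<alpha>)" "U2 (s2 \<alpha>) = \<alpha>"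
  using assms by (simp_all add: s2_def)

lemma smu [simp]:
  assumes "f \<in> arr A" "g \<in> arr A" "trg A f = src A g"
  shows "smu g f \<in> cel W" "dom2 W (smu g f) = s1 g \<odot>\<^bsub>W\<^esub> s1 f" "cod2 W (smu g f) = s1 (g \<odot>\<^bsub>A\<^esub> f)"
    "U2 (smu g f) = id2 A (g \<odot>\<^bsub>A\<^esub> f)" "invertible2 W (smu g f)"
  using assms proj.lift_invertible[of "s1 g \<odot>\<^bsub>W\<^esub> s1 f" "s1 (g \<odot>\<^bsub>A\<^esub> f)" "id2 A (g \<odot>\<^bsub>A\<^esub> f)"]
  by (simp_all add: smu_def proj.A.invertible_id2)

lemma snu [simp]:
  assumes "a \<in> obj A"
  shows "snu a \<in> cel W" "dom2 W (snu a) = id1 W (s0 a)" "cod2 W (snu a) = s1 (id1 A a)"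
    "U2 (snu a) = id2 A (id1 A a)" "invertible2 W (snu a)"
  using assms proj.lift_invertible[of "id1 W (s0 a)" "s1 (id1 A a)" "id2 A (id1 A a)"]
  by (simp_all add: snu_def proj.A.invertible_id2)

lemma pseudofunctor_psf: "pseudofunctor A B psf"
  unfolding pseudofunctor_def
proof (intro conjI ballI impI)
  show "two_category A" "two_category B" by unfold_locales
next
  fix f assume [simp]: "f \<in> arr A"
  have "s2 (id2 A f) = id2 W (s1 f)" by (rule proj.faithful) simp_all
  then show "on2 psf (id2 A f) = id2 B (on1 psf f)" by simp
next
  fix \<alpha> \<beta> assume [simp]: "\<alpha> \<in> cel A" "\<beta> \<in> cel A" "cod2 A \<alpha> = dom2 A \<beta>"
  have "s2 (\<beta> \<bullet>\<^bsub>A\<^esub> \<alpha>) = s2 \<beta> \<bullet>\<^bsub>W\<^esub> s2 \<alpha>" by (rule proj.faithful) simp_all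
  then show "on2 psf (\<beta> \<bullet>\<^bsub>A\<^esub> \<alpha>) = on2 psf \<beta> \<bullet>\<^bsub>B\<^esub> on2 psf \<alpha>" by simp
next
  fix \<alpha> \<beta> assume [simp]: "\<alpha> \<in> cel A" "\<beta> \<in> cel A" "trg A (dom2 A \<alpha>) = src A (dom2 A \<beta>)"
  have "smu (cod2 A \<beta>) (cod2 A \<alpha>) \<bullet>\<^bsub>W\<^esub> (s2 \<beta> \<star>\<^bsub>W\<^esub> s2 \<alpha>) = s2 (\<beta> \<star>\<^bsub>A\<^esub> \<alpha>) \<bullet>\<^bsub>W\<^esub> smu (dom2 A \<beta>) (dom2 A \<alpha>)"
    by (rule proj.faithful) simp_all
  from arg_cong[OF this, of V2]
  show "mu psf (cod2 A \<beta>) (cod2 A \<alpha>) \<bullet>\<^bsub>B\<^esub> (on2 psf \<beta> \<star>\<^bsub>B\<^esub> on2 psf \<alpha>)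
      = on2 psf (\<beta> \<star>\<^bsub>A\<^esub> \<alpha>) \<bullet>\<^bsub>B\<^esub> mu psf (dom2 A \<beta>) (dom2 A \<alpha>)" by simp
next
  fix f g h assume [simp]: "f \<in> arr A" "g \<in> arr A" "h \<in> arr A" "trg A f = src A g" "trg A g = src A h"
  have "smu h (g \<odot>\<^bsub>A\<^esub> f) \<bullet>\<^bsub>W\<^esub> (s1 h \<rhd>\<^bsub>W\<^esub> smu g f) = smu (h \<odot>\<^bsub>A\<^esub> g) f \<bullet>\<^bsub>W\<^esub> (smu h g \<lhd>\<^bsub>W\<^esub> s1 f)"
    by (rule proj.faithful) simp_all
  from arg_cong[OF this, of V2]
  show "mu psf h (g \<odot>\<^bsub>A\<^esub> f) \<bullet>\<^bsub>B\<^esub> (on1 psf h \<rhd>\<^bsub>B\<^esub> mu psf g f) = mu psf (h \<odot>\<^bsub>A\<^esub> g) f \<bullet>\<^bsub>B\<^esub> (mu psf h g \<lhd>\<^bsub>B\<^esub> on1 psf f)"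
    by simp
next
  fix f assume [simp]: "f \<in> arr A"
  have "smu (id1 A (trg A f)) f \<bullet>\<^bsub>W\<^esub> (snu (trg A f) \<lhd>\<^bsub>W\<^esub> s1 f) = id2 W (s1 f)"
    by (rule proj.faithful) simp_all
  from arg_cong[OF this, of V2]
  show "mu psf (id1 A (trg A f)) f \<bullet>\<^bsub>B\<^esub> (nu psf (trg A f) \<lhd>\<^bsub>B\<^esub> on1 psf f) = id2 B (on1 psf f)" by simp
  have "smu f (id1 A (src A f)) \<bullet>\<^bsub>W\<^esub> (s1 f \<rhd>\<^bsub>W\<^esub> snu (src A f)) = id2 W (s1 f)"
    by (rule proj.faithful) simp_all
  from arg_cong[OF this, of V2]
  show "mu psf f (id1 A (src A f)) \<bullet>\<^bsub>B\<^esub> (on1 psf f \<rhd>\<^bsub>B\<^esub> nu psf (src A f)) = id2 B (on1 psf f)" by simp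
qed (simp_all add: img.F2_invertible)

end

subsection \<open>The biadjoint biequivalence of a span\<close>

text \<open>A span \<open>A \<leftarrow> W \<rightarrow> B\<close> of projections with a section of either leg. Every \<open>w\<close> is compared with the chosen
  lifts of its two images, by \<open>k w : w \<rightarrow> b0 (V0 w)\<close> over an identity of \<open>B\<close> and by
  \<open>h w : a0 (U0 w) \<rightarrow> w\<close> over an identity of \<open>A\<close>. Projecting \<open>k\<close> to \<open>A\<close> gives the unit, and projecting \<open>h\<close> to \<open>B\<close>
  the counit.\<close>

locale biequivalence_span =
  M: section_image W A U0 U1 U2 B V0 V1 V2 a0 a1 + T: section_image W B V0 V1 V2 A U0 U1 U2 b0 b1
  for W :: "('o, 'm, 'c) two_cat" and A :: "('p, 'n, 'd) two_cat" and U0 U1 U2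
    and B :: "('q, 'l, 'e) two_cat" and V0 V1 V2 and a0 a1 b0 b1
begin

abbreviation "Mpsf \<equiv> M.psf"
abbreviation "Tpsf \<equiv> T.psf"

definition k :: "'o \<Rightarrow> 'm" where
  "k w = (SOME p. p \<in> hom W w (b0 (V0 w)) \<and> V1 p = id1 B (V0 w))"

definition h :: "'o \<Rightarrow> 'm" where
  "h w = (SOME p. p \<in> hom W (a0 (U0 w)) w \<and> U1 p = id1 A (U0 w))"

lemma k [simp]:
  assumes "w \<in> obj W"
  shows "k w \<in> arr W" "src W (k w) = w" "trg W (k w) = b0 (V0 w)" "V1 (k w) = id1 B (V0 w)"
proof -
  have "\<exists>p. p \<in> hom W w (b0 (V0 w)) \<and> V1 p = id1 B (V0 w)"
    using T.proj.full1[of w "b0 (V0 w)" "id1 B (V0 w)"] assms by auto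
  from someI_ex[OF this]
  show "k w \<in> arr W" "src W (k w) = w" "trg W (k w) = b0 (V0 w)" "V1 (k w) = id1 B (V0 w)"
    unfolding k_def[symmetric] by simp_all
qed

lemma h [simp]:
  assumes "w \<in> obj W"
  shows "h w \<in> arr W" "src W (h w) = a0 (U0 w)" "trg W (h w) = w" "U1 (h w) = id1 A (U0 w)"
proof -
  have "\<exists>p. p \<in> hom W (a0 (U0 w)) w \<and> U1 p = id1 A (U0 w)"
    using M.proj.full1[of "a0 (U0 w)" w "id1 A (U0 w)"] assms by auto
  from someI_ex[OF this]
  show "h w \<in> arr W" "src W (h w) = a0 (U0 w)" "trg W (h w) = w" "U1 (h w) = id1 A (U0 w)"
    unfolding h_def[symmetric] by simp_all
qed

lemma k_equivalence:
  assumes [simp]: "w \<in> obj W"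
  shows "equivalence1 W (k w)"
proof -
  obtain q where "q \<in> arr W" "src W q = b0 (V0 w)" "trg W q = w" "V1 q = id1 B (V0 w)"
    using T.proj.full1[of "b0 (V0 w)" w "id1 B (V0 w)"] by auto
  then show ?thesis by (intro T.proj.equivalence_over_identity[of _ q]) simp_all
qed

lemma h_equivalence:
  assumes [simp]: "w \<in> obj W"
  shows "equivalence1 W (h w)"
proof -
  obtain q where "q \<in> arr W" "src W q = w" "trg W q = a0 (U0 w)" "U1 q = id1 A (U0 w)"
    using M.proj.full1[of w "a0 (U0 w)" "id1 A (U0 w)"] by auto
  then show ?thesis by (intro M.proj.equivalence_over_identity[of _ q]) simp_all
qed

definition kn :: "'m \<Rightarrow> 'c" where
  "kn p = T.proj.lift (b1 (V1 p) \<odot>\<^bsub>W\<^esub> k (src W p)) (k (trg W p) \<odot>\<^bsub>W\<^esub> p) (id2 B (V1 p))"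

definition hn :: "'m \<Rightarrow> 'c" where
  "hn p = M.proj.lift (p \<odot>\<^bsub>W\<^esub> h (src W p)) (h (trg W p) \<odot>\<^bsub>W\<^esub> a1 (U1 p)) (id2 A (U1 p))"

lemma kn [simp]:
  assumes [simp]: "p \<in> arr W"
  shows "kn p \<in> cel W" "dom2 W (kn p) = b1 (V1 p) \<odot>\<^bsub>W\<^esub> k (src W p)" "cod2 W (kn p) = k (trg W p) \<odot>\<^bsub>W\<^esub> p"
    "V2 (kn p) = id2 B (V1 p)"
  by (simp_all add: kn_def)

lemma kn_invertible [simp]:
  assumes [simp]: "p \<in> arr W"
  shows "invertible2 W (kn p)"
  unfolding kn_def by (rule T.proj.lift_invertible) (simp_all add: M.img.A.invertible_id2)

lemma hn [simp]:
  assumes [simp]: "p \<in> arr W"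
  shows "hn p \<in> cel W" "dom2 W (hn p) = p \<odot>\<^bsub>W\<^esub> h (src W p)" "cod2 W (hn p) = h (trg W p) \<odot>\<^bsub>W\<^esub> a1 (U1 p)"
    "U2 (hn p) = id2 A (U1 p)"
  by (simp_all add: hn_def)

lemma hn_invertible [simp]:
  assumes [simp]: "p \<in> arr W"
  shows "invertible2 W (hn p)"
  unfolding hn_def by (rule M.proj.lift_invertible) (simp_all add: M.proj.A.invertible_id2)

definition \<eta> :: "('p, 'n, 'n, 'd) pstrans" where
  "\<eta> = \<lparr> tc = (\<lambda>a. U1 (k (a0 a))), tn = (\<lambda>f. U2 (kn (a1 f))) \<rparr>"

definition \<epsilon> :: "('q, 'l, 'l, 'e) pstrans" where
  "\<epsilon> = \<lparr> tc = (\<lambda>b. V1 (h (b0 b))), tn = (\<lambda>f. V2 (hn (b1 f))) \<rparr>"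

lemma eta_sel [simp]: "tc \<eta> a = U1 (k (a0 a))" "tn \<eta> f = U2 (kn (a1 f))"
  by (simp_all add: \<eta>_def)

lemma epsilon_sel [simp]: "tc \<epsilon> b = V1 (h (b0 b))" "tn \<epsilon> g = V2 (hn (b1 g))"
  by (simp_all add: \<epsilon>_def)

lemma ps_id_sel [simp]: "on0 (ps_id X) a = a" "on1 (ps_id X) f = f" "on2 (ps_id X) \<alpha> = \<alpha>"
  "mu (ps_id X) g f = id2 X (g \<odot>\<^bsub>X\<^esub> f)" "nu (ps_id X) a = id2 X (id1 X a)"
  by (simp_all add: ps_id_def)

lemma ps_comp_sel [simp]: "on0 (ps_comp X G F) a = on0 G (on0 F a)" "on1 (ps_comp X G F) f = on1 G (on1 F f)"
  "on2 (ps_comp X G F) \<alpha> = on2 G (on2 F \<alpha>)"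
  "mu (ps_comp X G F) g f = on2 G (mu F g f) \<bullet>\<^bsub>X\<^esub> mu G (on1 F g) (on1 F f)"
  "nu (ps_comp X G F) a = on2 G (nu F a) \<bullet>\<^bsub>X\<^esub> nu G (on0 F a)"
  by (simp_all add: ps_comp_def)

lemma eta_pseudonatural: "pseudonatural A A (ps_id A) (ps_comp A Tpsf Mpsf) \<eta>"
  unfolding pseudonatural_def
proof (intro conjI ballI impI)
  show "pseudofunctor A A (ps_id A)" by (rule pseudofunctor_id) unfold_locales
  show "pseudofunctor A A (ps_comp A Tpsf Mpsf)"
    by (rule pseudofunctor_comp[OF M.pseudofunctor_psf T.pseudofunctor_psf])
next
  fix \<alpha> assume [simp]: "\<alpha> \<in> cel A"
  have "kn (a1 (cod2 A \<alpha>)) \<bullet>\<^bsub>W\<^esub> (T.s2 (V2 (M.s2 \<alpha>)) \<lhd>\<^bsub>W\<^esub> k (a0 (src A (dom2 A \<alpha>))))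
      = (k (a0 (trg A (dom2 A \<alpha>))) \<rhd>\<^bsub>W\<^esub> M.s2 \<alpha>) \<bullet>\<^bsub>W\<^esub> kn (a1 (dom2 A \<alpha>))"
    by (rule T.proj.faithful) simp_all
  from arg_cong[OF this, of U2]
  show "tn \<eta> (cod2 A \<alpha>) \<bullet>\<^bsub>A\<^esub> (on2 (ps_comp A Tpsf Mpsf) \<alpha> \<lhd>\<^bsub>A\<^esub> tc \<eta> (src A (dom2 A \<alpha>)))
      = (tc \<eta> (trg A (dom2 A \<alpha>)) \<rhd>\<^bsub>A\<^esub> on2 (ps_id A) \<alpha>) \<bullet>\<^bsub>A\<^esub> tn \<eta> (dom2 A \<alpha>)" by simp
next
  fix f g assume [simp]: "f \<in> arr A" "g \<in> arr A" "trg A f = src A g"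
  have "kn (a1 (g \<odot>\<^bsub>A\<^esub> f)) \<bullet>\<^bsub>W\<^esub> ((T.s2 (V2 (M.smu g f)) \<bullet>\<^bsub>W\<^esub> T.smu (V1 (a1 g)) (V1 (a1 f))) \<lhd>\<^bsub>W\<^esub> k (a0 (src A f)))
      = (k (a0 (trg A g)) \<rhd>\<^bsub>W\<^esub> M.smu g f) \<bullet>\<^bsub>W\<^esub> (kn (a1 g) \<lhd>\<^bsub>W\<^esub> a1 f) \<bullet>\<^bsub>W\<^esub> (b1 (V1 (a1 g)) \<rhd>\<^bsub>W\<^esub> kn (a1 f))"
    by (rule T.proj.faithful) simp_all
  from arg_cong[OF this, of U2]
  show "tn \<eta> (g \<odot>\<^bsub>A\<^esub> f) \<bullet>\<^bsub>A\<^esub> (mu (ps_comp A Tpsf Mpsf) g f \<lhd>\<^bsub>A\<^esub> tc \<eta> (src A f))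
          = (tc \<eta> (trg A g) \<rhd>\<^bsub>A\<^esub> mu (ps_id A) g f) \<bullet>\<^bsub>A\<^esub> (tn \<eta> g \<lhd>\<^bsub>A\<^esub> on1 (ps_id A) f)
            \<bullet>\<^bsub>A\<^esub> (on1 (ps_comp A Tpsf Mpsf) g \<rhd>\<^bsub>A\<^esub> tn \<eta> f)" by simp
next
  fix a assume [simp]: "a \<in> obj A"
  have "kn (a1 (id1 A a)) \<bullet>\<^bsub>W\<^esub> ((T.s2 (V2 (M.snu a)) \<bullet>\<^bsub>W\<^esub> T.snu (V0 (a0 a))) \<lhd>\<^bsub>W\<^esub> k (a0 a)) = k (a0 a) \<rhd>\<^bsub>W\<^esub> M.snu a"
    by (rule T.proj.faithful) simp_all
  from arg_cong[OF this, of U2]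
  show "tn \<eta> (id1 A a) \<bullet>\<^bsub>A\<^esub> (nu (ps_comp A Tpsf Mpsf) a \<lhd>\<^bsub>A\<^esub> tc \<eta> a) = tc \<eta> a \<rhd>\<^bsub>A\<^esub> nu (ps_id A) a" by simp
qed (simp_all add: M.proj.F2_invertible)

lemma epsilon_pseudonatural: "pseudonatural B B (ps_comp B Mpsf Tpsf) (ps_id B) \<epsilon>"
  unfolding pseudonatural_def
proof (intro conjI ballI impI)
  show "pseudofunctor B B (ps_id B)" by (rule pseudofunctor_id) unfold_locales
  show "pseudofunctor B B (ps_comp B Mpsf Tpsf)"
    by (rule pseudofunctor_comp[OF T.pseudofunctor_psf M.pseudofunctor_psf])
next
  fix \<alpha> assume [simp]: "\<alpha> \<in> cel B"
  have "hn (b1 (cod2 B \<alpha>)) \<bullet>\<^bsub>W\<^esub> (T.s2 \<alpha> \<lhd>\<^bsub>W\<^esub> h (b0 (src B (dom2 B \<alpha>))))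
      = (h (b0 (trg B (dom2 B \<alpha>))) \<rhd>\<^bsub>W\<^esub> M.s2 (U2 (T.s2 \<alpha>))) \<bullet>\<^bsub>W\<^esub> hn (b1 (dom2 B \<alpha>))"
    by (rule M.proj.faithful) simp_all
  from arg_cong[OF this, of V2]
  show "tn \<epsilon> (cod2 B \<alpha>) \<bullet>\<^bsub>B\<^esub> (on2 (ps_id B) \<alpha> \<lhd>\<^bsub>B\<^esub> tc \<epsilon> (src B (dom2 B \<alpha>)))
      = (tc \<epsilon> (trg B (dom2 B \<alpha>)) \<rhd>\<^bsub>B\<^esub> on2 (ps_comp B Mpsf Tpsf) \<alpha>) \<bullet>\<^bsub>B\<^esub> tn \<epsilon> (dom2 B \<alpha>)" by simp
next
  fix f g assume [simp]: "f \<in> arr B" "g \<in> arr B" "trg B f = src B g"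
  have "hn (b1 (g \<odot>\<^bsub>B\<^esub> f)) \<bullet>\<^bsub>W\<^esub> (T.smu g f \<lhd>\<^bsub>W\<^esub> h (b0 (src B f)))
      = (h (b0 (trg B g)) \<rhd>\<^bsub>W\<^esub> (M.s2 (U2 (T.smu g f)) \<bullet>\<^bsub>W\<^esub> M.smu (U1 (b1 g)) (U1 (b1 f))))
        \<bullet>\<^bsub>W\<^esub> (hn (b1 g) \<lhd>\<^bsub>W\<^esub> a1 (U1 (b1 f))) \<bullet>\<^bsub>W\<^esub> (b1 g \<rhd>\<^bsub>W\<^esub> hn (b1 f))"
    by (rule M.proj.faithful) simp_all
  from arg_cong[OF this, of V2]
  show "tn \<epsilon> (g \<odot>\<^bsub>B\<^esub> f) \<bullet>\<^bsub>B\<^esub> (mu (ps_id B) g f \<lhd>\<^bsub>B\<^esub> tc \<epsilon> (src B f))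
          = (tc \<epsilon> (trg B g) \<rhd>\<^bsub>B\<^esub> mu (ps_comp B Mpsf Tpsf) g f) \<bullet>\<^bsub>B\<^esub> (tn \<epsilon> g \<lhd>\<^bsub>B\<^esub> on1 (ps_comp B Mpsf Tpsf) f)
            \<bullet>\<^bsub>B\<^esub> (on1 (ps_id B) g \<rhd>\<^bsub>B\<^esub> tn \<epsilon> f)" by simp
next
  fix a assume [simp]: "a \<in> obj B"
  have "hn (b1 (id1 B a)) \<bullet>\<^bsub>W\<^esub> (T.snu a \<lhd>\<^bsub>W\<^esub> h (b0 a)) = h (b0 a) \<rhd>\<^bsub>W\<^esub> (M.s2 (U2 (T.snu a)) \<bullet>\<^bsub>W\<^esub> M.snu (U0 (b0 a)))"
    by (rule M.proj.faithful) simp_all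
  from arg_cong[OF this, of V2]
  show "tn \<epsilon> (id1 B a) \<bullet>\<^bsub>B\<^esub> (nu (ps_id B) a \<lhd>\<^bsub>B\<^esub> tc \<epsilon> a) = tc \<epsilon> a \<rhd>\<^bsub>B\<^esub> nu (ps_comp B Mpsf Tpsf) a" by simp
qed (simp_all add: M.img.F2_invertible)

theorem span_biequivalence: "biequivalence A B Mpsf Tpsf \<eta> \<epsilon>"
  unfolding biequivalence_def
  using M.pseudofunctor_psf T.pseudofunctor_psf eta_pseudonatural epsilon_pseudonatural
    M.proj.F1_equivalence[OF k_equivalence] M.img.F1_equivalence[OF h_equivalence] by simp

text \<open>In \<open>W\<close>, the lift of the triangle composite at \<open>a\<close> lies over the same 1-cell of \<open>A\<close> as \<open>k (a0 a)\<close>, so the two are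
  isomorphic by a 2-cell over an identity. Its image in \<open>B\<close>, where \<open>k\<close> becomes an identity, is the triangulator.\<close>

lemma triangle_M:
  "\<exists>s. invertible_modification A B Mpsf Mpsf
     (tr_comp A B (tr_pre \<epsilon> Mpsf) (tr_post A B Mpsf (ps_id A) (ps_comp A Tpsf Mpsf) \<eta>)) (tr_id B Mpsf) s"
proof -
  define S where "S a = M.proj.lift (h (b0 (V0 (a0 a))) \<odot>\<^bsub>W\<^esub> a1 (U1 (k (a0 a)))) (k (a0 a)) (id2 A (U1 (k (a0 a))))" for a
  have S [simp]: "S a \<in> cel W" "dom2 W (S a) = h (b0 (V0 (a0 a))) \<odot>\<^bsub>W\<^esub> a1 (U1 (k (a0 a)))" "cod2 W (S a) = k (a0 a)"
    "U2 (S a) = id2 A (U1 (k (a0 a)))" if [simp]: "a \<in> obj A" for a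
    by (simp_all add: S_def)
  have Si [simp]: "invertible2 W (S a)" if [simp]: "a \<in> obj A" for a
    unfolding S_def by (rule M.proj.lift_invertible) (simp_all add: M.proj.A.invertible_id2)
  have "invertible_modification A B Mpsf Mpsf
     (tr_comp A B (tr_pre \<epsilon> Mpsf) (tr_post A B Mpsf (ps_id A) (ps_comp A Tpsf Mpsf) \<eta>)) (tr_id B Mpsf) (\<lambda>a. V2 (S a))"
    unfolding invertible_modification_def
  proof (intro conjI ballI)
    fix f assume [simp]: "f \<in> arr A"
    let ?a = "src A f" let ?b = "trg A f"
    let ?n = "(h (b0 (V0 (a0 ?b))) \<rhd>\<^bsub>W\<^esub> (inv2 W (M.smu (U1 (k (a0 ?b))) f) \<bullet>\<^bsub>W\<^esub> M.s2 (U2 (kn (a1 f)))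
        \<bullet>\<^bsub>W\<^esub> M.smu (U1 (b1 (V1 (a1 f)))) (U1 (k (a0 ?a))))) \<bullet>\<^bsub>W\<^esub> (hn (b1 (V1 (a1 f))) \<lhd>\<^bsub>W\<^esub> a1 (U1 (k (a0 ?a))))"
    have i: "U2 (inv2 W (M.smu (U1 (k (a0 ?b))) f)) = id2 A (U1 (k (a0 ?b)) \<odot>\<^bsub>A\<^esub> f)"
    proof -
      have "inverse2 A (id2 A (U1 (k (a0 ?b)) \<odot>\<^bsub>A\<^esub> f)) (id2 A (U1 (k (a0 ?b)) \<odot>\<^bsub>A\<^esub> f))"
        by (simp add: M.proj.A.inverse2_iff)
      from M.proj.A.inv2_eq[OF this] show ?thesis by (simp add: M.proj.F2_inv2)
    qed
    have "kn (a1 f) \<bullet>\<^bsub>W\<^esub> (b1 (V1 (a1 f)) \<rhd>\<^bsub>W\<^esub> S ?a) = (S ?b \<lhd>\<^bsub>W\<^esub> a1 f) \<bullet>\<^bsub>W\<^esub> ?n"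
      by (rule M.proj.faithful) (simp_all add: i)
    from arg_cong[OF this, of V2]
    show "tn (tr_id B Mpsf) f \<bullet>\<^bsub>B\<^esub> (on1 Mpsf f \<rhd>\<^bsub>B\<^esub> V2 (S ?a)) = (V2 (S ?b) \<lhd>\<^bsub>B\<^esub> on1 Mpsf f) \<bullet>\<^bsub>B\<^esub>
        tn (tr_comp A B (tr_pre \<epsilon> Mpsf) (tr_post A B Mpsf (ps_id A) (ps_comp A Tpsf Mpsf) \<eta>)) f"
      by (simp add: tr_id_def tr_comp_def tr_pre_def tr_post_def M.img.F2_inv2 M.img.F2_invertible)
  qed (simp_all add: tr_id_def tr_comp_def tr_pre_def tr_post_def M.img.F2_invertible)
  then show ?thesis by blast
qed

lemma triangle_T:
  "\<exists>t. invertible_modification B A Tpsf Tpsf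
     (tr_comp B A (tr_post B A Tpsf (ps_comp B Mpsf Tpsf) (ps_id B) \<epsilon>) (tr_pre \<eta> Tpsf)) (tr_id A Tpsf) t"
proof -
  define S where "S b = T.proj.lift (b1 (V1 (h (b0 b))) \<odot>\<^bsub>W\<^esub> k (a0 (U0 (b0 b)))) (h (b0 b)) (id2 B (V1 (h (b0 b))))" for b
  have S [simp]: "S b \<in> cel W" "dom2 W (S b) = b1 (V1 (h (b0 b))) \<odot>\<^bsub>W\<^esub> k (a0 (U0 (b0 b)))" "cod2 W (S b) = h (b0 b)"
    "V2 (S b) = id2 B (V1 (h (b0 b)))" if [simp]: "b \<in> obj B" for b
    by (simp_all add: S_def)
  have Si [simp]: "invertible2 W (S b)" if [simp]: "b \<in> obj B" for b
    unfolding S_def by (rule T.proj.lift_invertible) (simp_all add: M.img.A.invertible_id2)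
  have "invertible_modification B A Tpsf Tpsf
     (tr_comp B A (tr_post B A Tpsf (ps_comp B Mpsf Tpsf) (ps_id B) \<epsilon>) (tr_pre \<eta> Tpsf)) (tr_id A Tpsf) (\<lambda>b. U2 (S b))"
    unfolding invertible_modification_def
  proof (intro conjI ballI)
    fix f assume [simp]: "f \<in> arr B"
    let ?a = "src B f" let ?b = "trg B f"
    let ?n = "(inv2 W (T.smu (V1 (h (b0 ?b))) (V1 (a1 (U1 (b1 f))))) \<bullet>\<^bsub>W\<^esub> T.s2 (V2 (hn (b1 f)))
        \<bullet>\<^bsub>W\<^esub> T.smu f (V1 (h (b0 ?a)))) \<lhd>\<^bsub>W\<^esub> k (a0 (U0 (b0 ?a)))"
    let ?m = "b1 (V1 (h (b0 ?b))) \<rhd>\<^bsub>W\<^esub> kn (a1 (U1 (b1 f)))"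
    have i: "V2 (inv2 W (T.smu (V1 (h (b0 ?b))) (V1 (a1 (U1 (b1 f)))))) = id2 B (V1 (h (b0 ?b)) \<odot>\<^bsub>B\<^esub> V1 (a1 (U1 (b1 f))))"
    proof -
      have "inverse2 B (id2 B (V1 (h (b0 ?b)) \<odot>\<^bsub>B\<^esub> V1 (a1 (U1 (b1 f))))) (id2 B (V1 (h (b0 ?b)) \<odot>\<^bsub>B\<^esub> V1 (a1 (U1 (b1 f)))))"
        by (simp add: M.img.A.inverse2_iff)
      from M.img.A.inv2_eq[OF this] show ?thesis by (simp add: M.img.F2_inv2)
    qed
    have "hn (b1 f) \<bullet>\<^bsub>W\<^esub> (b1 f \<rhd>\<^bsub>W\<^esub> S ?a) = (S ?b \<lhd>\<^bsub>W\<^esub> a1 (U1 (b1 f))) \<bullet>\<^bsub>W\<^esub> (?m \<bullet>\<^bsub>W\<^esub> ?n)"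
      by (rule T.proj.faithful) (simp_all add: i)
    from arg_cong[OF this, of U2]
    show "tn (tr_id A Tpsf) f \<bullet>\<^bsub>A\<^esub> (on1 Tpsf f \<rhd>\<^bsub>A\<^esub> U2 (S ?a)) = (U2 (S ?b) \<lhd>\<^bsub>A\<^esub> on1 Tpsf f) \<bullet>\<^bsub>A\<^esub>
        tn (tr_comp B A (tr_post B A Tpsf (ps_comp B Mpsf Tpsf) (ps_id B) \<epsilon>) (tr_pre \<eta> Tpsf)) f"
      by (simp add: tr_id_def tr_comp_def tr_pre_def tr_post_def M.proj.F2_inv2 M.proj.F2_invertible)
  qed (simp_all add: tr_id_def tr_comp_def tr_pre_def tr_post_def M.proj.F2_invertible)
  then show ?thesis by blast
qed

theorem span_biadjunction: "biadjunction A B Mpsf Tpsf \<eta> \<epsilon>"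
  unfolding biadjunction_def
  using M.pseudofunctor_psf T.pseudofunctor_psf eta_pseudonatural epsilon_pseudonatural triangle_M triangle_T
  by blast

end

section \<open>The 2-category of framings\<close>

lemma coop_sel [simp]:
  "obj (coop K) = obj K" "arr (coop K) = arr K" "src (coop K) = trg K" "trg (coop K) = src K"
  "cel (coop K) = cel K" "dom2 (coop K) = cod2 K" "cod2 (coop K) = dom2 K" "id1 (coop K) = id1 K"
  "g \<odot>\<^bsub>coop K\<^esub> f = f \<odot>\<^bsub>K\<^esub> g" "id2 (coop K) = id2 K" "\<beta> \<bullet>\<^bsub>coop K\<^esub> \<alpha> = \<alpha> \<bullet>\<^bsub>K\<^esub> \<beta>" "\<beta> \<star>\<^bsub>coop K\<^esub> \<alpha> = \<alpha> \<star>\<^bsub>K\<^esub> \<beta>"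
  by (simp_all add: coop_def)

lemma two_category_coop:
  assumes "two_category K"
  shows "two_category (coop K)"
proof -
  interpret two_category K by fact
  show ?thesis
  proof unfold_locales
    fix \<alpha> \<alpha>' \<beta> \<beta>' f f' f'' g g' g''
    assume "\<alpha> \<in> cells (coop K) f f'" "\<alpha>' \<in> cells (coop K) f' f''" "\<beta> \<in> cells (coop K) g g'"
      "\<beta>' \<in> cells (coop K) g' g''" "trg (coop K) f = src (coop K) g"
    then have a: "\<alpha> \<in> cel K" "\<alpha>' \<in> cel K" "\<beta> \<in> cel K" "\<beta>' \<in> cel K" "cod2 K \<alpha>' = dom2 K \<alpha>" "cod2 K \<beta>' = dom2 K \<beta>"
      and "src K (cod2 K \<alpha>) = trg K (cod2 K \<beta>)" by auto
    then have "trg K (dom2 K \<beta>') = src K (dom2 K \<alpha>')"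
      using src_parallel trg_parallel by metis
    then show "(\<beta>' \<bullet>\<^bsub>coop K\<^esub> \<beta>) \<star>\<^bsub>coop K\<^esub> (\<alpha>' \<bullet>\<^bsub>coop K\<^esub> \<alpha>) =
        (\<beta>' \<star>\<^bsub>coop K\<^esub> \<alpha>') \<bullet>\<^bsub>coop K\<^esub> (\<beta> \<star>\<^bsub>coop K\<^esub> \<alpha>)"
      using interchange'[of \<beta>' \<beta> \<alpha>' \<alpha>] a by simp
  qed (simp_all add: hcmp_assoc' flip: lw_def rw_def)
qed

lemma sub2_sel [simp]:
  "obj (sub2 K Ob Ar) = Ob" "arr (sub2 K Ob Ar) = Ar" "src (sub2 K Ob Ar) = src K" "trg (sub2 K Ob Ar) = trg K"
  "\<alpha> \<in> cel (sub2 K Ob Ar) \<longleftrightarrow> \<alpha> \<in> cel K \<and> dom2 K \<alpha> \<in> Ar \<and> cod2 K \<alpha> \<in> Ar"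
  "dom2 (sub2 K Ob Ar) = dom2 K" "cod2 (sub2 K Ob Ar) = cod2 K" "id1 (sub2 K Ob Ar) = id1 K"
  "g \<odot>\<^bsub>sub2 K Ob Ar\<^esub> f = g \<odot>\<^bsub>K\<^esub> f" "id2 (sub2 K Ob Ar) = id2 K" "\<beta> \<bullet>\<^bsub>sub2 K Ob Ar\<^esub> \<alpha> = \<beta> \<bullet>\<^bsub>K\<^esub> \<alpha>"
  "\<beta> \<star>\<^bsub>sub2 K Ob Ar\<^esub> \<alpha> = \<beta> \<star>\<^bsub>K\<^esub> \<alpha>"
  by (simp_all add: sub2_def)

lemma two_category_sub2:
  assumes "two_category K"
    and "\<And>A. A \<in> Ob \<Longrightarrow> A \<in> obj K" and "\<And>f. f \<in> Ar \<Longrightarrow> f \<in> arr K \<and> src K f \<in> Ob \<and> trg K f \<in> Ob"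
    and "\<And>A. A \<in> Ob \<Longrightarrow> id1 K A \<in> Ar"
    and "\<And>f g. f \<in> Ar \<Longrightarrow> g \<in> Ar \<Longrightarrow> trg K f = src K g \<Longrightarrow> g \<odot>\<^bsub>K\<^esub> f \<in> Ar"
  shows "two_category (sub2 K Ob Ar)"
proof -
  interpret two_category K by fact
  note [simp] = assms(2-5)
  show ?thesis
    by unfold_locales (simp_all add: hcmp_assoc' interchange' flip: lw_def rw_def)
qed

text \<open>A framing \<open>s : G \<rightarrow> X\<close> presents \<open>X\<close> as an object of models of \<open>G\<close>. A framed square from \<open>s\<close> to \<open>s'\<close>
  consists of \<open>f : G \<rightarrow> G'\<close>, an adjunction \<open>l \<stileturn> r\<close> with \<open>l : X \<rightarrow> X'\<close>, an isomorphism \<open>\<zeta> : s' f \<Rightarrow> l s\<close> and the counit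
  of the adjunction; the unit is left out because it is determined by the rest. A framed cell consists of 2-cells
  between the components \<open>f\<close>, \<open>l\<close> and, in the opposite direction, \<open>r\<close>, along with the two squares that bound
  it, since domain and codomain must be recoverable from a cell.\<close>

datatype ('o, 'm) framing = Framing (fg: 'o) (fx: 'o) (fs: 'm)

datatype ('o, 'm, 'c) fsquare =
  Fsquare (qs: "('o, 'm) framing") (qt: "('o, 'm) framing") (qf: 'm) (ql: 'm) (qr: 'm) (qz: 'c) (qe: 'c)

datatype ('o, 'm, 'c) fcell =
  Fcell (cs: "('o, 'm, 'c) fsquare") (ct: "('o, 'm, 'c) fsquare") (ca: 'c) (cl: 'c) (cr: 'c)

text \<open>The two sides of the duality are arbitrary locally full sub-2-categories here, and \<open>Fra\<close> selects the
  framings in use.\<close>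

locale framings = two_category K for K :: "('o, 'm, 'c) two_cat" (structure) +
  fixes ObG ObX :: "'o set" and ArG ArX :: "'m set" and Fra :: "('o, 'm) framing \<Rightarrow> bool"
  assumes ObG: "A \<in> ObG \<Longrightarrow> A \<in> obj K" and ArG: "f \<in> ArG \<Longrightarrow> f \<in> arr K \<and> src K f \<in> ObG \<and> trg K f \<in> ObG"
    and idG: "A \<in> ObG \<Longrightarrow> id1 K A \<in> ArG"
    and cmpG: "\<lbrakk>f \<in> ArG; g \<in> ArG; trg K f = src K g\<rbrakk> \<Longrightarrow> g \<odot> f \<in> ArG"
    and ObX: "A \<in> ObX \<Longrightarrow> A \<in> obj K" and ArX: "f \<in> ArX \<Longrightarrow> f \<in> arr K \<and> src K f \<in> ObX \<and> trg K f \<in> ObX"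
    and idX: "A \<in> ObX \<Longrightarrow> id1 K A \<in> ArX"
    and cmpX: "\<lbrakk>f \<in> ArX; g \<in> ArX; trg K f = src K g\<rbrakk> \<Longrightarrow> g \<odot> f \<in> ArX"
    and Fra: "Fra w \<Longrightarrow> fg w \<in> ObG \<and> fx w \<in> ObX \<and> fs w \<in> hom K (fg w) (fx w)"
begin

abbreviation "G2 \<equiv> sub2 K ObG ArG"
abbreviation "X2 \<equiv> sub2 K ObX ArX"

lemma G2: "two_category G2"
  by (rule two_category_sub2) (use ObG ArG idG cmpG in \<open>auto intro: two_category_axioms\<close>)

lemma X2: "two_category X2"
  by (rule two_category_sub2) (use ObX ArX idX cmpX in \<open>auto intro: two_category_axioms\<close>)

definition sq :: "('o, 'm, 'c) fsquare \<Rightarrow> bool" where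
  "sq q \<longleftrightarrow> Fra (qs q) \<and> Fra (qt q) \<and> qf q \<in> ArG \<and> qf q \<in> hom K (fg (qs q)) (fg (qt q)) \<and>
     ql q \<in> hom K (fx (qs q)) (fx (qt q)) \<and> qr q \<in> ArX \<and> (\<exists>\<eta>. adjunction K (ql q) (qr q) \<eta> (qe q)) \<and>
     qz q \<in> cells K (fs (qt q) \<odot> qf q) (ql q \<odot> fs (qs q)) \<and> invertible2 K (qz q)"

definition fc :: "('o, 'm, 'c) fcell \<Rightarrow> bool" where
  "fc \<chi> \<longleftrightarrow> sq (cs \<chi>) \<and> sq (ct \<chi>) \<and> qs (ct \<chi>) = qs (cs \<chi>) \<and> qt (ct \<chi>) = qt (cs \<chi>) \<and>
     ca \<chi> \<in> cells K (qf (cs \<chi>)) (qf (ct \<chi>)) \<and> cl \<chi> \<in> cells K (ql (cs \<chi>)) (ql (ct \<chi>)) \<and>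
     cr \<chi> \<in> cells K (qr (ct \<chi>)) (qr (cs \<chi>)) \<and>
     (cl \<chi> \<lhd> fs (qs (cs \<chi>))) \<bullet> qz (cs \<chi>) = qz (ct \<chi>) \<bullet> (fs (qt (cs \<chi>)) \<rhd> ca \<chi>) \<and>
     mate (qe (cs \<chi>)) (qe (ct \<chi>)) (cl \<chi>) (cr \<chi>)"

definition sqcmp :: "('o, 'm, 'c) fsquare \<Rightarrow> ('o, 'm, 'c) fsquare \<Rightarrow> ('o, 'm, 'c) fsquare" where
  "sqcmp q p = Fsquare (qs p) (qt q) (qf q \<odot> qf p) (ql q \<odot> ql p) (qr p \<odot> qr q)
     ((ql q \<rhd> qz p) \<bullet> (qz q \<lhd> qf p)) (qe q \<bullet> (ql q \<rhd> qe p \<lhd> qr q))"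

definition fr2 :: "(('o, 'm) framing, ('o, 'm, 'c) fsquare, ('o, 'm, 'c) fcell) two_cat" where
  "fr2 = \<lparr> obj = {w. Fra w}, arr = {q. sq q}, src = qs, trg = qt, cel = {\<chi>. fc \<chi>}, dom2 = cs, cod2 = ct,
     id1 = (\<lambda>w. Fsquare w w (id1 K (fg w)) (id1 K (fx w)) (id1 K (fx w)) (id2 K (fs w)) (id2 K (id1 K (fx w)))),
     cmp = sqcmp, id2 = (\<lambda>q. Fcell q q (id2 K (qf q)) (id2 K (ql q)) (id2 K (qr q))),
     vcmp = (\<lambda>\<beta> \<alpha>. Fcell (cs \<alpha>) (ct \<beta>) (ca \<beta> \<bullet> ca \<alpha>) (cl \<beta> \<bullet> cl \<alpha>) (cr \<alpha> \<bullet> cr \<beta>)),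
     hcmp = (\<lambda>\<beta> \<alpha>. Fcell (sqcmp (cs \<beta>) (cs \<alpha>)) (sqcmp (ct \<beta>) (ct \<alpha>)) (ca \<beta> \<star> ca \<alpha>) (cl \<beta> \<star> cl \<alpha>) (cr \<alpha> \<star> cr \<beta>)) \<rparr>"

lemma fr2_sel [simp]:
  "w \<in> obj fr2 \<longleftrightarrow> Fra w" "q \<in> arr fr2 \<longleftrightarrow> sq q" "src fr2 = qs" "trg fr2 = qt" "\<chi> \<in> cel fr2 \<longleftrightarrow> fc \<chi>"
  "dom2 fr2 = cs" "cod2 fr2 = ct"
  "id1 fr2 w = Fsquare w w (id1 K (fg w)) (id1 K (fx w)) (id1 K (fx w)) (id2 K (fs w)) (id2 K (id1 K (fx w)))"
  "q \<odot>\<^bsub>fr2\<^esub> p = sqcmp q p" "id2 fr2 q = Fcell q q (id2 K (qf q)) (id2 K (ql q)) (id2 K (qr q))"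
  "\<beta> \<bullet>\<^bsub>fr2\<^esub> \<alpha> = Fcell (cs \<alpha>) (ct \<beta>) (ca \<beta> \<bullet> ca \<alpha>) (cl \<beta> \<bullet> cl \<alpha>) (cr \<alpha> \<bullet> cr \<beta>)"
  "\<beta> \<star>\<^bsub>fr2\<^esub> \<alpha> = Fcell (sqcmp (cs \<beta>) (cs \<alpha>)) (sqcmp (ct \<beta>) (ct \<alpha>)) (ca \<beta> \<star> ca \<alpha>) (cl \<beta> \<star> cl \<alpha>) (cr \<alpha> \<star> cr \<beta>)"
  by (simp_all add: fr2_def)

lemma sqcmp_sel [simp]:
  "qs (sqcmp q p) = qs p" "qt (sqcmp q p) = qt q" "qf (sqcmp q p) = qf q \<odot> qf p" "ql (sqcmp q p) = ql q \<odot> ql p"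
  "qr (sqcmp q p) = qr p \<odot> qr q" "qz (sqcmp q p) = (ql q \<rhd> qz p) \<bullet> (qz q \<lhd> qf p)"
  "qe (sqcmp q p) = qe q \<bullet> (ql q \<rhd> qe p \<lhd> qr q)"
  by (simp_all add: sqcmp_def)

lemma FraD:
  assumes "Fra w"
  shows "fg w \<in> ObG" "fx w \<in> ObX" "fg w \<in> obj K" "fx w \<in> obj K" "fs w \<in> arr K" "src K (fs w) = fg w" "trg K (fs w) = fx w"
  using Fra[OF assms] ObG ObX by auto

lemma sqD:
  assumes "sq q"
  shows "Fra (qs q)" "Fra (qt q)" "qf q \<in> ArG" "qf q \<in> arr K" "src K (qf q) = fg (qs q)" "trg K (qf q) = fg (qt q)"
    "ql q \<in> arr K" "src K (ql q) = fx (qs q)" "trg K (ql q) = fx (qt q)"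
    "qr q \<in> ArX" "qr q \<in> arr K" "src K (qr q) = fx (qt q)" "trg K (qr q) = fx (qs q)"
    "qz q \<in> cel K" "dom2 K (qz q) = fs (qt q) \<odot> qf q" "cod2 K (qz q) = ql q \<odot> fs (qs q)" "invertible2 K (qz q)"
    "qe q \<in> cel K" "dom2 K (qe q) = ql q \<odot> qr q" "cod2 K (qe q) = id1 K (fx (qt q))"
proof -
  obtain \<eta> where a: "adjunction K (ql q) (qr q) \<eta> (qe q)" using assms by (auto simp: sq_def)
  show "Fra (qs q)" "Fra (qt q)" "qf q \<in> ArG" "qf q \<in> arr K" "src K (qf q) = fg (qs q)" "trg K (qf q) = fg (qt q)"
    "ql q \<in> arr K" "src K (ql q) = fx (qs q)" "trg K (ql q) = fx (qt q)"
    "qr q \<in> ArX" "qr q \<in> arr K" "src K (qr q) = fx (qt q)" "trg K (qr q) = fx (qs q)"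
    "qz q \<in> cel K" "dom2 K (qz q) = fs (qt q) \<odot> qf q" "cod2 K (qz q) = ql q \<odot> fs (qs q)" "invertible2 K (qz q)"
    "qe q \<in> cel K" "dom2 K (qe q) = ql q \<odot> qr q" "cod2 K (qe q) = id1 K (fx (qt q))"
    using assms adjunctionD[OF a] by (simp_all add: sq_def)
qed

lemma sq_adj:
  assumes "sq q"
  obtains \<eta> where "adjunction K (ql q) (qr q) \<eta> (qe q)"
  using assms by (auto simp: sq_def)

lemma fcD:
  assumes "fc \<chi>"
  shows "sq (cs \<chi>)" "sq (ct \<chi>)" "qs (ct \<chi>) = qs (cs \<chi>)" "qt (ct \<chi>) = qt (cs \<chi>)"
    "ca \<chi> \<in> cel K" "dom2 K (ca \<chi>) = qf (cs \<chi>)" "cod2 K (ca \<chi>) = qf (ct \<chi>)"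
    "cl \<chi> \<in> cel K" "dom2 K (cl \<chi>) = ql (cs \<chi>)" "cod2 K (cl \<chi>) = ql (ct \<chi>)"
    "cr \<chi> \<in> cel K" "dom2 K (cr \<chi>) = qr (ct \<chi>)" "cod2 K (cr \<chi>) = qr (cs \<chi>)"
    "(cl \<chi> \<lhd> fs (qs (cs \<chi>))) \<bullet> qz (cs \<chi>) = qz (ct \<chi>) \<bullet> (fs (qt (cs \<chi>)) \<rhd> ca \<chi>)"
    "qe (ct \<chi>) \<bullet> (cl \<chi> \<lhd> qr (ct \<chi>)) = qe (cs \<chi>) \<bullet> (ql (cs \<chi>) \<rhd> cr \<chi>)"
proof -
  show a: "sq (cs \<chi>)" "sq (ct \<chi>)" "qs (ct \<chi>) = qs (cs \<chi>)" "qt (ct \<chi>) = qt (cs \<chi>)"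
    "ca \<chi> \<in> cel K" "dom2 K (ca \<chi>) = qf (cs \<chi>)" "cod2 K (ca \<chi>) = qf (ct \<chi>)"
    "cl \<chi> \<in> cel K" "dom2 K (cl \<chi>) = ql (cs \<chi>)" "cod2 K (cl \<chi>) = ql (ct \<chi>)"
    "cr \<chi> \<in> cel K" "dom2 K (cr \<chi>) = qr (ct \<chi>)" "cod2 K (cr \<chi>) = qr (cs \<chi>)"
    "(cl \<chi> \<lhd> fs (qs (cs \<chi>))) \<bullet> qz (cs \<chi>) = qz (ct \<chi>) \<bullet> (fs (qt (cs \<chi>)) \<rhd> ca \<chi>)"
    using assms by (simp_all add: fc_def)
  have "mate (qe (cs \<chi>)) (qe (ct \<chi>)) (cl \<chi>) (cr \<chi>)" using assms by (simp add: fc_def)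
  then show "qe (ct \<chi>) \<bullet> (cl \<chi> \<lhd> qr (ct \<chi>)) = qe (cs \<chi>) \<bullet> (ql (cs \<chi>) \<rhd> cr \<chi>)"
    by (simp add: mate_def a)
qed

lemma fcI:
  assumes "sq (cs \<chi>)" "sq (ct \<chi>)" "qs (ct \<chi>) = qs (cs \<chi>)" "qt (ct \<chi>) = qt (cs \<chi>)"
    "ca \<chi> \<in> cel K" "dom2 K (ca \<chi>) = qf (cs \<chi>)" "cod2 K (ca \<chi>) = qf (ct \<chi>)"
    "cl \<chi> \<in> cel K" "dom2 K (cl \<chi>) = ql (cs \<chi>)" "cod2 K (cl \<chi>) = ql (ct \<chi>)"
    "cr \<chi> \<in> cel K" "dom2 K (cr \<chi>) = qr (ct \<chi>)" "cod2 K (cr \<chi>) = qr (cs \<chi>)"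
    "(cl \<chi> \<lhd> fs (qs (cs \<chi>))) \<bullet> qz (cs \<chi>) = qz (ct \<chi>) \<bullet> (fs (qt (cs \<chi>)) \<rhd> ca \<chi>)"
    "qe (ct \<chi>) \<bullet> (cl \<chi> \<lhd> qr (ct \<chi>)) = qe (cs \<chi>) \<bullet> (ql (cs \<chi>) \<rhd> cr \<chi>)"
  shows "fc \<chi>"
  using assms by (simp add: fc_def mate_def)

lemma sq_id:
  assumes "Fra w"
  shows "sq (Fsquare w w (id1 K (fg w)) (id1 K (fx w)) (id1 K (fx w)) (id2 K (fs w)) (id2 K (id1 K (fx w))))"
proof -
  note [simp] = FraD[OF assms] assms
  have "\<exists>\<eta>. adjunction K (id1 K (fx w)) (id1 K (fx w)) \<eta> (id2 K (id1 K (fx w)))"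
    using adjunction_id[of "fx w"] by auto
  then show ?thesis by (simp add: sq_def idG idX invertible_id2)
qed

lemma sq_cmp:
  assumes p: "sq p" and q: "sq q" and c: "qt p = qs q"
  shows "sq (sqcmp q p)"
proof -
  note [simp] = sqD[OF p] sqD[OF q] c FraD[OF sqD(1)[OF p]] FraD[OF sqD(1)[OF q]] FraD[OF sqD(2)[OF q]]
  obtain \<eta> \<eta>' where "adjunction K (ql p) (qr p) \<eta> (qe p)" "adjunction K (ql q) (qr q) \<eta>' (qe q)"
    using sq_adj[OF p] sq_adj[OF q] by metis
  from adjunction_cmp[OF this] have "\<exists>\<eta>. adjunction K (ql q \<odot> ql p) (qr p \<odot> qr q) \<eta> (qe q \<bullet> (ql q \<rhd> qe p \<lhd> qr q))"
    by auto
  moreover have "invertible2 K ((ql q \<rhd> qz p) \<bullet> (qz q \<lhd> qf p))"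
    by (intro invertible_vcmp invertible_lw invertible_rw) simp_all
  ultimately show ?thesis by (simp add: sq_def cmpG cmpX)
qed

lemma sqcmp_assoc:
  assumes p: "sq p" and q: "sq q" and r: "sq r" and c: "qt p = qs q" "qt q = qs r"
  shows "sqcmp (sqcmp r q) p = sqcmp r (sqcmp q p)"
proof -
  note [simp] = sqD[OF p] sqD[OF q] sqD[OF r] c FraD[OF sqD(1)[OF p]] FraD[OF sqD(1)[OF q]] FraD[OF sqD(2)[OF q]]
    FraD[OF sqD(1)[OF r]] FraD[OF sqD(2)[OF r]]
  show ?thesis by (rule fsquare.expand) simp
qed

lemma fc_vcmp:
  assumes x: "fc \<chi>" and y: "fc \<xi>" and c: "ct \<chi> = cs \<xi>"
  shows "fc (Fcell (cs \<chi>) (ct \<xi>) (ca \<xi> \<bullet> ca \<chi>) (cl \<xi> \<bullet> cl \<chi>) (cr \<chi> \<bullet> cr \<xi>))"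
proof -
  let ?p = "cs \<chi>" let ?q = "cs \<xi>" let ?r = "ct \<xi>"
  have sq [simp]: "sq ?p" "sq ?q" "sq ?r" using fcD(1,2)[OF x] fcD(1,2)[OF y] c by simp_all
  have e [simp]: "qs ?q = qs ?p" "qt ?q = qt ?p" "qs ?r = qs ?p" "qt ?r = qt ?p"
    using fcD(3,4)[OF x] fcD(3,4)[OF y] c by simp_all
  note [simp] = sqD(4-9,11-)[OF sq(1)] FraD[OF sqD(1)[OF sq(1)]] FraD[OF sqD(2)[OF sq(1)]]
  have [simp]: "qf ?q \<in> arr K" "src K (qf ?q) = fg (qs ?p)" "trg K (qf ?q) = fg (qt ?p)"
    "qf ?r \<in> arr K" "src K (qf ?r) = fg (qs ?p)" "trg K (qf ?r) = fg (qt ?p)"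
    "ql ?q \<in> arr K" "src K (ql ?q) = fx (qs ?p)" "trg K (ql ?q) = fx (qt ?p)"
    "ql ?r \<in> arr K" "src K (ql ?r) = fx (qs ?p)" "trg K (ql ?r) = fx (qt ?p)"
    "qr ?q \<in> arr K" "src K (qr ?q) = fx (qt ?p)" "trg K (qr ?q) = fx (qs ?p)"
    "qr ?r \<in> arr K" "src K (qr ?r) = fx (qt ?p)" "trg K (qr ?r) = fx (qs ?p)"
    "qz ?q \<in> cel K" "dom2 K (qz ?q) = fs (qt ?p) \<odot> qf ?q" "cod2 K (qz ?q) = ql ?q \<odot> fs (qs ?p)"
    "qz ?r \<in> cel K" "dom2 K (qz ?r) = fs (qt ?p) \<odot> qf ?r" "cod2 K (qz ?r) = ql ?r \<odot> fs (qs ?p)"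
    "qe ?q \<in> cel K" "dom2 K (qe ?q) = ql ?q \<odot> qr ?q" "cod2 K (qe ?q) = id1 K (fx (qt ?p))"
    "qe ?r \<in> cel K" "dom2 K (qe ?r) = ql ?r \<odot> qr ?r" "cod2 K (qe ?r) = id1 K (fx (qt ?p))"
    using sqD[OF sq(2)] sqD[OF sq(3)] by simp_all
  note [simp] = fcD(5-13)[OF x, unfolded c] fcD(5-13)[OF y]
  have z: "(cl \<chi> \<lhd> fs (qs ?p)) \<bullet> qz ?p = qz ?q \<bullet> (fs (qt ?p) \<rhd> ca \<chi>)"
    "(cl \<xi> \<lhd> fs (qs ?p)) \<bullet> qz ?q = qz ?r \<bullet> (fs (qt ?p) \<rhd> ca \<xi>)"
    using fcD(14)[OF x] fcD(14)[OF y] c by simp_all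
  have m: "qe ?q \<bullet> (cl \<chi> \<lhd> qr ?q) = qe ?p \<bullet> (ql ?p \<rhd> cr \<chi>)"
    "qe ?r \<bullet> (cl \<xi> \<lhd> qr ?r) = qe ?q \<bullet> (ql ?q \<rhd> cr \<xi>)"
    using fcD(15)[OF x] fcD(15)[OF y] c by simp_all
  have s: "(ql ?q \<rhd> cr \<xi>) \<bullet> (cl \<chi> \<lhd> qr ?r) = (cl \<chi> \<lhd> qr ?q) \<bullet> (ql ?p \<rhd> cr \<xi>)"
    using slide[of "cr \<xi>" "qr ?r" "qr ?q" "cl \<chi>" "ql ?p" "ql ?q"] by simp
  show ?thesis
    by (rule fcI) (simp_all add: z(1) extend_eq[OF z(2)] extend_eq[OF m(2)] s extend_eq[OF m(1)])
qed

lemma fc_hcmp: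
  assumes x: "fc \<chi>" and y: "fc \<xi>" and c: "qt (cs \<chi>) = qs (cs \<xi>)"
  shows "fc (Fcell (sqcmp (cs \<xi>) (cs \<chi>)) (sqcmp (ct \<xi>) (ct \<chi>)) (ca \<xi> \<star> ca \<chi>) (cl \<xi> \<star> cl \<chi>) (cr \<chi> \<star> cr \<xi>))"
proof -
  let ?p = "cs \<chi>" let ?p' = "ct \<chi>" let ?q = "cs \<xi>" let ?q' = "ct \<xi>"
  have sq [simp]: "sq ?p" "sq ?p'" "sq ?q" "sq ?q'" using fcD(1,2)[OF x] fcD(1,2)[OF y] by simp_all
  have e [simp]: "qs ?p' = qs ?p" "qt ?p = qs ?q" "qt ?p' = qs ?q" "qs ?q' = qs ?q" "qt ?q' = qt ?q"
    using fcD(3,4)[OF x] fcD(3,4)[OF y] c by simp_all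
  note [simp] = FraD[OF sqD(1)[OF sq(1)]] FraD[OF sqD(1)[OF sq(3)]] FraD[OF sqD(2)[OF sq(3)]]
    sqD(4-9,11-)[OF sq(1), unfolded e] sqD(4-9,11-)[OF sq(2), unfolded e]
    sqD(4-9,11-)[OF sq(3), unfolded e] sqD(4-9,11-)[OF sq(4), unfolded e]
    fcD(5-13)[OF x] fcD(5-13)[OF y]
  let ?s = "fs (qs ?p)" let ?s' = "fs (qs ?q)" let ?s'' = "fs (qt ?q)"
  have z: "(cl \<chi> \<lhd> ?s) \<bullet> qz ?p = qz ?p' \<bullet> (?s' \<rhd> ca \<chi>)" "(cl \<xi> \<lhd> ?s') \<bullet> qz ?q = qz ?q' \<bullet> (?s'' \<rhd> ca \<xi>)"
    using fcD(14)[OF x] fcD(14)[OF y] by simp_all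
  have m: "qe ?p' \<bullet> (cl \<chi> \<lhd> qr ?p') = qe ?p \<bullet> (ql ?p \<rhd> cr \<chi>)" "qe ?q' \<bullet> (cl \<xi> \<lhd> qr ?q') = qe ?q \<bullet> (ql ?q \<rhd> cr \<xi>)"
    using fcD(15)[OF x] fcD(15)[OF y] by simp_all
  have Z: "((cl \<xi> \<star> cl \<chi>) \<lhd> ?s) \<bullet> (ql ?q \<rhd> qz ?p) \<bullet> (qz ?q \<lhd> qf ?p)
      = (ql ?q' \<rhd> qz ?p') \<bullet> (qz ?q' \<lhd> qf ?p') \<bullet> (?s'' \<rhd> (ca \<xi> \<star> ca \<chi>))"
  proof -
    have s1: "(cl \<xi> \<lhd> ql ?p \<lhd> ?s) \<bullet> (ql ?q \<rhd> qz ?p) = (ql ?q' \<rhd> qz ?p) \<bullet> (cl \<xi> \<lhd> ?s' \<lhd> qf ?p)"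
      using slide[of "qz ?p" "?s' \<odot> qf ?p" "ql ?p \<odot> ?s" "cl \<xi>" "ql ?q" "ql ?q'"] by simp
    have s2: "(ql ?q' \<rhd> (cl \<chi> \<lhd> ?s)) \<bullet> (ql ?q' \<rhd> qz ?p) = (ql ?q' \<rhd> qz ?p') \<bullet> (ql ?q' \<rhd> ?s' \<rhd> ca \<chi>)"
      using arg_cong[OF z(1), of "\<lambda>x. ql ?q' \<rhd> x"] by simp
    have s3: "(cl \<xi> \<lhd> ?s' \<lhd> qf ?p) \<bullet> (qz ?q \<lhd> qf ?p) = (qz ?q' \<lhd> qf ?p) \<bullet> (?s'' \<rhd> ca \<xi> \<lhd> qf ?p)"
      using arg_cong[OF z(2), of "\<lambda>x. x \<lhd> qf ?p"] by simp
    have s4: "(ql ?q' \<rhd> ?s' \<rhd> ca \<chi>) \<bullet> (qz ?q' \<lhd> qf ?p) = (qz ?q' \<lhd> qf ?p') \<bullet> (?s'' \<rhd> qf ?q' \<rhd> ca \<chi>)"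
      using slide[of "ca \<chi>" "qf ?p" "qf ?p'" "qz ?q'" "?s'' \<odot> qf ?q'" "ql ?q' \<odot> ?s'"] by simp
    show ?thesis
      by (simp add: hcmp_eq2[of "cl \<chi>"] hcmp_eq2[of "ca \<chi>"] extend_eq[OF s1] extend_eq[OF s2] s3 extend_eq[OF s4])
  qed
  have M: "qe ?q' \<bullet> (ql ?q' \<rhd> (qe ?p' \<lhd> qr ?q')) \<bullet> ((cl \<xi> \<star> cl \<chi>) \<lhd> qr ?p' \<lhd> qr ?q')
      = qe ?q \<bullet> (ql ?q \<rhd> (qe ?p \<lhd> qr ?q)) \<bullet> (ql ?q \<rhd> ql ?p \<rhd> (cr \<chi> \<star> cr \<xi>))"
  proof -
    have s1: "(ql ?q' \<rhd> (qe ?p' \<lhd> qr ?q')) \<bullet> (ql ?q' \<rhd> (cl \<chi> \<lhd> qr ?p' \<lhd> qr ?q')) =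
       (ql ?q' \<rhd> (qe ?p \<lhd> qr ?q')) \<bullet> (ql ?q' \<rhd> ql ?p \<rhd> (cr \<chi> \<lhd> qr ?q'))"
      using arg_cong[OF m(1), of "\<lambda>x. ql ?q' \<rhd> x \<lhd> qr ?q'"] by simp
    have s2: "(ql ?q' \<rhd> ql ?p \<rhd> (cr \<chi> \<lhd> qr ?q')) \<bullet> (cl \<xi> \<lhd> ql ?p \<lhd> qr ?p' \<lhd> qr ?q') =
       (cl \<xi> \<lhd> ql ?p \<lhd> qr ?p \<lhd> qr ?q') \<bullet> (ql ?q \<rhd> ql ?p \<rhd> (cr \<chi> \<lhd> qr ?q'))"
      using slide[of "ql ?p \<rhd> cr \<chi> \<lhd> qr ?q'" "ql ?p \<odot> qr ?p' \<odot> qr ?q'" "ql ?p \<odot> qr ?p \<odot> qr ?q'" "cl \<xi>" "ql ?q" "ql ?q'"]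
      by simp
    have s3: "(ql ?q' \<rhd> (qe ?p \<lhd> qr ?q')) \<bullet> (cl \<xi> \<lhd> ql ?p \<lhd> qr ?p \<lhd> qr ?q') =
       (cl \<xi> \<lhd> qr ?q') \<bullet> (ql ?q \<rhd> (qe ?p \<lhd> qr ?q'))"
      using slide[of "qe ?p \<lhd> qr ?q'" "ql ?p \<odot> qr ?p \<odot> qr ?q'" "qr ?q'" "cl \<xi>" "ql ?q" "ql ?q'"] by simp
    have s4: "(ql ?q \<rhd> cr \<xi>) \<bullet> (ql ?q \<rhd> (qe ?p \<lhd> qr ?q')) =
       (ql ?q \<rhd> (qe ?p \<lhd> qr ?q)) \<bullet> (ql ?q \<rhd> ql ?p \<rhd> qr ?p \<rhd> cr \<xi>)"
      using arg_cong[OF slide[of "cr \<xi>" "qr ?q'" "qr ?q" "qe ?p" "ql ?p \<odot> qr ?p" "id1 K (fx (qs ?q))"], of "\<lambda>x. ql ?q \<rhd> x"]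
      by simp
    show ?thesis
      by (simp add: hcmp_eq2[of "cl \<chi>"] hcmp_eq2[of "cr \<xi>"] extend_eq[OF s1] s2 extend_eq[OF s3]
          extend_eq[OF m(2)] extend_eq[OF s4])
  qed
  show ?thesis
    by (rule fcI) (simp_all add: sq_cmp Z M)
qed

lemma fr2: "two_category fr2"
proof
  fix q assume "q \<in> arr fr2"
  then have q: "sq q" by simp
  note [simp] = sqD[OF q] FraD[OF sqD(1)[OF q]] FraD[OF sqD(2)[OF q]] q
  show "src fr2 q \<in> obj fr2" "trg fr2 q \<in> obj fr2" by simp_all
  have "fc (Fcell q q (id2 K (qf q)) (id2 K (ql q)) (id2 K (qr q)))" by (rule fcI) simp_all
  then show "id2 fr2 q \<in> cells fr2 q q" by simp
next
  fix w assume "w \<in> obj fr2"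
  then show "id1 fr2 w \<in> hom fr2 w w" by (simp add: sq_id)
next
  fix p q u v t assume "p \<in> hom fr2 u v" "q \<in> hom fr2 v t"
  then have "sq p" "sq q" and [simp]: "qs p = u" "qt p = v" "qs q = v" "qt q = t" by simp_all
  note [simp] = sqD[OF this(1)] sqD[OF this(2)] this(1,2)
  show "q \<odot>\<^bsub>fr2\<^esub> p \<in> hom fr2 u t" by (simp add: sq_cmp)
  show "id2 fr2 q \<star>\<^bsub>fr2\<^esub> id2 fr2 p = id2 fr2 (q \<odot>\<^bsub>fr2\<^esub> p)" by simp
next
  fix p q r u v t s assume "p \<in> hom fr2 u v" "q \<in> hom fr2 v t" "r \<in> hom fr2 t s"
  then show "(r \<odot>\<^bsub>fr2\<^esub> q) \<odot>\<^bsub>fr2\<^esub> p = r \<odot>\<^bsub>fr2\<^esub> q \<odot>\<^bsub>fr2\<^esub> p" by (simp add: sqcmp_assoc)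
next
  fix q u v assume "q \<in> hom fr2 u v"
  then have q: "sq q" and [simp]: "qs q = u" "qt q = v" by simp_all
  note [simp] = sqD[OF q, simplified] FraD[OF sqD(1)[OF q], simplified] FraD[OF sqD(2)[OF q], simplified]
  show "id1 fr2 v \<odot>\<^bsub>fr2\<^esub> q = q" "q \<odot>\<^bsub>fr2\<^esub> id1 fr2 u = q" by (rule fsquare.expand; simp)+
next
  fix \<alpha> \<beta> p q r assume "\<alpha> \<in> cells fr2 p q" "\<beta> \<in> cells fr2 q r"
  then show "\<beta> \<bullet>\<^bsub>fr2\<^esub> \<alpha> \<in> cells fr2 p r" using fc_vcmp[of \<alpha> \<beta>] by simp
next
  fix \<alpha> \<beta> \<gamma> p q r t assume "\<alpha> \<in> cells fr2 p q" "\<beta> \<in> cells fr2 q r" "\<gamma> \<in> cells fr2 r t"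
  then have a: "fc \<alpha>" "fc \<beta>" "fc \<gamma>" and [simp]: "cs \<alpha> = p" "ct \<alpha> = q" "cs \<beta> = q" "ct \<beta> = r" "cs \<gamma> = r" "ct \<gamma> = t" by simp_all
  note [simp] = fcD(5-13)[OF a(1)] fcD(5-13)[OF a(2)] fcD(5-13)[OF a(3)]
  show "(\<gamma> \<bullet>\<^bsub>fr2\<^esub> \<beta>) \<bullet>\<^bsub>fr2\<^esub> \<alpha> = \<gamma> \<bullet>\<^bsub>fr2\<^esub> \<beta> \<bullet>\<^bsub>fr2\<^esub> \<alpha>" by simp
next
  fix \<alpha> p q assume "\<alpha> \<in> cells fr2 p q"
  then have a: "fc \<alpha>" and e [simp]: "cs \<alpha> = p" "ct \<alpha> = q" by simp_all
  note [simp] = fcD(5-13)[OF a] FraD[OF sqD(1)[OF fcD(1)[OF a]]] FraD[OF sqD(2)[OF fcD(1)[OF a]]]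
     sqD[OF fcD(1)[OF a]] fcD(3,4)[OF a]
  have t: "qs q = qs p" "qt q = qt p" "sq q" "sq p" using fcD(1-4)[OF a] by simp_all
  note [simp] = t sqD[OF t(3)]
  note [simp] = FraD[OF sqD(1)[OF fcD(1)[OF a]], unfolded e] FraD[OF sqD(2)[OF fcD(1)[OF a]], unfolded e]
     sqD[OF fcD(1)[OF a], unfolded e]
  have [simp]: "src K (qf q) = fg (qs p)" "trg K (qf q) = fg (qt p)" "src K (ql q) = fx (qs p)" "trg K (ql q) = fx (qt p)"
    "src K (qr q) = fx (qt p)" "trg K (qr q) = fx (qs p)"
    using sqD[OF t(3)] t by simp_all
  show "id2 fr2 q \<bullet>\<^bsub>fr2\<^esub> \<alpha> = \<alpha>" "\<alpha> \<bullet>\<^bsub>fr2\<^esub> id2 fr2 p = \<alpha>" by (rule fcell.expand; simp)+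
  have i: "sqcmp (Fsquare (qt p) (qt p) (id1 K (fg (qt p))) (id1 K (fx (qt p))) (id1 K (fx (qt p))) (id2 K (fs (qt p))) (id2 K (id1 K (fx (qt p))))) x = x"
    "sqcmp x (Fsquare (qs p) (qs p) (id1 K (fg (qs p))) (id1 K (fx (qs p))) (id1 K (fx (qs p))) (id2 K (fs (qs p))) (id2 K (id1 K (fx (qs p))))) = x"
    if x: "sq x" "qs x = qs p" "qt x = qt p" for x
  proof -
    note [simp] = x sqD[OF x(1), unfolded x(2,3)]
    show "sqcmp (Fsquare (qt p) (qt p) (id1 K (fg (qt p))) (id1 K (fx (qt p))) (id1 K (fx (qt p))) (id2 K (fs (qt p))) (id2 K (id1 K (fx (qt p))))) x = x"
      "sqcmp x (Fsquare (qs p) (qs p) (id1 K (fg (qs p))) (id1 K (fx (qs p))) (id1 K (fx (qs p))) (id2 K (fs (qs p))) (id2 K (id1 K (fx (qs p))))) = x"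
      by (rule fsquare.expand; simp)+
  qed
  have h: "id2 K (id1 K A) \<star> x = x" "x \<star> id2 K (id1 K B) = x" if "x \<in> cel K" "trg K (dom2 K x) = A" "src K (dom2 K x) = B" for x A B
    using that lw_id1[of x] rw_id1[of x] by (simp_all add: lw_def rw_def)
  show "id2 fr2 (id1 fr2 (trg fr2 p)) \<star>\<^bsub>fr2\<^esub> \<alpha> = \<alpha>" "\<alpha> \<star>\<^bsub>fr2\<^esub> id2 fr2 (id1 fr2 (src fr2 p)) = \<alpha>"
    by (rule fcell.expand; simp add: i h)+
next
  fix \<alpha> \<beta> p q r t assume "\<alpha> \<in> cells fr2 p q" "\<beta> \<in> cells fr2 r t" "trg fr2 p = src fr2 r"
  then show "\<beta> \<star>\<^bsub>fr2\<^esub> \<alpha> \<in> cells fr2 (r \<odot>\<^bsub>fr2\<^esub> p) (t \<odot>\<^bsub>fr2\<^esub> q)" using fc_hcmp[of \<alpha> \<beta>] by simp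
next
  fix \<alpha> \<beta> \<gamma> p p' q q' r r' assume "\<alpha> \<in> cells fr2 p p'" "\<beta> \<in> cells fr2 q q'" "\<gamma> \<in> cells fr2 r r'"
     "trg fr2 p = src fr2 q" "trg fr2 q = src fr2 r"
  then have a: "fc \<alpha>" "fc \<beta>" "fc \<gamma>" and e [simp]: "cs \<alpha> = p" "ct \<alpha> = p'" "cs \<beta> = q" "ct \<beta> = q'" "cs \<gamma> = r" "ct \<gamma> = r'"
    "qt p = qs q" "qt q = qs r" by simp_all
  have t [simp]: "sq p" "sq q" "sq r" "sq p'" "sq q'" "sq r'" "qs p' = qs p" "qt p' = qs q" "qs q' = qs q" "qt q' = qs r"
     "qs r' = qs r" "qt r' = qt r"
    using fcD(1-4)[OF a(1)] fcD(1-4)[OF a(2)] fcD(1-4)[OF a(3)] by simp_all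
  note [simp] = fcD(5-13)[OF a(1)] fcD(5-13)[OF a(2)] fcD(5-13)[OF a(3)] sqcmp_assoc hcmp_assoc'
    sqD(4-9,11-13)[OF t(1), unfolded e] sqD(4-9,11-13)[OF t(2), unfolded e] sqD(4-9,11-13)[OF t(3), unfolded e]
    sqD(11-13)[OF t(4), unfolded t(7-12)] sqD(11-13)[OF t(5), unfolded t(7-12)] sqD(11-13)[OF t(6), unfolded t(7-12)]
  show "(\<gamma> \<star>\<^bsub>fr2\<^esub> \<beta>) \<star>\<^bsub>fr2\<^esub> \<alpha> = \<gamma> \<star>\<^bsub>fr2\<^esub> \<beta> \<star>\<^bsub>fr2\<^esub> \<alpha>" by simp
next
  fix \<alpha> \<alpha>' \<beta> \<beta>' p p' p'' q q' q''
  assume "\<alpha> \<in> cells fr2 p p'" "\<alpha>' \<in> cells fr2 p' p''" "\<beta> \<in> cells fr2 q q'" "\<beta>' \<in> cells fr2 q' q''" "trg fr2 p = src fr2 q"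
  then have a: "fc \<alpha>" "fc \<alpha>'" "fc \<beta>" "fc \<beta>'" and e [simp]: "cs \<alpha> = p" "ct \<alpha> = p'" "cs \<alpha>' = p'" "ct \<alpha>' = p''"
    "cs \<beta> = q" "ct \<beta> = q'" "cs \<beta>' = q'" "ct \<beta>' = q''" "qt p = qs q" by simp_all
  have t [simp]: "sq p" "sq q" "sq p'" "sq q'" "qs p' = qs p" "qt p' = qs q" "qs q' = qs q" "qt q' = qt q"
    using fcD(1-4)[OF a(1)] fcD(1-4)[OF a(3)] by simp_all
  have u [simp]: "sq p''" "sq q''" "qs p'' = qs p" "qt p'' = qs q" "qs q'' = qs q" "qt q'' = qt q"
    using fcD(1-4)[OF a(2)] fcD(1-4)[OF a(4)] by simp_all
  note [simp] = fcD(5-13)[OF a(1)] fcD(5-13)[OF a(2)] fcD(5-13)[OF a(3)] fcD(5-13)[OF a(4)] interchange'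
    sqD(11-13)[OF u(1), unfolded u(3-6)] sqD(11-13)[OF u(2), unfolded u(3-6)]
    sqD(4-9,11-13)[OF t(1), unfolded e] sqD(4-9,11-13)[OF t(2), unfolded e]
    sqD(4-9,11-13)[OF t(3), unfolded t(5-8)] sqD(4-9,11-13)[OF t(4), unfolded t(5-8)]
  show "(\<beta>' \<bullet>\<^bsub>fr2\<^esub> \<beta>) \<star>\<^bsub>fr2\<^esub> (\<alpha>' \<bullet>\<^bsub>fr2\<^esub> \<alpha>) = (\<beta>' \<star>\<^bsub>fr2\<^esub> \<alpha>') \<bullet>\<^bsub>fr2\<^esub> (\<beta> \<star>\<^bsub>fr2\<^esub> \<alpha>)" by simp
next
  fix \<alpha> assume "\<alpha> \<in> cel fr2"
  then have a: "fc \<alpha>" by simp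
  show "dom2 fr2 \<alpha> \<in> arr fr2" "cod2 fr2 \<alpha> \<in> arr fr2" "src fr2 (dom2 fr2 \<alpha>) = src fr2 (cod2 fr2 \<alpha>)"
    "trg fr2 (dom2 fr2 \<alpha>) = trg fr2 (cod2 fr2 \<alpha>)" using fcD[OF a] by simp_all
qed

text \<open>Squares and cells of framings point in the direction of \<open>f\<close> and \<open>l\<close>, which is opposite to that of \<open>r\<close>. The
  legs of the span therefore start at the coop.\<close>

lemma strict_G: "strict_functor (coop fr2) (coop G2) fg qf ca"
proof -
  interpret W: two_category "coop fr2" by (rule two_category_coop[OF fr2])
  interpret A: two_category "coop G2" by (rule two_category_coop[OF G2])
  show ?thesis by unfold_locales (auto simp: sqD FraD fcD)
qed

lemma strict_X: "strict_functor (coop fr2) X2 fx qr cr"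
proof -
  interpret W: two_category "coop fr2" by (rule two_category_coop[OF fr2])
  interpret A: two_category X2 by (rule X2)
  show ?thesis by unfold_locales (auto simp: sqD FraD fcD)
qed

end

text \<open>Density of a frame makes a 2-cell between left adjoints determined by its restriction along the frame, and
  full faithfulness identifies that restriction with a 2-cell between the components \<open>f\<close>. The remaining two
  conditions say that 1-cells lift along both projections.\<close>

locale dense_framings = framings +
  assumes fs_ff: "Fra w \<Longrightarrow> fully_faithful1 K (fs w)"
    and fs_dense: "Fra w \<Longrightarrow> lext (fs w) (id1 K (fx w))"
    and lift_f: "\<lbrakk>Fra w; Fra w'; f \<in> ArG; src K f = fg w; trg K f = fg w'\<rbrakk>
      \<Longrightarrow> \<exists>q. sq q \<and> qs q = w \<and> qt q = w' \<and> qf q = f"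
    and lift_r: "\<lbrakk>Fra w; Fra w'; r \<in> ArX; src K r = fx w'; trg K r = fx w\<rbrakk>
      \<Longrightarrow> \<exists>q. sq q \<and> qs q = w \<and> qt q = w' \<and> qr q = r"
begin

lemma sq_lext:
  assumes q: "sq q"
  shows "lext (fs (qs q)) (ql q)"
proof -
  obtain \<eta> where "adjunction K (ql q) (qr q) \<eta> (qe q)" using q by (rule sq_adj)
  from lext_left_adjoint[OF adjointI[OF this] fs_dense[OF sqD(1)[OF q]]]
  show ?thesis using sqD[OF q] FraD[OF sqD(1)[OF q]] by simp
qed

text \<open>The component on \<open>l\<close> is determined by \<open>\<alpha>\<close> because \<open>l\<close> is an extension along the frame, and the component
  on \<open>r\<close> is its mate.\<close>

lemma cell_lift_f:
  assumes p: "sq p" and q: "sq q" and e: "qs q = qs p" "qt q = qt p"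
    and a: "\<alpha> \<in> cel K" "dom2 K \<alpha> = qf p" "cod2 K \<alpha> = qf q"
  shows "\<exists>!\<chi>. (fc \<chi> \<and> cs \<chi> = p \<and> ct \<chi> = q) \<and> ca \<chi> = \<alpha>"
proof -
  note [simp] = sqD[OF p] sqD[OF q, unfolded e] FraD[OF sqD(1)[OF p]] FraD[OF sqD(2)[OF p]] e a p q
  obtain \<eta> where ap: "adjunction K (ql p) (qr p) \<eta> (qe p)" using p by (rule sq_adj)
  obtain \<eta>' where aq: "adjunction K (ql q) (qr q) \<eta>' (qe q)" using q by (rule sq_adj)
  let ?s = "fs (qs p)" let ?s' = "fs (qt p)"
  let ?\<gamma> = "qz q \<bullet> (?s' \<rhd> \<alpha>) \<bullet> inv2 K (qz p)"
  obtain l where l [simp]: "l \<in> cel K" "dom2 K l = ql p" "cod2 K l = ql q" and le: "(l \<lhd> ?s) \<bullet> id2 K (ql p \<odot> ?s) = ?\<gamma>"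
    using is_lan_ex[OF sq_lext[OF p], of "ql q" ?\<gamma>] by auto
  have le': "l \<lhd> ?s = ?\<gamma>" using le by simp
  define r where "r = conj_right K \<eta> (qe q) (qr p) (qr q) l"
  have r: "r \<in> cells K (qr q) (qr p)" "mate (qe p) (qe q) l r"
    using mate_conj_right[OF ap aq, of l] by (simp_all add: r_def)
  then have [simp]: "r \<in> cel K" "dom2 K r = qr q" "cod2 K r = qr p" by simp_all
  show ?thesis
  proof (rule ex1I[of _ "Fcell p q \<alpha> l r"])
    show "(fc (Fcell p q \<alpha> l r) \<and> cs (Fcell p q \<alpha> l r) = p \<and> ct (Fcell p q \<alpha> l r) = q) \<and> ca (Fcell p q \<alpha> l r) = \<alpha>"
      using r(2) by (simp add: fc_def le')
  next
    fix \<chi> assume "(fc \<chi> \<and> cs \<chi> = p \<and> ct \<chi> = q) \<and> ca \<chi> = \<alpha>"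
    then have x: "fc \<chi>" and [simp]: "cs \<chi> = p" "ct \<chi> = q" "ca \<chi> = \<alpha>" by simp_all
    note [simp] = fcD(8-13)[OF x]
    have z: "(cl \<chi> \<lhd> ?s) \<bullet> qz p = qz q \<bullet> (?s' \<rhd> \<alpha>)" using fcD(14)[OF x] by simp
    have "cl \<chi> \<lhd> ?s = ?\<gamma>" using arg_cong[OF z, of "\<lambda>x. x \<bullet> inv2 K (qz p)"] by simp
    then have L: "cl \<chi> = l" by (intro is_lan_unique[OF sq_lext[OF p], of "cl \<chi>" l]) (simp_all add: le')
    have "mate (qe p) (qe q) l (cr \<chi>)" using x L by (simp add: fc_def)
    then have "cr \<chi> = r" unfolding r_def by (intro mate_unique_right[OF ap aq]) simp_all
    then show "\<chi> = Fcell p q \<alpha> l r" using L by (intro fcell.expand) simp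
  qed
qed

text \<open>The component on \<open>l\<close> is the mate of the given 2-cell, and its restriction along the frame comes from a unique
  2-cell between the components \<open>f\<close> because the target frame is fully faithful.\<close>

lemma cell_lift_r:
  assumes p: "sq p" and q: "sq q" and e: "qs q = qs p" "qt q = qt p"
    and a: "r \<in> cel K" "dom2 K r = qr q" "cod2 K r = qr p"
  shows "\<exists>!\<chi>. (fc \<chi> \<and> cs \<chi> = p \<and> ct \<chi> = q) \<and> cr \<chi> = r"
proof -
  note [simp] = sqD[OF p] sqD[OF q, unfolded e] FraD[OF sqD(1)[OF p]] FraD[OF sqD(2)[OF p]] e a p q
  obtain \<eta> where ap: "adjunction K (ql p) (qr p) \<eta> (qe p)" using p by (rule sq_adj)
  obtain \<eta>' where aq: "adjunction K (ql q) (qr q) \<eta>' (qe q)" using q by (rule sq_adj)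
  let ?s = "fs (qs p)" let ?s' = "fs (qt p)"
  define l where "l = conj_left K \<eta>' (qe p) (ql q) (ql p) r"
  have l: "l \<in> cells K (ql p) (ql q)" "mate (qe p) (qe q) l r"
    using mate_conj_left[OF ap aq, of r] by (simp_all add: l_def)
  then have [simp]: "l \<in> cel K" "dom2 K l = ql p" "cod2 K l = ql q" by simp_all
  let ?\<gamma> = "inv2 K (qz q) \<bullet> (l \<lhd> ?s) \<bullet> qz p"
  obtain \<alpha> where [simp]: "\<alpha> \<in> cel K" "dom2 K \<alpha> = qf p" "cod2 K \<alpha> = qf q" and ae: "?s' \<rhd> \<alpha> = ?\<gamma>"
    using ff_full[OF fs_ff[OF sqD(2)[OF p]], of "qf p" "qf q" ?\<gamma>] by auto
  show ?thesis
  proof (rule ex1I[of _ "Fcell p q \<alpha> l r"])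
    show "(fc (Fcell p q \<alpha> l r) \<and> cs (Fcell p q \<alpha> l r) = p \<and> ct (Fcell p q \<alpha> l r) = q) \<and> cr (Fcell p q \<alpha> l r) = r"
      using l(2) by (simp add: fc_def ae)
  next
    fix \<chi> assume "(fc \<chi> \<and> cs \<chi> = p \<and> ct \<chi> = q) \<and> cr \<chi> = r"
    then have x: "fc \<chi>" and [simp]: "cs \<chi> = p" "ct \<chi> = q" "cr \<chi> = r" by simp_all
    note [simp] = fcD(5-10)[OF x]
    have "mate (qe p) (qe q) (cl \<chi>) r" using x by (simp add: fc_def)
    then have L: "cl \<chi> = l" unfolding l_def by (intro mate_unique_left[OF ap aq]) simp_all
    have z: "(l \<lhd> ?s) \<bullet> qz p = qz q \<bullet> (?s' \<rhd> ca \<chi>)" using fcD(14)[OF x] L by simp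
    have "?s' \<rhd> ca \<chi> = ?s' \<rhd> \<alpha>" by (simp add: ae z)
    then have "ca \<chi> = \<alpha>" by (intro ff_faithful[OF fs_ff[OF sqD(2)[OF p]], of "ca \<chi>" \<alpha>]) simp_all
    then show "\<chi> = Fcell p q \<alpha> l r" using L by (intro fcell.expand) simp
  qed
qed

lemma projection_G: "projection (coop fr2) (coop G2) fg qf ca"
proof -
  interpret strict_functor "coop fr2" "coop G2" fg qf ca by (rule strict_G)
  show ?thesis
  proof unfold_locales
    fix w w' f assume "w \<in> obj (coop fr2)" "w' \<in> obj (coop fr2)" "f \<in> hom (coop G2) (fg w) (fg w')"
    then show "\<exists>p \<in> hom (coop fr2) w w'. qf p = f" using lift_f[of w' w f] by auto
  next
    fix p q \<alpha>
    assume "p \<in> arr (coop fr2)" "q \<in> arr (coop fr2)" "src (coop fr2) q = src (coop fr2) p"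
      "trg (coop fr2) q = trg (coop fr2) p" "\<alpha> \<in> cells (coop G2) (qf p) (qf q)"
    then have "\<exists>!\<chi>. (fc \<chi> \<and> cs \<chi> = q \<and> ct \<chi> = p) \<and> ca \<chi> = \<alpha>"
      by (intro cell_lift_f) simp_all
    then show "\<exists>!\<chi>. \<chi> \<in> cells (coop fr2) p q \<and> ca \<chi> = \<alpha>" by (simp add: conj_commute conj_left_commute)
  qed
qed

lemma projection_X: "projection (coop fr2) X2 fx qr cr"
proof -
  interpret strict_functor "coop fr2" X2 fx qr cr by (rule strict_X)
  show ?thesis
  proof unfold_locales
    fix w w' f assume "w \<in> obj (coop fr2)" "w' \<in> obj (coop fr2)" "f \<in> hom X2 (fx w) (fx w')"
    then show "\<exists>p \<in> hom (coop fr2) w w'. qr p = f" using lift_r[of w' w f] by auto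
  next
    fix p q \<alpha>
    assume "p \<in> arr (coop fr2)" "q \<in> arr (coop fr2)" "src (coop fr2) q = src (coop fr2) p"
      "trg (coop fr2) q = trg (coop fr2) p" "\<alpha> \<in> cells X2 (qr p) (qr q)"
    then have "\<exists>!\<chi>. (fc \<chi> \<and> cs \<chi> = q \<and> ct \<chi> = p) \<and> cr \<chi> = \<alpha>"
      by (intro cell_lift_r) simp_all
    then show "\<exists>!\<chi>. \<chi> \<in> cells (coop fr2) p q \<and> cr \<chi> = \<alpha>" by (simp add: conj_commute conj_left_commute)
  qed
qed

end

section \<open>Coherence 2-cells of the action of a doctrine\<close>

context kz
begin

lemma push_lan_ex1:
  assumes f: "f \<in> arr K" and g: "g \<in> arr K" "src K g = dob S (src K f)" "trg K g = dob S (trg K f)"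
    and c: "\<gamma> \<in> cells K (unt S (trg K f) \<odot> f) (g \<odot> unt S (src K f))"
  shows "\<exists>!\<theta>. \<theta> \<in> cells K (push K S f) g \<and> (\<theta> \<lhd> unt S (src K f)) \<bullet> pushc K S f = \<gamma>"
  using push_lan[OF f] assms unfolding is_lan_iff by simp

lemma push2_ex1:
  assumes "\<alpha> \<in> cel K"
  shows "\<exists>!\<theta>. \<theta> \<in> cells K (push K S (dom2 K \<alpha>)) (push K S (cod2 K \<alpha>)) \<and>
     (\<theta> \<lhd> unt S (src K (dom2 K \<alpha>))) \<bullet> pushc K S (dom2 K \<alpha>) =
       pushc K S (cod2 K \<alpha>) \<bullet> (unt S (trg K (dom2 K \<alpha>)) \<rhd> \<alpha>)"
  using assms by (intro push_lan_ex1) simp_all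

lemma push2:
  assumes "\<alpha> \<in> cel K"
  shows "push2 K S \<alpha> \<in> cel K" "dom2 K (push2 K S \<alpha>) = push K S (dom2 K \<alpha>)" "cod2 K (push2 K S \<alpha>) = push K S (cod2 K \<alpha>)"
    "(push2 K S \<alpha> \<lhd> unt S (src K (dom2 K \<alpha>))) \<bullet> pushc K S (dom2 K \<alpha>) =
       pushc K S (cod2 K \<alpha>) \<bullet> (unt S (trg K (dom2 K \<alpha>)) \<rhd> \<alpha>)"
  using theI'[OF push2_ex1[OF assms]] unfolding push2_def[symmetric] by simp_all

lemma push2_eqI:
  assumes "\<alpha> \<in> cel K" "\<theta> \<in> cells K (push K S (dom2 K \<alpha>)) (push K S (cod2 K \<alpha>))"
    "(\<theta> \<lhd> unt S (src K (dom2 K \<alpha>))) \<bullet> pushc K S (dom2 K \<alpha>) =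
       pushc K S (cod2 K \<alpha>) \<bullet> (unt S (trg K (dom2 K \<alpha>)) \<rhd> \<alpha>)"
  shows "\<theta> = push2 K S \<alpha>"
  by (rule ex1_eq[OF push2_ex1[OF assms(1)]]) (use assms push2[OF assms(1)] in simp_all)

lemma push_cmp_ex1:
  assumes "f \<in> arr K" "g \<in> arr K" "trg K f = src K g"
  shows "\<exists>!\<theta>. \<theta> \<in> cells K (push K S (g \<odot> f)) (push K S g \<odot> push K S f) \<and>
     (\<theta> \<lhd> unt S (src K f)) \<bullet> pushc K S (g \<odot> f) = (push K S g \<rhd> pushc K S f) \<bullet> (pushc K S g \<lhd> f)"
  using assms push_lan_ex1[of "g \<odot> f" "push K S g \<odot> push K S f" "(push K S g \<rhd> pushc K S f) \<bullet> (pushc K S g \<lhd> f)"]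
  by simp

lemma push_cmp:
  assumes "f \<in> arr K" "g \<in> arr K" "trg K f = src K g"
  shows "push_cmp K S g f \<in> cel K" "dom2 K (push_cmp K S g f) = push K S (g \<odot> f)"
    "cod2 K (push_cmp K S g f) = push K S g \<odot> push K S f"
    "(push_cmp K S g f \<lhd> unt S (src K f)) \<bullet> pushc K S (g \<odot> f) = (push K S g \<rhd> pushc K S f) \<bullet> (pushc K S g \<lhd> f)"
  using theI'[OF push_cmp_ex1[OF assms]] unfolding push_cmp_def[symmetric] by simp_all

lemma push_cmp_eqI:
  assumes "f \<in> arr K" "g \<in> arr K" "trg K f = src K g"
    "\<theta> \<in> cells K (push K S (g \<odot> f)) (push K S g \<odot> push K S f)"
    "(\<theta> \<lhd> unt S (src K f)) \<bullet> pushc K S (g \<odot> f) = (push K S g \<rhd> pushc K S f) \<bullet> (pushc K S g \<lhd> f)"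
  shows "\<theta> = push_cmp K S g f"
  by (rule ex1_eq[OF push_cmp_ex1[OF assms(1-3)]]) (use assms push_cmp[OF assms(1-3)] in simp_all)

lemma push_id_ex1:
  assumes "A \<in> obj K"
  shows "\<exists>!\<theta>. \<theta> \<in> cells K (push K S (id1 K A)) (id1 K (dob S A)) \<and>
     (\<theta> \<lhd> unt S A) \<bullet> pushc K S (id1 K A) = id2 K (unt S A)"
  using assms push_lan_ex1[of "id1 K A" "id1 K (dob S A)" "id2 K (unt S A)"] by simp

lemma push_id:
  assumes "A \<in> obj K"
  shows "push_id K S A \<in> cel K" "dom2 K (push_id K S A) = push K S (id1 K A)"
    "cod2 K (push_id K S A) = id1 K (dob S A)" "(push_id K S A \<lhd> unt S A) \<bullet> pushc K S (id1 K A) = id2 K (unt S A)"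
  using theI'[OF push_id_ex1[OF assms]] unfolding push_id_def[symmetric] by simp_all

lemma push_id_eqI:
  assumes "A \<in> obj K" "\<theta> \<in> cells K (push K S (id1 K A)) (id1 K (dob S A))"
     "(\<theta> \<lhd> unt S A) \<bullet> pushc K S (id1 K A) = id2 K (unt S A)"
  shows "\<theta> = push_id K S A"
  by (rule ex1_eq[OF push_id_ex1[OF assms(1)]]) (use assms push_id[OF assms(1)] in simp_all)

lemma pres_id: "A \<in> obj K \<Longrightarrow> pres (id1 K A)"
  using pres_left_adjoint[OF adjoint_id] .

end

section \<open>The duality\<close>

locale gu_duality = gu_context K P S D \<upsilon>
  for K :: "('o, 'm, 'c) two_cat" (structure) and P S D \<upsilon> +
  assumes env: "\<And>G. petit K P G \<Longrightarrow>
           \<exists>G' i. cauchy_complete K S G' \<and> petit K P G' \<and> i \<in> hom K G G' \<and> equivalence1 K (push K S i)"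
begin

definition RexO where "RexO = {A. petit K P A \<and> cauchy_complete K S A \<and> cocomplete K D A}"
definition RexA where "RexA = {f \<in> arr K. src K f \<in> RexO \<and> trg K f \<in> RexO \<and> cocontinuous K D f}"
definition LPO where "LPO = {A. presentable K P S A}"
definition LPA where "LPA = {f \<in> arr K. src K f \<in> LPO \<and> trg K f \<in> LPO \<and> cocontinuous K S f \<and> (\<exists>l. adjoint K l f)}"

lemma Rex_eq: "Rex K P S D = sub2 K RexO RexA"
  by (simp add: Rex_def RexO_def RexA_def Let_def)

lemma LP_eq: "LP K P S = sub2 K LPO LPA"
  by (simp add: LP_def LPO_def LPA_def Let_def)

lemma RexOD:
  assumes "G \<in> RexO"
  shows "petit K P G" "cauchy_complete K S G" "cocomplete K D G" "G \<in> obj K"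
  using assms petitD(1)[of G] by (simp_all add: RexO_def)

lemma RexA_iff: "f \<in> RexA \<longleftrightarrow> f \<in> arr K \<and> src K f \<in> RexO \<and> trg K f \<in> RexO \<and> D.pres f"
  unfolding RexA_def mem_Collect_eq D.cocontinuous_iff using RexOD(3) by blast

lemma LPO_obj: "X \<in> LPO \<Longrightarrow> X \<in> obj K"
  by (simp add: LPO_def presentable_def accessible_def)

lemma presentable_equivalence:
  assumes X: "X \<in> LPO" and e: "equivalence1 K e" "src K e = X"
  shows "trg K e \<in> LPO"
proof -
  have [simp]: "X \<in> obj K" using LPO_obj[OF X] .
  obtain e' where e': "adjoint K e e'" "adjoint K e' e" "equivalence1 K e'" "e' \<odot> e \<simeq> id1 K X" "e \<odot> e' \<simeq> id1 K (trg K e)"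
    "fully_faithful1 K e'" using equivalence_inverse[OF e(1)] e(2) by metis
  note [simp] = adjoint_type[OF e'(1)] e(2)
  have p: "presentable K P S X" using X by (simp add: LPO_def)
  then obtain G a where G: "petit K P G" and a: "equivalence1 K a" "a \<in> hom K X (dob S G)"
    unfolding presentable_def accessible_def equivalent0_def by blast
  note [simp] = petitD(1)[OF G]
  have [simp]: "a \<in> arr K" "src K a = X" "trg K a = dob S G" using a by simp_all
  have "equivalence1 K (a \<odot> e')" by (rule equivalence_cmp[OF e'(3) a(1)]) simp
  then have "accessible K P S (trg K e)"
    unfolding accessible_def equivalent0_def using G by (intro conjI exI[of _ G] bexI[of _ "a \<odot> e'"]) simp_all
  moreover obtain H L i where H: "petit K P H" "L \<in> hom K (dob P H) X" "i \<in> hom K X (dob P H)" "adjoint K L i"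
    "fully_faithful1 K i" "cocontinuous K S i" using p unfolding presentable_def by blast
  have [simp]: "L \<in> arr K" "src K L = dob P H" "trg K L = X" "i \<in> arr K" "src K i = X" "trg K i = dob P H" using H by simp_all
  have "adjoint K (e \<odot> L) (i \<odot> e')" by (rule adjoint_cmp[OF H(4) e'(1)]) simp
  moreover have "fully_faithful1 K (i \<odot> e')" by (rule ff_cmp[OF e'(6) H(5)]) simp
  moreover have "cocontinuous K S (i \<odot> e')"
    using S.pres_cmp[OF S.pres_left_adjoint[OF e'(2)] S.cocontinuous_pres[OF H(6)]] H(6) S.cocomplete_equivalence[of e] e(1)
    by (simp add: S.cocontinuous_iff)
  moreover have "e \<odot> L \<in> hom K (dob P H) (trg K e)" "i \<odot> e' \<in> hom K (trg K e) (dob P H)" by simp_all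
  ultimately show ?thesis
    unfolding LPO_def presentable_def mem_Collect_eq using H(1) by blast
qed

text \<open>The Cauchy completion \<open>G'\<close> of a petit \<open>G\<close> has \<open>SG \<simeq> SG'\<close>, so it is \<open>D\<close>-cocomplete as soon as \<open>SG\<close> is
  presentable.\<close>

lemma LPO_equivalent_free:
  assumes X: "X \<in> LPO"
  obtains G E where "G \<in> RexO" "equivalence1 K E" "src K E = dob S G" "trg K E = X"
proof -
  obtain G a where G: "petit K P G" and a: "equivalence1 K a" "a \<in> hom K X (dob S G)"
    using X unfolding LPO_def presentable_def accessible_def equivalent0_def by blast
  obtain G' i where G': "cauchy_complete K S G'" "petit K P G'" "i \<in> hom K G G'" "equivalence1 K (push K S i)"
    using env[OF G] by blast
  have "trg K a \<in> LPO" by (rule presentable_equivalence[OF X a(1)]) (use a in simp)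
  then have "trg K (push K S i) \<in> LPO"
    using a G'(3) by - (rule presentable_equivalence[OF _ G'(4) refl], simp)
  then have "dob S G' \<in> LPO" using G' by simp
  then have R: "G' \<in> RexO"
    using G' D_cocomplete_if_presentable by (simp add: LPO_def RexO_def)
  have [simp]: "i \<in> arr K" "src K i = G" "trg K i = G'" "a \<in> arr K" "src K a = X" "trg K a = dob S G" using G'(3) a by simp_all
  obtain a' where a': "adjoint K a a'" "equivalence1 K a'" using equivalence_inverse[OF a(1)] .
  obtain j' where j': "adjoint K (push K S i) j'" "equivalence1 K j'" using equivalence_inverse[OF G'(4)] .
  note [simp] = adjoint_type[OF a'(1)] adjoint_type[OF j'(1)]
  have "equivalence1 K (a' \<odot> j')" by (rule equivalence_cmp[OF j'(2) a'(2)]) simp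
  then show ?thesis using that[OF R, of "a' \<odot> j'"] by simp
qed

lemma LPO_cocomplete:
  assumes X: "X \<in> LPO"
  shows "cocomplete K S X"
proof -
  obtain G E where E: "G \<in> RexO" "equivalence1 K E" "src K E = dob S G" "trg K E = X"
    using LPO_equivalent_free[OF X] .
  then show ?thesis using S.cocomplete_equivalence[of E] S.free_cocomplete[OF RexOD(4)[OF E(1)]] by simp
qed

lemma LPA_iff: "f \<in> LPA \<longleftrightarrow> f \<in> arr K \<and> src K f \<in> LPO \<and> trg K f \<in> LPO \<and> S.pres f \<and> (\<exists>l. adjoint K l f)"
  unfolding LPA_def mem_Collect_eq S.cocontinuous_iff using LPO_cocomplete by blast

text \<open>The equivalence \<open>SG \<simeq> X\<close> is not part of a framing: as the extension of the frame along the unit, it is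
  determined up to isomorphism.\<close>

definition Fra :: "('o, 'm) framing \<Rightarrow> bool" where
  "Fra w \<longleftrightarrow> fg w \<in> RexO \<and> fx w \<in> LPO \<and> fs w \<in> hom K (fg w) (fx w) \<and>
     (\<exists>E. equivalence1 K E \<and> src K E = dob S (fg w) \<and> trg K E = fx w \<and> fs w \<simeq> E \<odot> unt S (fg w))"

lemma FraE:
  assumes "Fra w"
  obtains E E' where "E \<in> arr K" "src K E = dob S (fg w)" "trg K E = fx w" "fs w \<simeq> E \<odot> unt S (fg w)"
    "E' \<in> arr K" "src K E' = fx w" "trg K E' = dob S (fg w)" "adjoint K E E'" "adjoint K E' E" "equivalence1 K E'"
    "E' \<odot> E \<simeq> id1 K (dob S (fg w))" "E \<odot> E' \<simeq> id1 K (fx w)" "fully_faithful1 K E" "equivalence1 K E"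
proof -
  obtain E where E: "equivalence1 K E" "src K E = dob S (fg w)" "trg K E = fx w" "fs w \<simeq> E \<odot> unt S (fg w)"
    using assms by (auto simp: Fra_def)
  obtain E' where E': "adjoint K E E'" "adjoint K E' E" "equivalence1 K E'"
    "E' \<odot> E \<simeq> id1 K (src K E)" "E \<odot> E' \<simeq> id1 K (trg K E)" "fully_faithful1 K E"
    using equivalence_inverse[OF E(1)] by metis
  show ?thesis using that[of E E'] E E' adjoint_type[OF E'(1)] by simp
qed

lemma RexA_obj: "f \<in> RexA \<Longrightarrow> f \<in> arr K \<and> src K f \<in> RexO \<and> trg K f \<in> RexO"
  by (simp add: RexA_iff)

lemma LPA_obj: "f \<in> LPA \<Longrightarrow> f \<in> arr K \<and> src K f \<in> LPO \<and> trg K f \<in> LPO"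
  by (simp add: LPA_iff)

lemma RexA_cmp: "f \<in> RexA \<Longrightarrow> g \<in> RexA \<Longrightarrow> trg K f = src K g \<Longrightarrow> g \<odot> f \<in> RexA"
  using D.pres_cmp[of f g] by (simp add: RexA_iff)

lemma LPA_cmp:
  assumes "f \<in> LPA" "g \<in> LPA" "trg K f = src K g"
  shows "g \<odot> f \<in> LPA"
proof -
  obtain l l' where l: "adjoint K l f" "adjoint K l' g" using assms by (auto simp: LPA_iff)
  have "adjoint K (l \<odot> l') (g \<odot> f)"
    by (rule adjoint_cmp[OF l(2) l(1)]) (use adjoint_type[OF l(1)] adjoint_type[OF l(2)] assms(3) in simp)
  then show ?thesis using assms S.pres_cmp[of f g] by (auto simp: LPA_iff)
qed

lemma RexA_id: "A \<in> RexO \<Longrightarrow> id1 K A \<in> RexA"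
  using RexOD(4)[of A] D.pres_id[of A] by (simp add: RexA_iff)

lemma LPA_id: "A \<in> LPO \<Longrightarrow> id1 K A \<in> LPA"
  using LPO_obj[of A] S.pres_id[of A] adjoint_id[of A] unfolding LPA_iff by fastforce

lemma Fra_type: "Fra w \<Longrightarrow> fg w \<in> RexO \<and> fx w \<in> LPO \<and> fs w \<in> hom K (fg w) (fx w)"
  by (simp add: Fra_def)

lemma framings: "framings K RexO LPO RexA LPA Fra"
  by unfold_locales (fact RexOD(4) RexA_obj RexA_id RexA_cmp LPO_obj LPA_obj LPA_id LPA_cmp Fra_type)+

sublocale framings K RexO LPO RexA LPA Fra by (rule framings)

lemma Rex_right_adjoint:
  assumes f: "f \<in> RexA"
  obtains R where "adjoint K (push K S f) R" "S.pres R"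
proof -
  have t: "src K f \<in> RexO" "trg K f \<in> RexO" "f \<in> arr K" "D.pres f" using f by (simp_all add: RexA_iff)
  show ?thesis
    by (rule push_S_right_adjoint[OF RexOD(1,3)[OF t(1)] RexOD(1,3)[OF t(2)] t(3) refl refl t(4)]) (rule that)
qed

lemma S_free_LPO: "G \<in> RexO \<Longrightarrow> dob S G \<in> LPO"
  using presentable_S_free[OF RexOD(1,3)] by (simp add: LPO_def)

text \<open>Frames inherit full faithfulness and density from the unit. A \<open>D\<close>-cocontinuous \<open>f\<close> lifts to a square whose
  adjunction is \<open>S\<^sub>!f\<close> and its right adjoint, conjugated by the framing equivalences. Conversely, given \<open>r\<close> with left
  adjoint \<open>l\<close>, Cauchy completeness applies to \<open>l\<close> conjugated by these equivalences, and the \<open>f\<close> obtained is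
  \<open>D\<close>-cocontinuous because \<open>S\<^sub>!f\<close> is a left adjoint.\<close>

lemma dense_framings: "dense_framings K RexO LPO RexA LPA Fra"
proof unfold_locales
  fix w assume w: "Fra w"
  note [simp] = FraD[OF w]
  obtain E E' where E [simp]: "E \<in> arr K" "src K E = dob S (fg w)" "trg K E = fx w"
    and Es: "fs w \<simeq> E \<odot> unt S (fg w)" and E' [simp]: "E' \<in> arr K" "src K E' = fx w" "trg K E' = dob S (fg w)"
    and EE: "adjoint K E E'" "adjoint K E' E" "E \<odot> E' \<simeq> id1 K (fx w)" and ffE: "fully_faithful1 K E" and eqE: "equivalence1 K E"
    using FraE[OF w] by metis
  have "fully_faithful1 K (E \<odot> unt S (fg w))"
    by (rule ff_cmp[OF ff_unt(2) ffE]) simp_all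
  then show "fully_faithful1 K (fs w)" by (rule ff_iso) (rule iso1_sym[OF Es])
  have "lext E (E \<odot> E')"
  proof -
    obtain E'' \<eta> \<epsilon> where a: "adjunction K E E'' \<eta> \<epsilon>" and i: "invertible2 K \<eta>" "invertible2 K \<epsilon>"
      using equivalence_adjunction[OF eqE] .
    note [simp] = adjunctionD(1-10)[OF a, simplified]
    have "is_lan K E E (E \<odot> E'') (E \<rhd> \<eta>)" using adjunction_is_lan[OF a, of E] by simp
    then have "lext E (E \<odot> E'')" by (rule lextI) (simp add: invertible_lw i)
    moreover have "E \<odot> E'' \<simeq> id1 K (fx w)" by (rule iso1I[OF i(2)]) simp_all
    ultimately show ?thesis using iso1_trans[OF _ iso1_sym[OF EE(3)]] lext_iso by blast
  qed
  then have lE: "lext E (id1 K (fx w))" by (rule lext_iso) (rule EE(3))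
  have "lext (unt S (fg w)) E" using lext_left_adjoint[OF EE(1) S.dense[of "fg w"]] by simp
  from is_lan_paste[OF this, of E "id1 K (fx w)" "id2 K E"] lE
  have "lext (E \<odot> unt S (fg w)) (id1 K (fx w))" by simp
  note l = this
  obtain \<psi> where psi: "invertible2 K \<psi>" "\<psi> \<in> cel K" "dom2 K \<psi> = E \<odot> unt S (fg w)" "cod2 K \<psi> = fs w"
    using iso1_sym[OF Es] by (rule iso1E)
  have "is_lan K (fs w) (E \<odot> unt S (fg w)) (id1 K (fx w)) \<psi>"
    using is_lan_along_iso[OF l psi(1,3)] psi by simp
  then show "lext (fs w) (id1 K (fx w))" by (rule lextI) (rule psi(1))
next
  fix w w' f assume w: "Fra w" and w': "Fra w'" and f: "f \<in> RexA" "src K f = fg w" "trg K f = fg w'"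
  note [simp] = FraD[OF w] FraD[OF w'] f w w'
  have [simp]: "f \<in> arr K" using f by (simp add: RexA_iff)
  obtain E E\<^sub>i where E [simp]: "E \<in> arr K" "src K E = dob S (fg w)" "trg K E = fx w"
    and Es: "fs w \<simeq> E \<odot> unt S (fg w)" and E\<^sub>i [simp]: "E\<^sub>i \<in> arr K" "src K E\<^sub>i = fx w" "trg K E\<^sub>i = dob S (fg w)"
    and EE: "adjoint K E E\<^sub>i" "adjoint K E\<^sub>i E" "E\<^sub>i \<odot> E \<simeq> id1 K (dob S (fg w))"
    using FraE[OF w] by metis
  obtain E' E\<^sub>i' where E' [simp]: "E' \<in> arr K" "src K E' = dob S (fg w')" "trg K E' = fx w'"
    and Es': "fs w' \<simeq> E' \<odot> unt S (fg w')" and E\<^sub>i' [simp]: "E\<^sub>i' \<in> arr K" "src K E\<^sub>i' = fx w'" "trg K E\<^sub>i' = dob S (fg w')"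
    and EE': "adjoint K E' E\<^sub>i'" "adjoint K E\<^sub>i' E'"
    using FraE[OF w'] by metis
  obtain R where R: "adjoint K (push K S f) R" "S.pres R" using Rex_right_adjoint[OF f(1)] .
  note [simp] = adjoint_type[OF R(1)]
  let ?l = "E' \<odot> push K S f \<odot> E\<^sub>i" let ?r = "E \<odot> R \<odot> E\<^sub>i'"
  have a: "adjoint K ?l ?r"
    using adjoint_cmp[OF adjoint_cmp[OF EE(2) R(1)] EE'(1)] by simp
  then obtain \<eta> \<epsilon> where ad: "adjunction K ?l ?r \<eta> \<epsilon>" by (auto simp: adjoint_def)
  have "S.pres ?r"
    using S.pres_cmp[OF S.pres_cmp[OF S.pres_left_adjoint[OF EE'(2)] R(2)] S.pres_left_adjoint[OF EE(1)]] by simp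
  then have r: "?r \<in> LPA" using a by (auto simp: LPA_iff)
  have "fs w' \<odot> f \<simeq> E' \<odot> unt S (fg w') \<odot> f" using iso1_rw[OF Es', of f] by simp
  also have "\<dots> \<simeq> E' \<odot> push K S f \<odot> unt S (fg w)" using iso1_lw[OF iso1_sym[OF S.push_unt[of f]], of E'] by simp
  also have "\<dots> \<simeq> E' \<odot> push K S f \<odot> E\<^sub>i \<odot> E \<odot> unt S (fg w)"
    using iso1_lw[OF iso1_rw[OF iso1_sym[OF EE(3)], of "unt S (fg w)"], of "E' \<odot> push K S f"] by simp
  also have "\<dots> \<simeq> ?l \<odot> fs w" using iso1_lw[OF iso1_sym[OF Es], of ?l] by simp
  finally obtain z where z: "invertible2 K z" "z \<in> cel K" "dom2 K z = fs w' \<odot> f" "cod2 K z = ?l \<odot> fs w" by (rule iso1E)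
  have "sq (Fsquare w w' f ?l ?r z \<epsilon>)" unfolding sq_def using r z ad by auto
  then show "\<exists>q. sq q \<and> qs q = w \<and> qt q = w' \<and> qf q = f" by (intro exI[of _ "Fsquare w w' f ?l ?r z \<epsilon>"]) simp
next
  fix w w' r assume w: "Fra w" and w': "Fra w'" and r: "r \<in> LPA" "src K r = fx w'" "trg K r = fx w"
  note [simp] = FraD[OF w] FraD[OF w'] r w w'
  obtain l where l: "adjoint K l r" using r by (auto simp: LPA_iff)
  then obtain \<eta> \<epsilon> where ad: "adjunction K l r \<eta> \<epsilon>" by (auto simp: adjoint_def)
  have [simp]: "r \<in> arr K" "l \<in> arr K" "src K l = fx w" "trg K l = fx w'" using r adjoint_type[OF l] by (simp_all add: LPA_iff)
  obtain E E\<^sub>i where E [simp]: "E \<in> arr K" "src K E = dob S (fg w)" "trg K E = fx w"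
    and Es: "fs w \<simeq> E \<odot> unt S (fg w)" and E\<^sub>i [simp]: "E\<^sub>i \<in> arr K" "src K E\<^sub>i = fx w" "trg K E\<^sub>i = dob S (fg w)"
    and EE: "adjoint K E E\<^sub>i" "adjoint K E\<^sub>i E"
    using FraE[OF w] by metis
  obtain E' E\<^sub>i' where E' [simp]: "E' \<in> arr K" "src K E' = dob S (fg w')" "trg K E' = fx w'"
    and Es': "fs w' \<simeq> E' \<odot> unt S (fg w')" and E\<^sub>i' [simp]: "E\<^sub>i' \<in> arr K" "src K E\<^sub>i' = fx w'" "trg K E\<^sub>i' = dob S (fg w')"
    and EE': "adjoint K E' E\<^sub>i'" "adjoint K E\<^sub>i' E'" "E' \<odot> E\<^sub>i' \<simeq> id1 K (fx w')"
    using FraE[OF w'] by metis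
  let ?q = "E\<^sub>i' \<odot> l \<odot> E" let ?q' = "E\<^sub>i \<odot> r \<odot> E'"
  have a: "adjoint K ?q ?q'" using adjoint_cmp[OF adjoint_cmp[OF EE(1) l] EE'(2)] by simp
  have p: "S.pres ?q'"
    using S.pres_cmp[OF S.pres_cmp[OF S.pres_left_adjoint[OF EE'(1)], of r] S.pres_left_adjoint[OF EE(2)]] r(1) by (simp add: LPA_iff)
  then have c: "cocontinuous K S ?q'" by (simp add: S.cocontinuous_iff S.free_cocomplete)
  have h: "?q \<in> hom K (dob S (fg w)) (dob S (fg w'))" "?q' \<in> hom K (dob S (fg w')) (dob S (fg w))" by simp_all
  have "cauchy_complete K S (fg w')" by (rule RexOD) simp
  then obtain f where f: "f \<in> hom K (fg w) (fg w')" "?q \<simeq> push K S f"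
    using a c h FraD(3)[OF w] unfolding cauchy_complete_def by blast
  have [simp]: "f \<in> arr K" "src K f = fg w" "trg K f = fg w'" using f by simp_all
  have "D.pres f"
    by (rule pres_if_push_left_adjoint[of "fg w" "fg w'", OF _ _ _ _ _ _ adjoint_iso_left[OF a f(2)]])
      (use RexOD[of "fg w"] in simp_all)
  then have fR: "f \<in> RexA" by (simp add: RexA_iff)
  have "fs w' \<odot> f \<simeq> E' \<odot> unt S (fg w') \<odot> f" using iso1_rw[OF Es', of f] by simp
  also have "\<dots> \<simeq> E' \<odot> push K S f \<odot> unt S (fg w)" using iso1_lw[OF iso1_sym[OF S.push_unt[of f]], of E'] by simp
  also have "\<dots> \<simeq> E' \<odot> E\<^sub>i' \<odot> l \<odot> E \<odot> unt S (fg w)"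
    using iso1_lw[OF iso1_rw[OF iso1_sym[OF f(2)], of "unt S (fg w)"], of E'] by simp
  also have "\<dots> \<simeq> l \<odot> E \<odot> unt S (fg w)" using iso1_rw[OF EE'(3), of "l \<odot> E \<odot> unt S (fg w)"] by simp
  also have "\<dots> \<simeq> l \<odot> fs w" using iso1_lw[OF iso1_sym[OF Es], of l] by simp
  finally obtain z where z: "invertible2 K z" "z \<in> cel K" "dom2 K z = fs w' \<odot> f" "cod2 K z = l \<odot> fs w" by (rule iso1E)
  have "sq (Fsquare w w' f l r z \<epsilon>)" unfolding sq_def using r z ad fR by auto
  then show "\<exists>q. sq q \<and> qs q = w \<and> qt q = w' \<and> qr q = r" by (intro exI[of _ "Fsquare w w' f l r z \<epsilon>"]) simp
qed

end

text \<open>The choices on which \<open>Mod\<close> and \<open>Th\<close> depend: a right adjoint \<open>rr f\<close> of \<open>S\<^sub>!f\<close> with unit \<open>hh f\<close> and counit \<open>ee f\<close>;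
  a framing \<open>b0 X\<close> of each presentable object and a square \<open>b1 r\<close> over each 1-cell between such objects; and for each
  framing \<open>s : G \<rightarrow> X\<close> an equivalence \<open>X \<rightarrow> SG\<close> that carries \<open>s\<close> to the unit, by an isomorphism \<open>ti\<close>.\<close>

locale gu_sections = gu_duality K P S D \<upsilon>
  for K :: "('o, 'm, 'c) two_cat" (structure) and P S D \<upsilon> +
  fixes rr :: "'m \<Rightarrow> 'm" and hh ee :: "'m \<Rightarrow> 'c"
    and b0 :: "'o \<Rightarrow> ('o, 'm) framing" and b1 :: "'m \<Rightarrow> ('o, 'm, 'c) fsquare"
    and Ei :: "('o, 'm) framing \<Rightarrow> 'm" and ti :: "('o, 'm) framing \<Rightarrow> 'c"
  assumes rr: "f \<in> RexA \<Longrightarrow> rr f \<in> LPA" "f \<in> RexA \<Longrightarrow> adjunction K (push K S f) (rr f) (hh f) (ee f)"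
    and b0: "X \<in> LPO \<Longrightarrow> Fra (b0 X)" "X \<in> LPO \<Longrightarrow> fx (b0 X) = X"
    and b1: "r \<in> LPA \<Longrightarrow> sq (b1 r)" "r \<in> LPA \<Longrightarrow> qs (b1 r) = b0 (trg K r)"
      "r \<in> LPA \<Longrightarrow> qt (b1 r) = b0 (src K r)" "r \<in> LPA \<Longrightarrow> qr (b1 r) = r"
    and Ei: "Fra w \<Longrightarrow> equivalence1 K (Ei w)" "Fra w \<Longrightarrow> src K (Ei w) = fx w" "Fra w \<Longrightarrow> trg K (Ei w) = dob S (fg w)"
    and ti: "Fra w \<Longrightarrow> invertible2 K (ti w)" "Fra w \<Longrightarrow> dom2 K (ti w) = Ei w \<odot> fs w"
      "Fra w \<Longrightarrow> cod2 K (ti w) = unt S (fg w)"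
begin

sublocale dense_framings K RexO LPO RexA LPA Fra by (rule dense_framings)

text \<open>The section that gives \<open>Mod\<close>: every \<open>G\<close> has the framing \<open>\<sigma> : G \<rightarrow> SG\<close>, and every \<open>f\<close> the square given by
  \<open>S\<^sub>!f \<stileturn> S\<^sup>*f\<close>.\<close>

definition a0 :: "'o \<Rightarrow> ('o, 'm) framing" where
  "a0 G = Framing G (dob S G) (unt S G)"

definition a1 :: "'m \<Rightarrow> ('o, 'm, 'c) fsquare" where
  "a1 f = Fsquare (a0 (src K f)) (a0 (trg K f)) f (push K S f) (rr f) (pushc K S f) (ee f)"

lemma a0_sel [simp]: "fg (a0 G) = G" "fx (a0 G) = dob S G" "fs (a0 G) = unt S G"
  by (simp_all add: a0_def)

lemma a1_sel [simp]: "qs (a1 f) = a0 (src K f)" "qt (a1 f) = a0 (trg K f)" "qf (a1 f) = f" "ql (a1 f) = push K S f"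
  "qr (a1 f) = rr f" "qz (a1 f) = pushc K S f" "qe (a1 f) = ee f"
  by (simp_all add: a1_def)

lemma Fra_a0: "G \<in> RexO \<Longrightarrow> Fra (a0 G)"
  unfolding Fra_def using RexOD(4)[of G] S_free_LPO[of G]
  by (auto intro!: exI[of _ "id1 K (dob S G)"] iso1_refl bexI[of _ "id1 K (dob S G)"] simp: equivalence1_def)

lemma sq_a1:
  assumes f: "f \<in> RexA"
  shows "sq (a1 f)"
  using rr[OF f] RexA_obj[OF f] by (auto simp: sq_def Fra_a0 f)

lemma section_M: "section_image (coop fr2) (coop G2) fg qf ca X2 fx qr cr a0 a1"
proof -
  interpret p: projection "coop fr2" "coop G2" fg qf ca by (rule projection_G)
  interpret i: strict_functor "coop fr2" X2 fx qr cr by (rule strict_X)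
  show ?thesis by unfold_locales (simp_all add: Fra_a0 sq_a1)
qed

lemma section_T: "section_image (coop fr2) X2 fx qr cr (coop G2) fg qf ca b0 b1"
proof -
  interpret p: projection "coop fr2" X2 fx qr cr by (rule projection_X)
  interpret i: strict_functor "coop fr2" "coop G2" fg qf ca by (rule strict_G)
  show ?thesis by unfold_locales (simp_all add: b0 b1)
qed

sublocale M: section_image "coop fr2" "coop G2" fg qf ca X2 fx qr cr a0 a1 by (rule section_M)
sublocale T: section_image "coop fr2" X2 fx qr cr "coop G2" fg qf ca b0 b1 by (rule section_T)
sublocale MT: biequivalence_span "coop fr2" "coop G2" fg qf ca X2 fx qr cr a0 a1 b0 b1 by unfold_locales

lemma fc_cr:
  assumes x: "fc \<chi>" and a: "adjunction K (ql (cs \<chi>)) (qr (cs \<chi>)) \<eta> (qe (cs \<chi>))"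
  shows "cr \<chi> = conj_right K \<eta> (qe (ct \<chi>)) (qr (cs \<chi>)) (qr (ct \<chi>)) (cl \<chi>)"
proof -
  obtain \<eta>' where a': "adjunction K (ql (ct \<chi>)) (qr (ct \<chi>)) \<eta>' (qe (ct \<chi>))" using fcD(2)[OF x] by (rule sq_adj)
  show ?thesis
    by (rule mate_unique_right[OF a a'])
      (use x sqD[OF fcD(1)[OF x]] sqD[OF fcD(2)[OF x]] fcD[OF x] in \<open>simp_all add: fc_def\<close>)
qed

lemma fc_cl:
  assumes x: "fc \<chi>" and a: "adjunction K (ql (ct \<chi>)) (qr (ct \<chi>)) \<eta>' (qe (ct \<chi>))"
  shows "cl \<chi> = conj_left K \<eta>' (qe (cs \<chi>)) (ql (ct \<chi>)) (ql (cs \<chi>)) (cr \<chi>)"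
proof -
  obtain \<eta> where a': "adjunction K (ql (cs \<chi>)) (qr (cs \<chi>)) \<eta> (qe (cs \<chi>))" using fcD(1)[OF x] by (rule sq_adj)
  show ?thesis
    by (rule mate_unique_left[OF a' a])
      (use x sqD[OF fcD(1)[OF x]] sqD[OF fcD(2)[OF x]] fcD[OF x] in \<open>simp_all add: fc_def\<close>)
qed

text \<open>In the framed cells that are lifts of 2-cells and of identities, the component between the left adjoints
  satisfies the equation that characterizes the action of \<open>S\<^sub>!\<close> on 2-cells or one of its coherence 2-cells, and the
  component between the right adjoints is its conjugate. A lift has domain \<open>ct\<close> and codomain \<open>cs\<close> because the
  section takes values in the coop.\<close>

theorem is_Mod_M: "is_Mod K P S D M.psf"
  unfolding is_Mod_def Rex_eq LP_eq
proof (intro conjI ballI; (rule exI[of _ hh], rule exI[of _ ee], intro conjI ballI impI)?)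
  show "pseudofunctor (coop G2) X2 M.psf" by (rule M.pseudofunctor_psf)
next
  fix G assume "G \<in> obj G2"
  then show "on0 M.psf G = dob S G" by simp
next
  fix f assume "f \<in> arr G2"
  then show "adjunction K (push K S f) (on1 M.psf f) (hh f) (ee f)" by (simp add: rr)
next
  fix \<alpha> assume "\<alpha> \<in> cel G2"
  then have a: "\<alpha> \<in> cel (coop G2)" and a' [simp]: "\<alpha> \<in> cel K" "dom2 K \<alpha> \<in> RexA" "cod2 K \<alpha> \<in> RexA" by simp_all
  define \<chi> where "\<chi> = M.s2 \<alpha>"
  have x: "fc \<chi>" and c [simp]: "ct \<chi> = a1 (cod2 K \<alpha>)" "cs \<chi> = a1 (dom2 K \<alpha>)" "ca \<chi> = \<alpha>"
    using M.s2[OF a] by (simp_all add: \<chi>_def)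
  note [simp] = fcD(8-13)[OF x, simplified]
  have "cl \<chi> = push2 K S \<alpha>"
    by (rule S.push2_eqI) (use fcD(14)[OF x] in simp_all)
  then show "on2 M.psf \<alpha> = conj_right K (hh (dom2 K \<alpha>)) (ee (cod2 K \<alpha>)) (on1 M.psf (dom2 K \<alpha>)) (on1 M.psf (cod2 K \<alpha>)) (push2 K S \<alpha>)"
    using fc_cr[OF x, of "hh (dom2 K \<alpha>)"] rr(2)[OF a'(2)] by (simp flip: \<chi>_def)
next
  fix f g assume "f \<in> arr G2" "g \<in> arr G2" and [simp]: "trg K f = src K g"
  then have f [simp]: "f \<in> RexA" "g \<in> RexA" by simp_all
  then have [simp]: "f \<in> arr K" "g \<in> arr K" using RexA_obj by blast+
  have gf: "g \<odot> f \<in> RexA" by (rule cmpG) simp_all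
  define \<chi> where "\<chi> = M.smu f g"
  have x: "fc \<chi>" and c [simp]: "ct \<chi> = sqcmp (a1 g) (a1 f)" "cs \<chi> = a1 (g \<odot> f)" "ca \<chi> = id2 K (g \<odot> f)"
    using M.smu[of g f] by (simp_all add: \<chi>_def)
  note [simp] = fcD(8-13)[OF x, simplified]
  have "cl \<chi> = push_cmp K S g f"
    by (rule S.push_cmp_eqI) (use fcD(14)[OF x] in simp_all)
  then show "mu M.psf f g = conj_right K (hh (g \<odot> f)) (ee g \<bullet> (push K S g \<rhd> ee f \<lhd> on1 M.psf g))
               (on1 M.psf (g \<odot> f)) (on1 M.psf f \<odot> on1 M.psf g) (push_cmp K S g f)"
    using fc_cr[OF x, of "hh (g \<odot> f)"] rr(2)[OF gf] by (simp flip: \<chi>_def)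
next
  fix G assume "G \<in> obj G2"
  then have G [simp]: "G \<in> RexO" by simp
  note [simp] = RexOD(4)[OF G]
  define \<chi> where "\<chi> = M.snu G"
  have x: "fc \<chi>" and c [simp]: "ct \<chi> = id1 fr2 (a0 G)" "cs \<chi> = a1 (id1 K G)" "ca \<chi> = id2 K (id1 K G)"
    using M.snu[of G] by (simp_all add: \<chi>_def)
  note [simp] = fcD(8-13)[OF x, simplified]
  have "cl \<chi> = push_id K S G"
    by (rule S.push_id_eqI) (use fcD(14)[OF x] in simp_all)
  then show "nu M.psf G = conj_right K (hh (id1 K G)) (id2 K (id1 K (dob S G))) (on1 M.psf (id1 K G)) (id1 K (dob S G)) (push_id K S G)"
    using fc_cr[OF x, of "hh (id1 K G)"] rr(2)[OF idG[OF G]] by (simp flip: \<chi>_def)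
qed

subsection \<open>The comparison of framed squares with the action of \<open>S\<close>\<close>

lemma EiD:
  assumes "Fra w"
  shows "Ei w \<in> arr K" "src K (Ei w) = fx w" "trg K (Ei w) = dob S (fg w)" "ti w \<in> cel K" "invertible2 K (ti w)"
    "dom2 K (ti w) = Ei w \<odot> fs w" "cod2 K (ti w) = unt S (fg w)"
  using assms Ei ti equivalence_arr invertible_cel by simp_all

lemma frame_lext:
  assumes w: "Fra w" and L: "adjoint K L R" "src K L = fx w"
  shows "lext (fs w) L"
  using lext_left_adjoint[OF L(1) fs_dense[OF w]] FraD[OF w] adjoint_type[OF L(1)] L(2) by simp

lemma push_frame_lext:
  assumes w: "Fra w" and f: "f \<in> RexA" "src K f = fg w"
  shows "lext (fs w) (push K S f \<odot> Ei w)"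
proof -
  obtain R where R: "adjoint K (push K S f) R" using Rex_right_adjoint[OF f(1)] .
  obtain E' where "adjoint K (Ei w) E'" using equivalence_inverse[OF Ei(1)[OF w]] .
  from frame_lext[OF w adjoint_cmp[OF this R]] show ?thesis
    using RexA_obj[OF f(1)] EiD[OF w] f by simp
qed

text \<open>Restriction of a 2-cell along the frame, followed by the identification of \<open>S\<^sub>!f E s\<close> with \<open>\<sigma> f\<close>.\<close>

definition restr :: "('o, 'm) framing \<Rightarrow> 'm \<Rightarrow> 'c \<Rightarrow> 'c" where
  "restr w f \<theta> = (\<theta> \<lhd> fs w) \<bullet> (push K S f \<rhd> inv2 K (ti w)) \<bullet> pushc K S f"

text \<open>The domain is an extension along the frame, as \<open>S\<^sub>!f\<close> and the framing equivalence are left adjoints and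
  the frame is dense.\<close>

lemma restr_unique:
  assumes w: "Fra w" and f: "f \<in> RexA" "src K f = fg w"
    and t: "\<alpha> \<in> cel K" "\<beta> \<in> cel K" "dom2 K \<alpha> = push K S f \<odot> Ei w" "dom2 K \<beta> = push K S f \<odot> Ei w" "cod2 K \<beta> = cod2 K \<alpha>"
    and e: "restr w f \<alpha> = restr w f \<beta>"
  shows "\<alpha> = \<beta>"
proof -
  note [simp] = FraD[OF w] EiD[OF w] f t
  have [simp]: "f \<in> arr K" using RexA_obj f by blast
  have c: "(push K S f \<rhd> inv2 K (ti w)) \<bullet> (push K S f \<rhd> ti w) = id2 K (push K S f \<odot> Ei w \<odot> fs w)"
    by (simp flip: lw_vcmp)
  have r: "x \<lhd> fs w = restr w f x \<bullet> inv2 K (pushc K S f) \<bullet> (push K S f \<rhd> ti w)"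
    if "x \<in> cel K" "dom2 K x = push K S f \<odot> Ei w" for x
    using that by (simp add: restr_def c)
  have "\<alpha> \<lhd> fs w = \<beta> \<lhd> fs w" using r[of \<alpha>] r[of \<beta>] e by simp
  then show ?thesis
    by (intro is_lan_unique[OF push_frame_lext[OF w f], of \<alpha> \<beta>]) simp_all
qed

lemma th_ex:
  assumes q: "sq q"
  shows "\<exists>\<theta>. invertible2 K \<theta> \<and> \<theta> \<in> cells K (push K S (qf q) \<odot> Ei (qs q)) (Ei (qt q) \<odot> ql q) \<and>
    restr (qs q) (qf q) \<theta> = (Ei (qt q) \<rhd> qz q) \<bullet> (inv2 K (ti (qt q)) \<lhd> qf q)"
proof -
  note [simp] = sqD[OF q] FraD[OF sqD(1)[OF q]] FraD[OF sqD(2)[OF q]] EiD[OF sqD(1)[OF q]] EiD[OF sqD(2)[OF q]]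
  let ?w = "qs q" let ?w' = "qt q" let ?f = "qf q"
  let ?\<gamma> = "(Ei ?w' \<rhd> qz q) \<bullet> (inv2 K (ti ?w') \<lhd> ?f) \<bullet> inv2 K (pushc K S ?f) \<bullet> (push K S ?f \<rhd> ti ?w)"
  have i: "invertible2 K ?\<gamma>"
    by (intro invertible_vcmp invertible_lw invertible_rw invertible_inv2) simp_all
  obtain E' where E': "adjoint K (Ei ?w') E'" using equivalence_inverse[OF Ei(1)[OF sqD(2)[OF q]]] .
  obtain \<eta> where "adjunction K (ql q) (qr q) \<eta> (qe q)" using q by (rule sq_adj)
  from frame_lext[OF sqD(1)[OF q] adjoint_cmp[OF adjointI[OF this] E']]
  have 1: "lext (fs ?w) (Ei ?w' \<odot> ql q)" by simp
  have 2: "lext (fs ?w) (push K S ?f \<odot> Ei ?w)" by (rule push_frame_lext) simp_all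
  have "is_lan K (fs ?w) ((push K S ?f \<odot> Ei ?w) \<odot> fs ?w) (Ei ?w' \<odot> ql q) ?\<gamma>"
    using lext_is_lan[OF 1 i] by simp
  then obtain \<theta> where t: "invertible2 K \<theta>" "\<theta> \<in> cel K" "dom2 K \<theta> = push K S ?f \<odot> Ei ?w" "cod2 K \<theta> = Ei ?w' \<odot> ql q"
    and te: "(\<theta> \<lhd> fs ?w) \<bullet> id2 K ((push K S ?f \<odot> Ei ?w) \<odot> fs ?w) = ?\<gamma>"
    by (rule is_lan_iso_unique[OF 2])
  note [simp] = t
  have te': "\<theta> \<lhd> fs ?w = ?\<gamma>" using te by simp
  have c: "(push K S ?f \<rhd> ti ?w) \<bullet> (push K S ?f \<rhd> inv2 K (ti ?w)) = id2 K (push K S ?f \<odot> unt S (fg ?w))"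
    by (simp flip: lw_vcmp)
  have "restr ?w ?f \<theta> = (Ei ?w' \<rhd> qz q) \<bullet> (inv2 K (ti ?w') \<lhd> ?f)"
    by (simp add: restr_def te' extend_eq1[OF c])
  then show ?thesis by (intro exI[of _ \<theta>]) simp
qed

text \<open>In a framed square, \<open>l\<close> agrees with \<open>S\<^sub>!f\<close> up to the framing equivalences: \<open>th q\<close> is the isomorphism whose
  restriction along the frame is given by \<open>qz q\<close>.\<close>

definition th :: "('o, 'm, 'c) fsquare \<Rightarrow> 'c" where
  "th q = (SOME \<theta>. invertible2 K \<theta> \<and> \<theta> \<in> cells K (push K S (qf q) \<odot> Ei (qs q)) (Ei (qt q) \<odot> ql q) \<and>
    restr (qs q) (qf q) \<theta> = (Ei (qt q) \<rhd> qz q) \<bullet> (inv2 K (ti (qt q)) \<lhd> qf q))"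

lemma th:
  assumes "sq q"
  shows "invertible2 K (th q)" "th q \<in> cel K" "dom2 K (th q) = push K S (qf q) \<odot> Ei (qs q)"
    "cod2 K (th q) = Ei (qt q) \<odot> ql q"
    "restr (qs q) (qf q) (th q) = (Ei (qt q) \<rhd> qz q) \<bullet> (inv2 K (ti (qt q)) \<lhd> qf q)"
  using someI_ex[OF th_ex[OF assms]] unfolding th_def[symmetric] by simp_all

text \<open>After restriction along the frame, the characterization of \<open>S\<^sub>!\<close> on 2-cells reduces the claim to the
  compatibility of the framed cell with the isomorphisms \<open>qz\<close>. The lemmas on composites and identities follow the
  same pattern.\<close>

lemma th_natural:
  assumes x: "fc \<chi>"
  shows "th (ct \<chi>) \<bullet> (push2 K S (ca \<chi>) \<lhd> Ei (qs (cs \<chi>))) = (Ei (qt (cs \<chi>)) \<rhd> cl \<chi>) \<bullet> th (cs \<chi>)"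
proof (rule restr_unique)
  let ?p = "cs \<chi>" let ?q = "ct \<chi>" let ?w = "qs ?p" let ?w' = "qt ?p" let ?f = "qf ?p" let ?g = "qf ?q"
  have p: "sq ?p" and q: "sq ?q" and e [simp]: "qs ?q = ?w" "qt ?q = ?w'" using fcD[OF x] by simp_all
  note [simp] = sqD[OF p] FraD[OF sqD(1)[OF p]] FraD[OF sqD(2)[OF p]] EiD[OF sqD(1)[OF p]] EiD[OF sqD(2)[OF p]]
    sqD[OF q, unfolded e] th(1-4)[OF p] th(1-4)[OF q, unfolded e] fcD(5-13)[OF x]
  note [simp] = S.push2(1-3)[of "ca \<chi>", simplified]
  show "Fra ?w" "?f \<in> RexA" "src K ?f = fg ?w" by simp_all
  let ?L = "th ?q \<bullet> (push2 K S (ca \<chi>) \<lhd> Ei ?w)" let ?R = "(Ei ?w' \<rhd> cl \<chi>) \<bullet> th ?p"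
  show "?L \<in> cel K" "?R \<in> cel K" "dom2 K ?L = push K S ?f \<odot> Ei ?w" "dom2 K ?R = push K S ?f \<odot> Ei ?w" "cod2 K ?R = cod2 K ?L"
    by simp_all
  have s1: "(push2 K S (ca \<chi>) \<lhd> Ei ?w \<lhd> fs ?w) \<bullet> (push K S ?f \<rhd> inv2 K (ti ?w)) =
      (push K S ?g \<rhd> inv2 K (ti ?w)) \<bullet> (push2 K S (ca \<chi>) \<lhd> unt S (fg ?w))"
    using slide[of "inv2 K (ti ?w)" "unt S (fg ?w)" "Ei ?w \<odot> fs ?w" "push2 K S (ca \<chi>)" "push K S ?f" "push K S ?g"] by simp
  have s2: "(push2 K S (ca \<chi>) \<lhd> unt S (fg ?w)) \<bullet> pushc K S ?f = pushc K S ?g \<bullet> (unt S (fg ?w') \<rhd> ca \<chi>)"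
    using S.push2(4)[of "ca \<chi>"] by simp
  have t: "(th ?q \<lhd> fs ?w) \<bullet> (push K S ?g \<rhd> inv2 K (ti ?w)) \<bullet> pushc K S ?g = (Ei ?w' \<rhd> qz ?q) \<bullet> (inv2 K (ti ?w') \<lhd> ?g)"
    "(th ?p \<lhd> fs ?w) \<bullet> (push K S ?f \<rhd> inv2 K (ti ?w)) \<bullet> pushc K S ?f = (Ei ?w' \<rhd> qz ?p) \<bullet> (inv2 K (ti ?w') \<lhd> ?f)"
    using th(5)[OF q] th(5)[OF p] by (simp_all add: restr_def)
  have s3: "(inv2 K (ti ?w') \<lhd> ?g) \<bullet> (unt S (fg ?w') \<rhd> ca \<chi>) = (Ei ?w' \<rhd> fs ?w' \<rhd> ca \<chi>) \<bullet> (inv2 K (ti ?w') \<lhd> ?f)"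
    using slide[of "ca \<chi>" ?f ?g "inv2 K (ti ?w')" "unt S (fg ?w')" "Ei ?w' \<odot> fs ?w'"] by simp
  have s4: "(Ei ?w' \<rhd> qz ?q) \<bullet> (Ei ?w' \<rhd> fs ?w' \<rhd> ca \<chi>) = (Ei ?w' \<rhd> (cl \<chi> \<lhd> fs ?w)) \<bullet> (Ei ?w' \<rhd> qz ?p)"
    using arg_cong[OF fcD(14)[OF x], of "\<lambda>x. Ei ?w' \<rhd> x"] by simp
  have "restr ?w ?f ?L = ((th ?q \<lhd> fs ?w) \<bullet> (push K S ?g \<rhd> inv2 K (ti ?w)) \<bullet> pushc K S ?g) \<bullet> (unt S (fg ?w') \<rhd> ca \<chi>)"
    by (simp add: restr_def extend_eq[OF s1] s2)
  also have "\<dots> = (Ei ?w' \<rhd> (cl \<chi> \<lhd> fs ?w)) \<bullet> (Ei ?w' \<rhd> qz ?p) \<bullet> (inv2 K (ti ?w') \<lhd> ?f)"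
    unfolding t(1) by (simp add: s3 extend_eq[OF s4])
  also have "\<dots> = restr ?w ?f ?R" by (simp add: restr_def t(2))
  finally show "restr ?w ?f ?L = restr ?w ?f ?R" .
qed

lemma th_cmp:
  assumes p: "sq p" and q: "sq q" and c: "qt p = qs q"
  shows "(th q \<lhd> ql p) \<bullet> (push K S (qf q) \<rhd> th p) \<bullet> (push_cmp K S (qf q) (qf p) \<lhd> Ei (qs p)) = th (sqcmp q p)"
proof (rule restr_unique)
  let ?w = "qs p" let ?w' = "qs q" let ?w'' = "qt q" let ?f = "qf p" let ?g = "qf q"
  have r: "sq (sqcmp q p)" by (rule sq_cmp[OF p q c])
  note [simp] = c
  note [simp] = sqD[OF p, unfolded c] sqD[OF q] FraD[OF sqD(1)[OF p]] FraD[OF sqD(1)[OF q]] FraD[OF sqD(2)[OF q]]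
    EiD[OF sqD(1)[OF p]] EiD[OF sqD(1)[OF q]] EiD[OF sqD(2)[OF q]] th(1-4)[OF p, unfolded c] th(1-4)[OF q]
  note [simp] = th(1-4)[OF r, simplified] S.push_cmp(1-3)[of ?f ?g, simplified]
  show "Fra ?w" "?g \<odot> ?f \<in> RexA" "src K (?g \<odot> ?f) = fg ?w" by (simp_all add: cmpG)
  let ?L = "(th q \<lhd> ql p) \<bullet> (push K S ?g \<rhd> th p) \<bullet> (push_cmp K S ?g ?f \<lhd> Ei ?w)"
  show "?L \<in> cel K" "th (sqcmp q p) \<in> cel K" "dom2 K ?L = push K S (?g \<odot> ?f) \<odot> Ei ?w"
    "dom2 K (th (sqcmp q p)) = push K S (?g \<odot> ?f) \<odot> Ei ?w" "cod2 K (th (sqcmp q p)) = cod2 K ?L" by simp_all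
  have s1: "(push_cmp K S ?g ?f \<lhd> Ei ?w \<lhd> fs ?w) \<bullet> (push K S (?g \<odot> ?f) \<rhd> inv2 K (ti ?w)) =
      (push K S ?g \<rhd> push K S ?f \<rhd> inv2 K (ti ?w)) \<bullet> (push_cmp K S ?g ?f \<lhd> unt S (fg ?w))"
    using slide[of "inv2 K (ti ?w)" "unt S (fg ?w)" "Ei ?w \<odot> fs ?w" "push_cmp K S ?g ?f" "push K S (?g \<odot> ?f)" "push K S ?g \<odot> push K S ?f"]
    by simp
  have s2: "(push_cmp K S ?g ?f \<lhd> unt S (fg ?w)) \<bullet> pushc K S (?g \<odot> ?f) = (push K S ?g \<rhd> pushc K S ?f) \<bullet> (pushc K S ?g \<lhd> ?f)"
    using S.push_cmp(4)[of ?f ?g] by simp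
  have t: "(th p \<lhd> fs ?w) \<bullet> (push K S ?f \<rhd> inv2 K (ti ?w)) \<bullet> pushc K S ?f = (Ei ?w' \<rhd> qz p) \<bullet> (inv2 K (ti ?w') \<lhd> ?f)"
    "(th q \<lhd> fs ?w') \<bullet> (push K S ?g \<rhd> inv2 K (ti ?w')) \<bullet> pushc K S ?g = (Ei ?w'' \<rhd> qz q) \<bullet> (inv2 K (ti ?w'') \<lhd> ?g)"
    using th(5)[OF p] th(5)[OF q] by (simp_all add: restr_def)
  have t1: "(push K S ?g \<rhd> (th p \<lhd> fs ?w)) \<bullet> (push K S ?g \<rhd> push K S ?f \<rhd> inv2 K (ti ?w)) \<bullet> (push K S ?g \<rhd> pushc K S ?f)
      = (push K S ?g \<rhd> Ei ?w' \<rhd> qz p) \<bullet> (push K S ?g \<rhd> (inv2 K (ti ?w') \<lhd> ?f))"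
    using arg_cong[OF t(1), of "\<lambda>x. push K S ?g \<rhd> x"] by simp
  have t2: "(th q \<lhd> fs ?w' \<lhd> ?f) \<bullet> (push K S ?g \<rhd> (inv2 K (ti ?w') \<lhd> ?f)) \<bullet> (pushc K S ?g \<lhd> ?f)
      = (Ei ?w'' \<rhd> (qz q \<lhd> ?f)) \<bullet> (inv2 K (ti ?w'') \<lhd> ?g \<lhd> ?f)"
    using arg_cong[OF t(2), of "\<lambda>x. x \<lhd> ?f"] by simp
  have s3: "(th q \<lhd> ql p \<lhd> fs ?w) \<bullet> (push K S ?g \<rhd> Ei ?w' \<rhd> qz p) = (Ei ?w'' \<rhd> ql q \<rhd> qz p) \<bullet> (th q \<lhd> fs ?w' \<lhd> ?f)"
    using slide[of "qz p" "fs ?w' \<odot> ?f" "ql p \<odot> fs ?w" "th q" "push K S ?g \<odot> Ei ?w'" "Ei ?w'' \<odot> ql q"] by simp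
  have "restr ?w (?g \<odot> ?f) ?L = (th q \<lhd> ql p \<lhd> fs ?w) \<bullet> ((push K S ?g \<rhd> (th p \<lhd> fs ?w))
      \<bullet> (push K S ?g \<rhd> push K S ?f \<rhd> inv2 K (ti ?w)) \<bullet> (push K S ?g \<rhd> pushc K S ?f)) \<bullet> (pushc K S ?g \<lhd> ?f)"
    by (simp add: restr_def extend_eq[OF s1] s2)
  also have "\<dots> = (Ei ?w'' \<rhd> ql q \<rhd> qz p) \<bullet> ((th q \<lhd> fs ?w' \<lhd> ?f) \<bullet> (push K S ?g \<rhd> (inv2 K (ti ?w') \<lhd> ?f)) \<bullet> (pushc K S ?g \<lhd> ?f))"
    unfolding t1 by (simp add: extend_eq[OF s3])
  also have "\<dots> = restr ?w (?g \<odot> ?f) (th (sqcmp q p))"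
    unfolding t2 using th(5)[OF r] by simp
  finally show "restr ?w (?g \<odot> ?f) ?L = restr ?w (?g \<odot> ?f) (th (sqcmp q p))" .
qed

lemma th_id:
  assumes w: "Fra w"
  shows "push_id K S (fg w) \<lhd> Ei w = th (id1 fr2 w)"
proof (rule restr_unique[OF w])
  note [simp] = FraD[OF w] EiD[OF w] S.push_id(1-3)[of "fg w", simplified]
  have i: "sq (id1 fr2 w)" using sq_id[OF w] by simp
  note [simp] = th(1-4)[OF i, simplified]
  show "id1 K (fg w) \<in> RexA" "src K (id1 K (fg w)) = fg w" by (simp_all add: idG)
  show "push_id K S (fg w) \<lhd> Ei w \<in> cel K" "th (id1 fr2 w) \<in> cel K"
     "dom2 K (push_id K S (fg w) \<lhd> Ei w) = push K S (id1 K (fg w)) \<odot> Ei w"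
     "dom2 K (th (id1 fr2 w)) = push K S (id1 K (fg w)) \<odot> Ei w"
     "cod2 K (th (id1 fr2 w)) = cod2 K (push_id K S (fg w) \<lhd> Ei w)" by simp_all
  have s1: "(push_id K S (fg w) \<lhd> Ei w \<lhd> fs w) \<bullet> (push K S (id1 K (fg w)) \<rhd> inv2 K (ti w)) =
      inv2 K (ti w) \<bullet> (push_id K S (fg w) \<lhd> unt S (fg w))"
    using slide[of "inv2 K (ti w)" "unt S (fg w)" "Ei w \<odot> fs w" "push_id K S (fg w)" "push K S (id1 K (fg w))" "id1 K (dob S (fg w))"]
    by simp
  have "restr w (id1 K (fg w)) (push_id K S (fg w) \<lhd> Ei w) = inv2 K (ti w)"
    using S.push_id(4)[of "fg w"] by (simp add: restr_def extend_eq[OF s1])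
  also have "\<dots> = restr w (id1 K (fg w)) (th (id1 fr2 w))"
    using th(5)[OF i] by simp
  finally show "restr w (id1 K (fg w)) (push_id K S (fg w) \<lhd> Ei w) = restr w (id1 K (fg w)) (th (id1 fr2 w))" .
qed

text \<open>The comparisons \<open>th\<close> identify \<open>S\<^sub>!(Th p)\<close> with the left adjoint of \<open>p\<close>, up to the framing equivalences. Each compatibility with 2-cells and
  coherence 2-cells is naturality of \<open>th\<close> for a lifted cell, whose component between left adjoints is the conjugate of
  its component between right adjoints.\<close>

theorem is_Th_T: "is_Th K P S D T.psf"
proof -
  \<comment> \<open>A square records only the counit of its adjunction; a unit is chosen to match.\<close>
  define hT where "hT p = (SOME \<eta>. adjunction K (ql (b1 p)) (qr (b1 p)) \<eta> (qe (b1 p)))" for p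
  have hT: "adjunction K (ql (b1 p)) p (hT p) (qe (b1 p))" if "p \<in> LPA" for p
    using someI_ex[of "\<lambda>\<eta>. adjunction K (ql (b1 p)) (qr (b1 p)) \<eta> (qe (b1 p))"] sq_adj[OF b1(1)[OF that]] b1(4)[OF that]
    unfolding hT_def by metis
  show ?thesis
    unfolding is_Th_def Rex_eq LP_eq
  proof (rule conjI, goal_cases)
    case 1
    show ?case by (rule T.pseudofunctor_psf)
  next
    case 2
    show ?case
    proof (rule exI[of _ "\<lambda>A. Ei (b0 A)"], rule exI[of _ "\<lambda>p. ql (b1 p)"], rule exI[of _ hT],
      rule exI[of _ "\<lambda>p. qe (b1 p)"], rule exI[of _ "\<lambda>p. th (b1 p)"], intro conjI ballI impI)
    fix A assume "A \<in> obj X2"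
    then have A: "A \<in> LPO" by simp
    show "Ei (b0 A) \<in> hom K A (dob S (on0 T.psf A))" "equivalence1 K (Ei (b0 A))"
      using b0[OF A] EiD[OF b0(1)[OF A]] Ei(1)[OF b0(1)[OF A]] by simp_all
    let ?w = "b0 A" let ?\<chi> = "T.snu A"
    have x: "fc ?\<chi>" and c: "ct ?\<chi> = id1 fr2 ?w" "cs ?\<chi> = b1 (id1 K A)" "cr ?\<chi> = id2 K (id1 K A)"
      using T.snu[of A] A by simp_all
    have iA: "id1 K A \<in> LPA" using idX[OF A] .
    have [simp]: "A \<in> obj K" using LPO_obj[OF A] .
    note [simp] = b0[OF A] FraD[OF b0(1)[OF A]] EiD[OF b0(1)[OF A]] b1[OF iA, simplified]
    have q: "qs (b1 (id1 K A)) = ?w" "qt (b1 (id1 K A)) = ?w" by simp_all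
    have cl: "cl ?\<chi> = qe (b1 (id1 K A))"
      using fcD(15)[OF x] fcD(8-13)[OF x] sqD[OF b1(1)[OF iA]] by (simp add: c)
    have "(push_id K S (fg ?w) \<bullet> push2 K S (ca ?\<chi>)) \<lhd> Ei ?w = (push_id K S (fg ?w) \<lhd> Ei ?w) \<bullet> (push2 K S (ca ?\<chi>) \<lhd> Ei ?w)"
      using S.push2(1-3)[of "ca ?\<chi>"] fcD(5-7)[OF x] S.push_id(1-3)[of "fg ?w"] c sqD[OF b1(1)[OF iA]] by simp
    also have "\<dots> = (Ei ?w \<rhd> qe (b1 (id1 K A))) \<bullet> th (b1 (id1 K A))"
      using th_natural[OF x] unfolding th_id[OF b0(1)[OF A]] cl c(1,2) q .
    finally show "(push_id K S (on0 T.psf A) \<bullet> push2 K S (nu T.psf A)) \<lhd> Ei ?w = (Ei ?w \<rhd> qe (b1 (id1 K A))) \<bullet> th (b1 (id1 K A))"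
      by simp
  next
    fix p assume "p \<in> arr X2"
    then have p: "p \<in> LPA" by simp
    show "adjunction K (ql (b1 p)) p (hT p) (qe (b1 p))" by (rule hT[OF p])
    show "th (b1 p) \<in> cells K (push K S (on1 T.psf p) \<odot> Ei (b0 (trg K p))) (Ei (b0 (src K p)) \<odot> ql (b1 p))"
      "invertible2 K (th (b1 p))"
      using th(1-4)[OF b1(1)[OF p]] b1[OF p] by simp_all
  next
    fix \<beta> assume "\<beta> \<in> cel X2"
    then have b: "\<beta> \<in> cel X2" and b' [simp]: "\<beta> \<in> cel K" "dom2 K \<beta> \<in> LPA" "cod2 K \<beta> \<in> LPA" by simp_all
    let ?\<chi> = "T.s2 \<beta>"
    have x: "fc ?\<chi>" and c: "ct ?\<chi> = b1 (dom2 K \<beta>)" "cs ?\<chi> = b1 (cod2 K \<beta>)" "cr ?\<chi> = \<beta>"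
      using T.s2[OF b] by simp_all
    have q: "qs (b1 (cod2 K \<beta>)) = b0 (trg K (dom2 K \<beta>))" "qt (b1 (cod2 K \<beta>)) = b0 (src K (dom2 K \<beta>))"
      using b1[OF b'(3)] trg_cod2[of \<beta>] src_cod2[of \<beta>] by simp_all
    have cl: "cl ?\<chi> = conj_left K (hT (dom2 K \<beta>)) (qe (b1 (cod2 K \<beta>))) (ql (b1 (dom2 K \<beta>))) (ql (b1 (cod2 K \<beta>))) \<beta>"
      using fc_cl[OF x, of "hT (dom2 K \<beta>)"] hT[OF b'(2)] by (simp add: c b1)
    show "th (b1 (dom2 K \<beta>)) \<bullet> (push2 K S (on2 T.psf \<beta>) \<lhd> Ei (b0 (trg K (dom2 K \<beta>)))) =
       (Ei (b0 (src K (dom2 K \<beta>))) \<rhd>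
          conj_left K (hT (dom2 K \<beta>)) (qe (b1 (cod2 K \<beta>))) (ql (b1 (dom2 K \<beta>))) (ql (b1 (cod2 K \<beta>))) \<beta>) \<bullet> th (b1 (cod2 K \<beta>))"
      using th_natural[OF x] unfolding cl c(1,2) q by simp
  next
    fix p q assume "p \<in> arr X2" "q \<in> arr X2" and pq [simp]: "trg K p = src K q"
    then have p: "p \<in> LPA" and q: "q \<in> LPA" by simp_all
    have [simp]: "p \<in> arr K" "q \<in> arr K" using p q LPA_obj by blast+
    have qp: "q \<odot> p \<in> LPA" by (rule cmpX[OF p q pq])
    let ?\<chi> = "T.smu q p"
    have x: "fc ?\<chi>" and c: "ct ?\<chi> = sqcmp (b1 p) (b1 q)" "cs ?\<chi> = b1 (q \<odot> p)" "cr ?\<chi> = id2 K (q \<odot> p)"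
      using T.smu[of p q] p q by simp_all
    have e: "qs (b1 (q \<odot> p)) = b0 (trg K q)" "qt (b1 (q \<odot> p)) = b0 (src K p)" using b1[OF qp] by simp_all
    have ad: "adjunction K (ql (b1 p) \<odot> ql (b1 q)) (q \<odot> p) ((q \<rhd> hT p \<lhd> ql (b1 q)) \<bullet> hT q) (qe (b1 p) \<bullet> (ql (b1 p) \<rhd> qe (b1 q) \<lhd> p))"
      by (rule adjunction_cmp[OF hT[OF q] hT[OF p]])
        (use adjunctionD(3,4)[OF hT[OF q]] adjunctionD(3,4)[OF hT[OF p]] pq in simp)
    have cl: "cl ?\<chi> = conj_left K ((q \<rhd> hT p \<lhd> ql (b1 q)) \<bullet> hT q) (qe (b1 (q \<odot> p))) (ql (b1 p) \<odot> ql (b1 q)) (ql (b1 (q \<odot> p))) (id2 K (q \<odot> p))"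
      using fc_cl[OF x, of "(q \<rhd> hT p \<lhd> ql (b1 q)) \<bullet> hT q"] ad b1[OF p] b1[OF q] by (simp add: c)
    have m: "qt (b1 q) = qs (b1 p)" using b1[OF p] b1[OF q] by simp
    note t = th_cmp[OF b1(1)[OF q] b1(1)[OF p] m]
    note [simp] = b1[OF p] b1[OF q] b0[OF LPA_obj[OF q, THEN conjunct2, THEN conjunct2]]
    note ty = sqD[OF b1(1)[OF qp], unfolded e] sqD[OF b1(1)[OF p]] sqD[OF b1(1)[OF q]] th(1-4)[OF b1(1)[OF p]] th(1-4)[OF b1(1)[OF q]]
      EiD[OF sqD(1)[OF b1(1)[OF q]]] EiD[OF sqD(2)[OF b1(1)[OF q]]] EiD[OF sqD(2)[OF b1(1)[OF p]]]
      S.push_cmp(1-3)[of "qf (b1 q)" "qf (b1 p)"] S.push2(1-3)[of "ca ?\<chi>"] fcD(5-7)[OF x] c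
    let ?E = "Ei (b0 (trg K q))"
    have "(th (b1 p) \<lhd> ql (b1 q)) \<bullet> (push K S (qf (b1 p)) \<rhd> th (b1 q)) \<bullet> ((push_cmp K S (qf (b1 p)) (qf (b1 q)) \<bullet> push2 K S (ca ?\<chi>)) \<lhd> ?E)
       = ((th (b1 p) \<lhd> ql (b1 q)) \<bullet> (push K S (qf (b1 p)) \<rhd> th (b1 q)) \<bullet> (push_cmp K S (qf (b1 p)) (qf (b1 q)) \<lhd> ?E)) \<bullet> (push2 K S (ca ?\<chi>) \<lhd> ?E)"
      by (rule rw_split) (use ty in simp_all)
    also have "\<dots> = th (sqcmp (b1 p) (b1 q)) \<bullet> (push2 K S (ca ?\<chi>) \<lhd> ?E)" using t by simp
    also have "\<dots> = (Ei (b0 (src K p)) \<rhd> conj_left K ((q \<rhd> hT p \<lhd> ql (b1 q)) \<bullet> hT q) (qe (b1 (q \<odot> p)))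
        (ql (b1 p) \<odot> ql (b1 q)) (ql (b1 (q \<odot> p))) (id2 K (q \<odot> p))) \<bullet> th (b1 (q \<odot> p))"
      using th_natural[OF x] unfolding cl c(1,2) e .
    finally show "(th (b1 p) \<lhd> ql (b1 q)) \<bullet> (push K S (on1 T.psf p) \<rhd> th (b1 q)) \<bullet>
        ((push_cmp K S (on1 T.psf p) (on1 T.psf q) \<bullet> push2 K S (mu T.psf q p)) \<lhd> Ei (b0 (trg K q))) =
      (Ei (b0 (src K p)) \<rhd> conj_left K ((q \<rhd> hT p \<lhd> ql (b1 q)) \<bullet> hT q) (qe (b1 (q \<odot> p)))
        (ql (b1 p) \<odot> ql (b1 q)) (ql (b1 (q \<odot> p))) (id2 K (q \<odot> p))) \<bullet> th (b1 (q \<odot> p))" by simp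
    qed
  qed
qed

theorem duality:
  "\<exists>Mod Th \<eta> \<epsilon>. is_Mod K P S D Mod \<and> is_Th K P S D Th \<and>
           biadjunction (coop (Rex K P S D)) (LP K P S) Mod Th \<eta> \<epsilon> \<and>
           biequivalence (coop (Rex K P S D)) (LP K P S) Mod Th \<eta> \<epsilon>"
  using is_Mod_M is_Th_T MT.span_biadjunction MT.span_biequivalence unfolding Rex_eq LP_eq by blast

end

context gu_duality
begin

lemma sections_exist: "\<exists>rr hh ee b0 b1 Ei ti. gu_sections K P S D \<upsilon> rr hh ee b0 b1 Ei ti"
proof -
  interpret dense_framings K RexO LPO RexA LPA Fra by (rule dense_framings)
  have "\<exists>r h e. f \<in> RexA \<longrightarrow> r \<in> LPA \<and> adjunction K (push K S f) r h e" for f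
  proof (cases "f \<in> RexA")
    case True
    obtain R where R: "adjoint K (push K S f) R" "S.pres R" using Rex_right_adjoint[OF True] .
    have "R \<in> LPA" using R RexA_obj[OF True] S_free_LPO adjoint_type[OF R(1)] by (auto simp: LPA_iff)
    then show ?thesis using R(1) by (auto simp: adjoint_def)
  qed simp
  then obtain rr hh ee where 1: "\<And>f. f \<in> RexA \<Longrightarrow> rr f \<in> LPA \<and> adjunction K (push K S f) (rr f) (hh f) (ee f)" by metis
  have "\<exists>w. X \<in> LPO \<longrightarrow> Fra w \<and> fx w = X" for X
  proof (cases "X \<in> LPO")
    case True
    obtain G E where E: "G \<in> RexO" "equivalence1 K E" "src K E = dob S G" "trg K E = X" using LPO_equivalent_free[OF True] .
    then have "Fra (Framing G X (E \<odot> unt S G))"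
      using True RexOD(4)[OF E(1)] equivalence_arr[OF E(2)] by (auto simp: Fra_def intro!: exI[of _ E] iso1_refl)
    then show ?thesis by (intro exI[of _ "Framing G X (E \<odot> unt S G)"]) simp
  qed simp
  then obtain b0 where 2: "\<And>X. X \<in> LPO \<Longrightarrow> Fra (b0 X) \<and> fx (b0 X) = X" by metis
  have "\<exists>q. r \<in> LPA \<longrightarrow> sq q \<and> qs q = b0 (trg K r) \<and> qt q = b0 (src K r) \<and> qr q = r" for r
    using lift_r[of "b0 (trg K r)" "b0 (src K r)" r] 2 LPA_obj by metis
  then obtain b1 where 3: "\<And>r. r \<in> LPA \<Longrightarrow> sq (b1 r) \<and> qs (b1 r) = b0 (trg K r) \<and> qt (b1 r) = b0 (src K r) \<and> qr (b1 r) = r" by metis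
  have "\<exists>E t. Fra w \<longrightarrow> equivalence1 K E \<and> src K E = fx w \<and> trg K E = dob S (fg w) \<and> invertible2 K t \<and> dom2 K t = E \<odot> fs w \<and> cod2 K t = unt S (fg w)" for w
  proof (cases "Fra w")
    case True
    note [simp] = FraD[OF True]
    obtain E E' where E [simp]: "E \<in> arr K" "src K E = dob S (fg w)" "trg K E = fx w"
      and Es: "fs w \<simeq> E \<odot> unt S (fg w)" and E' [simp]: "E' \<in> arr K" "src K E' = fx w" "trg K E' = dob S (fg w)"
      and q: "equivalence1 K E'" and EE: "E' \<odot> E \<simeq> id1 K (dob S (fg w))"
      using FraE[OF True] by metis
    have "E' \<odot> fs w \<simeq> E' \<odot> E \<odot> unt S (fg w)" by (rule iso1_lw[OF Es]) simp_all
    also have "\<dots> \<simeq> unt S (fg w)" using iso1_rw[OF EE, of "unt S (fg w)"] by simp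
    finally obtain t where "invertible2 K t" "dom2 K t = E' \<odot> fs w" "cod2 K t = unt S (fg w)" by (rule iso1E)
    then show ?thesis using q by (intro exI[of _ E'] exI[of _ t]) simp
  qed simp
  then obtain Ei ti where 4: "\<And>w. Fra w \<Longrightarrow> equivalence1 K (Ei w) \<and> src K (Ei w) = fx w \<and> trg K (Ei w) = dob S (fg w) \<and>
     invertible2 K (ti w) \<and> dom2 K (ti w) = Ei w \<odot> fs w \<and> cod2 K (ti w) = unt S (fg w)" by metis
  have "gu_sections K P S D \<upsilon> rr hh ee b0 b1 Ei ti"
    by unfold_locales (use 1 2 3 4 in blast)+
  then show ?thesis by blast
qed

end

theorem theorem3p18:
  fixes K :: "('o, 'm, 'c) two_cat"
    and P S D :: "('o, 'm, 'c) doctrine"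
    and \<upsilon> :: "'o \<Rightarrow> 'm"
  assumes "two_category K"
    and "kz_context K P S \<upsilon>"
    and "gabriel_ulmer_envelope K P S D"
    and "\<And>G. petit K P G \<Longrightarrow>
           \<exists>G' i. cauchy_complete K S G' \<and> petit K P G' \<and> i \<in> hom K G G' \<and>
             equivalence1 K (push K S i)"
  shows "\<exists>Mod Th \<eta> \<epsilon>. is_Mod K P S D Mod \<and> is_Th K P S D Th \<and>
           biadjunction (coop (Rex K P S D)) (LP K P S) Mod Th \<eta> \<epsilon> \<and>
           biequivalence (coop (Rex K P S D)) (LP K P S) Mod Th \<eta> \<epsilon>"
proof -
  interpret gu_duality K P S D \<upsilon>
    using assms by (intro gu_duality.intro gu_context.intro gu_context_axioms.intro gu_duality_axioms.intro)
  obtain rr hh ee b0 b1 Ei ti where "gu_sections K P S D \<upsilon> rr hh ee b0 b1 Ei ti" using sections_exist by blast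
  then show ?thesis by (rule gu_sections.duality)
qed

end
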